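(* Let $\rho=(\{U_\lambda\}_{\lambda\geq0},\{V_\mu\}_{\mu\geq0})$ be an isometric representation of the Weyl commutation relations which is strongly irreducible and not of type $uu$. Then exactly one of the following holds: (i) $\rho$ is of type $pu$ and is unitarily equivalent to $\rho_\lambda$ for some $\lambda\in\mathbb{R}$; (ii) $\rho$ is of type $up$ and is unitarily equivalent to $\rho^\mu$ for some $\mu\in\mathbb{R}$; (iii) $\rho$ is of type $pp$ and is unitarily equivalent to $\rho_{\lambda,s}$ for some $\lambda\in\mathbb{R}$, $s>0$. Moreover, two representations of the same type in this list with different parameters are not unitarily equivalent (i.e. $\rho_\lambda\not\simeq\rho_{\lambda'}$ for $\lambda\neq\lambda'$, $\rho^\mu\not\simeq\rho^{\mu'}$ for $\mu\neq\mu'$, and $\rho_{\lambda,s}\not\simeq\rho_{\lambda',s'}$ for $(\lambda,s)\neq(\lambda',s')$).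
   Context: An isometric representation of the Weyl commutation relations is a pair of strongly continuous semigroups of isometries $\{U_\lambda:\lambda\geq0\}$, $\{V_\mu:\mu\geq0\}$ on a separable Hilbert space with $U_\lambda V_\mu=e^{i\lambda\mu}V_\mu U_\lambda$ for $\lambda,\mu\geq0$. Such a pair always has a unitary dilation: strongly continuous unitary groups $\{\tilde U_\lambda\}_{\lambda\in\mathbb{R}},\{\tilde V_\mu\}_{\mu\in\mathbb{R}}$ on a larger Hilbert space satisfying the same relation for all real parameters, whose compressions to the original space are $U_\lambda,V_\mu$ for $\lambda,\mu\geq0$; it is minimal if the larger space is the closed span of the images of the original space under the products $\tilde U_\lambda\tilde V_\mu$. The representation is strongly irreducible if it has a minimal unitary dilation on a separable Hilbert space which is irreducible (no proper nonzero closed subspace reducing both groups). A semigroup of isometries is pure if the intersection of the ranges of its members is $\{0\}$. $\rho$ is of type $uu$, $up$, $pu$, $pp$ if $(\{U_\lambda\},\{V_\mu\})$ are respectively (unitary, unitary), (unitary, pure), (pure, unitary), (pure, pure). Models: on $L^2(\mathbb{R})$ let $(M_\lambda f)(x)=e^{i\lambda x}f(x)$, $(D_\mu f)(x)=f(x-\mu)$, let $H^2(\mathbb{R})$ be the Hardy space of the upper half-plane, $\phi_s(x)=e^{-isx^2/2}$, and $K_{\lambda,s}=M_\lambda M_{\phi_s}H^2(\mathbb{R})$. Then $\rho_{\lambda,s}$ ($\lambda\in\mathbb{R},s>0$) is the representation given by restricting $\{M_\lambda\}_{\lambda\geq0}$ and $\{D_\mu\}_{\mu\geq0}$ to $K_{\lambda,s}$;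 $\rho_\lambda$ is the restriction to $M_\lambda H^2(\mathbb{R})$; $\rho^\mu$ is the restriction to $D_\mu L^2(\mathbb{R}_+)=L^2([\mu,\infty))$. Unitary equivalence of representations means a unitary between the spaces intertwining both semigroups. *)

theory Defs
  imports "HOL-Analysis.Analysis"
begin

class chilbert_space = banach +
  fixes scaleC :: "complex \<Rightarrow> 'a \<Rightarrow> 'a"
    and cinner :: "'a \<Rightarrow> 'a \<Rightarrow> complex"
  assumes scaleC_add_right: "scaleC c (x + y) = scaleC c x + scaleC c y"
    and scaleC_add_left: "scaleC (c + d) x = scaleC c x + scaleC d x"
    and scaleC_scaleC: "scaleC c (scaleC d x) = scaleC (c * d) x"
    and scaleC_one: "scaleC 1 x = x"
    and scaleR_scaleC: "scaleR r x = scaleC (complex_of_real r) x"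
    and norm_scaleC: "norm (scaleC c x) = cmod c * norm x"
    and cinner_add_left: "cinner (x + y) z = cinner x z + cinner y z"
    and cinner_scaleC_left: "cinner (scaleC c x) y = cnj c * cinner x y"
    and cinner_commute: "cinner x y = cnj (cinner y x)"
    and norm_eq_sqrt_cinner: "norm x = sqrt (Re (cinner x x))"

definition separable_hilbert :: "'a::chilbert_space itself \<Rightarrow> bool" where
  "separable_hilbert _ \<longleftrightarrow> separable_space (euclidean :: 'a topology)"

definition clinear :: "('a::chilbert_space \<Rightarrow> 'b::chilbert_space) \<Rightarrow> bool" where
  "clinear T \<longleftrightarrow> (\<forall>x y. T (x + y) = T x + T y) \<and> (\<forall>c x. T (scaleC c x) = scaleC c (T x))"

definition isometry_op :: "('a::chilbert_space \<Rightarrow> 'b::chilbert_space) \<Rightarrow> bool" where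
  "isometry_op T \<longleftrightarrow> clinear T \<and> (\<forall>x. norm (T x) = norm x)"

definition csubspace :: "'a::chilbert_space set \<Rightarrow> bool" where
  "csubspace M \<longleftrightarrow> 0 \<in> M \<and> (\<forall>x\<in>M. \<forall>y\<in>M. x + y \<in> M) \<and> (\<forall>c. \<forall>x\<in>M. scaleC c x \<in> M)"

definition closed_csubspace :: "'a::chilbert_space set \<Rightarrow> bool" where
  "closed_csubspace M \<longleftrightarrow> csubspace M \<and> closed M"

definition cspan :: "'a::chilbert_space set \<Rightarrow> 'a set" where
  "cspan S = \<Inter> {M. csubspace M \<and> S \<subseteq> M}"

definition orthogonal_complement :: "'a::chilbert_space set \<Rightarrow> 'a set" where
  "orthogonal_complement M = {y. \<forall>x\<in>M. cinner x y = 0}"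

definition reduces :: "('a::chilbert_space \<Rightarrow> 'a) \<Rightarrow> 'a set \<Rightarrow> bool" where
  "reduces T M \<longleftrightarrow> T ` M \<subseteq> M \<and> T ` orthogonal_complement M \<subseteq> orthogonal_complement M"

text \<open>Only the values at nonnegative parameters matter for a semigroup.\<close>
definition isometric_semigroup :: "(real \<Rightarrow> 'a::chilbert_space \<Rightarrow> 'a) \<Rightarrow> bool" where
  "isometric_semigroup U \<longleftrightarrow>
     U 0 = id \<and>
     (\<forall>a b. 0 \<le> a \<longrightarrow> 0 \<le> b \<longrightarrow> U (a + b) = U a \<circ> U b) \<and>
     (\<forall>a. 0 \<le> a \<longrightarrow> isometry_op (U a)) \<and>
     (\<forall>x. continuous_on {0..} (\<lambda>t. U t x))"

definition unitary_group :: "(real \<Rightarrow> 'a::chilbert_space \<Rightarrow> 'a) \<Rightarrow> bool" where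
  "unitary_group U \<longleftrightarrow>
     U 0 = id \<and> (\<forall>a b. U (a + b) = U a \<circ> U b) \<and>
     (\<forall>a. isometry_op (U a) \<and> surj (U a)) \<and>
     (\<forall>x. continuous_on UNIV (\<lambda>t. U t x))"

definition weyl_rel :: "(real \<Rightarrow> 'a::chilbert_space \<Rightarrow> 'a) \<Rightarrow> (real \<Rightarrow> 'a \<Rightarrow> 'a) \<Rightarrow> real set \<Rightarrow> bool" where
  "weyl_rel U V I \<longleftrightarrow>
     (\<forall>a\<in>I. \<forall>b\<in>I. \<forall>x. U a (V b x) = scaleC (exp (\<i> * complex_of_real (a * b))) (V b (U a x)))"

definition isometric_weyl_rep :: "(real \<Rightarrow> 'a::chilbert_space \<Rightarrow> 'a) \<Rightarrow> (real \<Rightarrow> 'a \<Rightarrow> 'a) \<Rightarrow> bool" where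
  "isometric_weyl_rep U V \<longleftrightarrow> isometric_semigroup U \<and> isometric_semigroup V \<and> weyl_rel U V {0..}"

definition unitary_sg :: "(real \<Rightarrow> 'a::chilbert_space \<Rightarrow> 'a) \<Rightarrow> bool" where
  "unitary_sg U \<longleftrightarrow> (\<forall>a. 0 \<le> a \<longrightarrow> surj (U a))"

definition pure_sg :: "(real \<Rightarrow> 'a::chilbert_space \<Rightarrow> 'a) \<Rightarrow> bool" where
  "pure_sg U \<longleftrightarrow> (\<Inter>a\<in>{0..}. range (U a)) = {0}"

definition type_uu where "type_uu U V \<longleftrightarrow> unitary_sg U \<and> unitary_sg V"
definition type_up where "type_up U V \<longleftrightarrow> unitary_sg U \<and> pure_sg V"
definition type_pu where "type_pu U V \<longleftrightarrow> pure_sg U \<and> unitary_sg V"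
definition type_pp where "type_pp U V \<longleftrightarrow> pure_sg U \<and> pure_sg V"

text \<open>J embeds the original space isometrically into the dilation space; the compression
condition says P_H Ut_a|_H = U_a, Vt_b similarly, for a, b \<ge> 0.\<close>
definition unitary_dilation ::
  "(real \<Rightarrow> 'k::chilbert_space \<Rightarrow> 'k) \<Rightarrow> (real \<Rightarrow> 'k \<Rightarrow> 'k) \<Rightarrow> ('h::chilbert_space \<Rightarrow> 'k)
   \<Rightarrow> (real \<Rightarrow> 'h \<Rightarrow> 'h) \<Rightarrow> (real \<Rightarrow> 'h \<Rightarrow> 'h) \<Rightarrow> bool" where
  "unitary_dilation Ut Vt J U V \<longleftrightarrow>
     unitary_group Ut \<and> unitary_group Vt \<and> weyl_rel Ut Vt UNIV \<and> isometry_op J \<and>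
     (\<forall>a. 0 \<le> a \<longrightarrow> (\<forall>x y. cinner (Ut a (J x)) (J y) = cinner (U a x) y)) \<and>
     (\<forall>b. 0 \<le> b \<longrightarrow> (\<forall>x y. cinner (Vt b (J x)) (J y) = cinner (V b x) y))"

definition minimal_dilation where
  "minimal_dilation Ut Vt J U V \<longleftrightarrow> unitary_dilation Ut Vt J U V \<and>
     closure (cspan {Ut a (Vt b (J x)) | a b x. True}) = UNIV"

definition irreducible_pair :: "(real \<Rightarrow> 'k::chilbert_space \<Rightarrow> 'k) \<Rightarrow> (real \<Rightarrow> 'k \<Rightarrow> 'k) \<Rightarrow> bool" where
  "irreducible_pair Ut Vt \<longleftrightarrow>
     (\<forall>M. closed_csubspace M \<and> (\<forall>a. reduces (Ut a) M) \<and> (\<forall>b. reduces (Vt b) M)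
        \<longrightarrow> M = {0} \<or> M = UNIV)"

text \<open>Strong irreducibility with witness dilation space of type 'k.  In the main theorem
'k is a free type variable of an assumption, so the theorem covers every choice of 'k,
i.e. it expresses "there is some separable Hilbert space carrying an irreducible
minimal unitary dilation".\<close>
definition strongly_irreducible_in ::
  "'k::chilbert_space itself \<Rightarrow> (real \<Rightarrow> 'h::chilbert_space \<Rightarrow> 'h) \<Rightarrow> (real \<Rightarrow> 'h \<Rightarrow> 'h) \<Rightarrow> bool" where
  "strongly_irreducible_in K U V \<longleftrightarrow> separable_hilbert K \<and>
     (\<exists>(Ut :: real \<Rightarrow> 'k \<Rightarrow> 'k) Vt J. minimal_dilation Ut Vt J U V \<and> irreducible_pair Ut Vt)"

text \<open>Elements of L^2(R) are represented by Borel square-integrable functions; equality in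
L^2 is equality almost everywhere.\<close>
definition L2 :: "(real \<Rightarrow> complex) set" where
  "L2 = {f. f \<in> borel_measurable lborel \<and> integrable lborel (\<lambda>x. (cmod (f x))\<^sup>2)}"

definition L2norm_sq :: "(real \<Rightarrow> complex) \<Rightarrow> real" where
  "L2norm_sq f = (LINT x|lborel. (cmod (f x))\<^sup>2)"

definition Mop :: "real \<Rightarrow> (real \<Rightarrow> complex) \<Rightarrow> (real \<Rightarrow> complex)" where
  "Mop a f = (\<lambda>x. exp (\<i> * complex_of_real (a * x)) * f x)"

definition Dop :: "real \<Rightarrow> (real \<Rightarrow> complex) \<Rightarrow> (real \<Rightarrow> complex)" where
  "Dop b f = (\<lambda>x. f (x - b))"

definition phi :: "real \<Rightarrow> real \<Rightarrow> complex" where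
  "phi s x = exp (- \<i> * complex_of_real (s * x\<^sup>2 / 2))"

definition hardy2 :: "(real \<Rightarrow> complex) set" where
  "hardy2 = {f \<in> L2. \<exists>F. F holomorphic_on {z. 0 < Im z} \<and>
      (\<exists>C. \<forall>y>0. integrable lborel (\<lambda>x. (cmod (F (Complex x y)))\<^sup>2) \<and>
                 (LINT x|lborel. (cmod (F (Complex x y)))\<^sup>2) \<le> C) \<and>
      ((\<lambda>y. LINT x|lborel. (cmod (F (Complex x y) - f x))\<^sup>2) \<longlongrightarrow> 0) (at_right 0)}"

definition K_ls :: "real \<Rightarrow> real \<Rightarrow> (real \<Rightarrow> complex) set" where
  "K_ls a s = {f \<in> L2. \<exists>h\<in>hardy2. AE x in lborel. f x = Mop a (\<lambda>t. phi s t * h t) x}"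

definition K_l :: "real \<Rightarrow> (real \<Rightarrow> complex) set" where
  "K_l a = {f \<in> L2. \<exists>h\<in>hardy2. AE x in lborel. f x = Mop a h x}"

definition K_up :: "real \<Rightarrow> (real \<Rightarrow> complex) set" where
  "K_up b = {f \<in> L2. AE x in lborel. x < b \<longrightarrow> f x = 0}"

definition equiv_to_model ::
  "(real \<Rightarrow> 'h::chilbert_space \<Rightarrow> 'h) \<Rightarrow> (real \<Rightarrow> 'h \<Rightarrow> 'h) \<Rightarrow> (real \<Rightarrow> complex) set \<Rightarrow> bool" where
  "equiv_to_model U V K \<longleftrightarrow> (\<exists>W :: 'h \<Rightarrow> real \<Rightarrow> complex.
     (\<forall>x. W x \<in> K) \<and>
     (\<forall>x. (norm x)\<^sup>2 = L2norm_sq (W x)) \<and>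
     (\<forall>x y. AE t in lborel. W (x + y) t = W x t + W y t) \<and>
     (\<forall>c x. AE t in lborel. W (scaleC c x) t = c * W x t) \<and>
     (\<forall>f\<in>K. \<exists>x. AE t in lborel. W x t = f t) \<and>
     (\<forall>a x. 0 \<le> a \<longrightarrow> (AE t in lborel. W (U a x) t = Mop a (W x) t)) \<and>
     (\<forall>b x. 0 \<le> b \<longrightarrow> (AE t in lborel. W (V b x) t = Dop b (W x) t)))"

definition models_equiv :: "(real \<Rightarrow> complex) set \<Rightarrow> (real \<Rightarrow> complex) set \<Rightarrow> bool" where
  "models_equiv K1 K2 \<longleftrightarrow> (\<exists>W :: (real \<Rightarrow> complex) \<Rightarrow> real \<Rightarrow> complex.
     (\<forall>f\<in>K1. W f \<in> K2 \<and> L2norm_sq (W f) = L2norm_sq f) \<and>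
     (\<forall>f\<in>K1. \<forall>g\<in>K1. AE t in lborel. W (\<lambda>u. f u + g u) t = W f t + W g t) \<and>
     (\<forall>c. \<forall>f\<in>K1. AE t in lborel. W (\<lambda>u. c * f u) t = c * W f t) \<and>
     (\<forall>g\<in>K2. \<exists>f\<in>K1. AE t in lborel. W f t = g t) \<and>
     (\<forall>a. \<forall>f\<in>K1. 0 \<le> a \<longrightarrow> (AE t in lborel. W (Mop a f) t = Mop a (W f) t)) \<and>
     (\<forall>b. \<forall>f\<in>K1. 0 \<le> b \<longrightarrow> (AE t in lborel. W (Dop b f) t = Dop b (W f) t)))"

end

theory Submission
 imports Defs "HOL-Complex_Analysis.Complex_Analysis" "HOL-Probability.Probability"
begin

text \<open>
 By the Stone--von Neumann theorem the irreducible dilation embeds into \<open>L\<^sup>2(\<real>)\<close> with the groups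
 \<open>M\<^sub>\<lambda>\<close>, \<open>D\<^sub>\<mu>\<close>, so the given representation becomes the restriction to a closed subspace \<open>S\<close>
 invariant under \<open>M\<^sub>\<lambda>\<close> and \<open>D\<^sub>\<mu>\<close> for nonnegative parameters. Beurling's theorem gives \<open>S = 1\<^sub>E L\<^sup>2\<close> or
 \<open>S = u H\<^sup>2\<close> with \<open>u\<close> unimodular. In the first case translation invariance makes \<open>E\<close> a half-line.
 In the second the functions \<open>\<omega>\<^sub>b(t) = cnj (u t) u(t - b)\<close> form an inner cocycle over the translation flow.
 The cocycle identity prevents zeros and, comparing \<open>\<omega>\<^sub>b\<close> at a point with \<open>\<omega>\<^sub>B\<close> for large \<open>B\<close> at points to
 its right, forces the harmonic function \<open>- log |\<omega>\<^sub>b|\<close> to vanish on the boundary; hence it is \<open>s b Im z\<close>,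
 and \<open>u\<close> is a quadratic exponential. Inequivalence holds because the matrix coefficients
 \<open>\<langle>f, M\<^sub>\<lambda> D\<^sub>\<mu> f\<rangle>\<close> determine \<open>f\<close> up to a constant, so equivalent models coincide as subspaces.
\<close>

section \<open>Hilbert space preliminaries\<close>

text \<open>Arguments on the line run through vanishing Cauchy transforms. H^2 is replaced by
  \<open>Hm\<close>, the functions annihilated by all kernels \<open>1 / (t - cnj v)\<close>, so
  that membership is a family of linear conditions, and Fourier or Poisson uniqueness turns
  vanishing transforms into a.e. equalities. A subspace of L^2 appears because the compression of
  the dilation is isometric, which forces the dilation to extend the given isometries. The main
  obstacle: unimodular boundary values and absence of zeros still allow singular inner factors.
  These are visible only in integrals of the logarithm near the real line, where convergence in mean
  is too weak; the comparison of distant points supplies a bound that is uniform on intervals. The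
  harmonic function may still carry mass at infinity, and the weight \<open>|t - w|^(-4)\<close> is
  used because the functional it produces kills exactly that linear term. The parameter s separates
  the types: once the symbol of the space is removed, translation by b is a translation times
  modulation by \<open>s * b\<close>, so V is unitary for s = 0 and pure for s > 0.\<close>

lemma cinner_add_right: "cinner x (y + z) = cinner x y + cinner x z" by (metis cinner_add_left cinner_commute complex_cnj_add)

lemma cinner_scaleC_right: "cinner x (scaleC c y) = c * cinner x y"
 by (metis cinner_commute cinner_scaleC_left complex_cnj_cnj complex_cnj_mult)

lemma scaleC_zero_left [simp]: "scaleC 0 x = 0" by (metis of_real_0 scaleR_scaleC scaleR_zero_left)

lemma scaleC_zero_right [simp]: "scaleC c 0 = 0" by (metis add_cancel_right_right scaleC_add_right)

lemma scaleC_minus_one: "scaleC (- 1) x = - x" using scaleR_scaleC[of "-1" x] by simp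

lemma scaleC_diff_right: "scaleC c (x - y) = scaleC c x - scaleC c y" by (metis add_diff_cancel diff_add_cancel scaleC_add_right)

lemma cinner_zero_left [simp]: "cinner 0 x = 0" using cinner_scaleC_left[of 0 x x] by simp

lemma cinner_zero_right [simp]: "cinner x 0 = 0" by (metis cinner_zero_left cinner_commute complex_cnj_zero)

lemma cinner_minus_left [simp]: "cinner (- x) y = - cinner x y" using cinner_scaleC_left[of "-1" x y] by (simp add: scaleC_minus_one)

lemma cinner_minus_right [simp]: "cinner x (- y) = - cinner x y" using cinner_scaleC_right[of x "-1" y] by (simp add: scaleC_minus_one)

lemma cinner_diff_left: "cinner (x - y) z = cinner x z - cinner y z" using cinner_add_left[of x "-y" z] by simp

lemma cinner_diff_right: "cinner x (y - z) = cinner x y - cinner x z" using cinner_add_right[of x y "-z"] by simp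

lemma cinner_self: "cinner x x = complex_of_real ((norm x)\<^sup>2)"
proof -
 have "Im (cinner x x) = 0" using cinner_commute[of x x] by (simp add: complex_eq_iff)
 moreover have "0 \<le> Re (cinner x x)" using norm_eq_sqrt_cinner[of x] norm_ge_zero[of x] by (metis real_sqrt_ge_0_iff)
 then have "(norm x)\<^sup>2 = Re (cinner x x)" by (simp add: norm_eq_sqrt_cinner)
 ultimately show ?thesis by (simp add: complex_eq_iff)
qed

lemma norm_add_sq: "(norm (x + y))\<^sup>2 = (norm x)\<^sup>2 + (norm y)\<^sup>2 + 2 * Re (cinner x y)"
 for x y :: "'a::chilbert_space"
proof -
 have "complex_of_real ((norm (x + y))\<^sup>2) = cinner x x + cinner y y + (cinner x y + cnj (cinner x y))"
  unfolding cinner_self[symmetric] by (simp add: cinner_add_left cinner_add_right cinner_commute[of y x])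
 then have "Re (complex_of_real ((norm (x + y))\<^sup>2)) = (norm x)\<^sup>2 + (norm y)\<^sup>2 + 2 * Re (cinner x y)"
  by (simp add: cinner_self flip: of_real_power)
 then show ?thesis by simp
qed

lemma norm_diff_sq: "(norm (x - y))\<^sup>2 = (norm x)\<^sup>2 + (norm y)\<^sup>2 - 2 * Re (cinner x y)"
 for x y :: "'a::chilbert_space"
 using norm_add_sq[of x "-y"] by simp

lemma parallelogram: "(norm (x + y))\<^sup>2 + (norm (x - y))\<^sup>2 = 2 * (norm x)\<^sup>2 + 2 * (norm y)\<^sup>2"
 for x y :: "'a::chilbert_space"
 by (simp add: norm_add_sq norm_diff_sq)

lemma Cauchy_Schwarz_cinner: "cmod (cinner x y) \<le> norm x * norm y"
proof -
 have re: "Re (cinner x z) \<le> norm x * norm z" for z :: 'a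
 proof -
  have "(norm (x + z))\<^sup>2 \<le> (norm x + norm z)\<^sup>2" by (simp add: norm_triangle_ineq power_mono)
  then show ?thesis by (simp add: norm_add_sq power2_sum)
 qed
 show ?thesis
 proof (cases "cinner x y = 0")
  case False
  define c where "c = cnj (cinner x y) / cmod (cinner x y)"
  have "cmod c = 1" using False by (simp add: c_def norm_divide)
  moreover have "cinner x (scaleC c y) = cmod (cinner x y)" using False complex_norm_square[of "cinner x y"]
   by (simp add: cinner_scaleC_right c_def field_simps power2_eq_square)
  ultimately show ?thesis using re[of "scaleC c y"] by (simp add: norm_scaleC)
 qed (simp add: )
qed

lemma tendsto_cinner:
 assumes "(f \<longlongrightarrow> a) F" "(g \<longlongrightarrow> b) F"
 shows "((\<lambda>x. cinner (f x) (g x)) \<longlongrightarrow> cinner a b) F"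
proof -
 define h where "h x = norm (f x - a) * norm (g x) + norm a * norm (g x - b)" for x
 have "(h \<longlongrightarrow> 0 * norm b + norm a * 0) F" unfolding h_def using assms
  by (intro tendsto_add tendsto_mult tendsto_const tendsto_norm tendsto_norm_zero LIM_zero)
 then have h: "(h \<longlongrightarrow> 0) F" by simp
 have "cmod (cinner (f x) (g x) - cinner a b) \<le> h x" for x
 proof -
  have "cinner (f x) (g x) - cinner a b = cinner (f x - a) (g x) + cinner a (g x - b)" by (simp add: cinner_diff_left cinner_diff_right)
  then show ?thesis unfolding h_def by (metis Cauchy_Schwarz_cinner add_mono norm_triangle_le)
 qed
 then have "\<forall>\<^sub>F x in F. norm (cinner (f x) (g x) - cinner a b) \<le> h x" by (intro always_eventually) blast
 then show ?thesis by (rule LIM_zero_cancel[OF Lim_null_comparison[OF _ h]])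
qed

lemma continuous_on_cinner:
 "continuous_on S f \<Longrightarrow> continuous_on S g \<Longrightarrow> continuous_on S (\<lambda>x. cinner (f x) (g x))"
 unfolding continuous_on_def by (simp add: tendsto_cinner)

lemma tendsto_scaleC: "(f \<longlongrightarrow> a) F \<Longrightarrow> ((\<lambda>x. scaleC c (f x)) \<longlongrightarrow> scaleC c a) F"
proof -
 assume "(f \<longlongrightarrow> a) F"
 then have "((\<lambda>x. cmod c * norm (f x - a)) \<longlongrightarrow> 0) F"
  by (simp add: LIM_zero tendsto_mult_right_zero tendsto_norm_zero)
 then have "((\<lambda>x. scaleC c (f x) - scaleC c a) \<longlongrightarrow> 0) F"
  by (intro tendsto_norm_zero_cancel[of "\<lambda>x. scaleC c (f x) - scaleC c a"])
   (simp add: scaleC_diff_right[symmetric] norm_scaleC)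
 then show ?thesis by (simp add: LIM_zero_iff)
qed

lemma csubspaceD:
 assumes "csubspace M"
 shows "0 \<in> M" "x \<in> M \<Longrightarrow> y \<in> M \<Longrightarrow> x + y \<in> M" "x \<in> M \<Longrightarrow> scaleC c x \<in> M"
  "x \<in> M \<Longrightarrow> y \<in> M \<Longrightarrow> x - y \<in> M" "x \<in> M \<Longrightarrow> scaleR r x \<in> M"
proof -
 show *: "0 \<in> M" "x \<in> M \<Longrightarrow> y \<in> M \<Longrightarrow> x + y \<in> M" "\<And>c x. x \<in> M \<Longrightarrow> scaleC c x \<in> M"
  using assms by (auto simp: csubspace_def)
 show "x \<in> M \<Longrightarrow> scaleR r x \<in> M" by (simp add: "*"(3) scaleR_scaleC)
 assume "x \<in> M" "y \<in> M"
 then have "x + scaleC (-1) y \<in> M" using assms by (auto simp: csubspace_def)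
 then show "x - y \<in> M" by (simp add: scaleC_minus_one)
qed

text \<open>Nearest-point argument: the parallelogram law makes a minimising sequence Cauchy, and
  optimality of its limit \<open>y\<close> in every direction \<open>z\<close> of \<open>M\<close>
  gives orthogonality.\<close>

theorem orthogonal_projection_exists:
 assumes M: "closed_csubspace M"
 obtains y where "y \<in> M" "x - y \<in> orthogonal_complement M"
proof -
 have sub: "csubspace M" and cl: "closed M" using M by (auto simp: closed_csubspace_def)
 note subD = csubspaceD[OF sub]
 have ne: "M \<noteq> {}" using subD(1) by auto
 define d where "d = infdist x M"
 have d_le: "d \<le> norm (x - y)" if "y \<in> M" for y using infdist_le[OF that, of x] by (simp add: d_def dist_norm)
 have "\<exists>y\<in>M. norm (x - y) < d + 1 / real (Suc n)" for n
 proof -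
  have "(INF y\<in>M. dist x y) < d + 1 / real (Suc n)" using ne by (simp add: d_def infdist_def)
  then show ?thesis using ne by (subst (asm) cINF_less_iff) (auto simp: dist_norm intro!: bdd_belowI2[of _ 0])
 qed
 then obtain Y where Y: "\<And>n. Y n \<in> M" "\<And>n. norm (x - Y n) < d + 1 / real (Suc n)" by metis
 have d0: "0 \<le> d" by (simp add: d_def infdist_nonneg)
 \<comment> \<open>The midpoint of \<open>Y m\<close> and \<open>Y n\<close> lies in
   \<open>M\<close>, so its distance from \<open>x\<close> is at least \<open>d\<close>; the
   parallelogram law converts this lower bound into closeness of the two points.\<close>
 have est: "(norm (Y m - Y n))\<^sup>2 \<le> (4 * d + 2) * (1 / real (Suc m) + 1 / real (Suc n))" for m n
 proof -
  define p where "p = 1 / real (Suc m)"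
  define q where "q = 1 / real (Suc n)"
  have pq: "0 < p" "p \<le> 1" "0 < q" "q \<le> 1" by (auto simp: p_def q_def)
  have mid: "scaleR (1/2) (Y m + Y n) \<in> M" by (intro subD Y)
  have "(x - Y m) + (x - Y n) = scaleR 2 (x - scaleR (1/2) (Y m + Y n))" by (simp add: algebra_simps scaleR_2)
  then have "norm ((x - Y m) + (x - Y n)) = 2 * norm (x - scaleR (1/2) (Y m + Y n))" by simp
  then have "2 * d \<le> norm ((x - Y m) + (x - Y n))" using d_le[OF mid] by simp
  then have "(2 * d)\<^sup>2 \<le> (norm ((x - Y m) + (x - Y n)))\<^sup>2" using d0 by (intro power_mono) auto
  moreover have "(norm (x - Y m))\<^sup>2 \<le> (d + p)\<^sup>2" "(norm (x - Y n))\<^sup>2 \<le> (d + q)\<^sup>2"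
   using Y(2)[of m] Y(2)[of n] by (auto simp: p_def q_def intro!: power_mono)
  moreover have "(x - Y m) - (x - Y n) = Y n - Y m" by simp
  ultimately have "(norm (Y n - Y m))\<^sup>2 \<le> 2 * (d + p)\<^sup>2 + 2 * (d + q)\<^sup>2 - (2 * d)\<^sup>2"
   using parallelogram[of "x - Y m" "x - Y n"] by simp
  also have "\<dots> = 4 * d * (p + q) + 2 * p * p + 2 * q * q" by (simp add: power2_eq_square algebra_simps)
  also have "\<dots> \<le> 4 * d * (p + q) + 2 * p + 2 * q"
   using pq mult_left_le[of p p] mult_left_le[of q q] by (simp only: mult.assoc less_imp_le simp_thms HOL.True_implies_equals)
  also have "\<dots> = (4 * d + 2) * (p + q)" by (simp add: algebra_simps)
  finally show ?thesis by (simp add: p_def q_def norm_minus_commute)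
 qed
 have "Cauchy Y"
 proof (rule metric_CauchyI)
  fix e :: real assume e: "0 < e"
  obtain N where N: "(4 * d + 2) * (2 / e\<^sup>2) < real N" using reals_Archimedean2 by blast
  have "dist (Y m) (Y n) < e" if "N \<le> m" "N \<le> n" for m n
  proof -
   have N0: "0 < real N" using N d0 e by (smt (verit) divide_nonneg_pos mult_nonneg_nonneg zero_less_power)
   have "1 / real (Suc m) + 1 / real (Suc n) \<le> 1 / real N + 1 / real N" using that N0 by (intro add_mono divide_left_mono) auto
   then have "(norm (Y m - Y n))\<^sup>2 \<le> (4 * d + 2) * (2 / real N)"
    using est[of m n] d0 mult_left_mono[of _ _ "4 * d + 2"] by (smt (verit) add_divide_distrib)
   also have "\<dots> < e\<^sup>2" using N N0 e by (simp add: field_simps)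
   finally show ?thesis using e by (simp add: dist_norm power_less_imp_less_base)
  qed
  then show "\<exists>M. \<forall>m\<ge>M. \<forall>n\<ge>M. dist (Y m) (Y n) < e" by blast
 qed
 then obtain y where y: "Y \<longlonglongrightarrow> y" using Cauchy_convergent_iff convergent_def by blast
 have yM: "y \<in> M" using closed_sequentially[OF cl Y(1) y] .
 have "(\<lambda>n. norm (x - Y n)) \<longlonglongrightarrow> norm (x - y)" by (intro tendsto_intros y)
 moreover have "(\<lambda>n. d + 1 / real (Suc n)) \<longlonglongrightarrow> d + 0" by (intro tendsto_intros LIMSEQ_Suc[OF lim_1_over_n])
 ultimately have yd: "norm (x - y) \<le> d" using Y(2) by (intro LIMSEQ_le[of "\<lambda>n. norm (x - Y n)"]) (auto intro: less_imp_le)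
 have "cinner z (x - y) = 0" if z: "z \<in> M" for z
 proof (cases "z = 0")
  case False
  \<comment> \<open>The Fourier coefficient of \<open>x - y\<close> along \<open>z\<close>: adding
    \<open>scaleC c z\<close> to \<open>y\<close> would lower the squared distance by
    \<open>|<z, x - y>|^2 / |z|^2\<close>.\<close>
  define c where "c = cinner z (x - y) / (norm z)\<^sup>2"
  have "d\<^sup>2 \<le> (norm ((x - y) - scaleC c z))\<^sup>2" using d_le[of "y + scaleC c z"] subD yM z d0
   by (intro power_mono) (auto simp: algebra_simps)
  also have "\<dots> = (norm (x - y))\<^sup>2 + (cmod c)\<^sup>2 * (norm z)\<^sup>2 - 2 * Re (c * cinner (x - y) z)"
   by (simp add: norm_diff_sq norm_scaleC power_mult_distrib cinner_scaleC_right)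
  also have "c * cinner (x - y) z = (cmod (cinner z (x - y)))\<^sup>2 / (norm z)\<^sup>2"
   by (simp add: c_def cinner_commute[of "x - y" z] complex_norm_square del: of_real_power)
  also have "(cmod c)\<^sup>2 * (norm z)\<^sup>2 = (cmod (cinner z (x - y)))\<^sup>2 / (norm z)\<^sup>2"
   using False by (simp add: c_def norm_divide power_divide norm_power) (simp add: field_simps power2_eq_square power4_eq_xxxx)
  finally have "d\<^sup>2 \<le> (norm (x - y))\<^sup>2 - (cmod (cinner z (x - y)))\<^sup>2 / (norm z)\<^sup>2"
   by (simp flip: of_real_power of_real_divide)
  moreover have "(norm (x - y))\<^sup>2 \<le> d\<^sup>2" using yd by (intro power_mono) auto
  ultimately have "(cmod (cinner z (x - y)))\<^sup>2 / (norm z)\<^sup>2 \<le> 0" by simp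
  then show ?thesis using False by (simp add: divide_le_0_iff)
 qed simp
 then have "x - y \<in> orthogonal_complement M" by (simp add: orthogonal_complement_def)
 then show thesis using that yM by blast
qed

text \<open>The component of \<open>x\<close> off \<open>M\<close> is orthogonal to itself.
  Membership proofs thereby become tests against vectors orthogonal to \<open>M\<close>.\<close>

lemma mem_closed_csubspaceI:
 assumes M: "closed_csubspace M" and x: "\<And>z. z \<in> orthogonal_complement M \<Longrightarrow> cinner z x = 0"
 shows "x \<in> M"
proof -
 obtain y where y: "y \<in> M" "x - y \<in> orthogonal_complement M" using orthogonal_projection_exists[OF M] by blast
 have "cinner (x - y) x = 0" using x[OF y(2)] .
 moreover have "cinner (x - y) y = 0"
  using y by (metis (mono_tags, lifting) cinner_commute complex_cnj_zero mem_Collect_eq orthogonal_complement_def)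
 ultimately have "cinner (x - y) (x - y) = 0" by (simp add: cinner_diff_right)
 then show ?thesis using y(1) by (simp add: cinner_self)
qed

text \<open>A vector \<open>e\<close> orthogonal to the kernel spans its complement, since
  subtracting a multiple of \<open>e\<close> brings any \<open>x\<close> into the kernel; a rescaled
  \<open>e\<close> represents the functional.\<close>

theorem Riesz_representation:
 fixes \<phi> :: "'a::chilbert_space \<Rightarrow> complex"
 assumes add: "\<And>x y. \<phi> (x + y) = \<phi> x + \<phi> y" and scale: "\<And>c x. \<phi> (scaleC c x) = c * \<phi> x"
  and bdd: "\<And>x. cmod (\<phi> x) \<le> B * norm x"
 obtains y where "\<And>x. \<phi> x = cinner y x"
proof -
 have diff: "\<phi> (x - y) = \<phi> x - \<phi> y" for x y by (metis add add_diff_cancel diff_add_cancel)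
 have z0: "\<phi> 0 = 0" using scale[of 0 0] by simp
 define M where "M = {x. \<phi> x = 0}"
 have "continuous_on UNIV \<phi>"
 proof (rule lipschitz_on_continuous_on)
  \<comment> \<open>A Lipschitz constant has to be nonnegative, and \<open>B\<close> carries no sign
    condition.\<close>
  show "lipschitz_on (max B 0) UNIV \<phi>"
  proof (rule lipschitz_onI)
   show "dist (\<phi> x) (\<phi> y) \<le> max B 0 * dist x y" for x y
    using bdd[of "x - y"] mult_right_mono[of B "max B 0" "norm (x - y)"] by (simp add: dist_norm diff[symmetric])
  qed simp
 qed
 then have "closed M" using continuous_closed_vimage[of "{0}" \<phi>] by (simp add: M_def vimage_def continuous_on_eq_continuous_at)
 then have M: "closed_csubspace M" by (auto simp: closed_csubspace_def csubspace_def M_def add scale z0)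
 show thesis
 proof (cases "M = UNIV")
  case True
  then show thesis using that[of 0] by (auto simp: M_def)
 next
  case False
  then obtain x0 where "x0 \<notin> M" by blast
  obtain y0 where y0: "y0 \<in> M" "x0 - y0 \<in> orthogonal_complement M" using orthogonal_projection_exists[OF M] by blast
  define e where "e = x0 - y0"
  have e0: "\<phi> e \<noteq> 0" using \<open>x0 \<notin> M\<close> y0 by (auto simp: e_def M_def diff)
  then have ne: "norm e \<noteq> 0" using z0 by auto
  have "\<phi> x = cinner (scaleC (cnj (\<phi> e) / (norm e)\<^sup>2) e) x" for x
  proof -
   have "x - scaleC (\<phi> x / \<phi> e) e \<in> M" using e0 by (simp add: M_def diff scale)
   then have "cinner (x - scaleC (\<phi> x / \<phi> e) e) e = 0" using y0(2) by (simp add: e_def orthogonal_complement_def)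
   then have "cinner x e = cnj (\<phi> x / \<phi> e) * (norm e)\<^sup>2" by (simp add: cinner_diff_left cinner_scaleC_left cinner_self)
   then have "cinner e x = \<phi> x / \<phi> e * (norm e)\<^sup>2" using cinner_commute[of e x] by simp
   then show ?thesis using e0 ne by (simp add: cinner_scaleC_left)
  qed
  then show thesis using that by blast
 qed
qed

section \<open>Closed spans, isometries and their extension\<close>

lemma csubspace_cspan: "csubspace (cspan S)" by (auto simp: cspan_def csubspace_def)

lemma cspan_superset: "S \<subseteq> cspan S" by (auto simp: cspan_def)

lemma cspan_minimal: "csubspace M \<Longrightarrow> S \<subseteq> M \<Longrightarrow> cspan S \<subseteq> M" by (auto simp: cspan_def)

lemma csubspace_closure:
 assumes "csubspace M"
 shows "csubspace (closure M)" unfolding csubspace_def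
proof (intro conjI ballI allI)
 show "0 \<in> closure M" using csubspaceD(1)[OF assms] closure_subset by blast
 fix x assume x: "x \<in> closure M"
 then obtain X where X: "\<And>n. X n \<in> M" "X \<longlonglongrightarrow> x" using closure_sequential by metis
 {
  fix y assume "y \<in> closure M"
  then obtain Y where "\<And>n. Y n \<in> M" "Y \<longlonglongrightarrow> y" using closure_sequential by metis
  then have "(\<lambda>n. X n + Y n) \<longlonglongrightarrow> x + y" "\<And>n. X n + Y n \<in> M"
   using X csubspaceD(2)[OF assms] by (auto intro: tendsto_add)
  then show "x + y \<in> closure M" unfolding closure_sequential[of "x + y" M] by (intro exI[of _ "\<lambda>n. X n + Y n"]) simp
 next
  fix c
  have "(\<lambda>n. scaleC c (X n)) \<longlonglongrightarrow> scaleC c x" "\<And>n. scaleC c (X n) \<in> M"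
   using X csubspaceD(3)[OF assms] by (auto intro: tendsto_scaleC)
  then show "scaleC c x \<in> closure M"
   unfolding closure_sequential[of "scaleC c x" M] by (intro exI[of _ "\<lambda>n. scaleC c (X n)"]) simp
 }
qed

lemma closed_csubspace_closure_cspan: "closed_csubspace (closure (cspan S))"
 by (simp add: closed_csubspace_def csubspace_closure csubspace_cspan)

lemma isometry_opD:
 assumes "isometry_op T"
 shows "T (x + y) = T x + T y" "T (scaleC c x) = scaleC c (T x)" "norm (T x) = norm x"
  "T (x - y) = T x - T y" "T 0 = 0"
proof -
 show *: "\<And>x y. T (x + y) = T x + T y" "T (scaleC c x) = scaleC c (T x)" "norm (T x) = norm x"
  using assms by (auto simp: isometry_op_def clinear_def)
 show "T (x - y) = T x - T y" by (metis *(1) add_diff_cancel diff_add_cancel)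
 show "T 0 = 0" using assms by (metis isometry_op_def norm_eq_zero)
qed

text \<open>Polarisation: real parts come from norms of sums, imaginary parts from replacing
  \<open>x\<close> by \<open>scaleC \<i> x\<close>.\<close>

lemma isometry_op_cinner:
 assumes "isometry_op T"
 shows "cinner (T x) (T y) = cinner x y"
proof -
 note D = isometry_opD[OF assms]
 have re: "Re (cinner (T x) (T y)) = Re (cinner x y)" for x y
  using norm_add_sq[of "T x" "T y"] norm_add_sq[of x y] D(3)[of "x + y"] D(1)[of x y] by (simp add: D(3))
 have "Im (cinner (T x) (T y)) = Im (cinner x y)" using re[of "scaleC \<i> x" y] by (simp add: D cinner_scaleC_left)
 with re show ?thesis by (simp add: complex_eq_iff)
qed

lemma isometry_op_compose: "isometry_op S \<Longrightarrow> isometry_op T \<Longrightarrow> isometry_op (S \<circ> T)"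
 by (auto simp: isometry_op_def clinear_def)

lemma isometry_op_dist:
 assumes "isometry_op T"
 shows "dist (T x) (T y) = dist x y" by (simp add: dist_norm isometry_opD(3)[OF assms] flip: isometry_opD(4)[OF assms])

lemma continuous_on_isometry_op: "isometry_op T \<Longrightarrow> continuous_on A T"
 by (intro lipschitz_on_continuous_on[of 1] lipschitz_onI) (auto simp: isometry_op_dist)

lemma closed_csubspace_isometry_range:
 fixes T :: "'a::chilbert_space \<Rightarrow> 'b::chilbert_space"
 assumes "isometry_op T"
 shows "closed_csubspace (range T)"
proof -
 note D = isometry_opD[OF assms]
 have "Topological_Spaces.complete (range T)" unfolding complete_def
 proof (intro allI impI, elim conjE)
  fix f assume f: "\<forall>n. f n \<in> range T" "Cauchy f"
  then have "\<forall>n. \<exists>x. f n = T x" by blast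
  then obtain g where g: "\<And>n. f n = T (g n)" by metis
  have "Cauchy g" using f(2) unfolding Cauchy_def g isometry_op_dist[OF assms] .
  then obtain l where "g \<longlonglongrightarrow> l" using Cauchy_convergent_iff convergent_def by blast
  then have "f \<longlonglongrightarrow> T l" unfolding g using continuous_on_isometry_op[OF assms, of UNIV]
   by (metis UNIV_I continuous_on_eq_continuous_at open_UNIV isCont_tendsto_compose)
  then show "\<exists>l\<in>range T. f \<longlonglongrightarrow> l" by blast
 qed
 then have "closed (range T)" by (rule complete_imp_closed)
 moreover have "csubspace (range T)" unfolding csubspace_def
 proof (intro conjI ballI allI)
  show "0 \<in> range T" using D(5) by (metis rangeI)
  fix x assume "x \<in> range T"
  then obtain l where l: "x = T l" by blast
  show "scaleC c x \<in> range T" for c unfolding l D(2)[symmetric] by simp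
  fix y assume "y \<in> range T"
  then obtain m where m: "y = T m" by blast
  show "x + y \<in> range T" unfolding l m D(1)[symmetric] by simp
 qed
 ultimately show ?thesis by (simp add: closed_csubspace_def)
qed

text \<open>Equal Gram matrices make the map on finite combinations of the \<open>\<phi> i\<close>
  norm preserving; well-definedness and the extension to the closure both follow from this.\<close>

theorem isometry_extension:
 fixes \<phi> :: "'i \<Rightarrow> 'a::chilbert_space" and \<psi> :: "'i \<Rightarrow> 'b::chilbert_space"
 assumes eq: "\<And>i j. cinner (\<phi> i) (\<phi> j) = cinner (\<psi> i) (\<psi> j)"
  and dense: "closure (cspan (range \<phi>)) = UNIV"
 obtains T where "isometry_op T" "\<And>i. T (\<phi> i) = \<psi> i"
proof -
 \<comment> \<open>Finite linear combinations are encoded as lists of coefficient-index pairs.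
   \<open>S\<close> and \<open>S'\<close> evaluate one list in the two spaces, so vectors need no
   unique representation.\<close>
 define S where "S = (\<lambda>(l :: (complex \<times> 'i) list). sum_list (map (\<lambda>(c, i). scaleC c (\<phi> i)) l))"
 define S' where "S' = (\<lambda>(l :: (complex \<times> 'i) list). sum_list (map (\<lambda>(c, i). scaleC c (\<psi> i)) l))"
 define sc where "sc = (\<lambda>(d::complex) (l :: (complex \<times> 'i) list). map (\<lambda>(c, i). (d * c, i)) l)"
 have simps: "S [] = 0" "S' [] = 0" "S ((c, i) # l) = scaleC c (\<phi> i) + S l"
  "S' ((c, i) # l) = scaleC c (\<psi> i) + S' l" for c i l
  by (auto simp: S_def S'_def)
 have app: "S (l @ m) = S l + S m" "S' (l @ m) = S' l + S' m" for l m by (auto simp: S_def S'_def)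
 have scS: "S (sc d l) = scaleC d (S l)" "S' (sc d l) = scaleC d (S' l)" for d l
  by (induction l) (auto simp: sc_def simps scaleC_add_right scaleC_scaleC)
 have inn1: "cinner (\<phi> i) (S m) = cinner (\<psi> i) (S' m)" for i m
  by (induction m) (auto simp: simps cinner_add_right cinner_scaleC_right eq)
 have inn: "cinner (S l) (S m) = cinner (S' l) (S' m)" for l m by (induction l) (auto simp: simps cinner_add_left cinner_scaleC_left inn1)
 have nrm: "norm (S l) = norm (S' l)" for l using inn[of l l] by (simp add: cinner_self flip: of_real_power)
 have dif: "S (l @ sc (- 1) m) = S l - S m" "S' (l @ sc (- 1) m) = S' l - S' m" for l m by (simp_all add: app scS scaleC_minus_one)
 have nrmd: "norm (S l - S m) = norm (S' l - S' m)" for l m using nrm[of "l @ sc (-1) m"] by (simp add: dif)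
 have "csubspace (range S)" unfolding csubspace_def
 proof (intro conjI ballI allI)
  show "0 \<in> range S" using simps(1) by (metis rangeI)
  fix x assume "x \<in> range S"
  then obtain l where l: "x = S l" by blast
  show "scaleC c x \<in> range S" for c unfolding l scS(1)[symmetric] by simp
  fix y assume "y \<in> range S"
  then obtain m where m: "y = S m" by blast
  show "x + y \<in> range S" unfolding l m app(1)[symmetric] by simp
 qed
 moreover have "\<phi> i \<in> range S" for i by (rule range_eqI[of _ _ "[(1, i)]"]) (simp add: simps scaleC_one)
 ultimately have "cspan (range \<phi>) \<subseteq> range S" by (intro cspan_minimal) auto
 then have "closure (range S) = UNIV" using dense closure_mono by blast
 then have "\<exists>L. (\<lambda>n. S (L n)) \<longlonglongrightarrow> x" for x
 proof -
  have "x \<in> closure (range S)" using \<open>closure (range S) = UNIV\<close> by simp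
  then obtain X where X: "\<And>n. X n \<in> range S" "X \<longlonglongrightarrow> x" unfolding closure_sequential by blast
  then have "\<And>n. \<exists>l. X n = S l" by blast
  then obtain L where "\<And>n. X n = S (L n)" by metis
  then have "(\<lambda>n. S (L n)) = X" by auto
  with X(2) have "(\<lambda>n. S (L n)) \<longlonglongrightarrow> x" by simp
  then show ?thesis by blast
 qed
 then obtain L where L: "\<And>x. (\<lambda>n. S (L x n)) \<longlonglongrightarrow> x" by metis
 have conv: "\<exists>y. (\<lambda>n. S' (l n)) \<longlonglongrightarrow> y" if "(\<lambda>n. S (l n)) \<longlonglongrightarrow> x" for l x
 proof -
  have "Cauchy (\<lambda>n. S (l n))" using that by (rule LIMSEQ_imp_Cauchy)
  then have "Cauchy (\<lambda>n. S' (l n))" unfolding Cauchy_def dist_norm nrmd .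
  then show ?thesis using Cauchy_convergent_iff convergent_def by blast
 qed
 define T where "T x = lim (\<lambda>n. S' (L x n))" for x
 have TL: "(\<lambda>n. S' (L x n)) \<longlonglongrightarrow> T x" for x
  using conv[OF L] by (simp add: T_def convergent_LIMSEQ_iff[symmetric] convergent_def)
 \<comment> \<open>Independence of the approximating lists; linearity and
   \<open>T (\<phi> i) = \<psi> i\<close> follow by choosing convenient ones.\<close>
 have T: "T x = y" if l: "(\<lambda>n. S (l n)) \<longlonglongrightarrow> x" "(\<lambda>n. S' (l n)) \<longlonglongrightarrow> y" for l x y
 proof -
  have "(\<lambda>n. S (L x n) - S (l n)) \<longlonglongrightarrow> x - x" by (intro tendsto_diff L l)
  then have "(\<lambda>n. norm (S' (L x n) - S' (l n))) \<longlonglongrightarrow> 0"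
   unfolding nrmd[symmetric] by (intro tendsto_norm_zero) simp
  moreover have "(\<lambda>n. norm (S' (L x n) - S' (l n))) \<longlonglongrightarrow> norm (T x - y)" by (intro tendsto_intros TL l)
  ultimately show ?thesis using LIMSEQ_unique by fastforce
 qed
 have "isometry_op T" unfolding isometry_op_def clinear_def
 proof (intro conjI allI)
  fix x y c
  show "T (x + y) = T x + T y" using L TL by (intro T[of "\<lambda>n. L x n @ L y n"]) (auto simp: app intro!: tendsto_add)
  show "T (scaleC c x) = scaleC c (T x)" using L TL by (intro T[of "\<lambda>n. sc c (L x n)"]) (auto simp: scS intro!: tendsto_scaleC)
  have "(\<lambda>n. norm (S (L x n))) \<longlonglongrightarrow> norm x" "(\<lambda>n. norm (S' (L x n))) \<longlonglongrightarrow> norm (T x)"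
   by (intro tendsto_intros L TL)+
  then show "norm (T x) = norm x" unfolding nrm using LIMSEQ_unique by blast
 qed
 moreover have "T (\<phi> i) = \<psi> i" for i by (rule T[of "\<lambda>_. [(1, i)]"]) (auto simp: simps scaleC_one)
 ultimately show thesis using that by blast
qed

section \<open>The Hilbert space of square-integrable functions\<close>

lemma measurable_cnj [measurable]: "f \<in> borel_measurable M \<Longrightarrow> (\<lambda>x. cnj (f x)) \<in> borel_measurable M"
 using measurable_compose[OF _ borel_measurable_continuous_onI[OF continuous_on_cnj[OF continuous_on_id]], of f M] by simp

lemma L2D: "f \<in> L2 \<Longrightarrow> f \<in> borel_measurable borel" "f \<in> L2 \<Longrightarrow> integrable lborel (\<lambda>x. (cmod (f x))\<^sup>2)"
 by (auto simp: L2_def)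

lemma L2I: "f \<in> borel_measurable borel \<Longrightarrow> integrable lborel (\<lambda>x. (cmod (f x))\<^sup>2) \<Longrightarrow> f \<in> L2"
 by (auto simp: L2_def)

lemma L2_bound:
 assumes "g \<in> L2" "f \<in> borel_measurable borel" "\<And>x. cmod (f x) \<le> B * cmod (g x)"
 shows "f \<in> L2"
proof (rule L2I)
 have "integrable lborel (\<lambda>x. B\<^sup>2 * (cmod (g x))\<^sup>2)" using L2D[OF assms(1)] by auto
 then show "integrable lborel (\<lambda>x. (cmod (f x))\<^sup>2)"
 proof (rule Bochner_Integration.integrable_bound)
  show "AE x in lborel. norm ((cmod (f x))\<^sup>2) \<le> norm (B\<^sup>2 * (cmod (g x))\<^sup>2)"
   using power_mono[OF assms(3) norm_ge_zero, of _ 2] by (intro AE_I2) (simp add: power_mult_distrib)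
 qed (use assms(2) in simp)
qed (fact assms(2))

lemma L2_bounded_mult:
 assumes "f \<in> L2" "g \<in> borel_measurable borel" "\<And>x. cmod (g x) \<le> B"
 shows "(\<lambda>x. g x * f x) \<in> L2"
proof (rule L2_bound[OF assms(1)])
 note [measurable] = L2D(1)[OF assms(1)] assms(2)
 show "(\<lambda>x. g x * f x) \<in> borel_measurable borel" by measurable
 show "cmod (g x * f x) \<le> B * cmod (f x)" for x unfolding norm_mult by (intro mult_right_mono assms(3)) simp
qed

lemma L2_scale: "f \<in> L2 \<Longrightarrow> (\<lambda>x. c * f x) \<in> L2" by (rule L2_bounded_mult[of f "\<lambda>_. c" "cmod c"]) auto

lemma L2_uminus: "f \<in> L2 \<Longrightarrow> (\<lambda>x. - f x) \<in> L2" using L2_scale[of f "-1"] by simp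

lemma L2_cnj: "f \<in> L2 \<Longrightarrow> (\<lambda>x. cnj (f x)) \<in> L2"
 by (rule L2_bound[of f _ 1]) (simp_all add: L2D(1) measurable_cnj)

lemma L2_add:
 assumes "f \<in> L2" "g \<in> L2"
 shows "(\<lambda>x. f x + g x) \<in> L2"
proof (rule L2I)
 note [measurable] = L2D(1)[OF assms(1)] L2D(1)[OF assms(2)]
 show "(\<lambda>x. f x + g x) \<in> borel_measurable borel" by simp
 have "integrable lborel (\<lambda>x. 2 * (cmod (f x))\<^sup>2 + 2 * (cmod (g x))\<^sup>2)"
  using L2D(2)[OF assms(1)] L2D(2)[OF assms(2)] by auto
 then show "integrable lborel (\<lambda>x. (cmod (f x + g x))\<^sup>2)"
 proof (rule Bochner_Integration.integrable_bound)
  have "(cmod (a + b))\<^sup>2 \<le> 2 * (cmod a)\<^sup>2 + 2 * (cmod b)\<^sup>2" for a b :: complex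
  proof -
   have "(cmod (a + b))\<^sup>2 \<le> (cmod a + cmod b)\<^sup>2" by (simp add: norm_triangle_ineq power_mono)
   also have "\<dots> \<le> 2 * (cmod a)\<^sup>2 + 2 * (cmod b)\<^sup>2"
    using zero_le_power2[of "cmod a - cmod b"] by (simp add: power2_diff power2_sum)
   finally show ?thesis .
  qed
  then show "AE x in lborel. norm ((cmod (f x + g x))\<^sup>2) \<le> norm (2 * (cmod (f x))\<^sup>2 + 2 * (cmod (g x))\<^sup>2)" by auto
 qed simp
qed

lemma L2_diff: "f \<in> L2 \<Longrightarrow> g \<in> L2 \<Longrightarrow> (\<lambda>x. f x - g x) \<in> L2"
 using L2_add[of f "\<lambda>x. - g x"] L2_uminus[of g] by simp

lemma L2_zero: "(\<lambda>_. 0) \<in> L2" by (rule L2I) auto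

lemma L2_mult_integrable:
 assumes "f \<in> L2" "g \<in> L2"
 shows "integrable lborel (\<lambda>x. f x * g x)"
proof -
 note [measurable] = L2D(1)[OF assms(1)] L2D(1)[OF assms(2)]
 have "integrable lborel (\<lambda>x. (cmod (f x))\<^sup>2 + (cmod (g x))\<^sup>2)" using L2D(2)[OF assms(1)] L2D(2)[OF assms(2)] by auto
 then show ?thesis
 proof (rule Bochner_Integration.integrable_bound)
  have "cmod (a * b) \<le> (cmod a)\<^sup>2 + (cmod b)\<^sup>2" for a b
  proof -
   have "cmod (a * b) = cmod a * cmod b" by (simp add: norm_mult)
   moreover have "2 * (cmod a * cmod b) \<le> (cmod a)\<^sup>2 + (cmod b)\<^sup>2" using sum_squares_bound[of "cmod a" "cmod b"] by simp
   moreover have "0 \<le> cmod a * cmod b" by simp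
   ultimately show ?thesis by linarith
  qed
  then show "AE x in lborel. norm (f x * g x) \<le> norm ((cmod (f x))\<^sup>2 + (cmod (g x))\<^sup>2)" by auto
 qed simp
qed

lemma L2_AE_cong:
 assumes "f \<in> L2" "g \<in> borel_measurable borel" "AE x in lborel. f x = g x"
 shows "g \<in> L2"
proof (rule L2I[OF assms(2)])
 have "integrable lborel (\<lambda>x. (cmod (f x))\<^sup>2) \<longleftrightarrow> integrable lborel (\<lambda>x. (cmod (g x))\<^sup>2)"
  using assms L2D[OF assms(1)] by (intro integrable_cong_AE) auto
 then show "integrable lborel (\<lambda>x. (cmod (g x))\<^sup>2)" using L2D[OF assms(1)] by simp
qed

lemma lborel_integral_shift:
 fixes f :: "real \<Rightarrow> 'a::{banach, second_countable_topology}"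
 shows "(LBINT x. f (x - b)) = (LBINT x. f x)" "(LBINT x. f (x + b)) = (LBINT x. f x)"
 using lborel_integral_real_affine[of 1 f "-b"] lborel_integral_real_affine[of 1 f "b"] by (simp_all add: add.commute)

lemma lborel_integrable_shift:
 fixes f :: "real \<Rightarrow> 'a::{banach, second_countable_topology}"
 shows "integrable lborel (\<lambda>x. f (x - b)) \<longleftrightarrow> integrable lborel f" "integrable lborel (\<lambda>x. f (x + b)) \<longleftrightarrow> integrable lborel f"
 using lborel_integrable_real_affine_iff[of 1 f "-b"] lborel_integrable_real_affine_iff[of 1 f "b"] by (simp_all add: add.commute)

lemma AE_lborel_shift:
 assumes "AE x in lborel. P x"
 shows "AE x in lborel. P (x - b :: real)"
proof -
 have "(+) (- b) = (\<lambda>x. x - b)" by auto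
 then have eq: "lborel = distr lborel borel (\<lambda>x. x - b)" using lborel_distr_plus[of "-b"] by simp
 have "AE x in distr lborel borel (\<lambda>x. x - b). P x" using assms unfolding eq[symmetric] .
 then show ?thesis by (rule AE_distrD[rotated]) simp
qed

lemma L2_Dop: "f \<in> L2 \<Longrightarrow> Dop b f \<in> L2"
proof -
 assume f: "f \<in> L2"
 show ?thesis unfolding Dop_def
 proof (rule L2I)
  show "(\<lambda>x. f (x - b)) \<in> borel_measurable borel" using L2D(1)[OF f] by measurable
  show "integrable lborel (\<lambda>x. (cmod (f (x - b)))\<^sup>2)"
   using lborel_integrable_shift(1)[of "\<lambda>x. (cmod (f x))\<^sup>2" b] L2D(2)[OF f] by blast
 qed
qed

lemma norm_exp_ii_of_real [simp]: "cmod (exp (\<i> * of_real r)) = 1" by (simp add: norm_exp_eq_Re)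

lemma L2_Mop: "f \<in> L2 \<Longrightarrow> Mop a f \<in> L2" unfolding Mop_def by (rule L2_bounded_mult[of f _ 1]) simp_all

text \<open>\<open>SOME\<close> depends only on the predicate, hence only on the a.e. class of
  \<open>f\<close>. Functions that agree a.e. receive literally the same representative, so HOL
  equality on the quotient type is a.e. equality.\<close>

definition L2_canonical :: "(real \<Rightarrow> complex) \<Rightarrow> real \<Rightarrow> complex" where
 "L2_canonical f = (SOME g. g \<in> L2 \<and> (AE x in lborel. g x = f x))"

text \<open>A class of almost everywhere equal functions is represented by one chosen member.\<close>

typedef l2 = "L2_canonical ` L2" morphisms fun_of_l2 Abs_l2
 using L2_zero by auto

definition to_l2 :: "(real \<Rightarrow> complex) \<Rightarrow> l2" where
 "to_l2 f = Abs_l2 (L2_canonical f)"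

lemma L2_canonical:
 assumes "f \<in> L2"
 shows "L2_canonical f \<in> L2" "AE x in lborel. L2_canonical f x = f x"
proof -
 have "\<exists>g. g \<in> L2 \<and> (AE x in lborel. g x = f x)" using assms by auto
 from someI_ex[OF this] show "L2_canonical f \<in> L2" "AE x in lborel. L2_canonical f x = f x" by (auto simp: L2_canonical_def)
qed

lemma fun_of_l2_L2 [simp]: "fun_of_l2 x \<in> L2" using fun_of_l2[of x] L2_canonical by auto

lemma fun_of_l2_measurable [measurable]: "fun_of_l2 x \<in> borel_measurable borel" using L2D(1)[of "fun_of_l2 x"] by simp

lemma fun_of_to_l2: "f \<in> L2 \<Longrightarrow> AE t in lborel. fun_of_l2 (to_l2 f) t = f t"
 using L2_canonical by (simp add: to_l2_def Abs_l2_inverse)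

lemma to_l2_eqI:
 assumes "AE t in lborel. f t = g t"
 shows "to_l2 f = to_l2 g"
proof -
 have "(AE x in lborel. h x = f x) \<longleftrightarrow> (AE x in lborel. h x = g x)" for h using assms by (auto elim!: AE_mp)
 then show ?thesis by (simp add: to_l2_def L2_canonical_def)
qed

lemma to_l2_fun_of_l2 [simp]: "to_l2 (fun_of_l2 x) = x"
proof (cases x)
 case (Abs_l2 y)
 then obtain f where f: "f \<in> L2" "y = L2_canonical f" by auto
 then have "to_l2 y = to_l2 f" using L2_canonical by (intro to_l2_eqI) auto
 then show ?thesis using f Abs_l2 by (simp add: Abs_l2_inverse to_l2_def)
qed

lemma l2_eqI: "AE t in lborel. fun_of_l2 x t = fun_of_l2 y t \<Longrightarrow> x = y"
 using to_l2_eqI[of "fun_of_l2 x" "fun_of_l2 y"] by simp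

lemma l2_cases:
 obtains f where "f \<in> L2" "x = to_l2 f"
 using that[of "fun_of_l2 x"] by simp

instantiation l2 :: real_inner
begin

definition "0 = to_l2 (\<lambda>_. 0)"
definition "x + y = to_l2 (\<lambda>t. fun_of_l2 x t + fun_of_l2 y t)"
definition "x - y = to_l2 (\<lambda>t. fun_of_l2 x t - fun_of_l2 y t)"
definition "- x = to_l2 (\<lambda>t. - fun_of_l2 x t)"
definition "scaleR r x = to_l2 (\<lambda>t. complex_of_real r * fun_of_l2 x t)"
definition "inner x y = Re (LBINT t. cnj (fun_of_l2 x t) * fun_of_l2 y t)"
definition "norm (x::l2) = sqrt (inner x x)"
definition "dist (x::l2) y = norm (x - y)"
definition "sgn (x::l2) = scaleR (inverse (norm x)) x"
definition "uniformity = (INF e\<in>{0<..}. principal {(x, y). dist (x::l2) y < e})"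
definition "open (U::l2 set) \<longleftrightarrow> (\<forall>x\<in>U. eventually (\<lambda>(x', y). x' = x \<longrightarrow> y \<in> U) uniformity)"

lemma fun_of_l2_ops:
 "AE t in lborel. fun_of_l2 0 t = 0"
 "AE t in lborel. fun_of_l2 (x + y) t = fun_of_l2 x t + fun_of_l2 y t"
 "AE t in lborel. fun_of_l2 (x - y) t = fun_of_l2 x t - fun_of_l2 y t"
 "AE t in lborel. fun_of_l2 (- x) t = - fun_of_l2 x t"
 "AE t in lborel. fun_of_l2 (scaleR r x) t = complex_of_real r * fun_of_l2 x t"
 unfolding zero_l2_def plus_l2_def minus_l2_def uminus_l2_def scaleR_l2_def
 by (intro fun_of_to_l2 L2_zero L2_add L2_diff L2_uminus L2_scale fun_of_l2_L2)+

lemma l2_inner_integrable: "integrable lborel (\<lambda>t. cnj (fun_of_l2 x t) * fun_of_l2 y t)"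
 by (intro L2_mult_integrable L2_cnj fun_of_l2_L2)

instance
proof
 fix x y z :: l2 and r s :: real
 show "x + y + z = x + (y + z)"
  apply (rule l2_eqI)
  using fun_of_l2_ops(2)[of "x + y" z] fun_of_l2_ops(2)[of "x" "y + z"] fun_of_l2_ops(2)[of y z] fun_of_l2_ops(2)[of x y]
  by eventually_elim simp
 show "x + y = y + x" by (simp add: plus_l2_def add.commute)
 show "0 + x = x"
  apply (rule l2_eqI)
  using fun_of_l2_ops(2)[of 0 x] fun_of_l2_ops(1) by eventually_elim simp
 show "- x + x = 0"
  apply (rule l2_eqI)
  using fun_of_l2_ops(2)[of "-x" x] fun_of_l2_ops(1) fun_of_l2_ops(4)[of x] by eventually_elim simp
 show "x - y = x + - y"
  apply (rule l2_eqI)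
  using fun_of_l2_ops(2)[of x "-y"] fun_of_l2_ops(3)[of x y] fun_of_l2_ops(4)[of y] by eventually_elim simp
 show "r *\<^sub>R (x + y) = r *\<^sub>R x + r *\<^sub>R y"
  apply (rule l2_eqI)
  using fun_of_l2_ops(5)[of r "x + y"] fun_of_l2_ops(2)[of "r *\<^sub>R x" "r *\<^sub>R y"] fun_of_l2_ops(5)[of r x]
   fun_of_l2_ops(5)[of r y] fun_of_l2_ops(2)[of x y]
  by eventually_elim (simp add: algebra_simps)
 show "(r + s) *\<^sub>R x = r *\<^sub>R x + s *\<^sub>R x"
  apply (rule l2_eqI)
  using fun_of_l2_ops(5)[of "r + s" "x"] fun_of_l2_ops(2)[of "r *\<^sub>R x" "s *\<^sub>R x"] fun_of_l2_ops(5)[of r x]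
   fun_of_l2_ops(5)[of s x]
  by eventually_elim (simp add: algebra_simps)
 show "r *\<^sub>R s *\<^sub>R x = (r * s) *\<^sub>R x"
  apply (rule l2_eqI)
  using fun_of_l2_ops(5)[of "r * s" "x"] fun_of_l2_ops(5)[of r "s *\<^sub>R x"] fun_of_l2_ops(5)[of s x]
  by eventually_elim (simp add: algebra_simps)
 show "1 *\<^sub>R x = x"
  apply (rule l2_eqI)
  using fun_of_l2_ops(5)[of 1 "x"] by eventually_elim simp
 show "dist x y = norm (x - y)" "sgn x = inverse (norm x) *\<^sub>R x" "norm x = sqrt (inner x x)"
  by (simp_all add: dist_l2_def sgn_l2_def norm_l2_def)
 show "uniformity = (INF e\<in>{0<..}. principal {(x, y). dist (x::l2) y < e})" by (rule uniformity_l2_def)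
 show "open U = (\<forall>x\<in>U. \<forall>\<^sub>F (x', y) in uniformity. x' = x \<longrightarrow> y \<in> U)" for U :: "l2 set"
  by (rule open_l2_def)
 have "inner x y = Re (cnj (LBINT t. cnj (fun_of_l2 x t) * fun_of_l2 y t))" by (simp add: inner_l2_def)
 also have "cnj (LBINT t. cnj (fun_of_l2 x t) * fun_of_l2 y t) = (LBINT t. cnj (fun_of_l2 y t) * fun_of_l2 x t)"
  by (simp add: Bochner_Integration.integral_cnj[symmetric] mult.commute del: Bochner_Integration.integral_cnj)
 finally show "inner x y = inner y x" by (simp add: inner_l2_def)
 have "(LBINT t. cnj (fun_of_l2 (x + y) t) * fun_of_l2 z t)
   = (LBINT t. cnj (fun_of_l2 x t) * fun_of_l2 z t + cnj (fun_of_l2 y t) * fun_of_l2 z t)"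
  by (rule integral_cong_AE) (use fun_of_l2_ops(2)[of x y] in \<open>auto elim!: AE_mp simp: algebra_simps\<close>)
 then show "inner (x + y) z = inner x z + inner y z" by (simp add: inner_l2_def l2_inner_integrable)
 have "(LBINT t. cnj (fun_of_l2 (r *\<^sub>R x) t) * fun_of_l2 y t)
   = (LBINT t. complex_of_real r * (cnj (fun_of_l2 x t) * fun_of_l2 y t))"
  by (rule integral_cong_AE) (use fun_of_l2_ops(5)[of r x] in \<open>auto elim!: AE_mp simp: algebra_simps\<close>)
 then show "inner (r *\<^sub>R x) y = r * inner x y" by (simp add: inner_l2_def)
 have sq: "inner x x = (LBINT t. (cmod (fun_of_l2 x t))\<^sup>2)"
 proof -
  have "cnj (fun_of_l2 x t) * fun_of_l2 x t = complex_of_real ((cmod (fun_of_l2 x t))\<^sup>2)" for t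
   by (simp add: complex_norm_square mult.commute del: of_real_power)
  then show ?thesis by (simp add: inner_l2_def del: of_real_power)
 qed
 then show "0 \<le> inner x x" by simp
 have "inner x x = 0 \<longleftrightarrow> (AE t in lborel. (cmod (fun_of_l2 x t))\<^sup>2 = 0)"
  unfolding sq by (rule integral_nonneg_eq_0_iff_AE) (auto simp: L2D)
 also have "\<dots> \<longleftrightarrow> x = 0"
 proof
  assume "AE t in lborel. (cmod (fun_of_l2 x t))\<^sup>2 = 0"
  then show "x = 0" by (intro l2_eqI) (use fun_of_l2_ops(1) in \<open>auto elim!: AE_mp\<close>)
 next
  assume "x = 0"
  then show "AE t in lborel. (cmod (fun_of_l2 x t))\<^sup>2 = 0" using fun_of_l2_ops(1) by auto
 qed
 finally show "inner x x = 0 \<longleftrightarrow> x = 0" .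
qed

end

lemma l2_norm_sq: "(norm x)\<^sup>2 = (LBINT t. (cmod (fun_of_l2 x t))\<^sup>2)"
proof -
 have "cnj (fun_of_l2 x t) * fun_of_l2 x t = complex_of_real ((cmod (fun_of_l2 x t))\<^sup>2)" for t
  by (simp add: complex_norm_square mult.commute del: of_real_power)
 then have "inner x x = (LBINT t. (cmod (fun_of_l2 x t))\<^sup>2)" by (simp add: inner_l2_def del: of_real_power)
 then show ?thesis by (simp add: norm_eq_sqrt_inner)
qed

lemma l2_norm_diff_sq: "(norm (x - y))\<^sup>2 = (LBINT t. (cmod (fun_of_l2 x t - fun_of_l2 y t))\<^sup>2)"
proof -
 have "AE t in lborel. (cmod (fun_of_l2 (x - y) t))\<^sup>2 = (cmod (fun_of_l2 x t - fun_of_l2 y t))\<^sup>2"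
  using fun_of_l2_ops(3)[of x y] by eventually_elim simp
 then show ?thesis unfolding l2_norm_sq by (intro integral_cong_AE) simp_all
qed

text \<open>Riesz--Fischer: the weights \<open>4 ^ n\<close> turn the \<open>L2\<close> bounds into pointwise geometric decay almost
 everywhere, and Fatou's lemma identifies the limit.\<close>

lemma L2_Cauchy_limit:
 fixes f :: "nat \<Rightarrow> real \<Rightarrow> complex"
 assumes f: "\<And>n. f n \<in> L2"
  and fast: "\<And>n. (LBINT x. (cmod (f (Suc n) x - f n x))\<^sup>2) \<le> (1/8) ^ n"
  and Cauchy: "\<And>e. 0 < e \<Longrightarrow> \<exists>N. \<forall>m\<ge>N. \<forall>n\<ge>N. (LBINT x. (cmod (f n x - f m x))\<^sup>2) \<le> e"
 obtains g where "g \<in> L2" "(\<lambda>n. LBINT x. (cmod (f n x - g x))\<^sup>2) \<longlonglongrightarrow> 0"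
proof -
 have [measurable]: "f n \<in> borel_measurable borel" for n using f L2D by blast
 have int: "integrable lborel (\<lambda>x. (cmod (f n x - f m x))\<^sup>2)" for m n using L2D(2)[OF L2_diff[OF f[of n] f[of m]]] .
 have "(\<integral>\<^sup>+x. (\<Sum>n. ennreal (4 ^ n * (cmod (f (Suc n) x - f n x))\<^sup>2)) \<partial>lborel)
   = (\<Sum>n. \<integral>\<^sup>+x. ennreal (4 ^ n * (cmod (f (Suc n) x - f n x))\<^sup>2) \<partial>lborel)"
  by (rule nn_integral_suminf) measurable
 also have "\<dots> \<le> (\<Sum>n. ennreal ((1/2) ^ n))"
 proof (rule suminf_le)
  fix n
  have "(\<integral>\<^sup>+x. ennreal (4 ^ n * (cmod (f (Suc n) x - f n x))\<^sup>2) \<partial>lborel)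
    = ennreal (LBINT x. 4 ^ n * (cmod (f (Suc n) x - f n x))\<^sup>2)"
   using int by (intro nn_integral_eq_integral) auto
  also have "(LBINT x. 4 ^ n * (cmod (f (Suc n) x - f n x))\<^sup>2) \<le> 4 ^ n * (1/8) ^ n" using fast by (simp add: mult_left_mono)
  also have "(4::real) ^ n * (1/8) ^ n = (1/2) ^ n" by (simp add: power_mult_distrib[symmetric])
  finally show "(\<integral>\<^sup>+x. ennreal (4 ^ n * (cmod (f (Suc n) x - f n x))\<^sup>2) \<partial>lborel) \<le> ennreal ((1/2) ^ n)"
   by (simp add: ennreal_leI)
 qed auto
 also have "\<dots> = ennreal (\<Sum>n. (1/2) ^ n)" by (intro suminf_ennreal2) (auto simp: summable_geometric)
 finally have fin: "AE x in lborel. (\<Sum>n. ennreal (4 ^ n * (cmod (f (Suc n) x - f n x))\<^sup>2)) \<noteq> \<infinity>"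
  by (intro nn_integral_PInf_AE) (auto simp: top_unique)
 have conv: "convergent (\<lambda>n. f n x)"
  if "(\<Sum>n. ennreal (4 ^ n * (cmod (f (Suc n) x - f n x))\<^sup>2)) \<noteq> \<infinity>" for x
 proof -
  have "summable (\<lambda>n. 4 ^ n * (cmod (f (Suc n) x - f n x))\<^sup>2)" by (rule summable_suminf_not_top) (use that in auto)
  then have "(\<lambda>n. 4 ^ n * (cmod (f (Suc n) x - f n x))\<^sup>2) \<longlonglongrightarrow> 0" by (rule summable_LIMSEQ_zero)
  then have "\<forall>\<^sub>F n in sequentially. 4 ^ n * (cmod (f (Suc n) x - f n x))\<^sup>2 < 1" by (rule order_tendstoD) simp
  then obtain N where N: "\<And>n. n \<ge> N \<Longrightarrow> 4 ^ n * (cmod (f (Suc n) x - f n x))\<^sup>2 < 1"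
   unfolding eventually_sequentially by blast
  have le: "norm (f (Suc n) x - f n x) \<le> (1/2) ^ n" if "n \<ge> N" for n
  proof -
   have "(cmod (f (Suc n) x - f n x))\<^sup>2 \<le> ((1/2) ^ n)\<^sup>2"
   proof -
    have "((1/2) ^ n)\<^sup>2 = (1/4 :: real) ^ n" by (simp add: power2_eq_square power_mult_distrib[symmetric])
    moreover have "(4::real) ^ n * (1/4) ^ n = 1" by (simp add: power_mult_distrib[symmetric])
    then have "(4::real) ^ n * (cmod (f (Suc n) x - f n x))\<^sup>2 \<le> 4 ^ n * (1/4) ^ n" using N[OF that] by simp
    then have "(cmod (f (Suc n) x - f n x))\<^sup>2 \<le> (1/4) ^ n" by simp
    ultimately show ?thesis by simp
   qed
   then show ?thesis by (rule power2_le_imp_le) simp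
  qed
  have "summable (\<lambda>n. (1/2 :: real) ^ n)" by (simp add: summable_geometric)
  then have "summable (\<lambda>n. f (Suc n) x - f n x)" by (rule summable_comparison_test') (rule le)
  then have "convergent (\<lambda>n. \<Sum>k<n. f (Suc k) x - f k x)" by (simp add: summable_iff_convergent)
  then have "convergent (\<lambda>n. (\<Sum>k<n. f (Suc k) x - f k x) + f 0 x)" by (simp add: convergent_add_const_right_iff)
  then show ?thesis using sum_lessThan_telescope[of "\<lambda>n. f n x"] by simp
 qed
 have AEconv: "AE x in lborel. convergent (\<lambda>n. f n x)" using fin by eventually_elim (rule conv)
 define g where "g x = lim (\<lambda>n. f n x)" for x
 have g_meas [measurable]: "g \<in> borel_measurable borel" unfolding g_def by measurable
 have lim: "AE x in lborel. (\<lambda>n. f n x) \<longlonglongrightarrow> g x" using AEconv by (auto simp: g_def convergent_LIMSEQ_iff)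
 have key: "integrable lborel (\<lambda>x. (cmod (f m x - g x))\<^sup>2) \<and> (LBINT x. (cmod (f m x - g x))\<^sup>2) \<le> e"
  if e: "0 < e" and N: "\<forall>m\<ge>N. \<forall>n\<ge>N. (LBINT x. (cmod (f n x - f m x))\<^sup>2) \<le> e" and m: "m \<ge> N" for m N e
 proof -
  have "(\<integral>\<^sup>+x. ennreal ((cmod (f m x - g x))\<^sup>2) \<partial>lborel)
    = (\<integral>\<^sup>+x. liminf (\<lambda>n. ennreal ((cmod (f m x - f n x))\<^sup>2)) \<partial>lborel)"
  proof (rule nn_integral_cong_AE)
   show "AE x in lborel. ennreal ((cmod (f m x - g x))\<^sup>2) = liminf (\<lambda>n. ennreal ((cmod (f m x - f n x))\<^sup>2))"
    using lim
   proof eventually_elim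
    case (elim x)
    then have "(\<lambda>n. ennreal ((cmod (f m x - f n x))\<^sup>2)) \<longlonglongrightarrow> ennreal ((cmod (f m x - g x))\<^sup>2)"
     by (intro tendsto_intros)
    then show ?case by (rule lim_imp_Liminf[symmetric, rotated]) simp
   qed
  qed
  also have "\<dots> \<le> liminf (\<lambda>n. \<integral>\<^sup>+x. ennreal ((cmod (f m x - f n x))\<^sup>2) \<partial>lborel)"
   by (rule nn_integral_liminf) measurable
  also have "\<dots> \<le> liminf (\<lambda>n. ennreal e)"
  proof (rule Liminf_mono)
   show "\<forall>\<^sub>F n in sequentially. (\<integral>\<^sup>+x. ennreal ((cmod (f m x - f n x))\<^sup>2) \<partial>lborel) \<le> ennreal e"
    unfolding eventually_sequentially
   proof (intro exI[of _ N] allI impI)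
    fix n assume "N \<le> n"
    then show "(\<integral>\<^sup>+x. ennreal ((cmod (f m x - f n x))\<^sup>2) \<partial>lborel) \<le> ennreal e"
     using N m int by (subst nn_integral_eq_integral) (auto intro: ennreal_leI)
   qed
  qed
  also have "\<dots> = ennreal e" by (simp add: Liminf_const)
  finally have le: "(\<integral>\<^sup>+x. ennreal ((cmod (f m x - g x))\<^sup>2) \<partial>lborel) \<le> ennreal e" .
  then have int': "integrable lborel (\<lambda>x. (cmod (f m x - g x))\<^sup>2)"
   by (intro integrableI_bounded) (auto intro: le_less_trans[OF le])
  moreover have "ennreal (LBINT x. (cmod (f m x - g x))\<^sup>2) \<le> ennreal e"
   using le int' by (subst nn_integral_eq_integral[symmetric]) auto
  ultimately show ?thesis using e by (simp add: ennreal_le_iff)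
 qed
 obtain N1 where N1: "\<forall>m\<ge>N1. \<forall>n\<ge>N1. (LBINT x. (cmod (f n x - f m x))\<^sup>2) \<le> 1" using Cauchy[of 1] by auto
 have "(\<lambda>x. f N1 x - g x) \<in> L2" using key[OF _ N1, of N1] by (intro L2I) auto
 from L2_diff[OF f[of N1] this] have "(\<lambda>x. f N1 x - (f N1 x - g x)) \<in> L2" .
 then have "g \<in> L2" by simp
 moreover have "(\<lambda>n. LBINT x. (cmod (f n x - g x))\<^sup>2) \<longlonglongrightarrow> 0"
 proof (rule LIMSEQ_I)
  fix e :: real assume e: "0 < e"
  obtain N where N: "\<forall>m\<ge>N. \<forall>n\<ge>N. (LBINT x. (cmod (f n x - f m x))\<^sup>2) \<le> e / 2"
   using Cauchy[of "e / 2"] e by auto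
  show "\<exists>no. \<forall>n\<ge>no. norm ((LBINT x. (cmod (f n x - g x))\<^sup>2) - 0) < e"
   using key[OF _ N] e by (intro exI[of _ N]) fastforce
 qed
 ultimately show thesis using that by blast
qed

text \<open>Passing to a subsequence with prescribed decay of consecutive distances prepares the
  geometric hypothesis of \<open>L2_Cauchy_limit\<close>.\<close>

lemma Cauchy_fast_subseq:
 fixes X :: "nat \<Rightarrow> 'a::metric_space"
 assumes "Cauchy X" and e: "\<And>n. 0 < e n"
 obtains r :: "nat \<Rightarrow> nat" where "strict_mono r" "\<And>n. dist (X (r (Suc n))) (X (r n)) < e n"
proof -
 have "\<exists>N. \<forall>m\<ge>N. \<forall>k\<ge>N. dist (X m) (X k) < e n" for n using metric_CauchyD[OF assms(1) e] .
 then obtain N where N: "\<And>n m k. m \<ge> N n \<Longrightarrow> k \<ge> N n \<Longrightarrow> dist (X m) (X k) < e n" by metis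
 have "\<exists>r. \<forall>n. N n \<le> r n \<and> (r n :: nat) < r (Suc n)"
 proof (rule dependent_nat_choice)
  show "\<exists>y. N (Suc n) \<le> y \<and> x < y" for x n by (rule exI[of _ "max (N (Suc n)) (Suc x)"]) auto
 qed auto
 then obtain r where r: "\<And>n. N n \<le> r n" "\<And>n. r n < r (Suc n)" by blast
 then have "dist (X (r (Suc n))) (X (r n)) < e n" for n by (meson N less_imp_le order_trans)
 then show thesis using that r(2) strict_mono_Suc_iff by blast
qed

instance l2 :: banach
proof
 fix X :: "nat \<Rightarrow> l2" assume X: "Cauchy X"
 \<comment> \<open>The squares of \<open>(1/3) ^ n\<close> are below \<open>(1/8) ^ n\<close>, which
   is still summable after multiplication by the weights \<open>4 ^ n\<close> of the limit
   lemma.\<close>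
 obtain r :: "nat \<Rightarrow> nat" where r: "strict_mono r" "\<And>n. dist (X (r (Suc n))) (X (r n)) < (1/3) ^ n"
  using Cauchy_fast_subseq[OF X, of "\<lambda>n. (1/3) ^ n"] by auto
 define f where "f n = fun_of_l2 (X (r n))" for n
 have f: "f n \<in> L2" for n by (simp add: f_def)
 have d: "(LBINT x. (cmod (f n x - f m x))\<^sup>2) = (dist (X (r n)) (X (r m)))\<^sup>2" for m n
  by (simp add: f_def dist_norm l2_norm_diff_sq)
 have "(dist (X (r (Suc n))) (X (r n)))\<^sup>2 \<le> (1/8) ^ n" for n
 proof -
  have "(dist (X (r (Suc n))) (X (r n)))\<^sup>2 \<le> ((1/3) ^ n)\<^sup>2" using r(2)[of n] by (intro power_mono) auto
  also have "\<dots> = (1/9) ^ n" by (simp add: power2_eq_square power_mult_distrib[symmetric])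
  also have "\<dots> \<le> (1/8) ^ n" by (intro power_mono) auto
  finally show ?thesis .
 qed
 moreover have "\<exists>N. \<forall>m\<ge>N. \<forall>n\<ge>N. (dist (X (r n)) (X (r m)))\<^sup>2 \<le> e" if "0 < e" for e
 proof -
  obtain N where N: "\<And>m n. m \<ge> N \<Longrightarrow> n \<ge> N \<Longrightarrow> dist (X m) (X n) < sqrt e"
   using metric_CauchyD[OF X, of "sqrt e"] \<open>0 < e\<close> by auto
  have "(dist (X (r n)) (X (r m)))\<^sup>2 \<le> e" if "m \<ge> N" "n \<ge> N" for m n
  proof -
   have "dist (X (r n)) (X (r m)) \<le> sqrt e" using N[of "r n" "r m"] that seq_suble[OF r(1), of n] seq_suble[OF r(1), of m] by simp
   then show ?thesis using \<open>0 < e\<close> by (simp add: real_le_rsqrt sqrt_ge_absD)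
  qed
  then show ?thesis by blast
 qed
 ultimately obtain g where g: "g \<in> L2" "(\<lambda>n. LBINT x. (cmod (f n x - g x))\<^sup>2) \<longlonglongrightarrow> 0"
  using L2_Cauchy_limit[of f, OF f, unfolded d] by blast
 have "(dist (X (r n)) (to_l2 g))\<^sup>2 = (LBINT x. (cmod (f n x - g x))\<^sup>2)" for n unfolding dist_norm l2_norm_diff_sq f_def
  using L2D(1)[OF g(1)] by (intro integral_cong_AE) (use fun_of_to_l2[OF g(1)] in \<open>auto elim!: AE_mp\<close>)
 then have "(\<lambda>n. (dist (X (r n)) (to_l2 g))\<^sup>2) \<longlonglongrightarrow> 0" using g(2) by simp
 then have "(\<lambda>n. sqrt ((dist (X (r n)) (to_l2 g))\<^sup>2)) \<longlonglongrightarrow> sqrt 0" by (intro tendsto_intros)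
 then have "(X \<circ> r) \<longlonglongrightarrow> to_l2 g" by (subst tendsto_dist_iff) (simp add: o_def)
 then show "convergent X" using Cauchy_converges_subseq[OF X r(1)] convergent_def by blast
qed

instantiation l2 :: chilbert_space
begin

definition "scaleC c x = to_l2 (\<lambda>t. c * fun_of_l2 x t)"
definition "cinner x y = (LBINT t. cnj (fun_of_l2 x t) * fun_of_l2 y t)"

lemma fun_of_l2_scaleC: "AE t in lborel. fun_of_l2 (scaleC c x) t = c * fun_of_l2 x t"
 unfolding scaleC_l2_def by (intro fun_of_to_l2 L2_scale fun_of_l2_L2)

instance
proof
 fix c d :: complex and x y z :: l2 and r :: real
 show "scaleC c (x + y) = scaleC c x + scaleC c y"
  apply (rule l2_eqI)
  using fun_of_l2_scaleC[of c "x + y"] fun_of_l2_ops(2)[of "scaleC c x" "scaleC c y"] fun_of_l2_scaleC[of c x]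
   fun_of_l2_scaleC[of c y] fun_of_l2_ops(2)[of x y]
  by eventually_elim (simp add: algebra_simps)
 show "scaleC (c + d) x = scaleC c x + scaleC d x"
  apply (rule l2_eqI)
  using fun_of_l2_scaleC[of "c + d" "x"] fun_of_l2_ops(2)[of "scaleC c x" "scaleC d x"] fun_of_l2_scaleC[of c x]
   fun_of_l2_scaleC[of d x]
  by eventually_elim (simp add: algebra_simps)
 show "scaleC c (scaleC d x) = scaleC (c * d) x"
  apply (rule l2_eqI)
  using fun_of_l2_scaleC[of "c * d" "x"] fun_of_l2_scaleC[of c "scaleC d x"] fun_of_l2_scaleC[of d x]
  by eventually_elim (simp add: algebra_simps)
 show "scaleC 1 x = x" by (simp add: scaleC_l2_def)
 show "r *\<^sub>R x = scaleC (complex_of_real r) x" by (simp add: scaleC_l2_def scaleR_l2_def)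
 have "(norm (scaleC c x))\<^sup>2 = (LBINT t. (cmod c)\<^sup>2 * (cmod (fun_of_l2 x t))\<^sup>2)"
  unfolding l2_norm_sq by (rule integral_cong_AE)
   (use fun_of_l2_scaleC[of c x] in \<open>auto elim!: AE_mp simp: norm_mult power_mult_distrib\<close>)
 also have "\<dots> = (cmod c * norm x)\<^sup>2" by (simp add: power_mult_distrib l2_norm_sq)
 finally show "norm (scaleC c x) = cmod c * norm x" by (rule power2_eq_imp_eq) auto
 have "(LBINT t. cnj (fun_of_l2 (x + y) t) * fun_of_l2 z t)
   = (LBINT t. cnj (fun_of_l2 x t) * fun_of_l2 z t + cnj (fun_of_l2 y t) * fun_of_l2 z t)"
  by (rule integral_cong_AE) (use fun_of_l2_ops(2)[of x y] in \<open>auto elim!: AE_mp simp: algebra_simps\<close>)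
 then show "cinner (x + y) z = cinner x z + cinner y z" by (simp add: cinner_l2_def l2_inner_integrable)
 have "(LBINT t. cnj (fun_of_l2 (scaleC c x) t) * fun_of_l2 y t)
   = (LBINT t. cnj c * (cnj (fun_of_l2 x t) * fun_of_l2 y t))"
  by (rule integral_cong_AE) (use fun_of_l2_scaleC[of c x] in \<open>auto elim!: AE_mp simp: algebra_simps\<close>)
 then show "cinner (scaleC c x) y = cnj c * cinner x y" by (simp add: cinner_l2_def)
 show "cinner x y = cnj (cinner y x)"
  by (simp add: cinner_l2_def Bochner_Integration.integral_cnj[symmetric] mult.commute del: Bochner_Integration.integral_cnj)
 show "norm x = sqrt (Re (cinner x x))" by (simp add: cinner_l2_def norm_l2_def inner_l2_def)
qed

end

lemma cinner_to_l2:
 assumes "f \<in> L2" "g \<in> L2"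
 shows "cinner (to_l2 f) (to_l2 g) = (LBINT t. cnj (f t) * g t)"
proof -
 note [measurable] = L2D(1)[OF assms(1)] L2D(1)[OF assms(2)]
 have "AE t in lborel. cnj (fun_of_l2 (to_l2 f) t) * fun_of_l2 (to_l2 g) t = cnj (f t) * g t"
  using fun_of_to_l2[OF assms(1)] fun_of_to_l2[OF assms(2)] by eventually_elim simp
 then show ?thesis unfolding cinner_l2_def by (intro integral_cong_AE) simp_all
qed

lemma to_l2_ops:
 assumes "f \<in> L2" "g \<in> L2"
 shows "to_l2 f + to_l2 g = to_l2 (\<lambda>t. f t + g t)" "to_l2 f - to_l2 g = to_l2 (\<lambda>t. f t - g t)"
proof -
 note AE = fun_of_to_l2[OF assms(1)] fun_of_to_l2[OF assms(2)]
 show "to_l2 f + to_l2 g = to_l2 (\<lambda>t. f t + g t)"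
  unfolding plus_l2_def by (rule to_l2_eqI) (use AE in \<open>eventually_elim, simp\<close>)
 show "to_l2 f - to_l2 g = to_l2 (\<lambda>t. f t - g t)"
  unfolding minus_l2_def by (rule to_l2_eqI) (use AE in \<open>eventually_elim, simp\<close>)
qed

lemma scaleC_to_l2:
 assumes "f \<in> L2"
 shows "scaleC c (to_l2 f) = to_l2 (\<lambda>t. c * f t)"
 unfolding scaleC_l2_def by (rule to_l2_eqI) (use fun_of_to_l2[OF assms] in \<open>eventually_elim, simp\<close>)

lemma to_l2_eq_iff:
 assumes "f \<in> L2" "g \<in> L2"
 shows "to_l2 f = to_l2 g \<longleftrightarrow> (AE t in lborel. f t = g t)"
proof
 assume "to_l2 f = to_l2 g"
 then have "AE t in lborel. fun_of_l2 (to_l2 f) t = g t" using fun_of_to_l2[OF assms(2)] by simp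
 with fun_of_to_l2[OF assms(1)] show "AE t in lborel. f t = g t" by eventually_elim simp
qed (rule to_l2_eqI)

lemma norm_to_l2_sq:
 assumes "f \<in> L2"
 shows "(norm (to_l2 f))\<^sup>2 = (LBINT t. (cmod (f t))\<^sup>2)"
proof -
 have "AE t in lborel. (cmod (fun_of_l2 (to_l2 f) t))\<^sup>2 = (cmod (f t))\<^sup>2" using fun_of_to_l2[OF assms] by eventually_elim simp
 then show ?thesis unfolding l2_norm_sq using L2D(1)[OF assms] by (intro integral_cong_AE) simp_all
qed

section \<open>Poisson and Fourier uniqueness\<close>

text \<open>Product majorants dominate all complex double integrals whose order is exchanged
  later.\<close>

lemma integrable_pair_bound:
 fixes F :: "'a::euclidean_space \<Rightarrow> 'b::euclidean_space \<Rightarrow> complex"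
 assumes [measurable]: "case_prod F \<in> borel_measurable (lborel \<Otimes>\<^sub>M lborel)"
  and f: "integrable lborel f" "\<And>x. 0 \<le> f x" and g: "integrable lborel g" "\<And>x. 0 \<le> g x"
  and le: "\<And>x y. cmod (F x y) \<le> f x * g y"
 shows "integrable (lborel \<Otimes>\<^sub>M lborel) (case_prod F)"
proof (rule integrableI_bounded)
 note [measurable] = borel_measurable_integrable[OF f(1)] borel_measurable_integrable[OF g(1)]
 have "(\<integral>\<^sup>+ p. ennreal (norm (case_prod F p)) \<partial>(lborel \<Otimes>\<^sub>M lborel))
   \<le> (\<integral>\<^sup>+ p. ennreal (f (fst p)) * ennreal (g (snd p)) \<partial>(lborel \<Otimes>\<^sub>M lborel))"
  by (intro nn_integral_mono) (auto simp: ennreal_mult'[symmetric] f g le split: prod.splits intro!: ennreal_leI)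
 also have "\<dots> = (\<integral>\<^sup>+ x. (\<integral>\<^sup>+ y. ennreal (f x) * ennreal (g y) \<partial>lborel) \<partial>lborel)"
  by (subst lborel.nn_integral_fst[symmetric]) auto
 also have "\<dots> = (\<integral>\<^sup>+ x. ennreal (f x) \<partial>lborel) * (\<integral>\<^sup>+ y. ennreal (g y) \<partial>lborel)"
  by (simp add: nn_integral_cmult nn_integral_multc)
 also have "\<dots> < \<infinity>" using f g by (simp add: nn_integral_eq_integral ennreal_mult_less_top)
 finally show "(\<integral>\<^sup>+ p. ennreal (norm (case_prod F p)) \<partial>(lborel \<Otimes>\<^sub>M lborel)) < \<infinity>" .
qed simp

lemma Fubini_bound:
 fixes F :: "'a::euclidean_space \<Rightarrow> 'b::euclidean_space \<Rightarrow> complex"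
 assumes "case_prod F \<in> borel_measurable (lborel \<Otimes>\<^sub>M lborel)"
  and "integrable lborel f" "\<And>x. 0 \<le> f x" and "integrable lborel g" "\<And>x. 0 \<le> g x"
  and "\<And>x y. cmod (F x y) \<le> f x * g y"
 shows "(LBINT x. LBINT y. F x y) = (LBINT y. LBINT x. F x y)"
 using lborel_pair.Fubini_integral[OF integrable_pair_bound[OF assms]] by simp

text \<open>Positive and negative parts are densities of two measures that are finite and equal on
  all half-lines \<open>{x<..}\<close>; such measures coincide, and so do their densities
  a.e.\<close>

lemma AE_zero_if_tails_zero:
 fixes f :: "real \<Rightarrow> real"
 assumes f: "integrable lborel f" and tails: "\<And>x. (LBINT t. indicator {x<..} t * f t) = 0"
 shows "AE t in lborel. f t = 0"
proof -
 note [measurable] = borel_measurable_integrable[OF f]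
 have int: "integrable lborel (\<lambda>t. indicator {x<..} t * max 0 (f t))" "integrable lborel (\<lambda>t. indicator {x<..} t * max 0 (- f t))" for x
  using f by (auto intro!: integrable_real_mult_indicator[of "{x<..}", unfolded mult.commute[of _ "indicator _ _"]])
 have em: "emeasure (density lborel (\<lambda>t. ennreal (max 0 (g t)))) {x<..} = ennreal (LBINT t. indicator {x<..} t * max 0 (g t))"
  if [measurable]: "g \<in> borel_measurable borel" and "integrable lborel (\<lambda>t. indicator {x<..} t * max 0 (g t))" for g :: "real \<Rightarrow> real" and x
 proof -
  have "emeasure (density lborel (\<lambda>t. ennreal (max 0 (g t)))) {x<..} = (\<integral>\<^sup>+t. ennreal (indicator {x<..} t * max 0 (g t)) \<partial>lborel)"
   by (subst emeasure_density) (auto intro!: nn_integral_cong simp: indicator_def)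
  then show ?thesis using that by (simp add: nn_integral_eq_integral)
 qed
 have "density lborel (\<lambda>t. ennreal (max 0 (f t))) = density lborel (\<lambda>t. ennreal (max 0 (- f t)))"
 proof (rule measure_eqI_lessThan)
  fix x
  show "emeasure (density lborel (\<lambda>t. ennreal (max 0 (f t)))) {x<..} < \<infinity>" using int by (subst em) auto
  have "(LBINT t. indicator {x<..} t * max 0 (f t)) - (LBINT t. indicator {x<..} t * max 0 (- f t))
    = (LBINT t. indicator {x<..} t * max 0 (f t) - indicator {x<..} t * max 0 (- f t))"
   using int by simp
  also have "\<dots> = (LBINT t. indicator {x<..} t * f t)"
   by (intro Bochner_Integration.integral_cong) (auto simp: indicator_def max_def)
  finally show "emeasure (density lborel (\<lambda>t. ennreal (max 0 (f t)))) {x<..}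
    = emeasure (density lborel (\<lambda>t. ennreal (max 0 (- f t)))) {x<..}"
   using int tails[of x] by (subst (1 2) em) auto
 qed auto
 then have "AE t in lborel. ennreal (max 0 (f t)) = ennreal (max 0 (- f t))"
  by (subst (asm) sigma_finite_measure.density_unique_iff[OF sigma_finite_lborel]) auto
 then show ?thesis by eventually_elim (auto simp: max_def split: if_splits)
qed

text \<open>The function is only locally integrable, so it is cut to \<open>[- n, n]\<close>. A tail
  of the cut function is again an interval integral, and the tail criterion applies to real and
  imaginary parts.\<close>

lemma AE_zero_if_interval_integrals_zero:
 fixes h :: "real \<Rightarrow> complex"
 assumes int: "\<And>a b. integrable lborel (\<lambda>t. indicator {a..b} t *\<^sub>R h t)"
  and zero: "\<And>a b. a < b \<Longrightarrow> (LBINT t. indicator {a..b} t *\<^sub>R h t) = 0"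
 shows "AE t in lborel. h t = 0"
proof -
 have zero': "(LBINT t. indicator {a..b} t *\<^sub>R h t) = 0" for a b
 proof (cases "a < b")
  case False
  have "AE t in lborel. indicator {a..b} t *\<^sub>R h t = 0"
   using AE_lborel_singleton[of a] by eventually_elim (use False in \<open>auto simp: indicator_def\<close>)
  then show ?thesis by (simp add: integral_eq_zero_AE)
 qed (rule zero)
 have tail: "(LBINT t. indicator {x<..} t *\<^sub>R (indicator {- r..r} t *\<^sub>R h t)) = 0" for x r
 proof -
  have ae: "AE t in lborel. indicator {x<..} t *\<^sub>R (indicator {- r..r} t *\<^sub>R h t) = indicator {max x (- r)..r} t *\<^sub>R h t"
   using AE_lborel_singleton[of x] by eventually_elim (auto simp: indicator_def)
  have [measurable]: "(\<lambda>t. indicator {a..b} t *\<^sub>R h t) \<in> borel_measurable borel" for a b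
   using borel_measurable_integrable[OF int[of a b]] by simp
  have "(LBINT t. indicator {x<..} t *\<^sub>R (indicator {- r..r} t *\<^sub>R h t))
    = (LBINT t. indicator {max x (- r)..r} t *\<^sub>R h t)"
   by (intro integral_cong_AE ae) (simp_all del: scaleR_scaleR)
  then show ?thesis by (simp only: zero')
 qed
 have "AE t in lborel. indicator {- real n..real n} t *\<^sub>R h t = 0" for n
 proof -
  let ?g = "\<lambda>t. indicator {- real n..real n} t *\<^sub>R h t"
  have ix: "integrable lborel (\<lambda>t. indicator {x<..} t *\<^sub>R ?g t)" for x by (intro integrable_mult_indicator int) simp
  have "AE t in lborel. Re (?g t) = 0"
  proof (rule AE_zero_if_tails_zero)
   fix x
   have "(LBINT t. indicator {x<..} t * Re (?g t)) = (LBINT t. Re (indicator {x<..} t *\<^sub>R ?g t))" by (simp add: mult.assoc)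
   also have "\<dots> = 0" using tail[of x "real n"] ix[of x] by (subst integral_Re) auto
   finally show "(LBINT t. indicator {x<..} t * Re (?g t)) = 0" .
  qed (rule integrable_Re[OF int])
  moreover have "AE t in lborel. Im (?g t) = 0"
  proof (rule AE_zero_if_tails_zero)
   fix x
   have "(LBINT t. indicator {x<..} t * Im (?g t)) = (LBINT t. Im (indicator {x<..} t *\<^sub>R ?g t))" by (simp add: mult.assoc)
   also have "\<dots> = 0" using tail[of x "real n"] ix[of x] by (subst integral_Im) auto
   finally show "(LBINT t. indicator {x<..} t * Im (?g t)) = 0" .
  qed (rule integrable_Im[OF int])
  ultimately show ?thesis by eventually_elim (simp add: complex_eq_iff)
 qed
 then have "AE t in lborel. \<forall>n. indicator {- real n..real n} t *\<^sub>R h t = 0" unfolding AE_all_countable by blast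
 then show ?thesis
 proof eventually_elim
  case (elim t)
  obtain n where "\<bar>t\<bar> \<le> real n" using real_arch_simple by blast
  then have "t \<in> {- real n..real n}" by auto
  then show ?case using spec[OF elim, of n] by (simp add: indicator_def)
 qed
qed

lemma integrable_inverse_1_plus_sq: "integrable lborel (\<lambda>t::real. 1 / (1 + t\<^sup>2))"
 and integral_inverse_1_plus_sq: "(LBINT t. 1 / (1 + t\<^sup>2)) = pi"
proof -
 show "integrable lborel (\<lambda>t::real. 1 / (1 + t\<^sup>2))"
  using integrable_inverse_1_plus_square by (simp add: set_integrable_def inverse_eq_divide)
 have "(LBINT t. 1 / (1 + t\<^sup>2)) = (LBINT x=-\<infinity>..\<infinity>. inverse (1 + x^2))"
  by (simp add: interval_lebesgue_integral_def set_lebesgue_integral_def inverse_eq_divide)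
 then show "(LBINT t. 1 / (1 + t\<^sup>2)) = pi" by (simp add: LBINT_inverse_1_plus_square)
qed

section \<open>The Poisson kernel of the upper half-plane\<close>

definition poisson :: "complex \<Rightarrow> real \<Rightarrow> real" where
 "poisson v t = Im v / (pi * (cmod (of_real t - v))\<^sup>2)"

lemma cmod_real_diff_sq: "(cmod (of_real t - v))\<^sup>2 = (t - Re v)\<^sup>2 + (Im v)\<^sup>2" by (simp add: cmod_power2)

lemma of_real_diff_nonzero: "Im v \<noteq> 0 \<Longrightarrow> complex_of_real t - v \<noteq> 0" by (auto simp: complex_eq_iff)

lemma cmod_of_real_diff_ge: "\<bar>Im v\<bar> \<le> cmod (of_real t - v)" using abs_Im_le_cmod[of "complex_of_real t - v"] by simp

text \<open>The constant is uniform over \<open>\<bar>Re v\<bar> \<le> R\<close>, as needed when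
  \<open>v\<close> runs over a horizontal segment in a Fubini argument; the bounded shift is
  absorbed by \<open>(Im v)^2 \<le> |t - v|^2\<close>.\<close>

lemma kernel_lower_bound:
 assumes "Im v \<noteq> 0" "\<bar>Re v\<bar> \<le> R"
 shows "1 + t\<^sup>2 \<le> (2 + (1 + 2 * R\<^sup>2) / (Im v)\<^sup>2) * (cmod (of_real t - v))\<^sup>2"
proof -
 have R: "(Re v)\<^sup>2 \<le> R\<^sup>2" using assms(2) by (simp add: abs_le_square_iff[symmetric])
 have "t\<^sup>2 \<le> 2 * (t - Re v)\<^sup>2 + 2 * (Re v)\<^sup>2"
  using zero_le_power2[of "t - 2 * Re v"] by (simp add: power2_eq_square algebra_simps)
 then have "1 + t\<^sup>2 \<le> 2 * (t - Re v)\<^sup>2 + (1 + 2 * R\<^sup>2)" using R by linarith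
 also have "\<dots> = 2 * (t - Re v)\<^sup>2 + (1 + 2 * R\<^sup>2) / (Im v)\<^sup>2 * (Im v)\<^sup>2" using assms(1) by simp
 also have "\<dots> \<le> 2 * ((t - Re v)\<^sup>2 + (Im v)\<^sup>2) + (1 + 2 * R\<^sup>2) / (Im v)\<^sup>2 * ((t - Re v)\<^sup>2 + (Im v)\<^sup>2)"
  by (intro add_mono mult_left_mono) auto
 finally show ?thesis by (simp add: cmod_real_diff_sq algebra_simps)
qed

lemma kernel_upper_bound:
 assumes "Im v \<noteq> 0" "\<bar>Re v\<bar> \<le> R"
 shows "1 / (cmod (of_real t - v))\<^sup>2 \<le> (2 + (1 + 2 * R\<^sup>2) / (Im v)\<^sup>2) / (1 + t\<^sup>2)"
proof -
 have "0 < (cmod (of_real t - v))\<^sup>2" using of_real_diff_nonzero[OF assms(1)] by simp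
 moreover have "0 < 1 + t\<^sup>2" by (simp add: add_pos_nonneg)
 ultimately show ?thesis using kernel_lower_bound[OF assms, of t] by (simp add: divide_simps)
qed

lemma kernel_sq_integrable:
 assumes "Im v \<noteq> 0"
 shows "integrable lborel (\<lambda>t. 1 / (cmod (of_real t - v))\<^sup>2)"
proof (rule Bochner_Integration.integrable_bound)
 let ?C = "2 + (1 + 2 * \<bar>Re v\<bar>\<^sup>2) / (Im v)\<^sup>2"
 show "integrable lborel (\<lambda>t::real. ?C * (1 / (1 + t\<^sup>2)))" by (intro integrable_mult_right integrable_inverse_1_plus_sq)
 show "AE t in lborel. norm (1 / (cmod (of_real t - v))\<^sup>2) \<le> norm (?C * (1 / (1 + t\<^sup>2)))"
  using kernel_upper_bound[OF assms, of "\<bar>Re v\<bar>"] by (intro AE_I2) (auto intro: order_trans[OF _ abs_ge_self])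
qed simp

lemma L2_kernel: "Im v \<noteq> 0 \<Longrightarrow> (\<lambda>t. 1 / (complex_of_real t - v)) \<in> L2"
 by (rule L2I) (simp_all add: norm_divide power_divide kernel_sq_integrable)

lemma poisson_nonneg: "0 < Im v \<Longrightarrow> 0 \<le> poisson v t" by (simp add: poisson_def)

lemma poisson_integrable: "Im v \<noteq> 0 \<Longrightarrow> integrable lborel (poisson v)"
proof -
 assume "Im v \<noteq> 0"
 then have "integrable lborel (\<lambda>t. Im v / pi * (1 / (cmod (of_real t - v))\<^sup>2))"
  by (intro integrable_mult_right kernel_sq_integrable)
 then show ?thesis by (simp add: poisson_def[abs_def])
qed

lemma poisson_integral:
 assumes "0 < Im v"
 shows "(LBINT t. poisson v t) = 1"
proof -
 have "(LBINT t. poisson v t) = \<bar>Im v\<bar> *\<^sub>R (LBINT s. poisson v (Re v + Im v * s))"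
  using assms by (intro lborel_integral_real_affine) auto
 also have "(\<lambda>s. poisson v (Re v + Im v * s)) = (\<lambda>s. (1 / (pi * Im v)) * (1 / (1 + s\<^sup>2)))"
 proof
  fix s
  have "(cmod (of_real (Re v + Im v * s) - v))\<^sup>2 = Im v * Im v * (1 + s\<^sup>2)"
   unfolding cmod_real_diff_sq by (simp add: power2_eq_square algebra_simps)
  then have "poisson v (Re v + Im v * s) = Im v / (pi * (Im v * Im v * (1 + s\<^sup>2)))" by (simp only: poisson_def)
  then show "poisson v (Re v + Im v * s) = (1 / (pi * Im v)) * (1 / (1 + s\<^sup>2))" using assms by simp
 qed
 also have "(LBINT s. (1 / (pi * Im v)) * (1 / (1 + s\<^sup>2))) = 1 / Im v"
  by (subst integral_mult_right_zero) (simp add: integral_inverse_1_plus_sq)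
 finally show ?thesis using assms by simp
qed

text \<open>The bridge between the two kinds of transform: a Poisson integral is the jump between
  the Cauchy integrals at \<open>v\<close> and at its reflection.\<close>

lemma poisson_eq_kernel_diff:
 assumes "0 < Im v"
 shows "complex_of_real (poisson v t) = (1 / (of_real t - v) - 1 / (of_real t - cnj v)) / (2 * pi * \<i>)"
proof -
 have n: "of_real t - v \<noteq> 0" "of_real t - cnj v \<noteq> 0" using assms by (auto simp: complex_eq_iff)
 have "1 / (of_real t - v) - 1 / (of_real t - cnj v) = (v - cnj v) / ((of_real t - v) * (of_real t - cnj v))"
  using n by (simp add: field_simps)
 also have "(of_real t - v) * (of_real t - cnj v) = complex_of_real ((cmod (of_real t - v))\<^sup>2)"
  using complex_norm_square[of "of_real t - v"] by simp
 also have "v - cnj v = 2 * \<i> * Im v" by (simp add: complex_eq_iff)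
 finally show ?thesis by (simp add: poisson_def)
qed

lemma poisson_le:
 assumes "0 < Im v" "\<bar>Re v\<bar> \<le> R"
 shows "poisson v t \<le> Im v / pi * (2 + (1 + 2 * R\<^sup>2) / (Im v)\<^sup>2) / (1 + t\<^sup>2)"
 using mult_left_mono[OF kernel_upper_bound[OF _ assms(2), of t], of "Im v / pi"] assms(1) by (simp add: poisson_def)

lemma poisson_measurable [measurable]: "poisson v \<in> borel_measurable borel" unfolding poisson_def[abs_def] by measurable

lemma poisson_mult_integrable:
 fixes h :: "real \<Rightarrow> complex"
 assumes [measurable]: "h \<in> borel_measurable borel" and h: "integrable lborel (\<lambda>t. cmod (h t) / (1 + t\<^sup>2))"
  and v: "0 < Im v"
 shows "integrable lborel (\<lambda>t. poisson v t * h t)"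
proof (rule Bochner_Integration.integrable_bound)
 let ?C = "Im v / pi * (2 + (1 + 2 * \<bar>Re v\<bar>\<^sup>2) / (Im v)\<^sup>2)"
 show "integrable lborel (\<lambda>t. ?C * (cmod (h t) / (1 + t\<^sup>2)))" using h by (rule integrable_mult_right)
 show "AE t in lborel. norm (poisson v t * h t) \<le> norm (?C * (cmod (h t) / (1 + t\<^sup>2)))"
 proof (rule AE_I2)
  fix t
  have "norm (poisson v t * h t) = poisson v t * cmod (h t)" using poisson_nonneg[OF v] by (simp add: norm_mult)
  also have "\<dots> \<le> ?C / (1 + t\<^sup>2) * cmod (h t)" using v by (intro mult_right_mono poisson_le) auto
  also have "\<dots> = ?C * (cmod (h t) / (1 + t\<^sup>2))" by simp
  also have "\<dots> \<le> norm (?C * (cmod (h t) / (1 + t\<^sup>2)))" unfolding real_norm_def by (rule abs_ge_self)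
  finally show "norm (poisson v t * h t) \<le> norm (?C * (cmod (h t) / (1 + t\<^sup>2)))" .
 qed
qed measurable

text \<open>The integral of \<open>poisson (Complex x y) t\<close> over \<open>x\<close> in
  \<open>[a, b]\<close>, for \<open>a \<le> b\<close> and \<open>0 < y\<close>; as the kernel is
  symmetric in \<open>x\<close> and \<open>t\<close>, it is the harmonic measure of
  \<open>[a, b]\<close> seen from \<open>Complex t y\<close>.\<close>

definition arctan_diff :: "real \<Rightarrow> real \<Rightarrow> real \<Rightarrow> real \<Rightarrow> real" where
 "arctan_diff a b y t = (arctan ((b - t) / y) - arctan ((a - t) / y)) / pi"

lemma has_derivative_arctan_poisson:
 assumes "0 < y"
 shows "((\<lambda>x. arctan ((x - t) / y) / pi) has_real_derivative poisson (Complex x y) t) (at x within S)"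
proof -
 have eq: "1 / (1 + ((x - t) / y)\<^sup>2) * (1 / y) / pi = poisson (Complex x y) t"
 proof -
  have "1 + ((x - t) / y)\<^sup>2 = ((t - x)\<^sup>2 + y\<^sup>2) / y\<^sup>2" using assms by (simp add: field_simps power2_commute)
  then have "1 / (1 + ((x - t) / y)\<^sup>2) * (1 / y) / pi = y / (pi * ((t - x)\<^sup>2 + y\<^sup>2))"
   using assms by (simp add: power2_eq_square)
  then show ?thesis by (simp add: poisson_def cmod_real_diff_sq)
 qed
 show ?thesis unfolding eq[symmetric] using assms by (auto intro!: derivative_eq_intros simp: inverse_eq_divide)
qed

lemma continuous_on_poisson_strip: "0 < y \<Longrightarrow> continuous_on S (\<lambda>x. poisson (Complex x y) t)"
 unfolding poisson_def cmod_real_diff_sq by (auto intro!: continuous_intros simp: sum_power2_eq_zero_iff)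

lemma integral_poisson_strip:
 assumes "0 < y" "a \<le> b"
 shows "(LBINT x. indicator {a..b} x *\<^sub>R poisson (Complex x y) t) = arctan_diff a b y t"
proof -
 have "(LBINT x. indicator {a..b} x *\<^sub>R poisson (Complex x y) t) = arctan ((b - t) / y) / pi - arctan ((a - t) / y) / pi"
 proof (rule integral_FTC_atLeastAtMost[OF assms(2)])
  show "((\<lambda>x. arctan ((x - t) / y) / pi) has_vector_derivative poisson (Complex x y) t) (at x within {a..b})" for x
   using has_derivative_arctan_poisson[OF assms(1)] by (simp add: has_real_derivative_iff_has_vector_derivative)
  show "continuous_on {a..b} (\<lambda>x. poisson (Complex x y) t)" by (rule continuous_on_poisson_strip[OF assms(1)])
 qed
 then show ?thesis by (simp add: arctan_diff_def diff_divide_distrib)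
qed

text \<open>A majorant of order \<open>1 / (1 + t^2)\<close> that does not depend on the height
  \<open>y\<close>, for dominated convergence as \<open>y\<close> tends to 0.\<close>

lemma arctan_diff_bound:
 assumes "0 < y" "y \<le> 1" "a < b"
 shows "\<bar>arctan_diff a b y t\<bar> \<le> (1 + 4 * (\<bar>a\<bar> + \<bar>b\<bar> + 1)\<^sup>2 + 8 * (b - a)) / (1 + t\<^sup>2)"
proof -
 \<comment> \<open>The summand 1 forces \<open>1 \<le> \<bar>t\<bar>\<close> outside
   \<open>2 * R\<close>, and the factor 2 keeps such \<open>t\<close> at distance at least
   \<open>\<bar>t\<bar> / 2\<close> from \<open>[a, b]\<close>.\<close>
 define R where "R = \<bar>a\<bar> + \<bar>b\<bar> + 1"
 have pos: "0 < 1 + t\<^sup>2" by (simp add: add_pos_nonneg)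
 have mono: "arctan ((a - t) / y) \<le> arctan ((b - t) / y)" using assms by (simp add: arctan_le_iff divide_right_mono)
 then have nn: "0 \<le> arctan_diff a b y t" by (simp add: arctan_diff_def)
 have "(1 + t\<^sup>2) * arctan_diff a b y t \<le> 1 + 4 * R\<^sup>2 + 8 * (b - a)"
 proof (cases "\<bar>t\<bar> \<le> 2 * R")
  case True
  have "arctan ((b - t) / y) - arctan ((a - t) / y) \<le> pi"
   using arctan_ubound[of "(b - t) / y"] arctan_lbound[of "(a - t) / y"] by linarith
  then have "arctan_diff a b y t \<le> 1" by (simp add: arctan_diff_def)
  moreover have "t\<^sup>2 \<le> (2 * R)\<^sup>2" using True by (metis abs_ge_zero power2_abs power_mono)
  ultimately have "(1 + t\<^sup>2) * arctan_diff a b y t \<le> (1 + (2 * R)\<^sup>2) * 1" using nn by (intro mult_mono) auto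
  then show ?thesis using assms by (simp add: power_mult_distrib)
 next
  case False
  \<comment> \<open>Far from \<open>[a, b]\<close> the mean value theorem replaces the arctan
    difference by the kernel at one point, which decays quadratically.\<close>
  obtain \<xi> where \<xi>: "a < \<xi>" "\<xi> < b"
   "arctan ((b - t) / y) / pi - arctan ((a - t) / y) / pi = (b - a) * poisson (Complex \<xi> y) t"
   using MVT2[OF assms(3), of "\<lambda>x. arctan ((x - t) / y) / pi" "\<lambda>x. poisson (Complex x y) t"]
    has_derivative_arctan_poisson[OF assms(1)] by blast
  have "\<bar>\<xi>\<bar> \<le> R" using \<xi> by (auto simp: R_def)
  then have "\<bar>t\<bar> / 2 \<le> \<bar>t - \<xi>\<bar>" using False by linarith
  then have "(\<bar>t\<bar> / 2)\<^sup>2 \<le> \<bar>t - \<xi>\<bar>\<^sup>2" by (intro power_mono) auto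
  then have t4: "t\<^sup>2 / 4 \<le> (t - \<xi>)\<^sup>2" by (simp add: power_divide)
  have "1 \<le> \<bar>t\<bar>" using False by (simp add: R_def)
  then have t1: "1 \<le> t\<^sup>2" using one_le_power[of "\<bar>t\<bar>" 2] by simp
  have "poisson (Complex \<xi> y) t = y / (pi * ((t - \<xi>)\<^sup>2 + y\<^sup>2))" by (simp add: poisson_def cmod_real_diff_sq)
  also have "\<dots> \<le> 1 / (1 * (t\<^sup>2 / 4))"
   using assms t4 t1 pi_ge_two by (intro frac_le mult_mono) (auto simp: add_increasing2)
  finally have le: "poisson (Complex \<xi> y) t \<le> 4 / t\<^sup>2" by simp
  have "arctan_diff a b y t = (b - a) * poisson (Complex \<xi> y) t" using \<xi>(3) by (simp add: arctan_diff_def diff_divide_distrib)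
  also have "\<dots> \<le> (b - a) * (4 / t\<^sup>2)" using assms le by (intro mult_left_mono) auto
  finally have "(1 + t\<^sup>2) * arctan_diff a b y t \<le> (2 * t\<^sup>2) * ((b - a) * (4 / t\<^sup>2))"
   using t1 nn pos by (intro mult_mono) auto
  also have "\<dots> = 2 * (b - a) * (t\<^sup>2 * (4 / t\<^sup>2))" by (simp only: ac_simps)
  also have "t\<^sup>2 * (4 / t\<^sup>2) = 4" using t1 by auto
  also have "2 * (b - a) * 4 = 8 * (b - a)" by simp
  finally show ?thesis using zero_le_power2[of R] by linarith
 qed
 then show ?thesis using nn pos unfolding R_def[symmetric] by (simp add: pos_le_divide_eq mult.commute)
qed

text \<open>For \<open>a < b\<close> the limit is the indicator of \<open>[a, b]\<close> with value
  1/2 at the endpoints, hence the form with \<open>sgn\<close>.\<close>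

lemma arctan_diff_tendsto:
 "(\<lambda>n. arctan_diff a b (1 / real (Suc n)) t) \<longlonglongrightarrow> (sgn (b - t) - sgn (a - t)) / 2"
proof -
 have lim: "(\<lambda>n. arctan (c / (1 / real (Suc n)))) \<longlonglongrightarrow> sgn c * (pi / 2)" for c
 proof -
  have pos: "(\<lambda>n. arctan (c * real (Suc n))) \<longlonglongrightarrow> pi / 2" if "0 < c" for c
  proof (rule filterlim_compose[OF tendsto_arctan_at_top])
   show "filterlim (\<lambda>n. c * real (Suc n)) at_top sequentially" by (rule filterlim_tendsto_pos_mult_at_top[OF tendsto_const that
       filterlim_compose[OF filterlim_real_sequentially filterlim_Suc]])
  qed
  consider "0 < c" | "c = 0" | "c < 0" by linarith
  then show ?thesis
  proof cases
   case 1
   then show ?thesis using pos[of c] by simp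
  next
   case 3
   then have "(\<lambda>n. - arctan (- c * real (Suc n))) \<longlonglongrightarrow> - (pi / 2)"
    using pos[of "- c"] by (intro tendsto_minus) simp
   then show ?thesis using 3 by (simp add: arctan_minus del: of_nat_Suc)
  qed simp
 qed
 have "(\<lambda>n. arctan_diff a b (1 / real (Suc n)) t) \<longlonglongrightarrow> (sgn (b - t) * (pi / 2) - sgn (a - t) * (pi / 2)) / pi"
  unfolding arctan_diff_def by (intro tendsto_divide tendsto_diff lim tendsto_const) auto
 then show ?thesis by (simp add: left_diff_distrib[symmetric] diff_divide_distrib)
qed

text \<open>Integrating the Poisson integrals over \<open>[a, b]\<close> and letting the height tend to \<open>0\<close> recovers the
 integral over \<open>[a, b]\<close>.\<close>

theorem poisson_uniqueness:
 fixes h :: "real \<Rightarrow> complex"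
 assumes [measurable]: "h \<in> borel_measurable borel" and h: "integrable lborel (\<lambda>t. cmod (h t) / (1 + t\<^sup>2))"
  and zero: "\<And>v. 0 < Im v \<Longrightarrow> (LBINT t. poisson v t * h t) = 0"
 shows "AE t in lborel. h t = 0"
proof (rule AE_zero_if_interval_integrals_zero)
 fix a b :: real
 have pos: "0 < 1 + t\<^sup>2" for t :: real by (simp add: add_pos_nonneg)
 show "integrable lborel (\<lambda>t. indicator {a..b} t *\<^sub>R h t)"
 proof (rule Bochner_Integration.integrable_bound)
  let ?C = "1 + (\<bar>a\<bar> + \<bar>b\<bar>)\<^sup>2"
  show "integrable lborel (\<lambda>t. ?C * (cmod (h t) / (1 + t\<^sup>2)))" using h by (rule integrable_mult_right)
  have "cmod (h t) \<le> ?C * (cmod (h t) / (1 + t\<^sup>2))" if "t \<in> {a..b}" for t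
  proof -
   have "t\<^sup>2 \<le> (\<bar>a\<bar> + \<bar>b\<bar>)\<^sup>2" using that by (auto simp flip: abs_le_square_iff)
   then have "(1 + t\<^sup>2) * (cmod (h t) / (1 + t\<^sup>2)) \<le> ?C * (cmod (h t) / (1 + t\<^sup>2))"
    using pos[of t] by (intro mult_right_mono) auto
   then show ?thesis using pos[of t] by simp
  qed
  then show "AE t in lborel. norm (indicator {a..b} t *\<^sub>R h t) \<le> norm (?C * (cmod (h t) / (1 + t\<^sup>2)))"
   by (intro AE_I2) (auto simp: indicator_def intro: order_trans[OF _ abs_ge_self])
 qed measurable
 assume ab: "a < b"
 have Fub: "(LBINT t. arctan_diff a b y t *\<^sub>R h t) = 0" if y: "0 < y" for y
 proof -
  define R where "R = \<bar>a\<bar> + \<bar>b\<bar>"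
  define C where "C = y / pi * (2 + (1 + 2 * R\<^sup>2) / y\<^sup>2)"
  define F where "F = (\<lambda>x t. indicator {a..b} x *\<^sub>R (poisson (Complex x y) t * h t))"
  have C0: "0 \<le> C" using y by (simp add: C_def)
  have "(LBINT x. LBINT t. F x t) = (LBINT t. LBINT x. F x t)"
  proof (rule Fubini_bound[where f="indicator {a..b}" and g="\<lambda>t. C * (cmod (h t) / (1 + t\<^sup>2))"])
   have "(\<lambda>p. indicator {a..b} (fst p) *\<^sub>R (y / (pi * ((snd p - fst p)\<^sup>2 + y\<^sup>2)) * h (snd p)))
     \<in> borel_measurable (lborel \<Otimes>\<^sub>M lborel)"
    by measurable
   then show "case_prod F \<in> borel_measurable (lborel \<Otimes>\<^sub>M lborel)"
    by (simp add: F_def poisson_def cmod_real_diff_sq split_beta')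
   show "integrable lborel (\<lambda>t. C * (cmod (h t) / (1 + t\<^sup>2)))" using h by (rule integrable_mult_right)
   show "0 \<le> C * (cmod (h t) / (1 + t\<^sup>2))" for t using C0 pos[of t] by simp
   show "cmod (F x t) \<le> indicator {a..b} x * (C * (cmod (h t) / (1 + t\<^sup>2)))" for x t
   proof (cases "x \<in> {a..b}")
    case True
    then have "poisson (Complex x y) t \<le> C / (1 + t\<^sup>2)" using poisson_le[of "Complex x y" R t] y by (auto simp: C_def R_def)
    then have "poisson (Complex x y) t * cmod (h t) \<le> C / (1 + t\<^sup>2) * cmod (h t)" by (intro mult_right_mono) auto
    then show ?thesis using True poisson_nonneg[of "Complex x y" t] y by (simp add: F_def norm_mult)
   qed (simp add: F_def)
  qed (simp_all add: integrable_indicator_iff emeasure_lborel_Icc_eq)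
  moreover have "(LBINT t. F x t) = 0" for x using zero[of "Complex x y"] y by (simp add: F_def)
  moreover have "(LBINT x. F x t) = arctan_diff a b y t *\<^sub>R h t" for t
  proof -
   have "(LBINT x. F x t) = (LBINT x. (indicator {a..b} x *\<^sub>R poisson (Complex x y) t) *\<^sub>R h t)"
    by (simp add: F_def scaleR_conv_of_real mult.assoc)
   also have "\<dots> = (LBINT x. indicator {a..b} x *\<^sub>R poisson (Complex x y) t) *\<^sub>R h t"
    using borel_integrable_atLeastAtMost'[OF continuous_on_poisson_strip[OF y], of a b t]
    by (intro integral_scaleR_left) (simp add: set_integrable_def)
   finally show ?thesis using integral_poisson_strip[OF y, of a b t] ab by simp
  qed
  ultimately show ?thesis by simp
 qed
 define w where "w t = (1 + 4 * (\<bar>a\<bar> + \<bar>b\<bar> + 1)\<^sup>2 + 8 * (b - a)) * (cmod (h t) / (1 + t\<^sup>2))" for t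
 have "(\<lambda>n. LBINT t. arctan_diff a b (1 / real (Suc n)) t *\<^sub>R h t)
   \<longlonglongrightarrow> (LBINT t. ((sgn (b - t) - sgn (a - t)) / 2) *\<^sub>R h t)"
 proof (rule integral_dominated_convergence[where w=w])
  show "integrable lborel w" unfolding w_def using h by (rule integrable_mult_right)
  show "AE t in lborel. (\<lambda>n. arctan_diff a b (1 / real (Suc n)) t *\<^sub>R h t) \<longlonglongrightarrow> ((sgn (b - t) - sgn (a - t)) / 2) *\<^sub>R h t"
   by (intro AE_I2 tendsto_scaleR arctan_diff_tendsto tendsto_const)
  show "AE t in lborel. norm (arctan_diff a b (1 / real (Suc n)) t *\<^sub>R h t) \<le> w t" for n
  proof (rule AE_I2)
   fix t
   show "norm (arctan_diff a b (1 / real (Suc n)) t *\<^sub>R h t) \<le> w t"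
    using mult_right_mono[OF arctan_diff_bound[of "1 / real (Suc n)" a b t] norm_ge_zero[of "h t"]] ab by (simp add: w_def)
  qed
  show "(\<lambda>t. arctan_diff a b (1 / real (Suc n)) t *\<^sub>R h t) \<in> borel_measurable lborel" for n
   unfolding arctan_diff_def by measurable
 qed measurable
 then have "(LBINT t. ((sgn (b - t) - sgn (a - t)) / 2) *\<^sub>R h t) = 0" using Fub LIMSEQ_unique[OF _ tendsto_const] by simp
 moreover have "(LBINT t. ((sgn (b - t) - sgn (a - t)) / 2) *\<^sub>R h t) = (LBINT t. indicator {a..b} t *\<^sub>R h t)"
 proof (rule integral_cong_AE)
  show "AE t in lborel. ((sgn (b - t) - sgn (a - t)) / 2) *\<^sub>R h t = indicator {a..b} t *\<^sub>R h t"
   using AE_lborel_singleton[of a] AE_lborel_singleton[of b]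
   by eventually_elim (use ab in \<open>auto simp: indicator_def sgn_if\<close>)
 qed measurable
 ultimately show "(LBINT t. indicator {a..b} t *\<^sub>R h t) = 0" by simp
qed

section \<open>Fourier transforms and Cauchy transforms\<close>

abbreviation cis_mult :: "real \<Rightarrow> real \<Rightarrow> complex" where
 "cis_mult a t \<equiv> exp (\<i> * of_real (a * t))"

lemma cis_mult_measurable [measurable]: "cis_mult a \<in> borel_measurable borel" by measurable

lemma integrable_cis_mult:
 assumes "integrable lborel h"
 shows "integrable lborel (\<lambda>t. cis_mult a t * h t)"
proof (rule Bochner_Integration.integrable_bound[OF assms])
 show "(\<lambda>t. cis_mult a t * h t) \<in> borel_measurable lborel" using borel_measurable_integrable[OF assms] by measurable
qed (simp add: norm_mult)

lemma integrable_bounded_mult: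
 fixes h g :: "real \<Rightarrow> complex"
 assumes "integrable lborel h" "g \<in> borel_measurable borel" "\<And>t. cmod (g t) \<le> B"
 shows "integrable lborel (\<lambda>t. g t * h t)"
proof (rule Bochner_Integration.integrable_bound)
 show "integrable lborel (\<lambda>t. B * cmod (h t))" using assms(1) by auto
 show "(\<lambda>t. g t * h t) \<in> borel_measurable lborel" using borel_measurable_integrable[OF assms(1)] assms(2) by measurable
 have "cmod (g t * h t) \<le> B * cmod (h t)" for t unfolding norm_mult by (intro mult_right_mono assms(3)) simp
 then show "AE t in lborel. norm (g t * h t) \<le> norm (B * cmod (h t))" by (intro AE_I2) (auto intro: order_trans[OF _ abs_ge_self])
qed

lemma kernel_measurable [measurable]: "(\<lambda>t. 1 / (complex_of_real t - v)) \<in> borel_measurable borel" by measurable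

lemma kernel_bounded: "Im v \<noteq> 0 \<Longrightarrow> cmod (1 / (complex_of_real t - v)) \<le> 1 / \<bar>Im v\<bar>"
 using cmod_of_real_diff_ge[of v t] by (simp add: norm_divide frac_le)

lemma integrable_kernel_mult: "integrable lborel h \<Longrightarrow> Im v \<noteq> 0 \<Longrightarrow> integrable lborel (\<lambda>t. h t / (complex_of_real t - v))"
 using integrable_bounded_mult[of h "\<lambda>t. 1 / (complex_of_real t - v)" "1 / \<bar>Im v\<bar>"] kernel_bounded[of v] by simp

text \<open>With \<open>v\<close> in the upper half-plane, \<open>A \<mapsto> \<integral> h t exp (\<i> A (t - cnj v)) / (t - cnj v)\<close> has derivative
 \<open>\<i> exp (- \<i> A cnj v) \<integral> h t exp (\<i> A t) = 0\<close> and tends to \<open>0\<close>.\<close>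

lemma cauchy_transform_zero_if_fourier_zero:
 fixes h :: "real \<Rightarrow> complex"
 assumes h: "integrable lborel h" and zero: "\<And>a. 0 \<le> a \<Longrightarrow> (LBINT t. cis_mult a t * h t) = 0"
  and v: "0 < Im v"
 shows "(LBINT t. h t / (of_real t - cnj v)) = 0"
proof -
 note [measurable] = borel_measurable_integrable[OF h]
 have v': "Im (cnj v) \<noteq> 0" using v by simp
 define I where "I = (LBINT t. h t / (of_real t - cnj v))"
 have E: "exp (- \<i> * of_real A * cnj v) * (LBINT t. cis_mult A t * (h t / (of_real t - cnj v))) = I" if A: "0 \<le> A" for A
 proof -
  \<comment> \<open>The differential equation in \<open>A\<close> is used in integrated form, by
    exchanging the integrals over \<open>[0, A]\<close> and over the line; the exponential has
    modulus \<open>exp (- a * Im v) \<le> 1\<close>, which provides the majorant.\<close>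
  define F where "F = (\<lambda>a t. indicator {0..A} a *\<^sub>R (exp (\<i> * of_real a * (of_real t - cnj v)) * h t))"
  have nexp: "cmod (exp (\<i> * of_real a * (of_real t - cnj v))) = exp (- a * Im v)" for a t by (simp add: norm_exp_eq_Re algebra_simps)
  have "(LBINT a. LBINT t. F a t) = (LBINT t. LBINT a. F a t)"
  proof (rule Fubini_bound[where f="indicator {0..A}" and g="\<lambda>t. cmod (h t)"])
   show "case_prod F \<in> borel_measurable (lborel \<Otimes>\<^sub>M lborel)" unfolding F_def split_beta' by measurable
   show "cmod (F a t) \<le> indicator {0..A} a * cmod (h t)" for a t
    using v by (auto simp: F_def indicator_def norm_mult nexp intro!: mult_left_le_one_le)
  qed (use h in \<open>simp_all add: integrable_indicator_iff emeasure_lborel_Icc_eq\<close>)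
  moreover have "(LBINT t. F a t) = 0" for a
  proof (cases "a \<in> {0..A}")
   case True
   have "(LBINT t. F a t) = (LBINT t. exp (- \<i> * of_real a * cnj v) * (cis_mult a t * h t))"
    using True by (simp add: F_def exp_add[symmetric] algebra_simps)
   then show ?thesis using zero[of a] True by simp
  qed (simp add: F_def)
  moreover have "(LBINT a. F a t) = (exp (\<i> * of_real A * (of_real t - cnj v)) - 1) / (\<i> * (of_real t - cnj v)) * h t" for t
  proof -
   let ?c = "\<i> * (of_real t - cnj v)"
   have c: "?c \<noteq> 0" using of_real_diff_nonzero[OF v'] by simp
   have "(LBINT a. indicator {0..A} a *\<^sub>R (exp (of_real a * ?c) * h t))
     = exp (of_real A * ?c) * h t / ?c - exp (of_real 0 * ?c) * h t / ?c"
   proof (rule integral_FTC_atLeastAtMost[OF A])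
    show "((\<lambda>a. exp (of_real a * ?c) * h t / ?c) has_vector_derivative exp (of_real a * ?c) * h t) (at a within {0..A})" for a
    proof -
     have "((\<lambda>z. exp (z * ?c) * h t / ?c) has_field_derivative exp (of_real a * ?c) * h t) (at (of_real a))"
      using c by (auto intro!: derivative_eq_intros)
     then show ?thesis using has_vector_derivative_real_field has_vector_derivative_at_within by blast
    qed
   qed (auto intro!: continuous_intros)
   then show ?thesis by (simp add: F_def algebra_simps diff_divide_distrib)
  qed
  ultimately have "(LBINT t. (exp (\<i> * of_real A * (of_real t - cnj v)) - 1) / (\<i> * (of_real t - cnj v)) * h t) = 0" by simp
  also have "(\<lambda>t. (exp (\<i> * of_real A * (of_real t - cnj v)) - 1) / (\<i> * (of_real t - cnj v)) * h t)
    = (\<lambda>t. (1 / \<i>) * (exp (- \<i> * of_real A * cnj v) * (cis_mult A t * (h t / (of_real t - cnj v))) - h t / (of_real t - cnj v)))"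
  proof
   fix t
   have gen: "(P * C - 1) / (\<i> * X) * h t = (1 / \<i>) * (P * (C * (h t / X)) - h t / X)" if "X \<noteq> 0" for P C X
    using that by (simp add: field_simps)
   have "exp (\<i> * of_real A * (of_real t - cnj v)) = exp (- \<i> * of_real A * cnj v) * cis_mult A t"
    by (simp add: exp_add[symmetric] algebra_simps)
   then show "(exp (\<i> * of_real A * (of_real t - cnj v)) - 1) / (\<i> * (of_real t - cnj v)) * h t
    = (1 / \<i>) * (exp (- \<i> * of_real A * cnj v) * (cis_mult A t * (h t / (of_real t - cnj v))) - h t / (of_real t - cnj v))"
    using gen[OF of_real_diff_nonzero[OF v', of t]] by (simp only:)
  qed
  finally have z: "(LBINT t. (1 / \<i>) * (exp (- \<i> * of_real A * cnj v) * (cis_mult A t * (h t / (of_real t - cnj v)))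
    - h t / (of_real t - cnj v))) = 0" .
  have gen: "(LBINT t. (1 / \<i>) * (P * (cis_mult A t * q t) - q t)) = (1 / \<i>) * (P * (LBINT t. cis_mult A t * q t) - integral\<^sup>L lborel q)"
   if "integrable lborel q" for P and q :: "real \<Rightarrow> complex"
   using that integrable_cis_mult[OF that, of A] by simp
  show ?thesis using z unfolding gen[OF integrable_kernel_mult[OF h v']] by (simp add: I_def)
 qed
 define B where "B = (LBINT t. cmod (h t / (of_real t - cnj v)))"
 \<comment> \<open>\<open>I\<close> does not depend on \<open>A\<close>, while the bound decays as
   \<open>A\<close> grows.\<close>
 have "cmod I \<le> exp (- A * Im v) * B" if "0 \<le> A" for A
 proof -
  have "cmod I = cmod (exp (- \<i> * of_real A * cnj v)) * cmod (LBINT t. cis_mult A t * (h t / (of_real t - cnj v)))"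
   by (simp add: E[OF that, symmetric] norm_mult)
  also have "cmod (exp (- \<i> * of_real A * cnj v)) = exp (- A * Im v)" by (simp add: norm_exp_eq_Re)
  also have "cmod (LBINT t. cis_mult A t * (h t / (of_real t - cnj v))) \<le> B"
   unfolding B_def by (rule order_trans[OF integral_norm_bound])
    (simp only: norm_mult norm_exp_ii_of_real mult_1_left order_refl)
  finally show ?thesis by (simp add: mult_left_mono)
 qed
 then have "\<forall>\<^sub>F A in at_top. cmod I \<le> exp (- A * Im v) * B"
  by (auto intro: eventually_mono[OF eventually_ge_at_top[of 0]])
 moreover have "((\<lambda>A. exp (- A * Im v) * B) \<longlongrightarrow> 0 * B) at_top"
 proof (intro tendsto_mult tendsto_const filterlim_compose[OF exp_at_bot])
  have "filterlim (\<lambda>A. Im v * A) at_top at_top"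
   using v by (rule filterlim_tendsto_pos_mult_at_top[OF tendsto_const _ filterlim_ident])
  then show "filterlim (\<lambda>A. - A * Im v) at_bot at_top" by (simp add: filterlim_uminus_at_bot mult.commute)
 qed
 ultimately have "cmod I \<le> 0 * B" by (intro tendsto_lowerbound) auto
 then show ?thesis by (simp add: I_def)
qed

lemma poisson_transform:
 fixes h :: "real \<Rightarrow> complex"
 assumes v: "0 < Im v"
  and int: "integrable lborel (\<lambda>t. h t / (complex_of_real t - v))" "integrable lborel (\<lambda>t. h t / (of_real t - cnj v))"
 shows "(LBINT t. poisson v t * h t)
  = ((LBINT t. h t / (of_real t - v)) - (LBINT t. h t / (of_real t - cnj v))) / (2 * pi * \<i>)"
proof -
 have "(LBINT t. poisson v t * h t)
   = (LBINT t. (h t / (of_real t - v) - h t / (of_real t - cnj v)) / (2 * pi * \<i>))"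
  unfolding poisson_eq_kernel_diff[OF v] by (intro Bochner_Integration.integral_cong refl) (simp add: diff_divide_distrib left_diff_distrib)
 then show ?thesis using int by simp
qed

lemma integrable_weight:
 fixes h :: "real \<Rightarrow> complex"
 assumes "integrable lborel h"
 shows "integrable lborel (\<lambda>t. cmod (h t) / (1 + t\<^sup>2))"
proof (rule Bochner_Integration.integrable_bound[OF assms])
 have "cmod (h t) / (1 + t\<^sup>2) \<le> cmod (h t) / 1" for t by (intro divide_left_mono) (auto simp: add_pos_nonneg)
 then show "AE t in lborel. norm (cmod (h t) / (1 + t\<^sup>2)) \<le> norm (h t)" by (intro AE_I2) (simp add: abs_of_nonneg)
qed (use borel_measurable_integrable[OF assms] in measurable)

lemma integrable_zero_if_cauchy_transforms_zero:
 fixes h :: "real \<Rightarrow> complex"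
 assumes h: "integrable lborel h"
  and up: "\<And>v. 0 < Im v \<Longrightarrow> (LBINT t. h t / (complex_of_real t - v)) = 0"
  and lo: "\<And>v. 0 < Im v \<Longrightarrow> (LBINT t. h t / (of_real t - cnj v)) = 0"
 shows "AE t in lborel. h t = 0"
proof (rule poisson_uniqueness)
 show "h \<in> borel_measurable borel" using borel_measurable_integrable[OF h] by simp
 show "integrable lborel (\<lambda>t. cmod (h t) / (1 + t\<^sup>2))" by (rule integrable_weight[OF h])
 fix v :: complex assume v: "0 < Im v"
 show "(LBINT t. poisson v t * h t) = 0" using up[OF v] lo[OF v] v by (subst poisson_transform) (auto intro!: integrable_kernel_mult h)
qed

text \<open>Nonnegative frequencies kill the Cauchy transforms at \<open>cnj v\<close>; complex
  conjugation turns the remaining frequencies into those at \<open>v\<close>. Their difference is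
  the Poisson integral.\<close>

theorem fourier_uniqueness:
 fixes h :: "real \<Rightarrow> complex"
 assumes h: "integrable lborel h" and zero: "\<And>a. (LBINT t. cis_mult a t * h t) = 0"
 shows "AE t in lborel. h t = 0"
proof (rule integrable_zero_if_cauchy_transforms_zero[OF h])
 fix v :: complex assume v: "0 < Im v"
 show "(LBINT t. h t / (of_real t - cnj v)) = 0" by (rule cauchy_transform_zero_if_fourier_zero[OF h zero v])
 have "(LBINT t. cnj (h t) / (of_real t - cnj v)) = 0"
 proof (rule cauchy_transform_zero_if_fourier_zero[OF _ _ v])
  fix a :: real
  have "(LBINT t. cis_mult a t * cnj (h t)) = (LBINT t. cnj (cis_mult (- a) t * h t))" by (simp add: exp_cnj)
  also have "\<dots> = 0" using zero[of "-a"] by (simp only: Bochner_Integration.integral_cnj complex_cnj_zero)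
  finally show "(LBINT t. cis_mult a t * cnj (h t)) = 0" .
 qed (use h in simp)
 then have "cnj (LBINT t. cnj (h t) / (of_real t - cnj v)) = 0" by simp
 then show "(LBINT t. h t / (complex_of_real t - v)) = 0" by (simp only: Bochner_Integration.integral_cnj[symmetric]) simp
qed

text \<open>A nonempty open set is not a null set.\<close>

lemma continuous_AE_zero:
 fixes h :: "real \<Rightarrow> complex"
 assumes "continuous_on UNIV h" "AE t in lborel. h t = 0"
 shows "h t = 0"
proof (rule ccontr)
 assume "h t \<noteq> 0"
 have op: "open {t. h t \<noteq> 0}" using assms(1) by (intro open_Collect_neq continuous_on_const)
 have "{t. h t \<noteq> 0} \<in> null_sets lborel" using assms(2) op AE_iff_null[of lborel "\<lambda>t. h t = 0"] by simp
 then have "negligible {t. h t \<noteq> 0}" by (simp add: negligible_iff_null_sets null_sets_completionI)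
 then show False using op open_not_negligible \<open>h t \<noteq> 0\<close> by blast
qed

text \<open>Read off from the characteristic function of the standard normal distribution.\<close>

lemma gaussian_fourier_std: "(LBINT x. cis_mult a x * complex_of_real (exp (- x\<^sup>2 / 2))) = complex_of_real (sqrt (2 * pi) * exp (- a\<^sup>2 / 2))"
proof -
 have "complex_of_real (exp (- a\<^sup>2 / 2)) = char std_normal_distribution a" by (simp add: char_std_normal_distribution)
 also have "\<dots> = (LBINT x. normal_density 0 1 x *\<^sub>R cis_mult a x)"
  unfolding char_def by (subst integral_density) (auto simp: normal_density_nonneg)
 also have "(\<lambda>x. normal_density 0 1 x *\<^sub>R cis_mult a x) = (\<lambda>x. complex_of_real (1 / sqrt (2 * pi)) * (cis_mult a x * complex_of_real (exp (- x\<^sup>2 / 2))))"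
  by (rule ext) (simp add: normal_density_def scaleR_conv_of_real)
 also have "(LBINT x. complex_of_real (1 / sqrt (2 * pi)) * (cis_mult a x * complex_of_real (exp (- x\<^sup>2 / 2))))
   = complex_of_real (1 / sqrt (2 * pi)) * (LBINT x. cis_mult a x * complex_of_real (exp (- x\<^sup>2 / 2)))"
  by simp
 finally have "complex_of_real (sqrt (2 * pi)) * complex_of_real (exp (- a\<^sup>2 / 2))
   = complex_of_real (sqrt (2 * pi)) * (complex_of_real (1 / sqrt (2 * pi)) * (LBINT x. cis_mult a x * complex_of_real (exp (- x\<^sup>2 / 2))))"
  by simp
 moreover have "sqrt (2 * pi) \<noteq> 0" by simp
 ultimately show ?thesis by (simp add: mult.assoc[symmetric])
qed

lemma gaussian_fourier:
 assumes "0 < s"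
 shows "(LBINT x. cis_mult a x * complex_of_real (exp (- (x - m)\<^sup>2 / (2 * s\<^sup>2))))
  = cis_mult a m * complex_of_real (s * sqrt (2 * pi) * exp (- (s * a)\<^sup>2 / 2))"
proof -
 have "(LBINT x. cis_mult a x * complex_of_real (exp (- (x - m)\<^sup>2 / (2 * s\<^sup>2))))
   = \<bar>s\<bar> *\<^sub>R (LBINT x. cis_mult a (m + s * x) * complex_of_real (exp (- (m + s * x - m)\<^sup>2 / (2 * s\<^sup>2))))"
  using assms by (intro lborel_integral_real_affine) auto
 also have "(\<lambda>x. cis_mult a (m + s * x) * complex_of_real (exp (- (m + s * x - m)\<^sup>2 / (2 * s\<^sup>2))))
   = (\<lambda>x. cis_mult a m * (cis_mult (s * a) x * complex_of_real (exp (- x\<^sup>2 / 2))))"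
 proof
  fix x
  have "- (m + s * x - m)\<^sup>2 / (2 * s\<^sup>2) = - x\<^sup>2 / 2" using assms by (simp add: power_mult_distrib)
  moreover have "cis_mult a (m + s * x) = cis_mult a m * cis_mult (s * a) x" by (simp add: exp_add[symmetric] algebra_simps)
  ultimately show "cis_mult a (m + s * x) * complex_of_real (exp (- (m + s * x - m)\<^sup>2 / (2 * s\<^sup>2)))
   = cis_mult a m * (cis_mult (s * a) x * complex_of_real (exp (- x\<^sup>2 / 2)))"
   by (simp only: mult.assoc)
 qed
 also have "(LBINT x. cis_mult a m * (cis_mult (s * a) x * complex_of_real (exp (- x\<^sup>2 / 2))))
   = cis_mult a m * complex_of_real (sqrt (2 * pi) * exp (- (s * a)\<^sup>2 / 2))"
  by (subst integral_mult_right_zero) (simp only: gaussian_fourier_std)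
 finally show ?thesis using assms by (simp add: scaleR_conv_of_real)
qed

lemma integrable_gaussian:
 assumes "0 < s"
 shows "integrable lborel (\<lambda>x::real. exp (- (x - m)\<^sup>2 / (2 * s\<^sup>2)))"
proof -
 have "integrable lborel (\<lambda>x. sqrt (2 * pi * s\<^sup>2) * normal_density m s x)"
  using integrable_normal_density[OF assms, of m] by (rule integrable_mult_right)
 then show ?thesis using assms by (simp add: normal_density_def)
qed

section \<open>The Gaussian vacuum of a Weyl system\<close>

abbreviation phase :: "real \<Rightarrow> complex" where
 "phase r \<equiv> exp (\<i> * of_real r)"

lemma phase_add: "phase (r + s) = phase r * phase s" by (simp add: exp_add[symmetric] algebra_simps)

lemma phase_minus_mult: "phase r * phase (- r) = 1" "phase (- r) * phase r = 1" by (simp_all add: exp_add[symmetric])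

text \<open>Purely algebraic, without continuity: modulations and translations on L^2 are an
  instance before strong continuity of translations is known, and that continuity is then derived
  from the vacuum.\<close>

locale weyl_system =
 fixes U V :: "real \<Rightarrow> 'k::chilbert_space \<Rightarrow> 'k"
 assumes U_isometry: "isometry_op (U a)" and V_isometry: "isometry_op (V a)"
  and U_add: "U (a + b) x = U a (U b x)" and V_add: "V (a + b) x = V a (V b x)"
  and U_zero: "U 0 x = x" and V_zero: "V 0 x = x"
  and weyl: "U a (V b x) = scaleC (phase (a * b)) (V b (U a x))"
begin

text \<open>The symmetric phase makes \<open>W (- p)\<close> the adjoint of \<open>W p\<close> and
  leaves only the symplectic form as multiplier in products.\<close>

definition W :: "real \<times> real \<Rightarrow> 'k \<Rightarrow> 'k" where
 "W p x = scaleC (phase (- (fst p * snd p) / 2)) (U (fst p) (V (snd p) x))"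

lemma U_adj: "cinner (U a x) y = cinner x (U (- a) y)"
 using isometry_op_cinner[OF U_isometry, of a x "U (- a) y"] U_add[of a "- a" y] by (simp add: U_zero)

lemma VU: "V b (U a x) = scaleC (phase (- (a * b))) (U a (V b x))" unfolding weyl scaleC_scaleC phase_minus_mult by (simp add: scaleC_one)

lemma W_isometry: "isometry_op (W p)"
proof -
 note U = isometry_opD[OF U_isometry] and V = isometry_opD[OF V_isometry]
 have "phase r * c = c * phase r" for r c by simp
 then show ?thesis unfolding isometry_op_def clinear_def W_def
  by (simp add: U(1,2,3) V(1,2,3) scaleC_add_right scaleC_scaleC norm_scaleC mult.commute
    del: of_real_minus of_real_divide of_real_mult)
qed

lemma W_W: "W p (W q x) = scaleC (phase ((fst p * snd q - snd p * fst q) / 2)) (W (p + q) x)"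
proof -
 obtain a b c d where p: "p = (a, b)" and q: "q = (c, d)" by (cases p, cases q) auto
 note U = isometry_opD[OF U_isometry] and V = isometry_opD[OF V_isometry]
 have "W p (W q x) = scaleC (phase (- (a * b) / 2) * phase (- (c * d) / 2) * phase (- (c * b))) (U (a + c) (V (b + d) x))"
  by (simp add: W_def p q U(2) V(2) VU scaleC_scaleC U_add V_add ac_simps del: of_real_minus of_real_divide of_real_mult)
 moreover have "- (a * b) / 2 + - (c * d) / 2 + - (c * b) = (a * d - b * c) / 2 + (- ((a + c) * (b + d)) / 2)" by (simp add: field_simps)
 then have "phase (- (a * b) / 2) * phase (- (c * d) / 2) * phase (- (c * b)) = phase ((a * d - b * c) / 2) * phase (- ((a + c) * (b + d)) / 2)"
  unfolding phase_add[symmetric] by simp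
 ultimately show ?thesis by (simp add: W_def p q scaleC_scaleC del: of_real_minus of_real_divide of_real_mult)
qed

lemma W_zero: "W 0 x = x" by (simp add: W_def U_zero V_zero scaleC_one)

lemma W_adj: "cinner (W p x) y = cinner x (W (- p) y)"
proof -
 have "W p (W (- p) y) = y" by (simp add: W_W W_zero scaleC_one)
 then show ?thesis using isometry_op_cinner[OF W_isometry, of p x "W (- p) y"] by simp
qed

lemma W_bound: "cmod (cinner z (W p x)) \<le> norm z * norm x"
 using Cauchy_Schwarz_cinner[of z "W p x"] isometry_opD(3)[OF W_isometry] by simp

text \<open>These are the coefficients of the harmonic-oscillator ground state; at
  \<open>p = 0\<close> the condition says that the vector has norm 1.\<close>

definition vacuum :: "'k \<Rightarrow> bool" where
 "vacuum \<Omega> \<longleftrightarrow> (\<forall>p. cinner \<Omega> (W p \<Omega>) = complex_of_real (exp (- ((fst p)\<^sup>2 + (snd p)\<^sup>2) / 4)))"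

text \<open>The Gram matrix of the orbit of a vacuum is the same in every Weyl system; this is what
  makes an intertwining isometry exist.\<close>

lemma vacuum_gram:
 assumes "vacuum \<Omega>"
 shows "cinner (W p \<Omega>) (W q \<Omega>) = phase ((- fst p * snd q + snd p * fst q) / 2)
  * complex_of_real (exp (- ((fst q - fst p)\<^sup>2 + (snd q - snd p)\<^sup>2) / 4))"
proof -
 have "cinner (W p \<Omega>) (W q \<Omega>) = phase ((- fst p * snd q + snd p * fst q) / 2) * cinner \<Omega> (W (- p + q) \<Omega>)"
  by (simp add: W_adj W_W cinner_scaleC_right)
 then show ?thesis using assms[unfolded vacuum_def, rule_format, of "- p + q"]
  by (simp only: fst_add snd_add fst_uminus snd_uminus fst_diff snd_diff uminus_add_conv_diff)
qed

end

section \<open>Gaussian integrals over phase space\<close>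

definition gauss :: "real \<times> real \<Rightarrow> real" where
 "gauss p = exp (- ((fst p)\<^sup>2 + (snd p)\<^sup>2) / 4)"

lemma gauss_measurable [measurable]: "gauss \<in> borel_measurable borel"
 unfolding gauss_def[abs_def] by (rule borel_measurable_continuous_onI) (auto intro!: continuous_intros)

lemma measurable_pair_continuous:
 fixes F :: "'a::euclidean_space \<Rightarrow> 'b::euclidean_space \<Rightarrow> complex"
 shows "continuous_on UNIV (case_prod F) \<Longrightarrow> case_prod F \<in> borel_measurable (lborel \<Otimes>\<^sub>M lborel)"
 by (simp add: lborel_prod borel_measurable_continuous_onI)

lemma gauss_continuous: "continuous_on S gauss" unfolding gauss_def[abs_def] by (auto intro!: continuous_intros)

lemma gauss_pos: "0 < gauss p" "0 \<le> gauss p" by (simp_all add: gauss_def)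

lemma gauss_minus: "gauss (- p) = gauss p" by (simp add: gauss_def)

lemma integrable_gaussian': "0 < c \<Longrightarrow> integrable lborel (\<lambda>x::real. exp (- c * (x - m)\<^sup>2))"
 using integrable_gaussian[of "1 / sqrt (2 * c)" m] by (simp add: power_divide field_simps)

lemma integrable_pair_mult:
 fixes A B :: "real \<Rightarrow> complex"
 assumes "integrable lborel A" "integrable lborel B"
 shows "integrable lborel (\<lambda>p. A (fst p) * B (snd p))"
  and "(LBINT p. A (fst p) * B (snd p)) = (LBINT a. A a) * (LBINT b. B b)"
proof -
 note [measurable] = borel_measurable_integrable[OF assms(1)] borel_measurable_integrable[OF assms(2)]
 have i: "integrable (lborel \<Otimes>\<^sub>M lborel) (\<lambda>(a, b). A a * B b)"
  by (rule integrable_pair_bound[where f="\<lambda>a. cmod (A a)" and g="\<lambda>b. cmod (B b)"]) (use assms in \<open>simp_all add: norm_mult\<close>)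
 then show "integrable lborel (\<lambda>p. A (fst p) * B (snd p))" by (simp add: lborel_prod split_beta')
 show "(LBINT p. A (fst p) * B (snd p)) = (LBINT a. A a) * (LBINT b. B b)"
  using lborel_pair.integral_fst'[OF i] by (simp add: lborel_prod split_beta')
qed

lemma integrable_gaussian2:
 assumes "0 < c"
 shows "integrable lborel (\<lambda>p::real \<times> real. exp (- c * ((fst p - m)\<^sup>2 + (snd p - n)\<^sup>2)))"
proof -
 have "integrable lborel (\<lambda>p. complex_of_real (exp (- c * (fst p - m)\<^sup>2)) * complex_of_real (exp (- c * (snd p - n)\<^sup>2)))"
  using integrable_gaussian'[OF assms] by (intro integrable_pair_mult) auto
 then have "integrable lborel (\<lambda>p. complex_of_real (exp (- c * (fst p - m)\<^sup>2) * exp (- c * (snd p - n)\<^sup>2)))"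
  by (simp only: of_real_mult)
 then have "integrable lborel (\<lambda>p. exp (- c * (fst p - m)\<^sup>2) * exp (- c * (snd p - n)\<^sup>2))"
  by (simp only: complex_of_real_integrable_eq)
 then show ?thesis by (simp add: exp_add[symmetric] algebra_simps)
qed

lemma gauss_integrable: "integrable lborel gauss"
proof -
 have "gauss = (\<lambda>p. exp (- (1/4) * ((fst p - 0)\<^sup>2 + (snd p - 0)\<^sup>2)))" by (rule ext) (simp add: gauss_def field_simps)
 then show ?thesis using integrable_gaussian2[of "1/4" 0 0] by simp
qed

lemma lborel_integral_shift2:
 fixes f :: "real \<times> real \<Rightarrow> complex"
 assumes [measurable]: "f \<in> borel_measurable borel"
 shows "(LBINT q. f (c + q)) = (LBINT q. f q)"
proof -
 have "(LBINT q. f q) = (LINT q|distr lborel borel ((+) c). f q)" by (simp add: lborel_distr_plus)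
 also have "\<dots> = (LBINT q. f (c + q))" by (rule integral_distr) auto
 finally show ?thesis ..
qed

lemma lborel_integral_reflect2:
 fixes f :: "real \<times> real \<Rightarrow> complex"
 assumes [measurable]: "f \<in> borel_measurable borel"
 shows "(LBINT q. f (- q)) = (LBINT q. f q)"
proof -
 have "lborel = density (distr lborel borel (\<lambda>x::real \<times> real. 0 + (-1) *\<^sub>R x)) (\<lambda>_. ennreal (\<bar>-1\<bar> ^ DIM(real \<times> real)))"
  by (rule lborel_affine) simp
 then have eq: "lborel = distr lborel borel (\<lambda>x::real \<times> real. - x)" by (simp add: density_1)
 have "(LBINT q. f q) = (LINT q|distr lborel borel (\<lambda>x::real \<times> real. - x). f q)" using eq by simp
 also have "\<dots> = (LBINT q. f (- q))" by (rule integral_distr) auto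
 finally show ?thesis ..
qed

text \<open>The twisted convolution identity behind \<open>P_W_P\<close>. In each coordinate the
  square is completed at half of \<open>s - r\<close>; what remains is a product of two Fourier
  transforms of unit Gaussians, whose phases cancel and whose factors recombine to
  \<open>gauss r * gauss s\<close>.\<close>

lemma gauss_convolution:
 "(LBINT p. complex_of_real (gauss p * gauss (s - p - r)) * phase ((fst p * snd r - snd p * fst r) / 2
   + ((fst p + fst r) * snd s - (snd p + snd r) * fst s) / 2))
  = complex_of_real (2 * pi * gauss r * gauss s)"
proof -
 obtain c d p q where r: "r = (c, d)" and s: "s = (p, q)" by (cases r, cases s) auto
 let ?A = "\<lambda>a. cis_mult ((d + q) / 2) a * complex_of_real (exp (- (a - (p - c) / 2)\<^sup>2 / (2 * 1\<^sup>2)))"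
 let ?B = "\<lambda>b. cis_mult (- (c + p) / 2) b * complex_of_real (exp (- (b - (q - d) / 2)\<^sup>2 / (2 * 1\<^sup>2)))"
 let ?K = "complex_of_real (exp (- ((p - c)\<^sup>2 + (q - d)\<^sup>2) / 8)) * phase ((c * q - d * p) / 2)"
 have A: "integrable lborel ?A" "integrable lborel ?B" by (intro integrable_cis_mult integrable_of_real integrable_gaussian; simp)+
 have eq: "complex_of_real (gauss x * gauss (s - x - r)) * phase ((fst x * snd r - snd x * fst r) / 2
   + ((fst x + fst r) * snd s - (snd x + snd r) * fst s) / 2) = ?K * (?A (fst x) * ?B (snd x))" for x
 proof -
  obtain a b where x: "x = (a, b)" by (cases x)
  have e1: "- (a\<^sup>2 + b\<^sup>2) / 4 + - ((p - a - c)\<^sup>2 + (q - b - d)\<^sup>2) / 4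
    = - ((p - c)\<^sup>2 + (q - d)\<^sup>2) / 8 + (- (a - (p - c) / 2)\<^sup>2 / (2 * 1\<^sup>2) + - (b - (q - d) / 2)\<^sup>2 / (2 * 1\<^sup>2))"
   by (simp add: power2_eq_square field_simps)
  have g: "gauss x * gauss (s - x - r) = exp (- ((p - c)\<^sup>2 + (q - d)\<^sup>2) / 8)
    * (exp (- (a - (p - c) / 2)\<^sup>2 / (2 * 1\<^sup>2)) * exp (- (b - (q - d) / 2)\<^sup>2 / (2 * 1\<^sup>2)))"
   unfolding gauss_def x r s fst_conv snd_conv fst_diff snd_diff exp_add[symmetric] e1 ..
  have e2: "(a * d - b * c) / 2 + ((a + c) * q - (b + d) * p) / 2 = (c * q - d * p) / 2 + ((d + q) / 2 * a + (- (c + p) / 2) * b)"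
   by (simp add: field_simps)
  show ?thesis unfolding g unfolding x r s fst_conv snd_conv e2 phase_add of_real_mult by (simp only: ac_simps)
 qed
 have "(LBINT x. ?K * (?A (fst x) * ?B (snd x))) = ?K * ((LBINT a. ?A a) * (LBINT b. ?B b))"
  by (simp only: integral_mult_right_zero integrable_pair_mult(2)[OF A])
 also have "(LBINT a. ?A a) = cis_mult ((d + q) / 2) ((p - c) / 2) * complex_of_real (1 * sqrt (2 * pi) * exp (- (1 * ((d + q) / 2))\<^sup>2 / 2))"
  by (rule gaussian_fourier) simp
 also have "(LBINT b. ?B b) = cis_mult (- (c + p) / 2) ((q - d) / 2) * complex_of_real (1 * sqrt (2 * pi) * exp (- (1 * (- (c + p) / 2))\<^sup>2 / 2))"
  by (rule gaussian_fourier) simp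
 also have "?K * ((cis_mult ((d + q) / 2) ((p - c) / 2) * complex_of_real (1 * sqrt (2 * pi) * exp (- (1 * ((d + q) / 2))\<^sup>2 / 2)))
   * (cis_mult (- (c + p) / 2) ((q - d) / 2) * complex_of_real (1 * sqrt (2 * pi) * exp (- (1 * (- (c + p) / 2))\<^sup>2 / 2))))
  = phase ((c * q - d * p) / 2 + ((d + q) / 2 * ((p - c) / 2) + (- (c + p) / 2) * ((q - d) / 2)))
   * complex_of_real ((sqrt (2 * pi) * sqrt (2 * pi)) * exp (- ((p - c)\<^sup>2 + (q - d)\<^sup>2) / 8 + (- (1 * ((d + q) / 2))\<^sup>2 / 2 + - (1 * (- (c + p) / 2))\<^sup>2 / 2)))"
  unfolding phase_add exp_add of_real_mult mult_1_left by (simp only: ac_simps mult_1_left mult_1_right of_real_1)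
 also have "(c * q - d * p) / 2 + ((d + q) / 2 * ((p - c) / 2) + (- (c + p) / 2) * ((q - d) / 2)) = 0" by (simp add: field_simps)
 also have "- ((p - c)\<^sup>2 + (q - d)\<^sup>2) / 8 + (- (1 * ((d + q) / 2))\<^sup>2 / 2 + - (1 * (- (c + p) / 2))\<^sup>2 / 2)
   = - (c\<^sup>2 + d\<^sup>2) / 4 + - (p\<^sup>2 + q\<^sup>2) / 4"
  by (simp add: power2_eq_square field_simps)
 also have "sqrt (2 * pi) * sqrt (2 * pi) = 2 * pi" by simp
 finally have "(LBINT x. ?K * (?A (fst x) * ?B (snd x))) = complex_of_real (2 * pi * gauss r * gauss s)"
  by (simp add: exp_add gauss_def r s)
 then show ?thesis by (simp only: eq)
qed

text \<open>A majorant that separates \<open>p\<close> from \<open>s\<close>, as Fubini demands; the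
  exact Gaussian couples them, so part of the exponent is given away.\<close>

lemma gauss_mult_bound: "gauss p * gauss (s - p - r) \<le> exp (- (1/8) * ((fst p - 0)\<^sup>2 + (snd p - 0)\<^sup>2)) * exp (- (1/16) * ((fst s - fst r)\<^sup>2 + (snd s - snd r)\<^sup>2))"
proof -
 have one: "u\<^sup>2 / 8 + w\<^sup>2 / 16 \<le> (u\<^sup>2 + (w - u)\<^sup>2) / 4" for u w :: real
 proof -
  have "(u\<^sup>2 + (w - u)\<^sup>2) / 4 - (u\<^sup>2 / 8 + w\<^sup>2 / 16) = ((3 * w - 4 * u)\<^sup>2 + 2 * u\<^sup>2) / 48"
   by (simp add: power2_eq_square field_simps)
  moreover have "0 \<le> ((3 * w - 4 * u)\<^sup>2 + 2 * u\<^sup>2) / 48" by simp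
  ultimately show ?thesis by linarith
 qed
 have "gauss p * gauss (s - p - r) = exp (- ((fst p)\<^sup>2 + ((fst s - fst r) - fst p)\<^sup>2) / 4 - ((snd p)\<^sup>2 + ((snd s - snd r) - snd p)\<^sup>2) / 4)"
  by (simp add: gauss_def exp_add[symmetric] field_simps)
 also have "\<dots> \<le> exp (- (1/8) * ((fst p - 0)\<^sup>2 + (snd p - 0)\<^sup>2) + - (1/16) * ((fst s - fst r)\<^sup>2 + (snd s - snd r)\<^sup>2))"
  using one[of "fst p" "fst s - fst r"] one[of "snd p" "snd s - snd r"] by (simp add: field_simps)
 finally show ?thesis unfolding exp_add .
qed

section \<open>The Gaussian average of a Weyl system\<close>

locale continuous_weyl_system = weyl_system U V for U V :: "real \<Rightarrow> 'k::chilbert_space \<Rightarrow> 'k" +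
 assumes U_cont: "continuous_on UNIV (\<lambda>t. U t x)" and V_cont: "continuous_on UNIV (\<lambda>t. V t x)"
begin

lemma W_cont: "continuous_on UNIV (\<lambda>p. cinner z (W p x))"
proof -
 have "cinner z (W p x) = phase (- (fst p * snd p) / 2) * cinner (U (- fst p) z) (V (snd p) x)" for p
  by (simp add: W_def cinner_scaleC_right U_adj del: of_real_minus of_real_divide of_real_mult)
 moreover have "continuous_on UNIV (\<lambda>p::real \<times> real. U (- fst p) z)"
  by (rule continuous_on_compose2[OF U_cont, of _ "\<lambda>p. - fst p"]) (auto intro!: continuous_intros)
 moreover have "continuous_on UNIV (\<lambda>p::real \<times> real. V (snd p) x)"
  by (rule continuous_on_compose2[OF V_cont, of _ snd]) (auto intro!: continuous_intros)
 ultimately show ?thesis by (auto intro!: continuous_intros continuous_on_cinner)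
qed

lemma W_measurable [measurable]: "(\<lambda>p. cinner z (W p x)) \<in> borel_measurable borel"
 using W_cont by (rule borel_measurable_continuous_onI)

lemma gauss_W_integrable: "integrable lborel (\<lambda>p. complex_of_real (gauss p) * cinner z (W p x))"
proof (rule Bochner_Integration.integrable_bound)
 show "integrable lborel (\<lambda>p. norm z * norm x * gauss p)" by (intro integrable_mult_right gauss_integrable)
 show "AE p in lborel. norm (complex_of_real (gauss p) * cinner z (W p x)) \<le> norm (norm z * norm x * gauss p)"
  using W_bound[of z _ x] gauss_pos by (intro AE_I2) (simp add: norm_mult mult.commute mult_left_mono abs_of_nonneg)
qed measurable

text \<open>The vector integral of \<open>gauss p\<close> times \<open>W p x\<close> is taken
  weakly: the functional is bounded through the total mass of \<open>gauss\<close>, and Riesz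
  represents it. The conjugate enters because the inner product is antilinear in its first
  argument.\<close>

lemma vacuum_form: "\<exists>y. \<forall>z. cinner z y = (LBINT p. complex_of_real (gauss p) * cinner z (W p x))"
proof -
 let ?\<phi> = "\<lambda>z. cnj (LBINT p. complex_of_real (gauss p) * cinner z (W p x))"
 obtain y where y: "\<And>z. ?\<phi> z = cinner y z"
 proof (rule Riesz_representation[of ?\<phi> "(LBINT p. gauss p) * norm x"])
  show "?\<phi> (z + z') = ?\<phi> z + ?\<phi> z'" for z z' using gauss_W_integrable by (simp add: cinner_add_left distrib_left)
  show "?\<phi> (scaleC c z) = c * ?\<phi> z" for c z by (simp add: cinner_scaleC_left mult.left_commute[of _ "cnj c"])
  show "cmod (?\<phi> z) \<le> (LBINT p. gauss p) * norm x * norm z" for z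
  proof -
   have "cmod (?\<phi> z) \<le> (LBINT p. norm (complex_of_real (gauss p) * cinner z (W p x)))" by simp
   also have "\<dots> \<le> (LBINT p. gauss p * (norm z * norm x))" using W_bound gauss_pos
    by (intro integral_mono integrable_norm gauss_W_integrable integrable_mult_left gauss_integrable)
     (simp add: norm_mult abs_of_nonneg mult_left_mono)
   finally show ?thesis by (simp add: ac_simps)
  qed
 qed blast
 have "cinner z y = (LBINT p. complex_of_real (gauss p) * cinner z (W p x))" for z
  using y[of z] cinner_commute[of z y] by (metis complex_cnj_cnj)
 then show ?thesis by blast
qed

text \<open>Von Neumann's operator. By \<open>P_W_P\<close> at \<open>r = 0\<close> it is
  \<open>2 * pi\<close> times an orthogonal projection, and its nonzero values are multiples of
  vacua.\<close>

definition P :: "'k \<Rightarrow> 'k" where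
 "P x = (SOME y. \<forall>z. cinner z y = (LBINT p. complex_of_real (gauss p) * cinner z (W p x)))"

lemma cinner_P: "cinner z (P x) = (LBINT p. complex_of_real (gauss p) * cinner z (W p x))"
 using someI_ex[OF vacuum_form[of x]] unfolding P_def by blast

lemma P_selfadjoint: "cinner (P z) x = cinner z (P x)"
proof -
 have "cinner (P z) x = cnj (LBINT p. complex_of_real (gauss p) * cinner x (W p z))"
  using cinner_commute[of "P z" x] by (simp only: cinner_P)
 also have "\<dots> = (LBINT p. cnj (complex_of_real (gauss p) * cinner x (W p z)))" by (simp only: Bochner_Integration.integral_cnj)
 also have "\<dots> = (LBINT p. complex_of_real (gauss (- p)) * cinner z (W (- p) x))" by (intro Bochner_Integration.integral_cong refl)
   (simp add: gauss_minus W_adj[symmetric] cinner_commute[of _ x, symmetric])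
 also have "\<dots> = (LBINT p. complex_of_real (gauss p) * cinner z (W p x))" by (rule lborel_integral_reflect2) measurable
 finally show ?thesis by (simp only: cinner_P)
qed

text \<open>Two weak integrals are merged into one over \<open>s = p + r + q\<close>; the inner
  integral over \<open>p\<close> then no longer involves the vectors and is the scalar of
  \<open>gauss_convolution\<close>.\<close>

lemma P_W_P: "cinner z (P (W r (P x))) = complex_of_real (2 * pi * gauss r) * cinner z (P x)"
proof -
 let ?\<theta> = "\<lambda>p s. (fst p * snd r - snd p * fst r) / 2 + ((fst p + fst r) * snd s - (snd p + snd r) * fst s) / 2"
 have "cinner z (P (W r (P x))) = (LBINT p. LBINT s. complex_of_real (gauss p * gauss (s - p - r)) * phase (?\<theta> p s) * cinner z (W s x))"
  unfolding cinner_P[of z "W r (P x)"]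
 proof (intro Bochner_Integration.integral_cong refl)
  fix p :: "real \<times> real"
  have "cinner z (W p (W r (P x))) = cinner (W (- r) (W (- p) z)) (P x)" by (simp add: W_adj)
  also have "\<dots> = (LBINT q. complex_of_real (gauss q) * cinner z (W p (W r (W q x))))" by (simp add: cinner_P W_adj)
  \<comment> \<open>Written in terms of \<open>p + r + q\<close> so that translation invariance of
    the measure can replace this sum by \<open>s\<close>.\<close>
  also have "\<dots> = (LBINT q. complex_of_real (gauss ((p + r + q) - p - r)) * phase (?\<theta> p (p + r + q)) * cinner z (W (p + r + q) x))"
  proof (intro Bochner_Integration.integral_cong refl)
   fix q :: "real \<times> real"
   have th: "?\<theta> p (p + r + q) = (fst p * snd r - snd p * fst r) / 2 + (fst (p + r) * snd q - snd (p + r) * fst q) / 2"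
    by (simp add: field_simps)
   have "W p (W r (W q x)) = scaleC (phase ((fst p * snd r - snd p * fst r) / 2) * phase ((fst (p + r) * snd q - snd (p + r) * fst q) / 2)) (W (p + r + q) x)"
    by (simp only: W_W[of p r "W q x"] W_W[of "p + r" q x] scaleC_scaleC)
   then show "complex_of_real (gauss q) * cinner z (W p (W r (W q x)))
     = complex_of_real (gauss ((p + r + q) - p - r)) * phase (?\<theta> p (p + r + q)) * cinner z (W (p + r + q) x)"
    unfolding th phase_add by (simp only: cinner_scaleC_right) (simp add: algebra_simps)
  qed
  also have "\<dots> = (LBINT s. complex_of_real (gauss (s - p - r)) * phase (?\<theta> p s) * cinner z (W s x))"
   by (rule lborel_integral_shift2, rule borel_measurable_continuous_onI)
    (auto intro!: continuous_intros W_cont continuous_on_compose2[OF gauss_continuous])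
  finally show "complex_of_real (gauss p) * cinner z (W p (W r (P x)))
    = (LBINT s. complex_of_real (gauss p * gauss (s - p - r)) * phase (?\<theta> p s) * cinner z (W s x))"
   by (simp add: mult.assoc)
 qed
 also have "\<dots> = (LBINT s. LBINT p. complex_of_real (gauss p * gauss (s - p - r)) * phase (?\<theta> p s) * cinner z (W s x))"
 proof (rule Fubini_bound[where f="\<lambda>p. exp (- (1/8) * ((fst p - 0)\<^sup>2 + (snd p - 0)\<^sup>2))"
    and g="\<lambda>s. norm z * norm x * exp (- (1/16) * ((fst s - fst r)\<^sup>2 + (snd s - snd r)\<^sup>2))"])
  show "integrable lborel (\<lambda>p::real \<times> real. exp (- (1/8) * ((fst p - 0)\<^sup>2 + (snd p - 0)\<^sup>2)))"
   by (rule integrable_gaussian2) simp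
  show "integrable lborel (\<lambda>s. norm z * norm x * exp (- (1/16) * ((fst s - fst r)\<^sup>2 + (snd s - snd r)\<^sup>2)))"
   by (intro integrable_mult_right integrable_gaussian2) simp
  fix p s :: "real \<times> real"
  have "cmod (of_real (gauss p * gauss (s - p - r)) * phase (?\<theta> p s) * cinner z (W s x))
    = gauss p * gauss (s - p - r) * cmod (cinner z (W s x))"
   unfolding norm_mult norm_exp_ii_of_real norm_of_real using gauss_pos by (simp add: abs_of_nonneg)
  also have "\<dots> \<le> exp (- (1/8) * ((fst p - 0)\<^sup>2 + (snd p - 0)\<^sup>2)) * exp (- (1/16) * ((fst s - fst r)\<^sup>2 + (snd s - snd r)\<^sup>2)) * (norm z * norm x)"
   by (intro mult_mono gauss_mult_bound W_bound) auto
  finally show "cmod (of_real (gauss p * gauss (s - p - r)) * phase (?\<theta> p s) * cinner z (W s x))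
    \<le> exp (- (1/8) * ((fst p - 0)\<^sup>2 + (snd p - 0)\<^sup>2)) * (norm z * norm x * exp (- (1/16) * ((fst s - fst r)\<^sup>2 + (snd s - snd r)\<^sup>2)))"
   by (simp only: ac_simps)
 next
  show "(\<lambda>(p, s). complex_of_real (gauss p * gauss (s - p - r)) * phase (?\<theta> p s) * cinner z (W s x))
    \<in> borel_measurable (lborel \<Otimes>\<^sub>M lborel)"
   by (rule measurable_pair_continuous)
    (auto intro!: continuous_intros continuous_on_compose2[OF W_cont] continuous_on_compose2[OF gauss_continuous] simp: split_beta')
 qed auto
 also have "\<dots> = (LBINT s. complex_of_real (2 * pi * gauss r) * (complex_of_real (gauss s) * cinner z (W s x)))"
  by (simp only: integral_mult_left_zero gauss_convolution) (simp only: of_real_mult ac_simps)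
 also have "\<dots> = complex_of_real (2 * pi * gauss r) * cinner z (P x)" by (simp only: integral_mult_right_zero cinner_P)
 finally show ?thesis .
qed

text \<open>If \<open>P\<close> vanished, so would its expectation in every vector
  \<open>W (c, d) z\<close>. Conjugation by \<open>W (c, d)\<close> multiplies \<open>W p\<close> by
  a character of \<open>p\<close>, so the continuous function \<open>gauss p * <z, W p z>\<close>
  would have zero Fourier transform, although its value at 0 is \<open>|z|^2\<close>.\<close>

lemma P_nonzero:
 assumes z: "z \<noteq> (0::'k)"
 shows "\<exists>x. P x \<noteq> 0"
proof (rule ccontr)
 assume "\<not> ?thesis"
 then have P0: "P x = 0" for x by blast
 define f where "f = (\<lambda>a b. complex_of_real (gauss (a, b)) * cinner z (W (a, b) z))"
 have fcont: "continuous_on UNIV (\<lambda>p. complex_of_real (gauss p) * cinner z (W p z))"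
  unfolding gauss_def by (intro continuous_intros W_cont) auto
 have fm [measurable]: "(\<lambda>p. f (fst p) (snd p)) \<in> borel_measurable borel" unfolding f_def prod.collapse by measurable
 have cm [measurable]: "(\<lambda>p::real \<times> real. cis_mult k (snd p)) \<in> borel_measurable borel"
  "(\<lambda>p::real \<times> real. cis_mult k (fst p)) \<in> borel_measurable borel" for k
  by (rule borel_measurable_continuous_onI; auto intro!: continuous_intros)+
 have bound: "cmod (f a b) \<le> exp (- (1/4) * (a - 0)\<^sup>2) * (norm z * norm z * exp (- (1/4) * (b - 0)\<^sup>2))" for a b
 proof -
  have "gauss (a, b) = exp (- (1/4) * (a - 0)\<^sup>2) * exp (- (1/4) * (b - 0)\<^sup>2)"
   by (simp add: gauss_def exp_add[symmetric] field_simps)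
  then have "cmod (f a b) = exp (- (1/4) * (a - 0)\<^sup>2) * exp (- (1/4) * (b - 0)\<^sup>2) * cmod (cinner z (W (a, b) z))"
   unfolding f_def norm_mult norm_of_real by (simp add: abs_of_nonneg)
  also have "\<dots> \<le> exp (- (1/4) * (a - 0)\<^sup>2) * exp (- (1/4) * (b - 0)\<^sup>2) * (norm z * norm z)"
   by (intro mult_left_mono W_bound) auto
  finally show ?thesis by (simp only: ac_simps)
 qed
 have ga: "integrable lborel (\<lambda>a::real. exp (- (1/4) * (a - 0)\<^sup>2))"
  and gb: "integrable lborel (\<lambda>b::real. norm z * norm z * exp (- (1/4) * (b - 0)\<^sup>2))"
  by (intro integrable_mult_right integrable_gaussian'; simp)+
 \<comment> \<open>Two-dimensional Fourier uniqueness is reached one variable at a time: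
   \<open>h c\<close> is the partial transform in the second variable.\<close>
 define h where "h c a = (LBINT b. cis_mult (- c) b * f a b)" for c a
 have hF: "(LBINT a. cis_mult d a * h c a) = 0" and hI: "integrable lborel (h c)" for c d
 proof -
  have Fm: "(\<lambda>(a, b). cis_mult (- c) b * f a b) \<in> borel_measurable (lborel \<Otimes>\<^sub>M lborel)"
   unfolding split_beta' lborel_prod using borel_measurable_times[OF cm(1)[of "- c"] fm] by simp
  have i1: "integrable (lborel \<Otimes>\<^sub>M lborel) (\<lambda>(a, b). cis_mult (- c) b * f a b)"
   by (rule integrable_pair_bound[OF Fm ga _ gb]) (use bound in \<open>auto simp: norm_mult simp del: of_real_mult of_real_minus\<close>)
  show "integrable lborel (h c)" using lborel_pair.integrable_fst'[OF i1] by (simp add: h_def[abs_def])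
  have Fm2: "(\<lambda>(a, b). cis_mult d a * (cis_mult (- c) b * f a b)) \<in> borel_measurable (lborel \<Otimes>\<^sub>M lborel)"
   unfolding split_beta' lborel_prod using borel_measurable_times[OF cm(2)[of d] borel_measurable_times[OF cm(1)[of "- c"] fm]] by simp
  have i2: "integrable (lborel \<Otimes>\<^sub>M lborel) (\<lambda>(a, b). cis_mult d a * (cis_mult (- c) b * f a b))"
   by (rule integrable_pair_bound[OF Fm2 ga _ gb]) (use bound in \<open>auto simp: norm_mult simp del: of_real_mult of_real_minus\<close>)
  have "(LBINT a. cis_mult d a * h c a) = (LBINT a. LBINT b. cis_mult d a * (cis_mult (- c) b * f a b))" by (simp add: h_def)
  also have "\<dots> = (LBINT p. cis_mult d (fst p) * (cis_mult (- c) (snd p) * f (fst p) (snd p)))"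
   using lborel_pair.integral_fst'[OF i2] by (simp add: lborel_prod split_beta')
  also have "\<dots> = (LBINT p. complex_of_real (gauss p) * cinner (W (c, d) z) (W p (W (c, d) z)))"
  proof (intro Bochner_Integration.integral_cong refl)
   fix p :: "real \<times> real"
   obtain a b where p: "p = (a, b)" by (cases p)
   have e: "(a * d - b * c) / 2 + (- c * (b + d) + d * (a + c)) / 2 = d * a + (- c) * b" by (simp add: field_simps)
   have "cinner (W (c, d) z) (W p (W (c, d) z)) = cinner z (W (- (c, d)) (W p (W (c, d) z)))" by (simp add: W_adj)
   also have "W (- (c, d)) (W p (W (c, d) z)) = scaleC (phase ((a * d - b * c) / 2) * phase ((- c * (b + d) + d * (a + c)) / 2)) (W p z)"
    using isometry_opD(2)[OF W_isometry]
    by (simp add: W_W p scaleC_scaleC del: of_real_mult of_real_minus of_real_divide of_real_diff of_real_add)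
   finally have "cinner (W (c, d) z) (W p (W (c, d) z)) = phase (d * a) * phase ((- c) * b) * cinner z (W p z)"
    unfolding phase_add[symmetric] e by (simp only: cinner_scaleC_right)
   then show "cis_mult d (fst p) * (cis_mult (- c) (snd p) * f (fst p) (snd p)) = complex_of_real (gauss p) * cinner (W (c, d) z) (W p (W (c, d) z))"
    by (simp only: p f_def fst_conv snd_conv ac_simps)
  qed
  also have "\<dots> = cinner (W (c, d) z) (P (W (c, d) z))" by (simp only: cinner_P)
  finally show "(LBINT a. cis_mult d a * h c a) = 0" by (simp add: P0)
 qed
 have fa: "continuous_on UNIV (\<lambda>a. f a b)" for b
 proof -
  have "continuous_on UNIV (\<lambda>a. (\<lambda>p. complex_of_real (gauss p) * cinner z (W p z)) (a, b))"
   by (rule continuous_on_compose2[OF fcont]) (auto intro!: continuous_intros)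
  then show ?thesis by (simp add: f_def)
 qed
 have fb: "continuous_on UNIV (\<lambda>b. f a b)" for a
 proof -
  have "continuous_on UNIV (\<lambda>b. (\<lambda>p. complex_of_real (gauss p) * cinner z (W p z)) (a, b))"
   by (rule continuous_on_compose2[OF fcont]) (auto intro!: continuous_intros)
  then show ?thesis by (simp add: f_def)
 qed
 have fbm [measurable]: "f a \<in> borel_measurable borel" for a using borel_measurable_continuous_onI[OF fb[of a]] by simp
 have bound': "cmod (f a b) \<le> norm z * norm z * exp (- (1/4) * (b - 0)\<^sup>2)" for a b
  by (rule order_trans[OF bound]) (simp add: mult_left_le_one_le)
 \<comment> \<open>Continuity upgrades vanishing almost everywhere to vanishing at
   \<open>a = 0\<close>, where the second variable is then treated.\<close>
 have "isCont (h c) a" for c a unfolding continuous_within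
 proof (rule tendsto_at_iff_sequentially[THEN iffD2], intro allI impI)
  fix X :: "nat \<Rightarrow> real" assume X: "X \<longlonglongrightarrow> a"
  have "(\<lambda>n. LBINT b. cis_mult (- c) b * f (X n) b) \<longlonglongrightarrow> (LBINT b. cis_mult (- c) b * f a b)"
  proof (rule integral_dominated_convergence[where w="\<lambda>b. norm z * norm z * exp (- (1/4) * (b - 0)\<^sup>2)"])
   show "AE b in lborel. (\<lambda>n. cis_mult (- c) b * f (X n) b) \<longlonglongrightarrow> cis_mult (- c) b * f a b"
   proof (intro AE_I2 tendsto_mult tendsto_const)
    fix b
    show "(\<lambda>n. f (X n) b) \<longlonglongrightarrow> f a b"
    proof (rule isCont_tendsto_compose[OF _ X])
     show "isCont (\<lambda>a. f a b) a" using fa[of b] by (simp add: continuous_on_eq_continuous_at)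
    qed
   qed
   show "AE b in lborel. norm (cis_mult (- c) b * f (X n) b) \<le> norm z * norm z * exp (- (1/4) * (b - 0)\<^sup>2)" for n
    unfolding norm_mult norm_exp_ii_of_real mult_1_left by (intro AE_I2 bound')
   show "(\<lambda>b. cis_mult (- c) b * f a b) \<in> borel_measurable lborel" by measurable
   show "(\<lambda>b. cis_mult (- c) b * f (X n) b) \<in> borel_measurable lborel" for n by measurable
  qed (rule gb)
  then show "((h c) \<circ> X) \<longlonglongrightarrow> h c a" by (simp add: h_def o_def)
 qed
 then have "continuous_on UNIV (h c)" for c by (simp add: continuous_on_eq_continuous_at)
 then have h0: "h c 0 = 0" for c using continuous_AE_zero[of "h c" 0] fourier_uniqueness[OF hI hF] by blast
 have "AE b in lborel. f 0 b = 0"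
 proof (rule fourier_uniqueness)
  show "integrable lborel (f 0)"
  proof (rule Bochner_Integration.integrable_bound[OF gb])
   show "AE b in lborel. norm (f 0 b) \<le> norm (norm z * norm z * exp (- (1/4) * (b - 0)\<^sup>2))"
    using bound'[of 0] by (intro AE_I2) (simp add: abs_of_nonneg)
  qed measurable
  show "(LBINT b. cis_mult c b * f 0 b) = 0" for c using h0[of "- c"] by (simp add: h_def)
 qed
 then have "f 0 0 = 0" using continuous_AE_zero[OF fb[of 0]] by blast
 moreover have "W (0, 0) z = z" using W_zero by (simp add: zero_prod_def)
 ultimately show False using z by (simp add: f_def gauss_def cinner_self)
qed

text \<open>Any nonzero \<open>P x\<close>, normalised: by \<open>P_W_P\<close> and self-adjointness
  its orbit coefficients are a constant times \<open>gauss r\<close>.\<close>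

theorem vacuum_exists:
 assumes "z \<noteq> (0::'k)"
 shows "\<exists>\<Omega>. vacuum \<Omega>"
proof -
 obtain x where x: "P x \<noteq> 0" using P_nonzero[OF assms] by blast
 define N where "N = norm (P x)"
 have N: "N \<noteq> 0" using x by (simp add: N_def)
 have W: "cinner (P x) (W r (P x)) = complex_of_real (2 * pi * gauss r) * cinner x (P x)" for r
  using P_W_P[of x r x] P_selfadjoint[of x "W r (P x)"] by simp
 have "complex_of_real (N\<^sup>2) = complex_of_real (2 * pi) * cinner x (P x)"
  using W[of 0] by (simp add: W_zero cinner_self N_def gauss_def)
 then have W': "cinner (P x) (W r (P x)) = complex_of_real (gauss r * N\<^sup>2)" for r using W[of r] by (simp add: ac_simps)
 have "vacuum (scaleC (complex_of_real (1 / N)) (P x))" unfolding vacuum_def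
 proof
  fix p
  have "cinner (scaleC (complex_of_real (1 / N)) (P x)) (W p (scaleC (complex_of_real (1 / N)) (P x)))
    = complex_of_real (1 / N * (1 / N) * (gauss p * N\<^sup>2))"
   unfolding isometry_opD(2)[OF W_isometry] cinner_scaleC_left cinner_scaleC_right W' by simp
  also have "1 / N * (1 / N) * (gauss p * N\<^sup>2) = gauss p" using N by (simp add: power2_eq_square)
  finally show "cinner (scaleC (complex_of_real (1 / N)) (P x)) (W p (scaleC (complex_of_real (1 / N)) (P x)))
    = complex_of_real (exp (- ((fst p)\<^sup>2 + (snd p)\<^sup>2) / 4))"
   by (simp only: gauss_def)
 qed
 then show ?thesis by blast
qed

end

section \<open>The Schroedinger representation\<close>

lemma closed_csubspace_eq_UNIV:
 assumes "closed_csubspace M" "S \<subseteq> M" "closure (cspan S) = UNIV"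
 shows "M = UNIV"
proof -
 have "cspan S \<subseteq> M" using assms(1,2) by (intro cspan_minimal) (auto simp: closed_csubspace_def)
 then have "closure (cspan S) \<subseteq> M" using assms(1) by (intro closure_minimal) (auto simp: closed_csubspace_def)
 then show ?thesis using assms(3) by auto
qed

lemma isometry_eq_on_dense:
 assumes A: "isometry_op A" and B: "isometry_op B" and eq: "\<And>x. x \<in> S \<Longrightarrow> A x = B x"
  and dense: "closure (cspan S) = UNIV"
 shows "A x = B x"
proof -
 have "closed_csubspace {x. A x = B x}" unfolding closed_csubspace_def csubspace_def
  using isometry_opD(1,2,5)[OF A] isometry_opD(1,2,5)[OF B] continuous_on_isometry_op[OF A] continuous_on_isometry_op[OF B]
  by (auto intro!: closed_Collect_eq)
 then have "{x. A x = B x} = UNIV" by (rule closed_csubspace_eq_UNIV[OF _ _ dense]) (simp add: subset_iff eq)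
 then show ?thesis by auto
qed

lemma generator_in_closure_cspan: "x \<in> S \<Longrightarrow> x \<in> closure (cspan S)"
 by (rule subsetD[OF closure_subset], rule subsetD[OF cspan_superset])

lemma closed_csubspace_vimage:
 assumes A: "isometry_op A" and S: "closed_csubspace S"
 shows "closed_csubspace {x. A x \<in> S}"
proof -
 have "closed (A -` S)" using S continuous_on_isometry_op[OF A, of UNIV]
  by (intro continuous_closed_vimage) (auto simp: closed_csubspace_def continuous_on_eq_continuous_at)
 then show ?thesis using S isometry_opD(1,2,5)[OF A] by (auto simp: closed_csubspace_def csubspace_def vimage_def)
qed

section \<open>Modulations, translations and the Gaussian ground state on L^2\<close>

definition Ml :: "real \<Rightarrow> l2 \<Rightarrow> l2" where
 "Ml a x = to_l2 (Mop a (fun_of_l2 x))"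

definition Dl :: "real \<Rightarrow> l2 \<Rightarrow> l2" where
 "Dl b x = to_l2 (Dop b (fun_of_l2 x))"

lemma Ml_to_l2:
 assumes "f \<in> L2"
 shows "Ml a (to_l2 f) = to_l2 (Mop a f)" unfolding Ml_def
proof (rule to_l2_eqI)
 show "AE t in lborel. Mop a (fun_of_l2 (to_l2 f)) t = Mop a f t" using fun_of_to_l2[OF assms] by eventually_elim (simp add: Mop_def)
qed

lemma Dl_to_l2:
 assumes "f \<in> L2"
 shows "Dl b (to_l2 f) = to_l2 (Dop b f)" unfolding Dl_def
proof (rule to_l2_eqI)
 show "AE t in lborel. Dop b (fun_of_l2 (to_l2 f)) t = Dop b f t"
  using AE_lborel_shift[OF fun_of_to_l2[OF assms], of b] by eventually_elim (simp add: Dop_def)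
qed

lemma Mop_Mop: "Mop a (Mop b f) = Mop (a + b) f" by (rule ext) (simp add: Mop_def exp_add[symmetric] algebra_simps)

lemma Dop_Dop: "Dop a (Dop b f) = Dop (a + b) f" by (rule ext) (simp add: Dop_def algebra_simps)

lemma Mop_Dop: "Mop a (Dop b f) = (\<lambda>t. phase (a * b) * Dop b (Mop a f) t)"
proof
 fix t
 have "phase (a * b) * phase (a * (t - b)) = phase (a * t)" unfolding phase_add[symmetric] by (simp add: algebra_simps)
 then show "Mop a (Dop b f) t = phase (a * b) * Dop b (Mop a f) t" unfolding Mop_def Dop_def mult.assoc[symmetric] by simp
qed

lemma Mop_zero: "Mop 0 f = f" and Dop_zero: "Dop 0 f = f" by (auto simp: Mop_def Dop_def)

lemma isometry_op_Ml: "isometry_op (Ml a)" unfolding isometry_op_def clinear_def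
proof (intro conjI allI)
 fix x y :: l2 and c
 obtain f where f: "f \<in> L2" "x = to_l2 f" by (rule l2_cases)
 obtain g where g: "g \<in> L2" "y = to_l2 g" by (rule l2_cases)
 show "Ml a (x + y) = Ml a x + Ml a y" using f g by (simp add: to_l2_ops Ml_to_l2 L2_add L2_Mop) (simp add: Mop_def algebra_simps)
 show "Ml a (scaleC c x) = scaleC c (Ml a x)"
  using f by (simp add: scaleC_to_l2 Ml_to_l2 L2_scale L2_Mop) (simp add: Mop_def algebra_simps)
 have "(norm (Ml a x))\<^sup>2 = (norm x)\<^sup>2"
  using f by (simp add: Ml_to_l2 norm_to_l2_sq L2_Mop) (simp add: Mop_def norm_mult del: of_real_mult)
 then show "norm (Ml a x) = norm x" by simp
qed

lemma isometry_op_Dl: "isometry_op (Dl b)" unfolding isometry_op_def clinear_def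
proof (intro conjI allI)
 fix x y :: l2 and c
 obtain f where f: "f \<in> L2" "x = to_l2 f" by (rule l2_cases)
 obtain g where g: "g \<in> L2" "y = to_l2 g" by (rule l2_cases)
 show "Dl b (x + y) = Dl b x + Dl b y" using f g by (simp add: to_l2_ops Dl_to_l2 L2_add L2_Dop) (simp add: Dop_def)
 show "Dl b (scaleC c x) = scaleC c (Dl b x)" using f by (simp add: scaleC_to_l2 Dl_to_l2 L2_scale L2_Dop) (simp add: Dop_def)
 have "(norm (Dl b x))\<^sup>2 = (norm x)\<^sup>2" using f lborel_integral_shift(1)[of "\<lambda>t. (cmod (f t))\<^sup>2" b]
  by (simp add: Dl_to_l2 norm_to_l2_sq L2_Dop) (simp add: Dop_def)
 then show "norm (Dl b x) = norm x" by simp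
qed

interpretation l2w: weyl_system Ml Dl
proof
 fix a b :: real and x :: l2
 obtain f where f: "f \<in> L2" "x = to_l2 f" by (rule l2_cases)
 show "Ml (a + b) x = Ml a (Ml b x)" "Dl (a + b) x = Dl a (Dl b x)" "Ml 0 x = x" "Dl 0 x = x"
  using f by (simp_all add: Ml_to_l2 Dl_to_l2 L2_Mop L2_Dop Mop_Mop Dop_Dop Mop_zero Dop_zero)
 show "Ml a (Dl b x) = scaleC (phase (a * b)) (Dl b (Ml a x))"
  using f by (simp add: Ml_to_l2 Dl_to_l2 L2_Mop L2_Dop Mop_Dop scaleC_to_l2 del: of_real_mult)
qed (rule isometry_op_Ml isometry_op_Dl)+

text \<open>The constant is \<open>pi^(-1/4)\<close>, which makes this a unit vector.\<close>

definition ground :: "real \<Rightarrow> complex" where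
 "ground t = complex_of_real (exp (- t\<^sup>2 / 2) / sqrt (sqrt pi))"

lemma ground_pos: "ground t \<noteq> 0" by (simp add: ground_def)

lemma ground_L2: "ground \<in> L2"
proof (rule L2I)
 show "ground \<in> borel_measurable borel" unfolding ground_def[abs_def] by measurable
 have "integrable lborel (\<lambda>t::real. (1 / sqrt pi) * exp (- 1 * (t - 0)\<^sup>2))"
  by (intro integrable_mult_right integrable_gaussian') simp
 moreover have "(cmod (ground t))\<^sup>2 = (1 / sqrt pi) * exp (- 1 * (t - 0)\<^sup>2)" for t
  unfolding ground_def norm_of_real power2_abs power_divide by (simp add: power2_eq_square exp_add[symmetric])
 ultimately show "integrable lborel (\<lambda>t. (cmod (ground t))\<^sup>2)" by simp
qed

lemma ground_overlap:
 "(LBINT t. cnj (ground t) * (cis_mult a t * ground (t - b))) = phase (a * b / 2) * complex_of_real (exp (- (a\<^sup>2 + b\<^sup>2) / 4))"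
proof -
 let ?s = "1 / sqrt 2 :: real"
 have "cnj (ground t) * (cis_mult a t * ground (t - b))
   = complex_of_real (exp (- b\<^sup>2 / 4) / sqrt pi) * (cis_mult a t * complex_of_real (exp (- (t - b / 2)\<^sup>2 / (2 * ?s\<^sup>2))))" for t
 proof -
  have e: "- t\<^sup>2 / 2 + - (t - b)\<^sup>2 / 2 = - b\<^sup>2 / 4 + - (t - b / 2)\<^sup>2 / (2 * ?s\<^sup>2)"
   by (simp add: power_divide) (simp add: power2_eq_square field_simps)
  have "exp (- t\<^sup>2 / 2) / sqrt (sqrt pi) * (exp (- (t - b)\<^sup>2 / 2) / sqrt (sqrt pi)) = exp (- t\<^sup>2 / 2) * exp (- (t - b)\<^sup>2 / 2) / sqrt pi"
   by simp
  also have "\<dots> = exp (- b\<^sup>2 / 4) / sqrt pi * exp (- (t - b / 2)\<^sup>2 / (2 * ?s\<^sup>2))"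
   unfolding exp_add[symmetric] e by (simp only: exp_add) simp
  finally have "ground t * ground (t - b) = complex_of_real (exp (- b\<^sup>2 / 4) / sqrt pi * exp (- (t - b / 2)\<^sup>2 / (2 * ?s\<^sup>2)))"
   by (simp only: ground_def of_real_mult[symmetric])
  moreover have "cnj (ground t) = ground t" by (simp add: ground_def)
  ultimately have "cnj (ground t) * (cis_mult a t * ground (t - b)) = complex_of_real (exp (- b\<^sup>2 / 4) / sqrt pi * exp (- (t - b / 2)\<^sup>2 / (2 * ?s\<^sup>2))) * cis_mult a t"
   by (metis (no_types, lifting) mult.assoc mult.commute)
  then show ?thesis by (simp only: of_real_mult ac_simps)
 qed
 then have "(LBINT t. cnj (ground t) * (cis_mult a t * ground (t - b)))
   = complex_of_real (exp (- b\<^sup>2 / 4) / sqrt pi) * (LBINT t. cis_mult a t * complex_of_real (exp (- (t - b / 2)\<^sup>2 / (2 * ?s\<^sup>2))))"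
  by (simp only: integral_mult_right_zero)
 also have "(LBINT t. cis_mult a t * complex_of_real (exp (- (t - b / 2)\<^sup>2 / (2 * ?s\<^sup>2))))
   = cis_mult a (b / 2) * complex_of_real (?s * sqrt (2 * pi) * exp (- (?s * a)\<^sup>2 / 2))"
  by (rule gaussian_fourier) simp
 also have "complex_of_real (exp (- b\<^sup>2 / 4) / sqrt pi) * (cis_mult a (b / 2) * complex_of_real (?s * sqrt (2 * pi) * exp (- (?s * a)\<^sup>2 / 2)))
   = phase (a * (b / 2)) * complex_of_real (exp (- b\<^sup>2 / 4) / sqrt pi * (?s * sqrt (2 * pi) * exp (- (?s * a)\<^sup>2 / 2)))"
  by (simp only: of_real_mult ac_simps)
 also have "exp (- b\<^sup>2 / 4) / sqrt pi * (?s * sqrt (2 * pi) * exp (- (?s * a)\<^sup>2 / 2)) = exp (- (a\<^sup>2 + b\<^sup>2) / 4)"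
  by (simp add: real_sqrt_mult power_mult_distrib power_divide exp_add[symmetric])
 finally show ?thesis by simp
qed

lemma vacuum_ground: "l2w.vacuum (to_l2 ground)" unfolding l2w.vacuum_def
proof
 fix p :: "real \<times> real"
 obtain a b where p: "p = (a, b)" by (cases p)
 have "l2w.W p (to_l2 ground) = scaleC (phase (- (a * b) / 2)) (to_l2 (Mop a (Dop b ground)))"
  by (simp add: l2w.W_def p Ml_to_l2 Dl_to_l2 ground_L2 L2_Dop)
 then have "cinner (to_l2 ground) (l2w.W p (to_l2 ground))
   = phase (- (a * b) / 2) * (LBINT t. cnj (ground t) * (cis_mult a t * ground (t - b)))"
  by (simp only: cinner_scaleC_right cinner_to_l2 ground_L2 L2_Dop L2_Mop) (simp only: Mop_def Dop_def)
 also have "\<dots> = (phase (- (a * b) / 2) * phase (a * b / 2)) * complex_of_real (exp (- (a\<^sup>2 + b\<^sup>2) / 4))"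
  by (simp only: ground_overlap mult.assoc)
 also have "phase (- (a * b) / 2) * phase (a * b / 2) = 1" unfolding phase_add[symmetric] by simp
 finally show "cinner (to_l2 ground) (l2w.W p (to_l2 ground)) = complex_of_real (exp (- ((fst p)\<^sup>2 + (snd p)\<^sup>2) / 4))"
  by (simp add: p)
qed

text \<open>Modulated ground states suffice: if \<open>f\<close> is orthogonal to all of them, then
  \<open>cnj (f t) * ground t\<close> has zero Fourier transform, and the Gaussian vanishes
  nowhere.\<close>

lemma dense_ground: "closure (cspan (range (\<lambda>p. l2w.W p (to_l2 ground)))) = UNIV"
proof (intro equalityI subset_UNIV subsetI)
 let ?S = "closure (cspan (range (\<lambda>p. l2w.W p (to_l2 ground))))"
 fix x :: l2
 show "x \<in> ?S"
 proof (rule mem_closed_csubspaceI[OF closed_csubspace_closure_cspan])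
  fix z assume z: "z \<in> orthogonal_complement ?S"
  obtain f where f: "f \<in> L2" "z = to_l2 f" by (rule l2_cases)
  have "AE t in lborel. cnj (f t) * ground t = 0"
  proof (rule fourier_uniqueness)
   show "integrable lborel (\<lambda>t. cnj (f t) * ground t)" by (intro L2_mult_integrable L2_cnj f ground_L2)
   fix a
   have "l2w.W (a, 0) (to_l2 ground) \<in> ?S" by (rule generator_in_closure_cspan) simp
   then have "cinner (l2w.W (a, 0) (to_l2 ground)) z = 0" using z by (auto simp: orthogonal_complement_def)
   then have "cinner z (l2w.W (a, 0) (to_l2 ground)) = 0" using cinner_commute[of z "l2w.W (a, 0) (to_l2 ground)"] by simp
   moreover have "l2w.W (a, 0) (to_l2 ground) = to_l2 (Mop a ground)" by (simp add: l2w.W_def l2w.V_zero scaleC_one Ml_to_l2 ground_L2)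
   ultimately have "(LBINT t. cnj (f t) * Mop a ground t) = 0" using f by (simp add: cinner_to_l2 ground_L2 L2_Mop)
   then show "(LBINT t. cis_mult a t * (cnj (f t) * ground t)) = 0" unfolding Mop_def by (simp only: ac_simps)
  qed
  then have "AE t in lborel. f t = 0" by eventually_elim (use ground_pos in auto)
  then have "z = 0" using f by (simp add: zero_l2_def to_l2_eq_iff L2_zero)
  then show "cinner z x = 0" by simp
 qed
qed

lemma Dl_eq_W: "Dl b x = l2w.W (0, b) x" and Ml_eq_W: "Ml a x = l2w.W (a, 0) x"
 by (simp_all add: l2w.W_def l2w.U_zero l2w.V_zero scaleC_one)

text \<open>The vectors that are translated continuously form a closed subspace, and on the dense
  orbit of the ground state the Gram formula makes the distance explicit.\<close>

lemma Dl_continuous_at_zero: "((\<lambda>h. Dl h x) \<longlongrightarrow> x) (at 0)"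
proof -
 define C where "C = {x. ((\<lambda>h. Dl h x) \<longlongrightarrow> x) (at 0)}"
 note D = isometry_opD[OF isometry_op_Dl]
 have "csubspace C" unfolding csubspace_def C_def by (auto simp: D(1,2,5) intro!: tendsto_add tendsto_scaleC)
 moreover have "closed C"
 proof (rule closed_sequential_limits[THEN iffD2])
  show "\<forall>X x. (\<forall>n. X n \<in> C) \<and> X \<longlonglongrightarrow> x \<longrightarrow> x \<in> C"
  proof (intro allI impI, elim conjE)
   fix X x assume X: "\<forall>n. X n \<in> C" "X \<longlonglongrightarrow> x"
   show "x \<in> C" unfolding C_def mem_Collect_eq
   proof (rule tendstoI)
    fix e :: real assume e: "0 < e"
    then obtain n where n: "dist (X n) x < e / 3" using metric_LIMSEQ_D[OF X(2), of "e / 3"] by auto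
    have "\<forall>\<^sub>F h in at 0. dist (Dl h (X n)) (X n) < e / 3" using X(1) e by (intro tendstoD) (simp_all add: C_def)
    then show "\<forall>\<^sub>F h in at 0. dist (Dl h x) x < e"
    proof eventually_elim
     case (elim h)
     have "dist (Dl h x) x \<le> dist (Dl h x) (Dl h (X n)) + dist (Dl h (X n)) (X n) + dist (X n) x"
      using dist_triangle[of "Dl h x" x "X n"] dist_triangle[of "Dl h x" "X n" "Dl h (X n)"] by linarith
     then show ?case using n elim isometry_op_dist[OF isometry_op_Dl, of h x "X n"] by (simp add: dist_commute)
    qed
   qed
  qed
 qed
 moreover have "l2w.W p (to_l2 ground) \<in> C" for p
 proof -
  let ?y = "l2w.W p (to_l2 ground)"
  have W: "Dl h ?y = scaleC (phase ((0 * snd p - h * fst p) / 2)) (l2w.W ((0, h) + p) (to_l2 ground))" for h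
   by (simp add: Dl_eq_W l2w.W_W)
  have c: "cinner ?y (Dl h ?y) = phase ((0 * snd p - h * fst p) / 2) * (phase ((- fst p * (h + snd p) + snd p * fst p) / 2)
    * complex_of_real (exp (- (0\<^sup>2 + h\<^sup>2) / 4)))" for h
   unfolding W cinner_scaleC_right l2w.vacuum_gram[OF vacuum_ground] by simp
  have "((\<lambda>h. cinner ?y (Dl h ?y)) \<longlongrightarrow> phase ((0 * snd p - 0 * fst p) / 2) * (phase ((- fst p * (0 + snd p) + snd p * fst p) / 2)
    * complex_of_real (exp (- (0\<^sup>2 + 0\<^sup>2) / 4)))) (at 0)"
   unfolding c by (intro tendsto_intros) auto
  then have "((\<lambda>h. cinner ?y (Dl h ?y)) \<longlongrightarrow> 1) (at 0)" by simp
  then have "((\<lambda>h. (norm ?y)\<^sup>2 + (norm ?y)\<^sup>2 - 2 * Re (cinner ?y (Dl h ?y))) \<longlongrightarrow> (norm ?y)\<^sup>2 + (norm ?y)\<^sup>2 - 2 * Re 1) (at 0)"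
   by (intro tendsto_intros)
  moreover have "(norm ?y)\<^sup>2 = 1"
   using l2w.vacuum_gram[OF vacuum_ground, of p p] by (simp add: cinner_self mult.commute flip: of_real_power)
  moreover have "(norm (?y - Dl h ?y))\<^sup>2 = (norm ?y)\<^sup>2 + (norm ?y)\<^sup>2 - 2 * Re (cinner ?y (Dl h ?y))" for h
   by (simp only: norm_diff_sq D(3))
  ultimately have "((\<lambda>h. (norm (?y - Dl h ?y))\<^sup>2) \<longlongrightarrow> 0) (at 0)" by simp
  then have "((\<lambda>h. sqrt ((norm (?y - Dl h ?y))\<^sup>2)) \<longlongrightarrow> sqrt 0) (at 0)" by (rule tendsto_real_sqrt)
  then have "((\<lambda>h. norm (Dl h ?y - ?y)) \<longlongrightarrow> 0) (at 0)" by (simp add: norm_minus_commute)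
  then show ?thesis unfolding C_def mem_Collect_eq by (rule LIM_zero_cancel[OF tendsto_norm_zero_cancel])
 qed
 ultimately have "C = UNIV" by (intro closed_csubspace_eq_UNIV[OF _ _ dense_ground]) (auto simp: closed_csubspace_def)
 then show ?thesis by (auto simp: C_def)
qed

lemma Dl_continuous: "continuous_on UNIV (\<lambda>b. Dl b x)"
proof -
 have "isCont (\<lambda>b. Dl b x) b" for b
 proof -
  have "((\<lambda>h. Dl b (Dl h x)) \<longlongrightarrow> Dl b x) (at 0)"
   using Dl_continuous_at_zero continuous_on_isometry_op[OF isometry_op_Dl, of UNIV b]
   by (intro isCont_tendsto_compose[of x "Dl b"]) (auto simp: continuous_on_eq_continuous_at)
  then show ?thesis by (simp add: isCont_iff l2w.V_add)
 qed
 then show ?thesis by (simp add: continuous_on_eq_continuous_at)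
qed

lemma L2_translation_continuous:
 assumes f: "f \<in> L2"
 shows "((\<lambda>h. LBINT t. (cmod (f (t - h) - f t))\<^sup>2) \<longlongrightarrow> 0) (at 0)"
proof -
 have "((\<lambda>h. (norm (Dl h (to_l2 f) - to_l2 f))\<^sup>2) \<longlongrightarrow> (norm (to_l2 f - to_l2 f))\<^sup>2) (at 0)"
  by (intro tendsto_intros Dl_continuous_at_zero)
 moreover have "(norm (Dl h (to_l2 f) - to_l2 f))\<^sup>2 = (LBINT t. (cmod (f (t - h) - f t))\<^sup>2)" for h
  using L2_Dop[OF f] f by (simp add: Dl_to_l2 to_l2_ops norm_to_l2_sq L2_diff) (simp add: Dop_def)
 ultimately show ?thesis by simp
qed

text \<open>The closed span of the orbit of a vacuum reduces both groups and is nonzero, so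
  irreducibility makes it everything. Its Gram matrix is that of the orbit of \<open>ground\<close>,
  and the resulting isometry intertwines because the Weyl operators obey the same product rule on
  both sides.\<close>

theorem stone_von_neumann_embedding:
 fixes U V :: "real \<Rightarrow> 'k::chilbert_space \<Rightarrow> 'k"
 assumes U: "unitary_group U" and V: "unitary_group V" and weyl: "weyl_rel U V UNIV"
  and irr: "irreducible_pair U V" and z: "z \<noteq> (0::'k)"
 obtains T :: "'k \<Rightarrow> l2" where "isometry_op T" "\<And>a x. T (U a x) = Ml a (T x)" "\<And>b x. T (V b x) = Dl b (T x)"
proof -
 interpret continuous_weyl_system U V
 proof
  have u: "U 0 = id" "\<And>a b. U (a + b) = U a \<circ> U b" "\<And>a. isometry_op (U a)" "\<And>x. continuous_on UNIV (\<lambda>t. U t x)"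
   using U unfolding unitary_group_def by blast+
  have v: "V 0 = id" "\<And>a b. V (a + b) = V a \<circ> V b" "\<And>a. isometry_op (V a)" "\<And>x. continuous_on UNIV (\<lambda>t. V t x)"
   using V unfolding unitary_group_def by blast+
  fix a b x
  show "isometry_op (U a)" "isometry_op (V a)" "U (a + b) x = U a (U b x)" "V (a + b) x = V a (V b x)" "U 0 x = x" "V 0 x = x"
   "continuous_on UNIV (\<lambda>t. U t x)" "continuous_on UNIV (\<lambda>t. V t x)"
   by (simp_all add: u v)
  show "U a (V b x) = scaleC (phase (a * b)) (V b (U a x))" using weyl unfolding weyl_rel_def by blast
 qed
 obtain \<Omega> where \<Omega>: "vacuum \<Omega>" using vacuum_exists[OF z] by blast
 define S where "S = closure (cspan (range (\<lambda>p. W p \<Omega>)))"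
 have S: "closed_csubspace S" by (simp add: S_def closed_csubspace_closure_cspan)
 have WS: "W q x \<in> S" if "x \<in> S" for q x
 proof -
  have "W q (W p \<Omega>) \<in> S" for p
  proof -
   have "W (q + p) \<Omega> \<in> S" unfolding S_def by (rule generator_in_closure_cspan) simp
   then show ?thesis unfolding W_W using S csubspaceD(3)[of S] by (simp add: closed_csubspace_def)
  qed
  then have "cspan (range (\<lambda>p. W p \<Omega>)) \<subseteq> {x. W q x \<in> S}"
   using closed_csubspace_vimage[OF W_isometry S] by (intro cspan_minimal) (auto simp: closed_csubspace_def)
  then have "S \<subseteq> {x. W q x \<in> S}" unfolding S_def using closed_csubspace_vimage[OF W_isometry S]
   by (intro closure_minimal) (auto simp: closed_csubspace_def S_def)
  then show ?thesis using that by blast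
 qed
 \<comment> \<open>The complement is invariant because the adjoint of \<open>W q\<close> is again a
   Weyl operator.\<close>
 have Wc: "W q y \<in> orthogonal_complement S" if "y \<in> orthogonal_complement S" for q y unfolding orthogonal_complement_def
 proof (intro CollectI ballI)
  fix x assume "x \<in> S"
  then have "cinner (W (- q) x) y = 0" using WS that by (auto simp: orthogonal_complement_def)
  then show "cinner x (W q y) = 0" by (simp add: W_adj)
 qed
 have UW: "U a x = W (a, 0) x" and VW: "V b x = W (0, b) x" for a b x by (simp_all add: W_def U_zero V_zero scaleC_one)
 have "S = {0} \<or> S = UNIV"
 proof -
  have red: "reduces (W q) S" for q unfolding reduces_def by (intro conjI image_subsetI WS Wc)
  have WU: "W (a, 0) = U a" and WV: "W (0, a) = V a" for a by (rule ext, rule UW[symmetric] VW[symmetric])+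
  have redU: "\<forall>a. reduces (U a) S" using red[of "(_, 0)"] unfolding WU by (rule allI)
  have redV: "\<forall>a. reduces (V a) S" using red[of "(0, _)"] unfolding WV by (rule allI)
  show ?thesis by (rule irr[unfolded irreducible_pair_def, rule_format]) (intro conjI S redU redV)
 qed
 moreover have "W 0 \<Omega> \<in> S" unfolding S_def by (rule generator_in_closure_cspan) simp
 moreover have "\<Omega> \<noteq> 0"
 proof
  assume "\<Omega> = 0"
  then show False using \<Omega>[unfolded vacuum_def, rule_format, of 0] by simp
 qed
 ultimately have dense: "S = UNIV" by (auto simp: W_zero)
 obtain T :: "'k \<Rightarrow> l2" where T: "isometry_op T" "\<And>p. T (W p \<Omega>) = l2w.W p (to_l2 ground)"
 proof (rule isometry_extension[of "\<lambda>p. W p \<Omega>" "\<lambda>p. l2w.W p (to_l2 ground)"])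
  show "cinner (W p \<Omega>) (W q \<Omega>) = cinner (l2w.W p (to_l2 ground)) (l2w.W q (to_l2 ground))" for p q
   by (simp only: vacuum_gram[OF \<Omega>] l2w.vacuum_gram[OF vacuum_ground])
  show "closure (cspan (range (\<lambda>p. W p \<Omega>))) = UNIV" using dense by (simp only: S_def)
 qed (rule that)
 have TW: "T (W q x) = l2w.W q (T x)" for q x
 proof -
  have "(T \<circ> W q) x = (l2w.W q \<circ> T) x"
  proof (rule isometry_eq_on_dense[of _ _ "range (\<lambda>p. W p \<Omega>)"])
   show "isometry_op (T \<circ> W q)" "isometry_op (l2w.W q \<circ> T)" by (intro isometry_op_compose T W_isometry l2w.W_isometry)+
   show "closure (cspan (range (\<lambda>p. W p \<Omega>))) = UNIV" using dense by (simp add: S_def)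
   fix x assume "x \<in> range (\<lambda>p. W p \<Omega>)"
   then show "(T \<circ> W q) x = (l2w.W q \<circ> T) x" by (auto simp only: o_apply T(2) W_W l2w.W_W isometry_opD(2)[OF T(1)])
  qed
  then show ?thesis by simp
 qed
 show thesis
 proof (rule that[OF T(1)])
  show "T (U a x) = Ml a (T x)" for a x using TW[of "(a, 0)" x] by (simp only: UW[symmetric] Ml_eq_W)
  show "T (V b x) = Dl b (T x)" for b x using TW[of "(0, b)" x] by (simp only: VW[symmetric] Dl_eq_W)
 qed
qed

section \<open>The Hardy space as an annihilator\<close>

text \<open>The Hardy space described through boundary functions alone, by vanishing of the Cauchy
  transforms in the lower half-plane; \<open>hardy2_eq_Hm\<close> gives the identification.\<close>

definition Hm :: "(real \<Rightarrow> complex) set" where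
 "Hm = {f \<in> L2. \<forall>v. 0 < Im v \<longrightarrow> (LBINT t. f t / (of_real t - cnj v)) = 0}"

definition cauchy_ext :: "(real \<Rightarrow> complex) \<Rightarrow> complex \<Rightarrow> complex" where
 "cauchy_ext f w = (LBINT t. f t / (complex_of_real t - w)) / (2 * pi * \<i>)"

lemma HmD: "f \<in> Hm \<Longrightarrow> f \<in> L2" "f \<in> Hm \<Longrightarrow> 0 < Im v \<Longrightarrow> (LBINT t. f t / (of_real t - cnj v)) = 0"
 by (auto simp: Hm_def)

lemma L2_kernel_integrable: "f \<in> L2 \<Longrightarrow> Im v \<noteq> 0 \<Longrightarrow> integrable lborel (\<lambda>t. f t / (complex_of_real t - v))"
 using L2_mult_integrable[OF _ L2_kernel, of f v] by simp

lemma cmod_diff_cnj: "cmod (of_real t - cnj v) = cmod (of_real t - v)"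
 by (metis complex_cnj_cnj complex_cnj_complex_of_real complex_cnj_diff complex_mod_cnj)

lemma kernel_sq_integral:
 assumes "0 < Im v"
 shows "(LBINT t. (cmod (1 / (of_real t - cnj v)))\<^sup>2) = pi / Im v"
proof -
 have "(cmod (1 / (of_real t - cnj v)))\<^sup>2 = pi / Im v * poisson v t" for t
  using assms by (simp add: poisson_def norm_divide cmod_diff_cnj power_divide)
 then show ?thesis by (simp add: poisson_integral[OF assms])
qed

lemma L2_Cauchy_Schwarz:
 assumes "f \<in> L2" "g \<in> L2"
 shows "(cmod (LBINT t. f t * g t))\<^sup>2 \<le> (LBINT t. (cmod (f t))\<^sup>2) * (LBINT t. (cmod (g t))\<^sup>2)"
proof -
 have "cinner (to_l2 (\<lambda>t. cnj (f t))) (to_l2 g) = (LBINT t. f t * g t)" using assms by (simp add: cinner_to_l2 L2_cnj)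
 then have "(cmod (LBINT t. f t * g t))\<^sup>2 \<le> (norm (to_l2 (\<lambda>t. cnj (f t))) * norm (to_l2 g))\<^sup>2"
  using Cauchy_Schwarz_cinner[of "to_l2 (\<lambda>t. cnj (f t))" "to_l2 g"] by (intro power_mono) auto
 then show ?thesis using assms by (simp add: power_mult_distrib norm_to_l2_sq L2_cnj)
qed

text \<open>Differentiation under the integral with explicit remainder: the difference quotient
  minus the candidate derivative is \<open>w' - w\<close> times an integral that stays bounded near
  \<open>w\<close>.\<close>

lemma cauchy_integral_has_derivative:
 assumes f: "f \<in> L2" and w: "Im w \<noteq> 0"
 shows "((\<lambda>w. LBINT t. f t / (complex_of_real t - w)) has_field_derivative
  (LBINT t. f t / (complex_of_real t - w)\<^sup>2)) (at w)"
proof -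
 note [measurable] = L2D(1)[OF f]
 \<comment> \<open>The distance of \<open>w\<close> from the real line; points within
   \<open>\<eta> / 2\<close> of \<open>w\<close> keep at least half of it, which bounds both
   kernels.\<close>
 define \<eta> where "\<eta> = \<bar>Im w\<bar>"
 have \<eta>: "0 < \<eta>" using w by (simp add: \<eta>_def)
 have nz: "complex_of_real t - w \<noteq> 0" for t using of_real_diff_nonzero[OF w] .
 have kb: "cmod (1 / (complex_of_real t - w)) \<le> 1 / \<eta>" for t using kernel_bounded[OF w] by (simp add: \<eta>_def)
 have i1: "integrable lborel (\<lambda>t. f t / (complex_of_real t - w))" by (rule L2_kernel_integrable[OF f w])
 have i2: "integrable lborel (\<lambda>t. f t / (complex_of_real t - w)\<^sup>2)"
  using integrable_bounded_mult[OF i1 kernel_measurable[of w] kb] by (simp add: power2_eq_square)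
 define C where "C = 2 / \<eta> * (LBINT t. cmod (f t / (complex_of_real t - w)\<^sup>2))"
 let ?F = "\<lambda>w. LBINT t. f t / (complex_of_real t - w)"
 let ?D = "LBINT t. f t / (complex_of_real t - w)\<^sup>2"
 have key: "cmod ((?F w' - ?F w) / (w' - w) - ?D) \<le> C * cmod (w' - w)" if w': "w' \<noteq> w" "cmod (w' - w) < \<eta> / 2" for w'
 proof -
  have "\<bar>Im w' - Im w\<bar> < \<eta> / 2" using abs_Im_le_cmod[of "w' - w"] w'(2) by simp
  then have im: "\<eta> / 2 \<le> \<bar>Im w'\<bar>" "Im w' \<noteq> 0" using \<eta> unfolding \<eta>_def by linarith+
  have nz': "complex_of_real t - w' \<noteq> 0" for t using of_real_diff_nonzero[OF im(2)] .
  have kb': "cmod (1 / (complex_of_real t - w')) \<le> 2 / \<eta>" for t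
  proof -
   have "cmod (1 / (complex_of_real t - w')) \<le> 1 / \<bar>Im w'\<bar>" by (rule kernel_bounded[OF im(2)])
   also have "\<dots> \<le> 1 / (\<eta> / 2)" using im \<eta> by (intro divide_left_mono) auto
   finally show ?thesis by simp
  qed
  have i1': "integrable lborel (\<lambda>t. f t / (complex_of_real t - w'))" by (rule L2_kernel_integrable[OF f im(2)])
  have i3: "integrable lborel (\<lambda>t. 1 / (complex_of_real t - w') * (f t / (complex_of_real t - w)\<^sup>2))"
   by (rule integrable_bounded_mult[OF i2 kernel_measurable kb'])
  have alg: "f t / (complex_of_real t - w') - f t / (complex_of_real t - w) - (w' - w) * (f t / (complex_of_real t - w)\<^sup>2)
    = (w' - w)\<^sup>2 * (1 / (complex_of_real t - w') * (f t / (complex_of_real t - w)\<^sup>2))" for t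
  proof -
   have gen: "c / a - c / b - (b - a) * (c / b\<^sup>2) = (b - a)\<^sup>2 * (1 / a * (c / b\<^sup>2))" if "a \<noteq> 0" "b \<noteq> 0" for a b c :: complex
    using that by (simp add: field_simps power2_eq_square)
   show ?thesis using gen[OF nz'[of t] nz[of t], of "f t"] by simp
  qed
  have "?F w' - ?F w - (w' - w) * ?D = (LBINT t. f t / (complex_of_real t - w') - f t / (complex_of_real t - w) - (w' - w) * (f t / (complex_of_real t - w)\<^sup>2))"
   using i1 i1' i2 by (simp del: times_divide_eq_right)
  also have "\<dots> = (w' - w)\<^sup>2 * (LBINT t. 1 / (complex_of_real t - w') * (f t / (complex_of_real t - w)\<^sup>2))"
   unfolding alg by (rule integral_mult_right_zero)
  finally have eq: "?F w' - ?F w - (w' - w) * ?D = (w' - w)\<^sup>2 * (LBINT t. 1 / (complex_of_real t - w') * (f t / (complex_of_real t - w)\<^sup>2))" .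
  have "cmod (LBINT t. 1 / (complex_of_real t - w') * (f t / (complex_of_real t - w)\<^sup>2))
    \<le> (LBINT t. cmod (1 / (complex_of_real t - w') * (f t / (complex_of_real t - w)\<^sup>2)))"
   by (rule integral_norm_bound)
  also have "\<dots> \<le> (LBINT t. 2 / \<eta> * cmod (f t / (complex_of_real t - w)\<^sup>2))"
  proof (rule integral_mono)
   show "cmod (1 / (complex_of_real t - w') * (f t / (complex_of_real t - w)\<^sup>2)) \<le> 2 / \<eta> * cmod (f t / (complex_of_real t - w)\<^sup>2)" for t
    unfolding norm_mult by (intro mult_right_mono kb') simp
  qed (use i2 i3 in \<open>auto intro: integrable_norm integrable_mult_right\<close>)
  also have "\<dots> = C" by (simp add: C_def)
  finally have b: "cmod (LBINT t. 1 / (complex_of_real t - w') * (f t / (complex_of_real t - w)\<^sup>2)) \<le> C" .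
  have "(?F w' - ?F w) / (w' - w) - ?D = (?F w' - ?F w - (w' - w) * ?D) / (w' - w)" using w'(1) by (simp add: diff_divide_distrib)
  also have "\<dots> = (w' - w) * (LBINT t. 1 / (complex_of_real t - w') * (f t / (complex_of_real t - w)\<^sup>2))"
   using w'(1) unfolding eq by (simp add: power2_eq_square)
  finally show ?thesis using mult_left_mono[OF b norm_ge_zero[of "w' - w"]] by (simp add: norm_mult mult.commute)
 qed
 have "((\<lambda>w'. (?F w' - ?F w) / (w' - w) - ?D) \<longlongrightarrow> 0) (at w)"
 proof (rule Lim_null_comparison)
  show "\<forall>\<^sub>F w' in at w. norm ((?F w' - ?F w) / (w' - w) - ?D) \<le> C * cmod (w' - w)"
   unfolding eventually_at using key \<eta> by (intro exI[of _ "\<eta> / 2"]) (auto simp: dist_norm)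
  have "((\<lambda>w'. C * cmod (w' - w)) \<longlongrightarrow> C * cmod (w - w)) (at w)" by (intro tendsto_intros)
  then show "((\<lambda>w'. C * cmod (w' - w)) \<longlongrightarrow> 0) (at w)" by simp
 qed
 then show ?thesis unfolding has_field_derivative_iff by (rule LIM_zero_cancel)
qed

lemma cauchy_ext_holomorphic:
 assumes "f \<in> L2"
 shows "cauchy_ext f holomorphic_on {z. 0 < Im z}" unfolding holomorphic_on_def field_differentiable_def
proof
 fix w assume "w \<in> {z. 0 < Im z}"
 then have "((\<lambda>w. LBINT t. f t / (complex_of_real t - w)) has_field_derivative
   (LBINT t. f t / (complex_of_real t - w)\<^sup>2)) (at w)"
  using assms by (intro cauchy_integral_has_derivative) auto
 from DERIV_cdivide[OF this, of "2 * pi * \<i>"]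
 show "\<exists>D. (cauchy_ext f has_field_derivative D) (at w within {z. 0 < Im z})"
  unfolding cauchy_ext_def[abs_def] using has_field_derivative_at_within by blast
qed

text \<open>For \<open>f\<close> in \<open>Hm\<close> the Cauchy integral at \<open>cnj w\<close>
  vanishes, so the jump formula leaves only the one at \<open>w\<close>.\<close>

lemma cauchy_ext_eq_poisson:
 fixes f :: "real \<Rightarrow> complex"
 assumes f: "f \<in> Hm" and w: "0 < Im w"
 shows "cauchy_ext f w = (LBINT t. poisson w t * f t)"
proof -
 have "integrable lborel (\<lambda>t. f t / (complex_of_real t - w))" "integrable lborel (\<lambda>t. f t / (of_real t - cnj w))"
  using w by (intro L2_kernel_integrable HmD(1)[OF f]; simp)+
 from poisson_transform[OF w this] show ?thesis using HmD(2)[OF f w] by (simp add: cauchy_ext_def)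
qed

section \<open>Poisson averages of L^2 functions\<close>

lemma poisson_bounded: "0 < Im v \<Longrightarrow> poisson v t \<le> 1 / (pi * Im v)"
proof -
 assume v: "0 < Im v"
 have "(Im v)\<^sup>2 \<le> (cmod (of_real t - v))\<^sup>2" using cmod_of_real_diff_ge[of v t] v by (intro power_mono) auto
 then have "Im v / (pi * (cmod (of_real t - v))\<^sup>2) \<le> Im v / (pi * (Im v)\<^sup>2)"
  using v by (intro divide_left_mono mult_left_mono mult_pos_pos) (auto simp: complex_eq_iff)
 then show ?thesis using v by (simp add: poisson_def power2_eq_square)
qed

lemma le_one_plus_square: "x \<le> 1 + x\<^sup>2" for x :: real
proof -
 have "2 * x \<le> x\<^sup>2 + 1" using zero_le_power2[of "x - 1"] by (simp add: power2_diff)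
 then show ?thesis using zero_le_power2[of x] by linarith
qed

text \<open>\<open>poisson w\<close> is a probability density; the inequality is nonnegativity of
  the variance of \<open>cmod (g t)\<close>.\<close>

lemma poisson_jensen:
 fixes g :: "real \<Rightarrow> complex"
 assumes [measurable]: "g \<in> borel_measurable borel" and i: "integrable lborel (\<lambda>t. poisson w t * (cmod (g t))\<^sup>2)"
  and w: "0 < Im w"
 shows "(cmod (LBINT t. poisson w t * g t))\<^sup>2 \<le> (LBINT t. poisson w t * (cmod (g t))\<^sup>2)"
proof -
 note P0 = poisson_nonneg[OF w] and Pi = poisson_integrable[of w]
 have i1: "integrable lborel (\<lambda>t. poisson w t * cmod (g t))"
 proof (rule Bochner_Integration.integrable_bound)
  show "integrable lborel (\<lambda>t. poisson w t + poisson w t * (cmod (g t))\<^sup>2)"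
   using i w by (intro Bochner_Integration.integrable_add poisson_integrable) auto
  have "poisson w t * cmod (g t) \<le> poisson w t + poisson w t * (cmod (g t))\<^sup>2" for t
   using mult_left_mono[OF le_one_plus_square[of "cmod (g t)"] P0[of t]] by (simp add: distrib_left)
  then show "AE t in lborel. norm (poisson w t * cmod (g t)) \<le> norm (poisson w t + poisson w t * (cmod (g t))\<^sup>2)"
   using P0 by (intro AE_I2) (simp add: abs_of_nonneg)
 qed measurable
 define m where "m = (LBINT t. poisson w t * cmod (g t))"
 have "0 \<le> (LBINT t. poisson w t * (cmod (g t) - m)\<^sup>2)" using P0 by (intro integral_nonneg_AE AE_I2) simp
 also have "(\<lambda>t. poisson w t * (cmod (g t) - m)\<^sup>2) = (\<lambda>t. poisson w t * (cmod (g t))\<^sup>2 - 2 * m * (poisson w t * cmod (g t)) + m\<^sup>2 * poisson w t)"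
  by (rule ext) (simp add: power2_diff algebra_simps)
 also have "(LBINT t. poisson w t * (cmod (g t))\<^sup>2 - 2 * m * (poisson w t * cmod (g t)) + m\<^sup>2 * poisson w t)
   = (LBINT t. poisson w t * (cmod (g t))\<^sup>2) - 2 * m * m + m\<^sup>2 * 1"
  using i i1 Pi w poisson_integral[OF w] by (simp add: m_def)
 finally have "m\<^sup>2 \<le> (LBINT t. poisson w t * (cmod (g t))\<^sup>2)" by (simp add: power2_eq_square)
 moreover have "cmod (LBINT t. poisson w t * g t) \<le> m"
 proof -
  have "cmod (LBINT t. poisson w t * g t) \<le> (LBINT t. cmod (poisson w t * g t))" by (rule integral_norm_bound)
  then show ?thesis using P0 by (simp add: m_def norm_mult)
 qed
 then have "(cmod (LBINT t. poisson w t * g t))\<^sup>2 \<le> m\<^sup>2" by (intro power_mono) auto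
 ultimately show ?thesis by linarith
qed

lemma poisson_symmetric: "poisson (Complex x y) t = poisson (Complex t y) x" by (simp add: poisson_def cmod_real_diff_sq power2_commute)

lemma poisson_shift: "poisson (Complex x y) (x + s) = poisson (Complex 0 y) s" unfolding poisson_def cmod_real_diff_sq by simp

lemma poisson_Complex: "poisson (Complex x y) t = y / (pi * ((t - x)\<^sup>2 + y\<^sup>2))" unfolding poisson_def cmod_real_diff_sq by simp

lemma poisson_scale:
 assumes "0 < y"
 shows "y * poisson (Complex 0 y) (y * s) = poisson \<i> s"
proof -
 have "(y * s)\<^sup>2 + y\<^sup>2 = y\<^sup>2 * (s\<^sup>2 + 1)" by (simp add: power2_eq_square algebra_simps)
 then have "poisson (Complex 0 y) (y * s) = y / (pi * (y\<^sup>2 * (s\<^sup>2 + 1)))" unfolding poisson_def cmod_real_diff_sq by simp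
 moreover have "poisson \<i> s = 1 / (pi * (s\<^sup>2 + 1))" unfolding poisson_def cmod_real_diff_sq by simp
 ultimately show ?thesis using assms by (simp add: power2_eq_square)
qed

text \<open>Jensen pointwise, then Tonelli: the kernel is symmetric in \<open>x\<close> and
  \<open>t\<close>, so it also has mass one when integrated over \<open>x\<close>.\<close>

lemma poisson_average_L2:
 fixes f :: "real \<Rightarrow> complex"
 assumes f: "f \<in> L2" and y: "0 < y"
 defines "Q \<equiv> \<lambda>x. LBINT t. poisson (Complex x y) t * f t"
 assumes Qm [measurable]: "Q \<in> borel_measurable borel"
 shows "integrable lborel (\<lambda>x. (cmod (Q x))\<^sup>2)" "(LBINT x. (cmod (Q x))\<^sup>2) \<le> (LBINT x. (cmod (f x))\<^sup>2)"
proof -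
 note [measurable] = L2D(1)[OF f] and fi = L2D(2)[OF f]
 have yv: "0 < Im (Complex x y)" for x using y by simp
 have ip: "integrable lborel (\<lambda>t. poisson (Complex x y) t * (cmod (f t))\<^sup>2)" for x
 proof (rule Bochner_Integration.integrable_bound)
  show "integrable lborel (\<lambda>t. 1 / (pi * y) * (cmod (f t))\<^sup>2)" using fi by (rule integrable_mult_right)
  show "AE t in lborel. norm (poisson (Complex x y) t * (cmod (f t))\<^sup>2) \<le> norm (1 / (pi * y) * (cmod (f t))\<^sup>2)"
   using poisson_bounded[OF yv, of x] poisson_nonneg[OF yv, of x] y
   by (intro AE_I2) (simp add: abs_of_nonneg abs_mult mult_right_mono del: times_divide_eq_left)
 qed measurable
 have Pm [measurable]: "(\<lambda>(x, t). ennreal (poisson (Complex x y) t * (cmod (f t))\<^sup>2)) \<in> borel_measurable (lborel \<Otimes>\<^sub>M lborel)"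
  unfolding poisson_Complex by measurable
 have "(\<integral>\<^sup>+x. ennreal ((cmod (Q x))\<^sup>2) \<partial>lborel) \<le> (\<integral>\<^sup>+x. (\<integral>\<^sup>+t. ennreal (poisson (Complex x y) t * (cmod (f t))\<^sup>2) \<partial>lborel) \<partial>lborel)"
 proof (rule nn_integral_mono)
  fix x
  have "(cmod (Q x))\<^sup>2 \<le> (LBINT t. poisson (Complex x y) t * (cmod (f t))\<^sup>2)"
   unfolding Q_def by (intro poisson_jensen ip yv) measurable
  then show "ennreal ((cmod (Q x))\<^sup>2) \<le> (\<integral>\<^sup>+t. ennreal (poisson (Complex x y) t * (cmod (f t))\<^sup>2) \<partial>lborel)"
   using ip[of x] poisson_nonneg[OF yv, of x] by (subst nn_integral_eq_integral) (auto intro: ennreal_leI)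
 qed
 also have "\<dots> = (\<integral>\<^sup>+t. (\<integral>\<^sup>+x. ennreal (poisson (Complex x y) t * (cmod (f t))\<^sup>2) \<partial>lborel) \<partial>lborel)"
  using lborel_pair.Fubini'[OF Pm] by simp
 also have "\<dots> = (\<integral>\<^sup>+t. ennreal ((cmod (f t))\<^sup>2) \<partial>lborel)"
 proof (rule nn_integral_cong)
  fix t
  have "(\<integral>\<^sup>+x. ennreal (poisson (Complex x y) t * (cmod (f t))\<^sup>2) \<partial>lborel)
    = (\<integral>\<^sup>+x. ennreal (poisson (Complex t y) x) * ennreal ((cmod (f t))\<^sup>2) \<partial>lborel)"
   using poisson_nonneg[OF yv] by (simp add: poisson_symmetric[of _ y t] ennreal_mult)
  also have "\<dots> = (\<integral>\<^sup>+x. ennreal (poisson (Complex t y) x) \<partial>lborel) * ennreal ((cmod (f t))\<^sup>2)"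
   by (rule nn_integral_multc) measurable
  also have "(\<integral>\<^sup>+x. ennreal (poisson (Complex t y) x) \<partial>lborel) = 1"
   using poisson_integral[OF yv] poisson_integrable[of "Complex t y"] poisson_nonneg[OF yv] y by (subst nn_integral_eq_integral) auto
  finally show "(\<integral>\<^sup>+x. ennreal (poisson (Complex x y) t * (cmod (f t))\<^sup>2) \<partial>lborel) = ennreal ((cmod (f t))\<^sup>2)"
   by simp
 qed
 also have "\<dots> = ennreal (LBINT t. (cmod (f t))\<^sup>2)" using fi by (intro nn_integral_eq_integral) auto
 finally have le: "(\<integral>\<^sup>+x. ennreal ((cmod (Q x))\<^sup>2) \<partial>lborel) \<le> ennreal (LBINT t. (cmod (f t))\<^sup>2)" .
 then show I: "integrable lborel (\<lambda>x. (cmod (Q x))\<^sup>2)" by (intro integrableI_bounded) (auto intro: le_less_trans[OF le])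
 have "ennreal (LBINT x. (cmod (Q x))\<^sup>2) \<le> ennreal (LBINT t. (cmod (f t))\<^sup>2)"
  using le I by (subst nn_integral_eq_integral[symmetric]) auto
 then show "(LBINT x. (cmod (Q x))\<^sup>2) \<le> (LBINT x. (cmod (f x))\<^sup>2)" by (simp add: ennreal_le_iff)
qed


text \<open>Jensen and Tonelli bound the squared error by the Poisson average of
  \<open>\<tau>\<close>, the squared modulus of continuity under translation. Rescaling fixes the
  kernel at height one and moves the height into the argument of \<open>\<tau>\<close>.\<close>

lemma poisson_average_converges:
 fixes f :: "real \<Rightarrow> complex"
 assumes f: "f \<in> L2"
  and Qm: "\<And>y. 0 < y \<Longrightarrow> (\<lambda>x. LBINT t. poisson (Complex x y) t * f t) \<in> borel_measurable borel"
 shows "((\<lambda>y. LBINT x. (cmod ((LBINT t. poisson (Complex x y) t * f t) - f x))\<^sup>2) \<longlongrightarrow> 0) (at_right 0)"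
proof -
 note [measurable] = L2D(1)[OF f] and fi = L2D(2)[OF f]
 define \<tau> where "\<tau> s = (LBINT x. (cmod (f (x + s) - f x))\<^sup>2)" for s
 \<comment> \<open>Bounds \<open>\<tau>\<close> everywhere; it is the dominating constant when the
   height tends to 0.\<close>
 define B where "B = 4 * (LBINT x. (cmod (f x))\<^sup>2)"
 have fs: "(\<lambda>x. f (x + s)) \<in> L2" for s using L2_Dop[OF f, of "- s"] by (simp add: Dop_def)
 have di: "integrable lborel (\<lambda>x. (cmod (f (x + s) - f x))\<^sup>2)" for s by (rule L2D(2)[OF L2_diff[OF fs f]])
 have \<tau>0: "0 \<le> \<tau> s" for s by (simp add: \<tau>_def)
 have \<tau>B: "\<tau> s \<le> B" for s
 proof -
  have "\<tau> s \<le> (LBINT x. 2 * (cmod (f (x + s)))\<^sup>2 + 2 * (cmod (f x))\<^sup>2)" unfolding \<tau>_def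
  proof (rule integral_mono[OF di])
   show "integrable lborel (\<lambda>x. 2 * (cmod (f (x + s)))\<^sup>2 + 2 * (cmod (f x))\<^sup>2)"
    using fi L2D(2)[OF fs] by (intro Bochner_Integration.integrable_add integrable_mult_right)
   fix x
   have "(cmod (f (x + s) - f x))\<^sup>2 \<le> (cmod (f (x + s)) + cmod (f x))\<^sup>2" by (simp add: norm_triangle_ineq4 power_mono)
   also have "\<dots> \<le> 2 * (cmod (f (x + s)))\<^sup>2 + 2 * (cmod (f x))\<^sup>2"
    using zero_le_power2[of "cmod (f (x + s)) - cmod (f x)"] by (simp add: power2_diff power2_sum)
   finally show "(cmod (f (x + s) - f x))\<^sup>2 \<le> 2 * (cmod (f (x + s)))\<^sup>2 + 2 * (cmod (f x))\<^sup>2" .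
  qed
  also have "\<dots> = 2 * (LBINT x. (cmod (f (x + s)))\<^sup>2) + 2 * (LBINT x. (cmod (f x))\<^sup>2)" using fi L2D(2)[OF fs] by simp
  also have "(LBINT x. (cmod (f (x + s)))\<^sup>2) = (LBINT x. (cmod (f x))\<^sup>2)" by (rule lborel_integral_shift(2))
  finally show ?thesis by (simp add: B_def)
 qed
 have \<tau>lim: "(\<tau> \<longlongrightarrow> 0) (at 0)"
 proof -
  have "((\<lambda>h. LBINT t. (cmod (f (t - (- h)) - f t))\<^sup>2) \<longlongrightarrow> 0) (at 0)"
  proof (rule filterlim_compose[OF L2_translation_continuous[OF f]])
   show "filterlim (\<lambda>h::real. - h) (at 0) (at 0)"
    by (auto simp: filterlim_at intro!: tendsto_eq_intros) (auto simp: eventually_at intro: exI[of _ 1])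
  qed
  then show ?thesis by (simp add: \<tau>_def[abs_def])
 qed
 have meas_\<tau> [measurable]: "\<tau> \<in> borel_measurable borel" unfolding \<tau>_def[abs_def] by measurable
 have bound: "(LBINT x. (cmod ((LBINT t. poisson (Complex x y) t * f t) - f x))\<^sup>2) \<le> (LBINT s. poisson \<i> s * \<tau> (y * s))"
  if y: "0 < y" for y
 proof -
  note [measurable] = Qm[OF y]
  have yv: "0 < Im (Complex x y)" for x using y by simp
  let ?Q = "\<lambda>x. LBINT t. poisson (Complex x y) t * f t"
  have pt: "(cmod (?Q x - f x))\<^sup>2 \<le> (LBINT s. poisson (Complex 0 y) s * (cmod (f (x + s) - f x))\<^sup>2)"
   and ipt: "integrable lborel (\<lambda>s. poisson (Complex 0 y) s * (cmod (f (x + s) - f x))\<^sup>2)" for x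
  proof -
   have ic: "integrable lborel (\<lambda>t. poisson (Complex x y) t * (cmod (f t - f x))\<^sup>2)"
   proof (rule Bochner_Integration.integrable_bound)
    show "integrable lborel (\<lambda>t. 2 / (pi * y) * (cmod (f t))\<^sup>2 + 2 * (cmod (f x))\<^sup>2 * poisson (Complex x y) t)"
     using fi y by (intro Bochner_Integration.integrable_add integrable_mult_right poisson_integrable) auto
    show "AE t in lborel. norm (poisson (Complex x y) t * (cmod (f t - f x))\<^sup>2) \<le> norm (2 / (pi * y) * (cmod (f t))\<^sup>2 + 2 * (cmod (f x))\<^sup>2 * poisson (Complex x y) t)"
    proof (rule AE_I2)
     fix t
     have P: "0 \<le> poisson (Complex x y) t" "poisson (Complex x y) t \<le> 1 / (pi * y)"
      using poisson_nonneg[OF yv] poisson_bounded[OF yv, of x t] by auto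
     have "(cmod (f t - f x))\<^sup>2 \<le> (cmod (f t) + cmod (f x))\<^sup>2" by (simp add: norm_triangle_ineq4 power_mono)
     also have "\<dots> \<le> 2 * (cmod (f t))\<^sup>2 + 2 * (cmod (f x))\<^sup>2"
      using zero_le_power2[of "cmod (f t) - cmod (f x)"] by (simp add: power2_diff power2_sum)
     finally have "poisson (Complex x y) t * (cmod (f t - f x))\<^sup>2 \<le> poisson (Complex x y) t * (2 * (cmod (f t))\<^sup>2 + 2 * (cmod (f x))\<^sup>2)"
      using P by (intro mult_left_mono)
     also have "\<dots> = poisson (Complex x y) t * (2 * (cmod (f t))\<^sup>2) + 2 * (cmod (f x))\<^sup>2 * poisson (Complex x y) t"
      by (simp add: algebra_simps)
     also have "\<dots> \<le> 1 / (pi * y) * (2 * (cmod (f t))\<^sup>2) + 2 * (cmod (f x))\<^sup>2 * poisson (Complex x y) t"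
      using P by (intro add_right_mono mult_right_mono) auto
     finally show "norm (poisson (Complex x y) t * (cmod (f t - f x))\<^sup>2) \<le> norm (2 / (pi * y) * (cmod (f t))\<^sup>2 + 2 * (cmod (f x))\<^sup>2 * poisson (Complex x y) t)"
      using P y by (simp add: abs_of_nonneg)
    qed
   qed measurable
   have iw: "integrable lborel (\<lambda>t. cmod (f t) / (1 + t\<^sup>2))"
   proof (rule Bochner_Integration.integrable_bound)
    show "integrable lborel (\<lambda>t. (cmod (f t))\<^sup>2 + 1 / (1 + t\<^sup>2))"
     by (intro Bochner_Integration.integrable_add fi integrable_inverse_1_plus_sq)
    have "a / k \<le> a\<^sup>2 + 1 / k" if "1 \<le> k" "0 \<le> a" for a k :: real
    proof -
     have "a \<le> 1 + a\<^sup>2" by (rule le_one_plus_square)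
     moreover have "a\<^sup>2 \<le> k * a\<^sup>2" using that mult_right_mono[of 1 k "a\<^sup>2"] by simp
     ultimately have "a \<le> k * (a\<^sup>2 + 1 / k)" using that by (simp add: distrib_left)
     then show ?thesis using that by (simp add: pos_divide_le_eq mult.commute)
    qed
    then show "AE t in lborel. norm (cmod (f t) / (1 + t\<^sup>2)) \<le> norm ((cmod (f t))\<^sup>2 + 1 / (1 + t\<^sup>2))"
     by (intro AE_I2) (simp add: abs_of_nonneg add_nonneg_nonneg)
   qed measurable
   have "(LBINT t. poisson (Complex x y) t * (f t - f x)) = ?Q x - (LBINT t. poisson (Complex x y) t * f x)"
    using poisson_mult_integrable[OF _ iw yv, of x] poisson_integrable[of "Complex x y"] y by (simp add: right_diff_distrib)
   also have "(LBINT t. complex_of_real (poisson (Complex x y) t) * f x) = f x" using poisson_integral[OF yv, of x] by simp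
   finally have "(cmod (?Q x - f x))\<^sup>2 \<le> (LBINT t. poisson (Complex x y) t * (cmod (f t - f x))\<^sup>2)"
    using poisson_jensen[OF _ ic yv] by simp
   also have "\<dots> = (LBINT s. poisson (Complex x y) (s + x) * (cmod (f (s + x) - f x))\<^sup>2)"
    by (rule lborel_integral_shift(2)[symmetric])
   finally show "(cmod (?Q x - f x))\<^sup>2 \<le> (LBINT s. poisson (Complex 0 y) s * (cmod (f (x + s) - f x))\<^sup>2)"
    by (simp add: poisson_shift add.commute[of _ x])
   show "integrable lborel (\<lambda>s. poisson (Complex 0 y) s * (cmod (f (x + s) - f x))\<^sup>2)"
    using ic lborel_integrable_shift(2)[of "\<lambda>t. poisson (Complex x y) t * (cmod (f t - f x))\<^sup>2" x]
    by (simp add: poisson_shift add.commute[of _ x])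
  qed
  have ir: "integrable lborel (\<lambda>s. poisson (Complex 0 y) s * \<tau> s)"
  proof (rule Bochner_Integration.integrable_bound)
   show "integrable lborel (\<lambda>s. B * poisson (Complex 0 y) s)" using y by (intro integrable_mult_right poisson_integrable) simp
   show "AE s in lborel. norm (poisson (Complex 0 y) s * \<tau> s) \<le> norm (B * poisson (Complex 0 y) s)"
    using \<tau>0 \<tau>B poisson_nonneg[OF yv, of 0] order_trans[OF \<tau>0 \<tau>B]
    by (intro AE_I2) (simp add: abs_mult abs_of_nonneg mult.commute mult_right_mono)
  qed measurable
  have pm [measurable]: "(\<lambda>(x, s). ennreal (poisson (Complex 0 y) s * (cmod (f (x + s) - f x))\<^sup>2)) \<in> borel_measurable (lborel \<Otimes>\<^sub>M lborel)"
   by measurable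
  have "(\<integral>\<^sup>+x. ennreal ((cmod (?Q x - f x))\<^sup>2) \<partial>lborel)
    \<le> (\<integral>\<^sup>+x. (\<integral>\<^sup>+s. ennreal (poisson (Complex 0 y) s * (cmod (f (x + s) - f x))\<^sup>2) \<partial>lborel) \<partial>lborel)"
  proof (rule nn_integral_mono)
   fix x
   show "ennreal ((cmod (?Q x - f x))\<^sup>2) \<le> (\<integral>\<^sup>+s. ennreal (poisson (Complex 0 y) s * (cmod (f (x + s) - f x))\<^sup>2) \<partial>lborel)"
    using pt[of x] ipt[of x] poisson_nonneg[OF yv, of 0] by (subst nn_integral_eq_integral) (auto intro: ennreal_leI)
  qed
  also have "\<dots> = (\<integral>\<^sup>+s. (\<integral>\<^sup>+x. ennreal (poisson (Complex 0 y) s * (cmod (f (x + s) - f x))\<^sup>2) \<partial>lborel) \<partial>lborel)"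
   using lborel_pair.Fubini'[OF pm] by simp
  also have "\<dots> = (\<integral>\<^sup>+s. ennreal (poisson (Complex 0 y) s * \<tau> s) \<partial>lborel)"
  proof (rule nn_integral_cong)
   fix s
   show "(\<integral>\<^sup>+x. ennreal (poisson (Complex 0 y) s * (cmod (f (x + s) - f x))\<^sup>2) \<partial>lborel) = ennreal (poisson (Complex 0 y) s * \<tau> s)"
    using di[of s] poisson_nonneg[OF yv, of 0] by (subst nn_integral_eq_integral) (auto simp: \<tau>_def)
  qed
  also have "\<dots> = ennreal (LBINT s. poisson (Complex 0 y) s * \<tau> s)"
   using ir poisson_nonneg[OF yv, of 0] \<tau>0 by (intro nn_integral_eq_integral) auto
  finally have le: "(\<integral>\<^sup>+x. ennreal ((cmod (?Q x - f x))\<^sup>2) \<partial>lborel) \<le> ennreal (LBINT s. poisson (Complex 0 y) s * \<tau> s)" .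
  then have I: "integrable lborel (\<lambda>x. (cmod (?Q x - f x))\<^sup>2)"
   by (intro integrableI_bounded) (auto intro: le_less_trans[OF le])
  have "ennreal (LBINT x. (cmod (?Q x - f x))\<^sup>2) \<le> ennreal (LBINT s. poisson (Complex 0 y) s * \<tau> s)"
   using le I by (subst nn_integral_eq_integral[symmetric]) auto
  then have "(LBINT x. (cmod (?Q x - f x))\<^sup>2) \<le> (LBINT s. poisson (Complex 0 y) s * \<tau> s)"
   using poisson_nonneg[OF yv, of 0] \<tau>0 by (subst (asm) ennreal_le_iff) (auto intro!: integral_nonneg_AE)
  also have "\<dots> = \<bar>y\<bar> *\<^sub>R (LBINT s. poisson (Complex 0 y) (0 + y * s) * \<tau> (0 + y * s))"
   using y by (intro lborel_integral_real_affine) simp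
  also have "\<dots> = (LBINT s. y * (poisson (Complex 0 y) (y * s) * \<tau> (y * s)))" using y by simp
  also have "\<dots> = (LBINT s. poisson \<i> s * \<tau> (y * s))" by (simp only: mult.assoc[symmetric] poisson_scale[OF y])
  finally show ?thesis .
 qed
 have lim: "((\<lambda>y. LBINT s. poisson \<i> s * \<tau> (y * s)) \<longlongrightarrow> 0) (at_right 0)"
 proof (rule tendsto_at_iff_sequentially[THEN iffD2], intro allI impI)
  fix X :: "nat \<Rightarrow> real" assume X: "\<forall>i. X i \<in> {0<..} - {0}" "X \<longlonglongrightarrow> 0"
  have "(\<lambda>n. LBINT s. poisson \<i> s * \<tau> (X n * s)) \<longlonglongrightarrow> (LINT s|(lborel::real measure). 0)"
  proof (rule integral_dominated_convergence[where w="\<lambda>s. B * poisson \<i> s" and f="\<lambda>_. 0" and M=lborel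
     and s="\<lambda>n s. poisson \<i> s * \<tau> (X n * s)"])
   show "integrable lborel (\<lambda>s. B * poisson \<i> s)" by (intro integrable_mult_right poisson_integrable) simp
   show "AE s in lborel. (\<lambda>n. poisson \<i> s * \<tau> (X n * s)) \<longlonglongrightarrow> 0" using AE_lborel_singleton[of 0]
   proof eventually_elim
    case (elim s)
    have "(\<lambda>n. \<tau> (X n * s)) \<longlonglongrightarrow> 0"
    proof (rule filterlim_compose[OF \<tau>lim])
     have "(\<lambda>n. X n * s) \<longlonglongrightarrow> 0 * s" by (intro tendsto_intros X)
     moreover have "X n * s \<noteq> 0" for n using spec[OF X(1), of n] elim by auto
     ultimately show "filterlim (\<lambda>n. X n * s) (at 0) sequentially" unfolding filterlim_at by (auto intro!: always_eventually)
    qed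
    then show ?case by (rule tendsto_mult_right_zero)
   qed
   show "AE s in lborel. norm (poisson \<i> s * \<tau> (X n * s)) \<le> B * poisson \<i> s" for n
   proof (rule AE_I2)
    fix s
    show "norm (poisson \<i> s * \<tau> (X n * s)) \<le> B * poisson \<i> s"
     using mult_right_mono[OF \<tau>B[of "X n * s"], of "poisson \<i> s"] \<tau>0[of "X n * s"] poisson_nonneg[of \<i> s]
     by (simp add: abs_mult abs_of_nonneg mult.commute[of "poisson _ _"])
   qed
  qed measurable
  then show "((\<lambda>y. LBINT s. poisson \<i> s * \<tau> (y * s)) \<circ> X) \<longlonglongrightarrow> 0" by (simp add: o_def)
 qed
 show ?thesis
 proof (rule tendsto_sandwich[OF _ _ tendsto_const lim])
  show "\<forall>\<^sub>F y in at_right 0. (LBINT x. (cmod ((LBINT t. poisson (Complex x y) t * f t) - f x))\<^sup>2) \<le> (LBINT s. poisson \<i> s * \<tau> (y * s))"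
   using bound by (auto simp: eventually_at_right[of 0 1] intro!: exI[of _ 1])
 qed simp
qed

section \<open>Boundary behaviour and the two descriptions of the Hardy space\<close>

lemma cauchy_ext_line_measurable:
 assumes "f \<in> L2" "0 < y"
 shows "(\<lambda>x. cauchy_ext f (Complex x y)) \<in> borel_measurable borel"
proof (rule borel_measurable_continuous_onI)
 have "continuous_on {z. 0 < Im z} (cauchy_ext f)" by (intro holomorphic_on_imp_continuous_on cauchy_ext_holomorphic assms)
 then show "continuous_on UNIV (\<lambda>x. cauchy_ext f (Complex x y))"
  by (rule continuous_on_compose2) (use assms in \<open>auto intro!: continuous_intros simp: Complex_eq\<close>)
qed

theorem Hm_boundary:
 assumes f: "f \<in> Hm"
 shows "\<And>y. 0 < y \<Longrightarrow> integrable lborel (\<lambda>x. (cmod (cauchy_ext f (Complex x y)))\<^sup>2)"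
  and "\<And>y. 0 < y \<Longrightarrow> (LBINT x. (cmod (cauchy_ext f (Complex x y)))\<^sup>2) \<le> (LBINT x. (cmod (f x))\<^sup>2)"
  and "((\<lambda>y. LBINT x. (cmod (cauchy_ext f (Complex x y) - f x))\<^sup>2) \<longlongrightarrow> 0) (at_right 0)"
proof -
 note fL = HmD(1)[OF f]
 have eq: "cauchy_ext f (Complex x y) = (LBINT t. poisson (Complex x y) t * f t)" if "0 < y" for x y
  using cauchy_ext_eq_poisson[OF f, of "Complex x y"] that by simp
 have m: "(\<lambda>x. LBINT t. poisson (Complex x y) t * f t) \<in> borel_measurable borel" if "0 < y" for y
  using cauchy_ext_line_measurable[OF fL that] by (simp add: eq[OF that])
 show "integrable lborel (\<lambda>x. (cmod (cauchy_ext f (Complex x y)))\<^sup>2)"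
  "(LBINT x. (cmod (cauchy_ext f (Complex x y)))\<^sup>2) \<le> (LBINT x. (cmod (f x))\<^sup>2)" if "0 < y" for y
  unfolding eq[OF that] by (rule poisson_average_L2[OF fL that m[OF that]])+
 show "((\<lambda>y. LBINT x. (cmod (cauchy_ext f (Complex x y) - f x))\<^sup>2) \<longlongrightarrow> 0) (at_right 0)"
 proof (rule Lim_transform_eventually[OF poisson_average_converges[OF fL m]])
  show "\<forall>\<^sub>F y in at_right 0. (LBINT x. (cmod ((LBINT t. poisson (Complex x y) t * f t) - f x))\<^sup>2) = (LBINT x. (cmod (cauchy_ext f (Complex x y) - f x))\<^sup>2)"
   using eq by (auto simp: eventually_at_right[of 0 1] intro!: exI[of _ 1])
 qed
qed

lemma Hm_subset_hardy2: "Hm \<subseteq> hardy2"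
proof
 fix f assume f: "f \<in> Hm"
 show "f \<in> hardy2" unfolding hardy2_def
 proof (intro CollectI conjI exI[of _ "cauchy_ext f"])
  show "f \<in> L2" by (rule HmD(1)[OF f])
  then show "cauchy_ext f holomorphic_on {z. 0 < Im z}" by (rule cauchy_ext_holomorphic)
  show "\<exists>C. \<forall>y>0. integrable lborel (\<lambda>x. (cmod (cauchy_ext f (Complex x y)))\<^sup>2) \<and> (LBINT x. (cmod (cauchy_ext f (Complex x y)))\<^sup>2) \<le> C"
   using Hm_boundary(1,2)[OF f] by blast
  show "((\<lambda>y. LBINT x. (cmod (cauchy_ext f (Complex x y) - f x))\<^sup>2) \<longlongrightarrow> 0) (at_right 0)"
   by (rule Hm_boundary(3)[OF f])
 qed
qed


text \<open>An integrable function cannot stay above a positive constant on a half-line; this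
  selects good rectangles in the contour argument.\<close>

lemma integrable_arbitrarily_small:
 fixes g :: "real \<Rightarrow> real"
 assumes g: "integrable lborel g" and c: "0 < c"
 shows "\<exists>R\<ge>N. g R < c"
proof (rule ccontr)
 assume "\<not> ?thesis"
 then have ge: "c \<le> g R" if "N \<le> R" for R using that by (meson not_less)
 define B where "B = (LBINT R. \<bar>g R\<bar>)"
 obtain n :: nat where "B < real n * c" using reals_Archimedean3[OF c] by blast
 then have n: "B < c * real n" by (simp add: mult.commute)
 have "c * real n = (LBINT R. indicator {N..N + real n} R * c)" by simp
 also have "\<dots> \<le> B" unfolding B_def
 proof (rule integral_mono)
  show "indicator {N..N + real n} R * c \<le> \<bar>g R\<bar>" for R using ge[of R] c by (auto simp: indicator_def)
 qed (use g in auto)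
 finally show False using n by simp
qed

text \<open>Cauchy's theorem on tall rectangles: the vertical sides are integrable in their position, hence
 arbitrarily small.\<close>

lemma line_integrals_equal:
 assumes hol: "\<Phi> holomorphic_on {z. 0 < Im z}" and y: "0 < y1" "y1 < y2"
  and int: "\<And>y. 0 < y \<Longrightarrow> integrable lborel (\<lambda>x. \<Phi> (Complex x y))"
  and B: "\<And>y. 0 < y \<Longrightarrow> (LBINT x. cmod (\<Phi> (Complex x y))) \<le> B"
 shows "(LBINT x. \<Phi> (Complex x y1)) = (LBINT x. \<Phi> (Complex x y2))"
proof -
 let ?S = "{z. 0 < Im z}"
 have S: "open ?S" "convex ?S" by (simp_all add: open_halfspace_Im_gt convex_halfspace_Im_gt)
 obtain \<Psi> where \<Psi>: "\<And>z. z \<in> ?S \<Longrightarrow> (\<Psi> has_field_derivative \<Phi> z) (at z)"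
  using holomorphic_convex_primitive'[OF S(2,1) hol] S(1) by (metis at_within_open)
 have cont: "continuous_on ?S \<Phi>" by (rule holomorphic_on_imp_continuous_on[OF hol])
 have lineH: "continuous_on A (\<lambda>x. \<Phi> (Complex x y))" if "0 < y" for y A
  by (rule continuous_on_compose2[OF cont]) (use that in \<open>auto intro!: continuous_intros simp: Complex_eq\<close>)
 have lineV: "continuous_on {y1..y2} (\<lambda>t. \<Phi> (Complex R t))" for R
  by (rule continuous_on_compose2[OF cont]) (use y in \<open>auto intro!: continuous_intros simp: Complex_eq\<close>)
 have H: "(LBINT x. indicator {- R..R} x *\<^sub>R \<Phi> (Complex x y)) = \<Psi> (Complex R y) - \<Psi> (Complex (- R) y)" if "0 \<le> R" "0 < y" for R y
 proof (rule integral_FTC_atLeastAtMost)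
  fix x
  have "((\<lambda>x. \<Psi> (Complex x y)) has_vector_derivative 1 * \<Phi> (Complex x y)) (at x within {- R..R})"
  proof (rule field_vector_diff_chain_within[of "\<lambda>x. Complex x y" _ _ _ \<Psi>, unfolded o_def])
   show "((\<lambda>x. Complex x y) has_vector_derivative 1) (at x within {- R..R})"
    unfolding Complex_eq by (auto intro!: derivative_eq_intros)
   show "(\<Psi> has_field_derivative \<Phi> (Complex x y)) (at (Complex x y) within (\<lambda>x. Complex x y) ` {- R..R})"
    using \<Psi>[of "Complex x y"] that by (auto intro: has_field_derivative_at_within)
  qed
  then show "((\<lambda>x. \<Psi> (Complex x y)) has_vector_derivative \<Phi> (Complex x y)) (at x within {- R..R})" by simp
 qed (use that lineH in auto)
 have V: "\<Psi> (Complex R y2) - \<Psi> (Complex R y1) = (LBINT t. indicator {y1..y2} t *\<^sub>R (\<i> * \<Phi> (Complex R t)))" for R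
 proof (rule integral_FTC_atLeastAtMost[symmetric])
  fix t assume t: "y1 \<le> t" "t \<le> y2"
  show "((\<lambda>t. \<Psi> (Complex R t)) has_vector_derivative \<i> * \<Phi> (Complex R t)) (at t within {y1..y2})"
  proof (rule field_vector_diff_chain_within[of "\<lambda>t. Complex R t" _ _ _ \<Psi>, unfolded o_def])
   show "((\<lambda>t. Complex R t) has_vector_derivative \<i>) (at t within {y1..y2})"
    unfolding Complex_eq by (auto intro!: derivative_eq_intros)
   show "(\<Psi> has_field_derivative \<Phi> (Complex R t)) (at (Complex R t) within (\<lambda>t. Complex R t) ` {y1..y2})"
    using \<Psi>[of "Complex R t"] t y by (auto intro: has_field_derivative_at_within)
  qed
 qed (use y lineV in \<open>auto intro!: continuous_intros\<close>)
 \<comment> \<open>The contribution of the vertical side at \<open>R\<close>. Tonelli and the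
   uniform bound \<open>B\<close> make it integrable in \<open>R\<close>; adding
   \<open>e (- R)\<close> makes both sides small for one common \<open>R\<close>.\<close>
 define e where "e R = cmod (\<Psi> (Complex R y2) - \<Psi> (Complex R y1))" for R
 have \<Psi>cont: "continuous_on ?S \<Psi>" using \<Psi> by (meson DERIV_continuous continuous_at_imp_continuous_on)
 have em [measurable]: "e \<in> borel_measurable borel" unfolding e_def by (rule borel_measurable_continuous_onI)
   (use y in \<open>auto intro!: continuous_intros continuous_on_compose2[OF \<Psi>cont] simp: Complex_eq\<close>)
 have \<Phi>m: "(\<lambda>(R, t). ennreal (indicator {y1..y2} t * cmod (\<Phi> (Complex R t)))) \<in> borel_measurable (lborel \<Otimes>\<^sub>M lborel)"
 proof -
  let ?T = "UNIV \<times> {y1..y2} :: (real \<times> real) set"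
  have c2: "continuous_on ?T (\<lambda>p. cmod (\<Phi> (Complex (fst p) (snd p))))"
   by (intro continuous_intros continuous_on_compose2[OF cont]) (use y in \<open>auto intro!: continuous_intros simp: Complex_eq\<close>)
  have "?T \<in> sets borel" by (intro borel_closed closed_Times) auto
  then have "(\<lambda>p. indicator ?T p *\<^sub>R cmod (\<Phi> (Complex (fst p) (snd p)))) \<in> borel_measurable borel"
   using borel_measurable_continuous_on_indicator[OF _ c2] by simp
  moreover have "(\<lambda>p. indicator ?T p *\<^sub>R cmod (\<Phi> (Complex (fst p) (snd p)))) = (\<lambda>(R, t). indicator {y1..y2} t * cmod (\<Phi> (Complex R t)))"
   by (auto simp: indicator_def fun_eq_iff)
  ultimately have "(\<lambda>(R, t). indicator {y1..y2} t * cmod (\<Phi> (Complex R t))) \<in> borel_measurable (lborel \<Otimes>\<^sub>M lborel)"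
   by (simp add: lborel_prod)
  then show ?thesis using measurable_compose[OF _ measurable_ennreal] by (simp add: split_beta')
 qed
 have "(\<integral>\<^sup>+R. ennreal (e R) \<partial>lborel) \<le> (\<integral>\<^sup>+R. (\<integral>\<^sup>+t. ennreal (indicator {y1..y2} t * cmod (\<Phi> (Complex R t))) \<partial>lborel) \<partial>lborel)"
 proof (rule nn_integral_mono)
  fix R
  have "e R \<le> (LBINT t. norm (indicator {y1..y2} t *\<^sub>R (\<i> * \<Phi> (Complex R t))))"
   unfolding e_def V by (rule integral_norm_bound)
  also have "\<dots> = (LBINT t. indicator {y1..y2} t * cmod (\<Phi> (Complex R t)))" by (simp add: norm_mult)
  finally have 1: "e R \<le> (LBINT t. indicator {y1..y2} t * cmod (\<Phi> (Complex R t)))" .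
  have 2: "integrable lborel (\<lambda>t. indicator {y1..y2} t * cmod (\<Phi> (Complex R t)))"
   using borel_integrable_atLeastAtMost'[OF continuous_on_norm[OF lineV[of R]]] by (simp add: set_integrable_def)
  show "ennreal (e R) \<le> (\<integral>\<^sup>+t. ennreal (indicator {y1..y2} t * cmod (\<Phi> (Complex R t))) \<partial>lborel)"
   using 1 2 by (subst nn_integral_eq_integral) (auto intro: ennreal_leI)
 qed
 also have "\<dots> = (\<integral>\<^sup>+t. (\<integral>\<^sup>+R. ennreal (indicator {y1..y2} t * cmod (\<Phi> (Complex R t))) \<partial>lborel) \<partial>lborel)"
  using lborel_pair.Fubini'[OF \<Phi>m] by simp
 also have "\<dots> \<le> (\<integral>\<^sup>+t. ennreal B * indicator {y1..y2} t \<partial>lborel)"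
 proof (rule nn_integral_mono)
  fix t
  show "(\<integral>\<^sup>+R. ennreal (indicator {y1..y2} t * cmod (\<Phi> (Complex R t))) \<partial>lborel) \<le> ennreal B * indicator {y1..y2} t"
  proof (cases "t \<in> {y1..y2}")
   case True
   then have t: "0 < t" using y by auto
   have "(\<integral>\<^sup>+R. ennreal (cmod (\<Phi> (Complex R t))) \<partial>lborel) = ennreal (LBINT R. cmod (\<Phi> (Complex R t)))"
    using int[OF t] by (intro nn_integral_eq_integral) auto
   then show ?thesis using True B[OF t] by (simp add: ennreal_leI)
  qed simp
 qed
 also have "\<dots> < \<infinity>" by (subst nn_integral_cmult) (auto simp: ennreal_mult_less_top emeasure_lborel_Icc_eq)
 finally have "(\<integral>\<^sup>+R. ennreal (norm (e R)) \<partial>lborel) < \<infinity>" by (simp add: e_def)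
 then have ei: "integrable lborel e" by (intro integrableI_bounded) auto
 then have ei': "integrable lborel (\<lambda>R. e R + e (- R))" using lborel_integrable_real_affine[of e "-1" 0] by simp
 have conv: "((\<lambda>R. LBINT x. indicator {- R..R} x *\<^sub>R \<Phi> (Complex x y)) \<longlongrightarrow> (LBINT x. \<Phi> (Complex x y))) at_top" if "0 < y" for y
 proof (rule integral_dominated_convergence_at_top[where w="\<lambda>x. norm (\<Phi> (Complex x y))"])
  note [measurable] = borel_measurable_integrable[OF int[OF that]]
  show "(\<lambda>x. \<Phi> (Complex x y)) \<in> borel_measurable lborel" "\<And>R. (\<lambda>x. indicator {- R..R} x *\<^sub>R \<Phi> (Complex x y)) \<in> borel_measurable lborel"
   by measurable
  show "integrable lborel (\<lambda>x. norm (\<Phi> (Complex x y)))" by (rule integrable_norm[OF int[OF that]])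
  show "AE x in lborel. ((\<lambda>R. indicator {- R..R} x *\<^sub>R \<Phi> (Complex x y)) \<longlongrightarrow> \<Phi> (Complex x y)) at_top"
  proof (rule AE_I2)
   fix x
   have "\<forall>\<^sub>F R in at_top. \<Phi> (Complex x y) = indicator {- R..R} x *\<^sub>R \<Phi> (Complex x y)"
    using eventually_ge_at_top[of "\<bar>x\<bar>"] by eventually_elim (auto simp: indicator_def)
   then show "((\<lambda>R. indicator {- R..R} x *\<^sub>R \<Phi> (Complex x y)) \<longlongrightarrow> \<Phi> (Complex x y)) at_top"
    by (rule Lim_transform_eventually[OF tendsto_const])
  qed
  show "\<forall>\<^sub>F R in at_top. AE x in lborel. norm (indicator {- R..R} x *\<^sub>R \<Phi> (Complex x y)) \<le> norm (\<Phi> (Complex x y))"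
   by (intro always_eventually allI AE_I2) (auto simp: indicator_def)
 qed
 define A where "A R = (LBINT x. indicator {- R..R} x *\<^sub>R \<Phi> (Complex x y2)) - (LBINT x. indicator {- R..R} x *\<^sub>R \<Phi> (Complex x y1))" for R
 have Alim: "(A \<longlongrightarrow> (LBINT x. \<Phi> (Complex x y2)) - (LBINT x. \<Phi> (Complex x y1))) at_top"
  unfolding A_def using y by (intro tendsto_diff conv) auto
 have Ab: "cmod (A R) \<le> e R + e (- R)" if "0 \<le> R" for R
 proof -
  have "A R = (\<Psi> (Complex R y2) - \<Psi> (Complex R y1)) - (\<Psi> (Complex (- R) y2) - \<Psi> (Complex (- R) y1))"
   using y that by (simp add: A_def H)
  then show ?thesis unfolding e_def by (metis norm_triangle_ineq4)
 qed
 show ?thesis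
 proof (rule ccontr)
  assume "\<not> ?thesis"
  then have c: "0 < cmod ((LBINT x. \<Phi> (Complex x y2)) - (LBINT x. \<Phi> (Complex x y1)))" (is "0 < ?c") by simp
  have "((\<lambda>R. cmod (A R)) \<longlongrightarrow> ?c) at_top" by (intro tendsto_norm Alim)
  then have "\<forall>\<^sub>F R in at_top. ?c / 2 < cmod (A R)" by (rule order_tendstoD) (use c in simp)
  then obtain N where N: "\<And>R. R \<ge> N \<Longrightarrow> ?c / 2 < cmod (A R)" unfolding eventually_at_top_linorder by blast
  obtain R where "R \<ge> max N 0" "e R + e (- R) < ?c / 2" using integrable_arbitrarily_small[OF ei', of "?c / 2" "max N 0"] c by auto
  then show False using N[of R] Ab[of R] by simp
 qed
qed

text \<open>The line integrals of \<open>F z / (z - cnj v)\<close> do not depend on the height.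
  Cauchy-Schwarz with the decaying norm of the kernel sends them to 0 upwards, so they are all 0;
  letting the height tend to 0 gives the condition on \<open>f\<close>.\<close>

lemma hardy2_subset_Hm: "hardy2 \<subseteq> Hm"
proof
 fix f assume "f \<in> hardy2"
 then obtain F C where f: "f \<in> L2" and F: "F holomorphic_on {z. 0 < Im z}"
  and Fi: "\<And>y. 0 < y \<Longrightarrow> integrable lborel (\<lambda>x. (cmod (F (Complex x y)))\<^sup>2)"
  and FC: "\<And>y. 0 < y \<Longrightarrow> (LBINT x. (cmod (F (Complex x y)))\<^sup>2) \<le> C"
  and lim: "((\<lambda>y. LBINT x. (cmod (F (Complex x y) - f x))\<^sup>2) \<longlongrightarrow> 0) (at_right 0)"
  unfolding hardy2_def by blast
 have FL2: "(\<lambda>x. F (Complex x y)) \<in> L2" if "0 < y" for y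
 proof (rule L2I[OF _ Fi[OF that]])
  show "(\<lambda>x. F (Complex x y)) \<in> borel_measurable borel"
   by (rule borel_measurable_continuous_onI, rule continuous_on_compose2[OF holomorphic_on_imp_continuous_on[OF F]])
    (use that in \<open>auto intro!: continuous_intros simp: Complex_eq\<close>)
 qed
 have "(LBINT t. f t / (of_real t - cnj v)) = 0" if v: "0 < Im v" for v
 proof -
  \<comment> \<open>The kernel at height \<open>y\<close>, moved to the real line: \<open>v\<close>
    becomes \<open>v + \<i> * y\<close>, so \<open>kernel_sq_integral\<close> gives its
    norm.\<close>
  define G where "G y t = 1 / (of_real t - cnj (v + \<i> * y))" for y t :: real
  define \<Phi> where "\<Phi> z = F z / (z - cnj v)" for z
  have vy: "0 < Im (v + \<i> * y)" if "0 \<le> y" for y :: real using v that by simp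
  have GL2: "G y \<in> L2" if "0 \<le> y" for y unfolding G_def by (rule L2_kernel) (use vy[OF that] in simp)
  have Gn: "(LBINT t. (cmod (G y t))\<^sup>2) = pi / (Im v + y)" if "0 \<le> y" for y
   unfolding G_def using kernel_sq_integral[OF vy[OF that]] by simp
  have \<Phi>G: "\<Phi> (Complex x y) = F (Complex x y) * G y x" for x y by (simp add: \<Phi>_def G_def Complex_eq algebra_simps)
  have int: "integrable lborel (\<lambda>x. \<Phi> (Complex x y))" if "0 < y" for y
   unfolding \<Phi>G using that by (intro L2_mult_integrable FL2 GL2) auto
  define I where "I y = (LBINT x. \<Phi> (Complex x y))" for y
  have "I y1 = I y2" if "0 < y1" "y1 < y2" for y1 y2 unfolding I_def
  proof (rule line_integrals_equal[OF _ that int])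
   show "\<Phi> holomorphic_on {z. 0 < Im z}" unfolding \<Phi>_def using v by (intro holomorphic_intros F) (auto simp: complex_eq_iff)
   fix y :: real assume y: "0 < y"
   have "(LBINT x. cmod (\<Phi> (Complex x y))) \<le> (LBINT x. (cmod (F (Complex x y)))\<^sup>2 + (cmod (G y x))\<^sup>2)"
   proof (rule integral_mono)
    show "integrable lborel (\<lambda>x. (cmod (F (Complex x y)))\<^sup>2 + (cmod (G y x))\<^sup>2)"
     using y by (intro Bochner_Integration.integrable_add Fi L2D(2)[OF GL2]) auto
    fix x
    have "2 * (cmod (F (Complex x y)) * cmod (G y x)) \<le> (cmod (F (Complex x y)))\<^sup>2 + (cmod (G y x))\<^sup>2"
     using sum_squares_bound[of "cmod (F (Complex x y))" "cmod (G y x)"] by simp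
    moreover have "0 \<le> cmod (F (Complex x y)) * cmod (G y x)" by simp
    ultimately show "cmod (\<Phi> (Complex x y)) \<le> (cmod (F (Complex x y)))\<^sup>2 + (cmod (G y x))\<^sup>2"
     unfolding \<Phi>G norm_mult by linarith
   qed (rule integrable_norm[OF int[OF y]])
   also have "\<dots> = (LBINT x. (cmod (F (Complex x y)))\<^sup>2) + pi / (Im v + y)"
    using y Gn[of y] L2D(2)[OF GL2, of y] Fi[OF y] by simp
   also have "\<dots> \<le> C + pi / Im v" using FC[OF y] v y by (intro add_mono divide_left_mono mult_pos_pos) auto
   finally show "(LBINT x. cmod (\<Phi> (Complex x y))) \<le> C + pi / Im v" .
  qed
  then have Iconst: "I y = I 1" if "0 < y" for y using that by (metis linorder_neqE_linordered_idom zero_less_one)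
  have Ib: "(cmod (I 1))\<^sup>2 \<le> C * (pi / (Im v + y))" if y: "0 < y" for y
  proof -
   have "(cmod (I y))\<^sup>2 \<le> (LBINT x. (cmod (F (Complex x y)))\<^sup>2) * (LBINT x. (cmod (G y x))\<^sup>2)"
    unfolding I_def \<Phi>G using y by (intro L2_Cauchy_Schwarz FL2 GL2) auto
   also have "\<dots> \<le> C * (pi / (Im v + y))" using FC[OF y] Gn[of y] v y by (simp add: divide_right_mono mult_right_mono)
   finally show ?thesis using Iconst[OF y] by simp
  qed
  have "((\<lambda>y. C * (pi / (Im v + y))) \<longlongrightarrow> C * 0) at_top"
   by (intro tendsto_mult tendsto_const tendsto_divide_0[OF tendsto_const] filterlim_at_top_imp_at_infinity
     filterlim_tendsto_add_at_top[OF tendsto_const filterlim_ident])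
  then have "(cmod (I 1))\<^sup>2 \<le> C * 0"
   by (rule tendsto_lowerbound) (use Ib in \<open>auto intro!: eventually_mono[OF eventually_gt_at_top[of 0]]\<close>)
  then have I0: "I y = 0" if "0 < y" for y using Iconst[OF that] by simp
  let ?J = "LBINT t. f t * G 0 t"
  \<comment> \<open>At height \<open>y\<close> the integral is 0. It differs from \<open>?J\<close>
    by the boundary error of \<open>F\<close> and by the change of kernel, which costs
    \<open>y\<close> times a constant.\<close>
  have b: "(cmod ?J) \<le> sqrt ((LBINT x. (cmod (F (Complex x y) - f x))\<^sup>2) * (pi / Im v)) + y * ((LBINT t. cmod (f t * G 0 t)) / Im v)"
   if y: "0 < y" for y
  proof -
   have i1: "integrable lborel (\<lambda>x. (F (Complex x y) - f x) * G y x)"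
    using y by (intro L2_mult_integrable L2_diff FL2 f GL2) auto
   have i2: "integrable lborel (\<lambda>x. f x * (G y x - G 0 x))" using y by (intro L2_mult_integrable L2_diff f GL2) auto
   have i3: "integrable lborel (\<lambda>x. f x * G 0 x)" by (intro L2_mult_integrable f GL2) auto
   have "I y = (LBINT x. (F (Complex x y) - f x) * G y x + f x * (G y x - G 0 x) + f x * G 0 x)"
    unfolding I_def \<Phi>G by (simp add: algebra_simps)
   also have "\<dots> = (LBINT x. (F (Complex x y) - f x) * G y x) + (LBINT x. f x * (G y x - G 0 x)) + ?J"
    using i1 i2 i3 by (simp only: Bochner_Integration.integral_add Bochner_Integration.integrable_add)
   finally have s0: "0 = (LBINT x. (F (Complex x y) - f x) * G y x) + (LBINT x. f x * (G y x - G 0 x)) + ?J" using I0[OF y] by simp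
   have gen: "c = - a - b" if "0 = a + b + c" for a b c :: complex
   proof -
    have "c = (a + b + c) - a - b" by simp
    then show ?thesis unfolding that[symmetric] by simp
   qed
   from gen[OF s0] have "?J = - (LBINT x. (F (Complex x y) - f x) * G y x) - (LBINT x. f x * (G y x - G 0 x))" .
   then have "cmod ?J \<le> cmod (LBINT x. (F (Complex x y) - f x) * G y x) + cmod (LBINT x. f x * (G y x - G 0 x))"
    by (metis norm_minus_cancel norm_triangle_ineq4)
   moreover have "cmod (LBINT x. (F (Complex x y) - f x) * G y x) \<le> sqrt ((LBINT x. (cmod (F (Complex x y) - f x))\<^sup>2) * (pi / Im v))"
   proof (rule real_le_rsqrt)
    have "(cmod (LBINT x. (F (Complex x y) - f x) * G y x))\<^sup>2
      \<le> (LBINT x. (cmod (F (Complex x y) - f x))\<^sup>2) * (LBINT x. (cmod (G y x))\<^sup>2)"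
     using y by (intro L2_Cauchy_Schwarz L2_diff FL2 f GL2) auto
    also have "\<dots> \<le> (LBINT x. (cmod (F (Complex x y) - f x))\<^sup>2) * (pi / Im v)"
     using y v Gn[of y] by (intro mult_left_mono) (auto intro!: divide_left_mono mult_pos_pos)
    finally show "(cmod (LBINT x. (F (Complex x y) - f x) * G y x))\<^sup>2 \<le> (LBINT x. (cmod (F (Complex x y) - f x))\<^sup>2) * (pi / Im v)" .
   qed
   moreover have "cmod (LBINT x. f x * (G y x - G 0 x)) \<le> y * ((LBINT t. cmod (f t * G 0 t)) / Im v)"
   proof -
    have pw: "cmod (f x * (G y x - G 0 x)) \<le> y / Im v * cmod (f x * G 0 x)" for x
    proof -
     let ?a = "of_real x - cnj (v + \<i> * y)" and ?b = "of_real x - cnj v"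
     have nz: "?a \<noteq> 0" "?b \<noteq> 0"
      using of_real_diff_nonzero[of "cnj (v + \<i> * y)" x] of_real_diff_nonzero[of "cnj v" x] v y by auto
     have "1 / ?a - 1 / ?b = (?b - ?a) / (?a * ?b)" using nz by (simp add: divide_simps)
     then have "G y x - G 0 x = - (\<i> * y) * (1 / ?a) * G 0 x" using nz by (simp add: G_def)
     then have "cmod (G y x - G 0 x) = y * cmod (1 / ?a) * cmod (G 0 x)" using y by (simp add: norm_mult norm_divide)
     also have "\<dots> \<le> y * (1 / Im v) * cmod (G 0 x)"
     proof (intro mult_right_mono mult_left_mono)
      have "cmod (1 / ?a) \<le> 1 / \<bar>Im (cnj (v + \<i> * y))\<bar>" by (rule kernel_bounded) (use v y in simp)
      also have "\<dots> \<le> 1 / Im v" using v y by (intro divide_left_mono) auto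
      finally show "cmod (1 / ?a) \<le> 1 / Im v" .
     qed (use y in auto)
     finally have "cmod (f x) * cmod (G y x - G 0 x) \<le> cmod (f x) * (y * (1 / Im v) * cmod (G 0 x))" by (intro mult_left_mono) auto
     then show ?thesis by (simp add: norm_mult ac_simps)
    qed
    have "cmod (LBINT x. f x * (G y x - G 0 x)) \<le> (LBINT x. cmod (f x * (G y x - G 0 x)))" by (rule integral_norm_bound)
    also have "\<dots> \<le> (LBINT x. y / Im v * cmod (f x * G 0 x))"
     by (intro integral_mono integrable_norm i2 integrable_mult_right i3 pw)
    finally show ?thesis by simp
   qed
   ultimately show ?thesis by linarith
  qed
  have "((\<lambda>y. sqrt ((LBINT x. (cmod (F (Complex x y) - f x))\<^sup>2) * (pi / Im v)) + y * ((LBINT t. cmod (f t * G 0 t)) / Im v))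
    \<longlongrightarrow> sqrt (0 * (pi / Im v)) + 0 * ((LBINT t. cmod (f t * G 0 t)) / Im v)) (at_right 0)"
   by (intro tendsto_intros lim)
  then have "cmod ?J \<le> sqrt (0 * (pi / Im v)) + 0 * ((LBINT t. cmod (f t * G 0 t)) / Im v)"
   by (rule tendsto_lowerbound) (use b in \<open>auto simp: eventually_at_right[of 0 1] intro!: exI[of _ 1]\<close>)
  then have "?J = 0" by simp
  then show ?thesis by (simp add: G_def)
 qed
 with f show "f \<in> Hm" by (simp add: Hm_def)
qed

theorem hardy2_eq_Hm: "hardy2 = Hm"
 using hardy2_subset_Hm Hm_subset_hardy2 by blast

section \<open>Subspaces invariant under the multiplications\<close>

lemma L2_weight_integrable:
 assumes f: "f \<in> L2"
 shows "integrable lborel (\<lambda>t. cmod (f t) / (1 + t\<^sup>2))"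
proof -
 have "(\<lambda>t. 1 / (complex_of_real t - \<i>) * (1 / (complex_of_real t - \<i>))) \<in> L2"
  by (rule L2_bounded_mult[OF L2_kernel kernel_measurable kernel_bounded]) simp_all
 note i = integrable_norm[OF L2_mult_integrable[OF f this]]
 have "norm (f t * (1 / (complex_of_real t - \<i>) * (1 / (complex_of_real t - \<i>)))) = cmod (f t) / (1 + t\<^sup>2)" for t
  using cmod_real_diff_sq[of t \<i>] unfolding norm_mult norm_divide norm_one by (simp add: power2_eq_square add.commute)
 then show ?thesis using i by simp
qed

lemma L2_zero_if_cauchy_transforms_zero:
 assumes h: "h \<in> L2"
  and up: "\<And>v. 0 < Im v \<Longrightarrow> (LBINT t. h t / (complex_of_real t - v)) = 0"
  and lo: "\<And>v. 0 < Im v \<Longrightarrow> (LBINT t. h t / (of_real t - cnj v)) = 0"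
 shows "AE t in lborel. h t = 0"
proof (rule poisson_uniqueness[OF L2D(1)[OF h] L2_weight_integrable[OF h]])
 fix v :: complex assume v: "0 < Im v"
 have "integrable lborel (\<lambda>t. h t / (complex_of_real t - v))" "integrable lborel (\<lambda>t. h t / (of_real t - cnj v))"
  using v by (intro L2_kernel_integrable h; simp)+
 from poisson_transform[OF v this] show "(LBINT t. poisson v t * h t) = 0" by (simp add: up[OF v] lo[OF v])
qed

definition mult_l2 :: "(real \<Rightarrow> complex) \<Rightarrow> l2 \<Rightarrow> l2" where
 "mult_l2 m x = to_l2 (\<lambda>t. m t * fun_of_l2 x t)"

lemma mult_l2_to_l2:
 assumes "f \<in> L2"
 shows "mult_l2 m (to_l2 f) = to_l2 (\<lambda>t. m t * f t)" unfolding mult_l2_def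
proof (rule to_l2_eqI)
 show "AE t in lborel. m t * fun_of_l2 (to_l2 f) t = m t * f t" using fun_of_to_l2[OF assms] by eventually_elim simp
qed

lemma isometry_op_mult_l2:
 assumes m: "m \<in> borel_measurable borel" "\<And>t. cmod (m t) = 1"
 shows "isometry_op (mult_l2 m)" unfolding isometry_op_def clinear_def
proof (intro conjI allI)
 fix x y :: l2 and c
 obtain f where f: "f \<in> L2" "x = to_l2 f" by (rule l2_cases)
 obtain g where g: "g \<in> L2" "y = to_l2 g" by (rule l2_cases)
 have mL: "(\<lambda>t. m t * h t) \<in> L2" if "h \<in> L2" for h using m by (intro L2_bounded_mult[OF that, of m 1]) auto
 show "mult_l2 m (x + y) = mult_l2 m x + mult_l2 m y" using f g by (simp add: to_l2_ops mult_l2_to_l2 L2_add mL) (simp add: algebra_simps)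
 show "mult_l2 m (scaleC c x) = scaleC c (mult_l2 m x)"
  using f by (simp add: scaleC_to_l2 mult_l2_to_l2 L2_scale mL) (simp add: algebra_simps)
 have "(norm (mult_l2 m x))\<^sup>2 = (norm x)\<^sup>2" using f by (simp add: mult_l2_to_l2 norm_to_l2_sq mL) (simp add: norm_mult m)
 then show "norm (mult_l2 m x) = norm x" by simp
qed

lemma orthogonal_complement_cinner:
 assumes "z \<in> orthogonal_complement S" "x \<in> S"
 shows "cinner z x = 0"
proof -
 have "cinner x z = 0" using assms by (simp add: orthogonal_complement_def)
 then show ?thesis using cinner_commute[of z x] by simp
qed

locale half_invariant =
 fixes S :: "l2 set"
 assumes S: "closed_csubspace S" and inv: "\<And>a x. 0 \<le> a \<Longrightarrow> x \<in> S \<Longrightarrow> Ml a x \<in> S"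
begin

lemmas subD = csubspaceD[OF conjunct1[OF S[unfolded closed_csubspace_def]]]

text \<open>Multiplication by \<open>1 / (t - cnj v)\<close> is a Laplace average of modulations
  with nonnegative parameter. In weak form: for \<open>g\<close> orthogonal to \<open>S\<close> the
  Cauchy transforms of \<open>cnj g * f\<close> at \<open>cnj v\<close> vanish.\<close>

lemma resolvent:
 assumes f: "f \<in> L2" "to_l2 f \<in> S" and v: "0 < Im v"
 shows "to_l2 (\<lambda>t. f t / (of_real t - cnj v)) \<in> S"
proof (rule mem_closed_csubspaceI[OF S])
 fix z assume z: "z \<in> orthogonal_complement S"
 obtain g where g: "g \<in> L2" "z = to_l2 g" by (rule l2_cases)
 have fk: "(\<lambda>t. f t / (of_real t - cnj v)) \<in> L2"
  using L2_bounded_mult[OF f(1) kernel_measurable kernel_bounded, of "cnj v"] v by simp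
 have "(LBINT t. cnj (g t) * f t / (of_real t - cnj v)) = 0"
 proof (rule cauchy_transform_zero_if_fourier_zero[OF _ _ v])
  show "integrable lborel (\<lambda>t. cnj (g t) * f t)" by (intro L2_mult_integrable L2_cnj f g)
  fix a :: real assume "0 \<le> a"
  then have "cinner z (Ml a (to_l2 f)) = 0" using z inv f by (intro orthogonal_complement_cinner)
  then have "(LBINT t. cnj (g t) * Mop a f t) = 0" using f g by (simp add: Ml_to_l2 cinner_to_l2 L2_Mop)
  then show "(LBINT t. cis_mult a t * (cnj (g t) * f t)) = 0" unfolding Mop_def by (simp only: ac_simps)
 qed
 then show "cinner z (to_l2 (\<lambda>t. f t / (of_real t - cnj v))) = 0" using g fk by (simp add: cinner_to_l2)
qed

text \<open>The quotient equals \<open>1 + (cnj v - w) / (t - cnj v)\<close>. For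
  \<open>w = v\<close> it is the Blaschke factor at \<open>v\<close>.\<close>

lemma quotient_kernel:
 assumes f: "f \<in> L2" "to_l2 f \<in> S" and v: "0 < Im v"
 shows "to_l2 (\<lambda>t. (complex_of_real t - w) / (of_real t - cnj v) * f t) \<in> S"
  and "(\<lambda>t. (complex_of_real t - w) / (of_real t - cnj v) * f t) \<in> L2"
proof -
 have fk: "(\<lambda>t. f t / (of_real t - cnj v)) \<in> L2"
  using L2_bounded_mult[OF f(1) kernel_measurable kernel_bounded, of "cnj v"] v by simp
 have eq: "(\<lambda>t. (complex_of_real t - w) / (of_real t - cnj v) * f t) = (\<lambda>t. f t + (cnj v - w) * (f t / (of_real t - cnj v)))"
 proof
  fix t
  have nz: "of_real t - cnj v \<noteq> 0" using v by (intro of_real_diff_nonzero) simp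
  have gen: "(a + c) / a * h = h + c * (h / a)" if "a \<noteq> 0" for a c h :: complex using that by (simp add: field_simps)
  show "(complex_of_real t - w) / (of_real t - cnj v) * f t = f t + (cnj v - w) * (f t / (of_real t - cnj v))"
   using gen[OF nz, of "cnj v - w" "f t"] by simp
 qed
 show "(\<lambda>t. (complex_of_real t - w) / (of_real t - cnj v) * f t) \<in> L2" unfolding eq by (intro L2_add L2_scale f fk)
 have "to_l2 f + scaleC (cnj v - w) (to_l2 (\<lambda>t. f t / (of_real t - cnj v))) \<in> S" by (intro subD resolvent f v)
 then show "to_l2 (\<lambda>t. (complex_of_real t - w) / (of_real t - cnj v) * f t) \<in> S"
  unfolding eq scaleC_to_l2[OF fk] to_l2_ops(1)[OF f(1) L2_scale[OF fk]] .
qed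

lemma doubly_invariant:
 assumes inv': "\<And>v f. 0 < Im v \<Longrightarrow> f \<in> L2 \<Longrightarrow> to_l2 f \<in> S \<Longrightarrow> to_l2 (\<lambda>t. (of_real t - cnj v) / (complex_of_real t - v) * f t) \<in> S"
 shows "\<exists>E\<in>sets borel. \<forall>f\<in>L2. to_l2 f \<in> S \<longleftrightarrow> (AE t in lborel. t \<notin> E \<longrightarrow> f t = 0)"
proof -
 have orth: "AE t in lborel. cnj (g t) * f t = 0"
  if f: "f \<in> L2" "to_l2 f \<in> S" and g: "g \<in> L2" "to_l2 g \<in> orthogonal_complement S" for f g
 proof (rule integrable_zero_if_cauchy_transforms_zero)
  show "integrable lborel (\<lambda>t. cnj (g t) * f t)" by (intro L2_mult_integrable L2_cnj f g)
  fix v :: complex assume v: "0 < Im v"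
  have fk: "(\<lambda>t. f t / (complex_of_real t - w)) \<in> L2" if "Im w \<noteq> 0" for w
   using L2_bounded_mult[OF f(1) kernel_measurable kernel_bounded[OF that]] by simp
  have c0: "cinner (to_l2 g) (to_l2 h) = 0" if "to_l2 h \<in> S" for h using orthogonal_complement_cinner[OF g(2) that] .
  have "cinner (to_l2 g) (to_l2 (\<lambda>t. f t / (of_real t - cnj v))) = 0" by (intro c0 resolvent f v)
  then show "(LBINT t. cnj (g t) * f t / (of_real t - cnj v)) = 0" using g fk[of "cnj v"] v by (simp add: cinner_to_l2)
  have nz: "complex_of_real t - v \<noteq> 0" for t using v by (intro of_real_diff_nonzero) simp
  have gen: "(a + c) / a * h = h + c * (h / a)" if "a \<noteq> 0" for a c h :: complex using that by (simp add: field_simps)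
  have "(\<lambda>t. (of_real t - cnj v) / (complex_of_real t - v) * f t) = (\<lambda>t. f t + (v - cnj v) * (f t / (complex_of_real t - v)))"
   using gen[OF nz, where c="v - cnj v"] by (intro ext) simp
  then have "cinner (to_l2 g) (to_l2 (\<lambda>t. f t + (v - cnj v) * (f t / (complex_of_real t - v)))) = 0"
   using c0[OF inv'[OF v f]] by simp
  moreover have "to_l2 (\<lambda>t. f t + (v - cnj v) * (f t / (complex_of_real t - v))) = to_l2 f + scaleC (v - cnj v) (to_l2 (\<lambda>t. f t / (complex_of_real t - v)))"
  proof -
   have fv: "(\<lambda>t. f t / (complex_of_real t - v)) \<in> L2" using fk[of v] v by simp
   show ?thesis unfolding scaleC_to_l2[OF fv] to_l2_ops(1)[OF f(1) L2_scale[OF fv]] ..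
  qed
  ultimately have "(v - cnj v) * cinner (to_l2 g) (to_l2 (\<lambda>t. f t / (complex_of_real t - v))) = 0"
   using c0[OF f(2)] by (simp add: cinner_add_right cinner_scaleC_right)
  moreover have "v - cnj v \<noteq> 0" using v by (auto simp: complex_eq_iff)
  ultimately show "(LBINT t. cnj (g t) * f t / (complex_of_real t - v)) = 0" using g fk[of v] v by (simp add: cinner_to_l2)
 qed
 \<comment> \<open>The projection of a nowhere vanishing function has the largest support in
   \<open>S\<close>: where \<open>p\<close> vanishes the complementary part does not, and this
   forces every \<open>f\<close> in \<open>S\<close> to vanish there.\<close>
 obtain y where y: "y \<in> S" "to_l2 ground - y \<in> orthogonal_complement S" using orthogonal_projection_exists[OF S] by blast
 obtain p where p: "p \<in> L2" "y = to_l2 p" by (rule l2_cases)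
 have gp: "(\<lambda>t. ground t - p t) \<in> L2" "to_l2 (\<lambda>t. ground t - p t) \<in> orthogonal_complement S"
  using y(2) p ground_L2 by (auto simp: to_l2_ops L2_diff)
 note [measurable] = L2D(1)[OF p(1)]
 define E where "E = {t. p t \<noteq> 0}"
 have "E \<in> sets borel" unfolding E_def by measurable
 moreover have "to_l2 f \<in> S \<longleftrightarrow> (AE t in lborel. t \<notin> E \<longrightarrow> f t = 0)" if f: "f \<in> L2" for f
 proof
  assume "to_l2 f \<in> S"
  from orth[OF f this gp] show "AE t in lborel. t \<notin> E \<longrightarrow> f t = 0" by eventually_elim (auto simp: E_def ground_pos)
 next
  assume E: "AE t in lborel. t \<notin> E \<longrightarrow> f t = 0"
  show "to_l2 f \<in> S"
  proof (rule mem_closed_csubspaceI[OF S])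
   fix z assume z: "z \<in> orthogonal_complement S"
   obtain g where g: "g \<in> L2" "z = to_l2 g" by (rule l2_cases)
   have "AE t in lborel. cnj (g t) * p t = 0" using orth[of p g] p y z g by simp
   with E have "AE t in lborel. cnj (g t) * f t = 0" by eventually_elim (auto simp: E_def)
   then show "cinner z (to_l2 f) = 0" using g f by (simp add: cinner_to_l2 integral_eq_zero_AE)
  qed
 qed
 ultimately show ?thesis by blast
qed

text \<open>The expected form of \<open>e\<close> is a unimodular function times
  \<open>sqrt c / (t - cnj v0)\<close>. Orthogonality makes the Poisson integrals of
  \<open>q = |e|^2 |t - v0|^2\<close> equal at all points, and Poisson uniqueness makes
  \<open>q\<close> constant.\<close>

lemma wandering_modulus:
 assumes e: "e \<in> L2" "to_l2 e \<noteq> 0" and v0: "0 < Im v0"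
  and orth: "\<And>v. 0 < Im v \<Longrightarrow> (LBINT t. cnj (e t) * ((complex_of_real t - v0) / (of_real t - cnj v) * e t)) = 0"
 obtains c where "0 < c" "AE t in lborel. (cmod (e t))\<^sup>2 * (cmod (of_real t - v0))\<^sup>2 = c"
proof -
 note [measurable] = L2D(1)[OF e(1)]
 define q where "q t = complex_of_real ((cmod (e t))\<^sup>2 * (cmod (of_real t - v0))\<^sup>2)" for t
 define K where "K = 2 + 2 * (Re v0)\<^sup>2 + (Im v0)\<^sup>2"
 have [measurable]: "q \<in> borel_measurable borel" unfolding q_def by measurable
 have pos: "0 < 1 + t\<^sup>2" for t :: real by (simp add: add_pos_nonneg)
 have K: "(cmod (of_real t - v0))\<^sup>2 / (1 + t\<^sup>2) \<le> K" for t
 proof -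
  have "(t - Re v0)\<^sup>2 \<le> 2 * t\<^sup>2 + 2 * (Re v0)\<^sup>2"
   using zero_le_power2[of "t + Re v0"] by (simp add: power2_sum power2_diff)
  then have "(cmod (of_real t - v0))\<^sup>2 \<le> 2 * t\<^sup>2 + (2 * (Re v0)\<^sup>2 + (Im v0)\<^sup>2)"
   by (simp add: cmod_real_diff_sq)
  also have "\<dots> \<le> K * (1 + t\<^sup>2)"
  proof -
   have "0 \<le> 2 + (2 * (Re v0)\<^sup>2 + (Im v0)\<^sup>2) * t\<^sup>2" by (simp add: add_nonneg_nonneg)
   then show ?thesis by (simp add: K_def algebra_simps)
  qed
  finally show ?thesis using pos[of t] by (simp add: pos_divide_le_eq)
 qed
 have qi: "integrable lborel (\<lambda>t. cmod (q t) / (1 + t\<^sup>2))"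
 proof (rule Bochner_Integration.integrable_bound)
  show "integrable lborel (\<lambda>t. K * (cmod (e t))\<^sup>2)" using L2D(2)[OF e(1)] by (rule integrable_mult_right)
  have "cmod (q t) / (1 + t\<^sup>2) = (cmod (of_real t - v0))\<^sup>2 / (1 + t\<^sup>2) * (cmod (e t))\<^sup>2" for t
   unfolding q_def norm_of_real by simp
  then have "cmod (q t) / (1 + t\<^sup>2) \<le> K * (cmod (e t))\<^sup>2" for t by (simp only: mult_right_mono[OF K] zero_le_power2)
  then show "AE t in lborel. norm (cmod (q t) / (1 + t\<^sup>2)) \<le> norm (K * (cmod (e t))\<^sup>2)"
   using pos by (intro AE_I2) (auto simp: abs_of_nonneg less_imp_le intro: order_trans[OF _ abs_ge_self])
 qed measurable
 define r where "r v t = cnj (e t) * ((complex_of_real t - v0) / (of_real t - cnj v) * e t)" for v t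
 have r0: "(LBINT t. r v t) = 0" if "0 < Im v" for v unfolding r_def by (rule orth[OF that])
 have ri: "integrable lborel (r v)" if "0 < Im v" for v
 proof -
  have "(\<lambda>t. (complex_of_real t - v0) / (of_real t - cnj v) * e t) \<in> L2"
  proof (rule L2_bounded_mult[OF e(1)])
   have nz: "of_real t - cnj v \<noteq> 0" for t using that by (intro of_real_diff_nonzero) simp
   have "(complex_of_real t - v0) / (of_real t - cnj v) = 1 + (cnj v - v0) * (1 / (of_real t - cnj v))" for t
    using nz[of t] by (simp add: field_simps)
   then have "cmod ((complex_of_real t - v0) / (of_real t - cnj v)) \<le> 1 + cmod (cnj v - v0) * cmod (1 / (of_real t - cnj v))" for t
    by (metis norm_mult norm_one norm_triangle_ineq)
   moreover have "cmod (1 / (of_real t - cnj v)) \<le> 1 / \<bar>Im (cnj v)\<bar>" for t by (rule kernel_bounded) (use that in simp)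
   ultimately show "cmod ((complex_of_real t - v0) / (of_real t - cnj v)) \<le> 1 + cmod (cnj v - v0) * (1 / \<bar>Im (cnj v)\<bar>)" for t
    by (meson add_left_mono mult_left_mono norm_ge_zero order_trans)
  qed measurable
  then show ?thesis unfolding r_def[abs_def] by (intro L2_mult_integrable L2_cnj e)
 qed
 have rq: "r v t = q t / ((of_real t - cnj v) * (of_real t - cnj v0))" for v t
 proof -
  have "of_real t - cnj v0 \<noteq> 0" using v0 by (intro of_real_diff_nonzero) simp
  moreover have "q t = (cnj (e t) * e t) * ((complex_of_real t - v0) * (of_real t - cnj v0))"
   using complex_norm_square[of "e t"] complex_norm_square[of "complex_of_real t - v0"] by (simp add: q_def mult.commute)
  ultimately show ?thesis by (simp add: r_def)
 qed
 have pq: "(LBINT t. poisson v t * q t) = (LBINT t. poisson v0 t * q t)" if v: "0 < Im v" for v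
 proof -
  \<comment> \<open>The resolvent identity, applied to each of the two Cauchy kernels in the Poisson
    kernel; the products that arise are \<open>r v\<close> and its conjugate, which integrate to
    0.\<close>
  have "poisson v t * q t - poisson v0 t * q t = ((v - v0) * cnj (r v t) - (cnj v - cnj v0) * r v t) / (2 * pi * \<i>)" for t
  proof -
   have nz: "complex_of_real t - v \<noteq> 0" "complex_of_real t - v0 \<noteq> 0" "of_real t - cnj v \<noteq> 0" "of_real t - cnj v0 \<noteq> 0"
    using v v0 by (auto intro!: of_real_diff_nonzero simp del: right_minus_eq)
   have gen: "(1 / a - 1 / a') - (1 / b - 1 / b') = (b - a) / (a * b) - (b' - a') / (a' * b')" if "a \<noteq> 0" "a' \<noteq> 0" "b \<noteq> 0" "b' \<noteq> 0" for a a' b b' :: complex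
    using that by (simp add: field_simps)
   have cr: "cnj (r v t) = q t / ((complex_of_real t - v) * (complex_of_real t - v0))" unfolding rq by (simp add: q_def)
   have "poisson v t * q t - poisson v0 t * q t
     = ((1 / (complex_of_real t - v) - 1 / (of_real t - cnj v)) - (1 / (complex_of_real t - v0) - 1 / (of_real t - cnj v0))) * q t / (2 * pi * \<i>)"
    unfolding poisson_eq_kernel_diff[OF v] poisson_eq_kernel_diff[OF v0] by (simp add: left_diff_distrib diff_divide_distrib)
   also have "\<dots> = (((v - v0) / ((complex_of_real t - v) * (complex_of_real t - v0)) - (cnj v - cnj v0) / ((of_real t - cnj v) * (of_real t - cnj v0)))) * q t / (2 * pi * \<i>)"
    unfolding gen[OF nz(1,3,2,4)] by simp
   finally show ?thesis unfolding cr unfolding rq by (simp add: left_diff_distrib)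
  qed
  then have "(LBINT t. poisson v t * q t - poisson v0 t * q t) = (LBINT t. ((v - v0) * cnj (r v t) - (cnj v - cnj v0) * r v t) / (2 * pi * \<i>))"
   by simp
  also have "\<dots> = 0" using ri[OF v] r0[OF v] by simp
  finally show ?thesis using poisson_mult_integrable[OF _ qi v] poisson_mult_integrable[OF _ qi v0] by simp
 qed
 define c where "c = Re (LBINT t. poisson v0 t * q t)"
 have creal: "(LBINT t. poisson v0 t * q t) = complex_of_real (LBINT t. poisson v0 t * ((cmod (e t))\<^sup>2 * (cmod (of_real t - v0))\<^sup>2))"
  unfolding q_def by (simp only: of_real_mult[symmetric] integral_complex_of_real)
 have c: "(LBINT t. poisson v0 t * q t) = complex_of_real c" unfolding c_def creal by simp
 have AE: "AE t in lborel. q t - complex_of_real c = 0"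
 proof (rule poisson_uniqueness)
  show "integrable lborel (\<lambda>t. cmod (q t - complex_of_real c) / (1 + t\<^sup>2))"
  proof (rule Bochner_Integration.integrable_bound)
   show "integrable lborel (\<lambda>t. cmod (q t) / (1 + t\<^sup>2) + \<bar>c\<bar> * (1 / (1 + t\<^sup>2)))"
    by (intro Bochner_Integration.integrable_add qi integrable_mult_right integrable_inverse_1_plus_sq)
   have "cmod (q t - complex_of_real c) / (1 + t\<^sup>2) \<le> cmod (q t) / (1 + t\<^sup>2) + \<bar>c\<bar> * (1 / (1 + t\<^sup>2))" for t
    using norm_triangle_ineq4[of "q t" "complex_of_real c"] pos[of t] by (simp add: add_divide_distrib[symmetric] divide_right_mono)
   then show "AE t in lborel. norm (cmod (q t - complex_of_real c) / (1 + t\<^sup>2)) \<le> norm (cmod (q t) / (1 + t\<^sup>2) + \<bar>c\<bar> * (1 / (1 + t\<^sup>2)))"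
    using pos by (intro AE_I2) (auto simp: abs_of_nonneg less_imp_le intro: order_trans[OF _ abs_ge_self])
  qed measurable
  fix v :: complex assume v: "0 < Im v"
  have "(LBINT t. poisson v t * (q t - complex_of_real c)) = (LBINT t. poisson v t * q t) - (LBINT t. poisson v t * complex_of_real c)"
   using poisson_mult_integrable[OF _ qi v] poisson_integrable[of v] v by (simp add: right_diff_distrib)
  also have "(LBINT t. complex_of_real (poisson v t) * complex_of_real c) = c" using poisson_integral[OF v] by simp
  finally show "(LBINT t. poisson v t * (q t - complex_of_real c)) = 0" using pq[OF v] c by simp
 qed measurable
 then have AE': "AE t in lborel. (cmod (e t))\<^sup>2 * (cmod (of_real t - v0))\<^sup>2 = c"
  by eventually_elim (simp only: q_def right_minus_eq of_real_eq_iff)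
 have "0 \<le> c"
 proof -
  have "0 \<le> (LBINT t. poisson v0 t * ((cmod (e t))\<^sup>2 * (cmod (of_real t - v0))\<^sup>2))"
   using poisson_nonneg[OF v0] by (intro integral_nonneg_AE AE_I2) simp
  then show ?thesis unfolding c_def creal by simp
 qed
 moreover have "c \<noteq> 0"
 proof
  assume "c = 0"
  from AE' have "AE t in lborel. e t = 0"
  proof eventually_elim
   case (elim t)
   have "complex_of_real t - v0 \<noteq> 0" using v0 by (intro of_real_diff_nonzero) simp
   then show ?case using elim \<open>c = 0\<close> by simp
  qed
  then have "to_l2 e = 0" using e(1) by (simp add: zero_l2_def to_l2_eq_iff L2_zero)
  then show False using e(2) by simp
 qed
 ultimately show thesis using that[OF _ AE'] by simp
qed

text \<open>\<open>CS\<close> is the Blaschke factor at \<open>v0\<close> times \<open>S\<close>, a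
  proper subspace of \<open>S\<close> because of \<open>f0\<close>. The part of \<open>f0\<close>
  orthogonal to it is a wandering vector of known modulus; dividing it by the kernel
  \<open>1 / (t - cnj v0)\<close> gives the unimodular symbol \<open>u\<close>.\<close>

lemma simply_invariant:
 assumes f0: "f0 \<in> L2" "to_l2 f0 \<in> S" and v0: "0 < Im v0"
  and not: "to_l2 (\<lambda>t. (of_real t - cnj v0) / (complex_of_real t - v0) * f0 t) \<notin> S"
 shows "\<exists>u\<in>borel_measurable borel. (\<forall>t. cmod (u t) = 1) \<and> (\<forall>f\<in>L2. to_l2 f \<in> S \<longleftrightarrow> (\<lambda>t. cnj (u t) * f t) \<in> Hm)"
proof -
 define m where "m t = (of_real t - cnj v0) / (complex_of_real t - v0)" for t
 have nz0: "complex_of_real t - v0 \<noteq> 0" "of_real t - cnj v0 \<noteq> 0" for t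
  using v0 by (auto intro!: of_real_diff_nonzero simp del: right_minus_eq)
 have mm [measurable]: "m \<in> borel_measurable borel" unfolding m_def by measurable
 have m1: "cmod (m t) = 1" for t using nz0 by (simp add: m_def norm_divide cmod_diff_cnj)
 note isoM = isometry_op_mult_l2[OF mm m1]
 define CS where "CS = {x. mult_l2 m x \<in> S}"
 have CS: "closed_csubspace CS" unfolding CS_def by (rule closed_csubspace_vimage[OF isoM S])
 have CSS: "x \<in> S" if "x \<in> CS" for x
 proof -
  obtain f where f: "f \<in> L2" "x = to_l2 f" by (rule l2_cases)
  have mf: "(\<lambda>t. m t * f t) \<in> L2" "to_l2 (\<lambda>t. m t * f t) \<in> S"
   using that f L2_bounded_mult[OF f(1) mm, of 1] m1 by (auto simp: CS_def mult_l2_to_l2)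
  have "to_l2 (\<lambda>t. (complex_of_real t - v0) / (of_real t - cnj v0) * (m t * f t)) \<in> S" by (rule quotient_kernel(1)[OF mf v0])
  moreover have "(\<lambda>t. (complex_of_real t - v0) / (of_real t - cnj v0) * (m t * f t)) = f"
   using nz0 by (auto simp: m_def fun_eq_iff)
  ultimately show ?thesis using f by simp
 qed
 have "to_l2 f0 \<notin> CS" using not f0 by (simp add: CS_def mult_l2_to_l2 m_def)
 moreover obtain y where y: "y \<in> CS" "to_l2 f0 - y \<in> orthogonal_complement CS" using orthogonal_projection_exists[OF CS] by blast
 ultimately have ne: "to_l2 f0 - y \<noteq> 0" by auto
 obtain e where e: "e \<in> L2" "to_l2 f0 - y = to_l2 e" by (rule l2_cases)
 have eS: "to_l2 e \<in> S" using f0(2) CSS[OF y(1)] subD(4) e(2) by metis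
 \<comment> \<open>The quotient \<open>(t - v0) / (t - cnj v) * f\<close> lies in \<open>CS\<close>:
   multiplied by \<open>m\<close> it becomes \<open>(t - cnj v0) / (t - cnj v) * f\<close>, which is
   in \<open>S\<close> by \<open>quotient_kernel\<close>.\<close>
 have eo: "(LBINT t. cnj (e t) * ((complex_of_real t - v0) / (of_real t - cnj v) * f t)) = 0"
  if f: "f \<in> L2" "to_l2 f \<in> S" and v: "0 < Im v" for f v
 proof -
  note q = quotient_kernel[OF f v, of v0]
  have "(\<lambda>t. m t * ((complex_of_real t - v0) / (of_real t - cnj v) * f t)) = (\<lambda>t. (of_real t - cnj v0) / (of_real t - cnj v) * f t)"
   using nz0 by (auto simp: m_def fun_eq_iff)
  then have "to_l2 (\<lambda>t. (complex_of_real t - v0) / (of_real t - cnj v) * f t) \<in> CS"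
   using quotient_kernel(1)[OF f v, of "cnj v0"] q by (simp add: CS_def mult_l2_to_l2)
  then have "cinner (to_l2 e) (to_l2 (\<lambda>t. (complex_of_real t - v0) / (of_real t - cnj v) * f t)) = 0"
   using y(2) e(2) by (intro orthogonal_complement_cinner[of _ CS]) auto
  then show ?thesis using e(1) q(2) by (simp only: cinner_to_l2)
 qed
 obtain c where c: "0 < c" and AEc: "AE t in lborel. (cmod (e t))\<^sup>2 * (cmod (of_real t - v0))\<^sup>2 = c"
 proof (rule wandering_modulus[OF e(1) _ v0])
  show "to_l2 e \<noteq> 0" using ne e(2) by simp
 qed (use eo[OF e(1) eS] that in auto)
 note [measurable] = L2D(1)[OF e(1)]
 \<comment> \<open>Set to 1 on the exceptional null set, so that it is unimodular at every
   point.\<close>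
 define u where "u t = (if (cmod (e t))\<^sup>2 * (cmod (of_real t - v0))\<^sup>2 = c then e t * (of_real t - cnj v0) / sqrt c else 1)" for t
 have um [measurable]: "u \<in> borel_measurable borel" unfolding u_def by measurable
 have u1: "cmod (u t) = 1" for t
 proof (cases "(cmod (e t))\<^sup>2 * (cmod (of_real t - v0))\<^sup>2 = c")
  case True
  then have "(cmod (u t))\<^sup>2 = 1" using c by (simp add: u_def norm_divide norm_mult power_divide power_mult_distrib cmod_diff_cnj)
  then have "cmod (u t) = 1 \<or> cmod (u t) = - 1" by (simp only: power2_eq_1_iff)
  then show ?thesis using norm_ge_zero[of "u t"] by linarith
 qed (simp add: u_def)
 have AEu: "AE t in lborel. u t = e t * (of_real t - cnj v0) / sqrt c" using AEc by eventually_elim (simp add: u_def)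
 have uL2: "(\<lambda>t. cnj (u t) * f t) \<in> L2" if "f \<in> L2" for f using u1 by (intro L2_bounded_mult[OF that, of _ 1]) auto
 have to_Hm: "(\<lambda>t. cnj (u t) * f t) \<in> Hm" if f: "f \<in> L2" "to_l2 f \<in> S" for f
 proof -
  note [measurable] = L2D(1)[OF f(1)]
  have "(LBINT t. cnj (u t) * f t / (of_real t - cnj v)) = 0" if v: "0 < Im v" for v
  proof -
   have "(LBINT t. cnj (u t) * f t / (of_real t - cnj v))
     = (LBINT t. (1 / sqrt c) * (cnj (e t) * ((complex_of_real t - v0) / (of_real t - cnj v) * f t)))"
   proof (rule integral_cong_AE)
    show "AE t in lborel. cnj (u t) * f t / (of_real t - cnj v)
      = (1 / sqrt c) * (cnj (e t) * ((complex_of_real t - v0) / (of_real t - cnj v) * f t))"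
     using AEu by eventually_elim simp
   qed measurable
   then show ?thesis using eo[OF f v] by (simp only: integral_mult_right_zero mult_zero_right)
  qed
  then show ?thesis using uL2[OF f(1)] by (simp add: Hm_def)
 qed
 \<comment> \<open>Converse inclusion: for the part \<open>d\<close> of \<open>f\<close> off
   \<open>S\<close>, both kinds of Cauchy transforms of \<open>cnj u * d\<close> vanish. One kind
   because \<open>cnj u * d\<close> is a difference of elements of \<open>Hm\<close>, the other
   because \<open>u / (t - cnj v)\<close> agrees a.e. with a multiple of an element of
   \<open>S\<close>, to which \<open>d\<close> is orthogonal.\<close>
 have "to_l2 f \<in> S" if f: "f \<in> L2" "(\<lambda>t. cnj (u t) * f t) \<in> Hm" for f
 proof -
  obtain y where y: "y \<in> S" "to_l2 f - y \<in> orthogonal_complement S" using orthogonal_projection_exists[OF S] by blast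
  obtain p where p: "p \<in> L2" "y = to_l2 p" by (rule l2_cases)
  define d where "d t = f t - p t" for t
  have dL2: "d \<in> L2" unfolding d_def by (intro L2_diff f p)
  note [measurable] = L2D(1)[OF dL2]
  have dS: "to_l2 d \<in> orthogonal_complement S" using y(2) p f by (simp add: d_def[abs_def] to_l2_ops)
  have pH: "(\<lambda>t. cnj (u t) * p t) \<in> Hm" using to_Hm p y by simp
  have "AE t in lborel. cnj (u t) * d t = 0"
  proof (rule L2_zero_if_cauchy_transforms_zero[OF uL2[OF dL2]])
   fix v :: complex assume v: "0 < Im v"
   have "(LBINT t. cnj (u t) * d t / (of_real t - cnj v))
     = (LBINT t. cnj (u t) * f t / (of_real t - cnj v) - cnj (u t) * p t / (of_real t - cnj v))"
    by (simp add: d_def right_diff_distrib diff_divide_distrib)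
   also have "\<dots> = (LBINT t. cnj (u t) * f t / (of_real t - cnj v)) - (LBINT t. cnj (u t) * p t / (of_real t - cnj v))"
    using v by (intro Bochner_Integration.integral_diff L2_kernel_integrable uL2 f p) auto
   finally show "(LBINT t. cnj (u t) * d t / (of_real t - cnj v)) = 0" using HmD(2)[OF f(2) v] HmD(2)[OF pH v] by simp
   note q = quotient_kernel[OF e(1) eS v, of "cnj v0"]
   have "cinner (to_l2 (\<lambda>t. (of_real t - cnj v0) / (of_real t - cnj v) * e t)) (to_l2 d) = 0"
    using dS q(1) by (auto simp: orthogonal_complement_def)
   then have z: "(LBINT t. cnj ((of_real t - cnj v0) / (of_real t - cnj v) * e t) * d t) = 0" using q(2) dL2 by (simp only: cinner_to_l2)
   have "(LBINT t. cnj (u t) * d t / (complex_of_real t - v))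
     = (LBINT t. (1 / sqrt c) * (cnj ((of_real t - cnj v0) / (of_real t - cnj v) * e t) * d t))"
   proof (rule integral_cong_AE)
    show "AE t in lborel. cnj (u t) * d t / (complex_of_real t - v)
      = (1 / sqrt c) * (cnj ((of_real t - cnj v0) / (of_real t - cnj v) * e t) * d t)"
     using AEu by eventually_elim simp
   qed measurable
   then show "(LBINT t. cnj (u t) * d t / (complex_of_real t - v)) = 0" using z by (simp only: integral_mult_right_zero mult_zero_right)
  qed
  then have "AE t in lborel. f t = p t"
  proof eventually_elim
   case (elim t)
   have "u t \<noteq> 0" using u1[of t] by auto
   then show ?case using elim by (simp add: d_def)
  qed
  then have "to_l2 f = to_l2 p" by (rule to_l2_eqI)
  then show ?thesis using p y by simp
 qed
 then show ?thesis using um u1 to_Hm by blast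
qed

theorem beurling_dichotomy:
 "(\<exists>E\<in>sets borel. \<forall>f\<in>L2. to_l2 f \<in> S \<longleftrightarrow> (AE t in lborel. t \<notin> E \<longrightarrow> f t = 0)) \<or>
 (\<exists>u\<in>borel_measurable borel. (\<forall>t. cmod (u t) = 1) \<and> (\<forall>f\<in>L2. to_l2 f \<in> S \<longleftrightarrow> (\<lambda>t. cnj (u t) * f t) \<in> Hm))"
proof (cases "\<forall>v f. 0 < Im v \<longrightarrow> f \<in> L2 \<longrightarrow> to_l2 f \<in> S \<longrightarrow> to_l2 (\<lambda>t. (of_real t - cnj v) / (complex_of_real t - v) * f t) \<in> S")
 case True
 then show ?thesis using doubly_invariant by blast
next
 case False
 then obtain v f where "0 < Im v" "f \<in> L2" "to_l2 f \<in> S"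
  "to_l2 (\<lambda>t. (of_real t - cnj v) / (complex_of_real t - v) * f t) \<notin> S"
  by blast
 then show ?thesis using simply_invariant by blast
qed

end

section \<open>Holomorphic functions with vanishing real boundary values\<close>

lemma halfplane_open_convex: "open {z. - \<delta> < Im z}" "convex {z. - \<delta> < Im z}"
 by (simp_all add: open_halfspace_Im_gt convex_halfspace_Im_gt)

text \<open>The integral over \<open>[- R, R]\<close> equals that over the other three sides of a
  rectangle of width \<open>2 * R\<close> and height \<open>R\<close>, hence is at most
  \<open>4 * R\<close> times \<open>C / R^2\<close>. The domain reaches below the real axis, so the
  axis itself can serve as a side.\<close>

lemma line_integral_zero:
 assumes hol: "\<Phi> holomorphic_on {z. - \<delta> < Im z}" and \<delta>: "0 < \<delta>"
  and dec: "\<And>z. 0 \<le> Im z \<Longrightarrow> R0 \<le> cmod z \<Longrightarrow> cmod (\<Phi> z) \<le> C / (cmod z)\<^sup>2"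
 shows "integrable lborel (\<lambda>t. \<Phi> (complex_of_real t))" "(LBINT t. \<Phi> (complex_of_real t)) = 0"
proof -
 let ?S = "{z. - \<delta> < Im z}"
 define R1 where "R1 = max R0 1"
 have R1: "R0 \<le> R1" "1 \<le> R1" by (auto simp: R1_def)
 have cont: "continuous_on ?S \<Phi>" by (rule holomorphic_on_imp_continuous_on[OF hol])
 have cont_line: "continuous_on A (\<lambda>t. \<Phi> (complex_of_real t))" for A
  by (rule continuous_on_compose2[OF cont]) (use \<delta> in \<open>auto intro!: continuous_intros\<close>)
 have "compact ((\<lambda>t. \<Phi> (complex_of_real t)) ` {- R1..R1})" by (intro compact_continuous_image cont_line) auto
 then have "bounded ((\<lambda>t. \<Phi> (complex_of_real t)) ` {- R1..R1})" by (rule compact_imp_bounded)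
 then obtain B where B: "\<And>t. t \<in> {- R1..R1} \<Longrightarrow> cmod (\<Phi> (complex_of_real t)) \<le> B"
  unfolding bounded_iff by blast
 have B0: "0 \<le> B" using order_trans[OF norm_ge_zero B[of 0]] R1 by simp
 have C0: "0 \<le> C"
 proof -
  have "0 \<le> C / (cmod (of_real R1))\<^sup>2" using dec[of "complex_of_real R1"] R1 by (intro order_trans[OF norm_ge_zero]) auto
  then show ?thesis using R1 by (simp add: zero_le_divide_iff)
 qed
 define K where "K = B * (1 + R1\<^sup>2) + 2 * C"
 have bnd: "cmod (\<Phi> (complex_of_real t)) \<le> K * (1 / (1 + t\<^sup>2))" for t
 proof -
  have pos: "0 < 1 + t\<^sup>2" by (simp add: add_pos_nonneg)
  have "cmod (\<Phi> (complex_of_real t)) * (1 + t\<^sup>2) \<le> K"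
  proof (cases "\<bar>t\<bar> \<le> R1")
   case True
   then have "t\<^sup>2 \<le> R1\<^sup>2" by (metis abs_ge_zero power2_abs power_mono)
   then have "cmod (\<Phi> (complex_of_real t)) * (1 + t\<^sup>2) \<le> B * (1 + R1\<^sup>2)" using True B0 by (intro mult_mono B) auto
   then show ?thesis using C0 by (simp add: K_def)
  next
   case False
   then have "1 \<le> \<bar>t\<bar>" "R0 \<le> \<bar>t\<bar>" using R1 by auto
   then have t1: "1 \<le> t\<^sup>2" using one_le_power[of "\<bar>t\<bar>" 2] by simp
   have "cmod (\<Phi> (complex_of_real t)) \<le> C / t\<^sup>2"
    using dec[of "complex_of_real t"] \<open>R0 \<le> \<bar>t\<bar>\<close> by simp
   then have "cmod (\<Phi> (complex_of_real t)) * (1 + t\<^sup>2) \<le> C / t\<^sup>2 * (2 * t\<^sup>2)"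
    using t1 C0 by (intro mult_mono) auto
   also have "\<dots> = 2 * C" using t1 by auto
   finally show ?thesis using B0 by (simp add: K_def add_increasing)
  qed
  then show ?thesis using pos by (simp add: pos_le_divide_eq)
 qed
 show int: "integrable lborel (\<lambda>t. \<Phi> (complex_of_real t))"
 proof (rule Bochner_Integration.integrable_bound)
  show "integrable lborel (\<lambda>t::real. K * (1 / (1 + t\<^sup>2)))" by (intro integrable_mult_right integrable_inverse_1_plus_sq)
  show "(\<lambda>t. \<Phi> (complex_of_real t)) \<in> borel_measurable lborel"
   using borel_measurable_continuous_onI[OF cont_line[of UNIV]] by simp
  show "AE t in lborel. norm (\<Phi> (complex_of_real t)) \<le> norm (K * (1 / (1 + t\<^sup>2)))"
   unfolding real_norm_def by (intro AE_I2 order_trans[OF bnd abs_ge_self])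
 qed
 obtain \<Psi> where "\<And>z. z \<in> ?S \<Longrightarrow> (\<Psi> has_field_derivative \<Phi> z) (at z within ?S)"
  using holomorphic_convex_primitive'[OF halfplane_open_convex(2,1) hol] by blast
 then have \<Psi>: "(\<Psi> has_field_derivative \<Phi> z) (at z)" if "z \<in> ?S" for z
  using that by (subst at_within_open[OF that halfplane_open_convex(1), symmetric]) blast
 have FTC: "(LBINT t. indicator {- R..R} t *\<^sub>R \<Phi> (complex_of_real t)) = \<Psi> (complex_of_real R) - \<Psi> (complex_of_real (- R))" if "0 \<le> R" for R
 proof (rule integral_FTC_atLeastAtMost)
  show "((\<lambda>t. \<Psi> (complex_of_real t)) has_vector_derivative \<Phi> (complex_of_real t)) (at t within {- R..R})" for t
  proof (rule has_vector_derivative_at_within, rule has_vector_derivative_real_field)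
   show "(\<Psi> has_field_derivative \<Phi> (complex_of_real t)) (at (complex_of_real t))" using \<delta> by (intro \<Psi>) simp
  qed
 qed (use that cont_line in auto)
 have seg: "cmod (\<Psi> b - \<Psi> a) \<le> C / R\<^sup>2 * cmod (b - a)"
  if R: "R1 \<le> R" and ab: "\<And>z. z \<in> closed_segment a b \<Longrightarrow> 0 \<le> Im z \<and> R \<le> cmod z" for a b R
 proof (rule field_differentiable_bound[of "closed_segment a b"])
  fix z assume z: "z \<in> closed_segment a b"
  show "(\<Psi> has_field_derivative \<Phi> z) (at z within closed_segment a b)"
   by (rule has_field_derivative_at_within, rule \<Psi>) (use ab[OF z] \<delta> in auto)
  have "cmod (\<Phi> z) \<le> C / (cmod z)\<^sup>2" using ab[OF z] R R1 by (intro dec) auto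
  also have "\<dots> \<le> C / R\<^sup>2" using ab[OF z] R R1 C0 by (intro divide_left_mono power_mono mult_pos_pos) auto
  finally show "cmod (\<Phi> z) \<le> C / R\<^sup>2" .
 qed auto
 have bound: "cmod (LBINT t. indicator {- R..R} t *\<^sub>R \<Phi> (complex_of_real t)) \<le> 4 * C / R" if R: "R1 \<le> R" for R
 proof -
  have R0: "0 < R" using R R1 by simp
  let ?a = "Complex (- R) 0" and ?b = "Complex (- R) R" and ?c = "Complex R R" and ?d = "Complex R 0"
  have reC: "\<bar>Re z\<bar> = R \<or> Im z = R \<Longrightarrow> R \<le> cmod z" for z
   using abs_Re_le_cmod[of z] abs_Im_le_cmod[of z] by auto
  have same: "closed_segment (Complex a b) (Complex a c) = {Complex a ((1 - s) * b + s * c) | s. 0 \<le> s \<and> s \<le> 1}" for a b c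
   by (auto simp: closed_segment_def complex_eq_iff algebra_simps)
  have same': "closed_segment (Complex b a) (Complex c a) = {Complex ((1 - s) * b + s * c) a | s. 0 \<le> s \<and> s \<le> 1}" for a b c
   by (auto simp: closed_segment_def complex_eq_iff algebra_simps)
  have 1: "cmod (\<Psi> ?b - \<Psi> ?a) \<le> C / R\<^sup>2 * cmod (?b - ?a)"
   by (rule seg[OF R]) (use R0 in \<open>auto simp: same intro!: reC\<close>)
  have 2: "cmod (\<Psi> ?c - \<Psi> ?b) \<le> C / R\<^sup>2 * cmod (?c - ?b)"
   by (rule seg[OF R]) (use R0 in \<open>auto simp: same' intro!: reC\<close>)
  have 3: "cmod (\<Psi> ?d - \<Psi> ?c) \<le> C / R\<^sup>2 * cmod (?d - ?c)"
   by (rule seg[OF R]) (use R0 in \<open>auto simp: same intro!: reC mult_left_le_one_le\<close>)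
  have n: "cmod (?b - ?a) = R" "cmod (?c - ?b) = 2 * R" "cmod (?d - ?c) = R" using R0 by (auto simp: complex_diff cmod_def real_sqrt_mult)
  have eqn: "\<Psi> ?d - \<Psi> ?a = (\<Psi> ?b - \<Psi> ?a) + (\<Psi> ?c - \<Psi> ?b) + (\<Psi> ?d - \<Psi> ?c)" by simp
  have "cmod (\<Psi> ?d - \<Psi> ?a) \<le> cmod (\<Psi> ?b - \<Psi> ?a) + cmod (\<Psi> ?c - \<Psi> ?b) + cmod (\<Psi> ?d - \<Psi> ?c)"
   unfolding eqn by (rule order_trans[OF norm_triangle_ineq add_right_mono[OF norm_triangle_ineq]])
  also have "\<dots> \<le> C / R\<^sup>2 * R + C / R\<^sup>2 * (2 * R) + C / R\<^sup>2 * R" using 1 2 3 unfolding n by linarith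
  also have "\<dots> = 4 * C / R" using R0 by (simp add: power2_eq_square field_simps)
  finally show ?thesis using R0 by (simp add: FTC Complex_eq)
 qed
 have conv: "((\<lambda>R. LBINT t. indicator {- R..R} t *\<^sub>R \<Phi> (complex_of_real t)) \<longlongrightarrow> (LBINT t. \<Phi> (complex_of_real t))) at_top"
 proof (rule integral_dominated_convergence_at_top[where w="\<lambda>t. norm (\<Phi> (complex_of_real t))"])
  note [measurable] = borel_measurable_integrable[OF int]
  show "(\<lambda>t. \<Phi> (complex_of_real t)) \<in> borel_measurable lborel" "\<And>R. (\<lambda>t. indicator {- R..R} t *\<^sub>R \<Phi> (complex_of_real t)) \<in> borel_measurable lborel"
   by measurable
  show "integrable lborel (\<lambda>t. norm (\<Phi> (complex_of_real t)))" by (rule integrable_norm[OF int])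
  show "AE t in lborel. ((\<lambda>R. indicator {- R..R} t *\<^sub>R \<Phi> (complex_of_real t)) \<longlongrightarrow> \<Phi> (complex_of_real t)) at_top"
  proof (rule AE_I2)
   fix t :: real
   have "\<forall>\<^sub>F R in at_top. \<Phi> (complex_of_real t) = indicator {- R..R} t *\<^sub>R \<Phi> (complex_of_real t)"
    using eventually_ge_at_top[of "\<bar>t\<bar>"] by eventually_elim (auto simp: indicator_def)
   then show "((\<lambda>R. indicator {- R..R} t *\<^sub>R \<Phi> (complex_of_real t)) \<longlongrightarrow> \<Phi> (complex_of_real t)) at_top"
    by (rule Lim_transform_eventually[OF tendsto_const])
  qed
  show "\<forall>\<^sub>F R in at_top. AE t in lborel. norm (indicator {- R..R} t *\<^sub>R \<Phi> (complex_of_real t)) \<le> norm (\<Phi> (complex_of_real t))"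
   by (intro always_eventually allI AE_I2) (auto simp: indicator_def)
 qed
 have "((\<lambda>R. 4 * C / R) \<longlongrightarrow> 0) at_top"
  by (intro tendsto_divide_0[OF tendsto_const] filterlim_at_top_imp_at_infinity filterlim_ident)
 moreover have "\<forall>\<^sub>F R in at_top. norm (LBINT t. indicator {- R..R} t *\<^sub>R \<Phi> (complex_of_real t)) \<le> 4 * C / R"
  using eventually_ge_at_top[of R1] by eventually_elim (rule bound)
 ultimately have "((\<lambda>R. LBINT t. indicator {- R..R} t *\<^sub>R \<Phi> (complex_of_real t)) \<longlongrightarrow> 0) at_top"
  by (rule Lim_null_comparison[rotated])
 then show "(LBINT t. \<Phi> (complex_of_real t)) = 0" by (rule tendsto_unique[OF trivial_limit_at_top_linorder conv])
qed

lemma cmod_diff_ge_half: "2 * cmod w \<le> cmod z \<Longrightarrow> cmod z / 2 \<le> cmod (z - w)"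
 using norm_triangle_ineq2[of z w] by linarith

text \<open>The contour lemma is applied to \<open>(E z - E w) / ((z - w) * (z - cnj w))\<close>,
  whose singularity at \<open>w\<close> is removable; on the real line \<open>1 / |t - w|^2\<close>
  is the Poisson kernel up to the factor \<open>pi / Im w\<close>.\<close>

lemma bounded_holomorphic_poisson:
 fixes E :: "complex \<Rightarrow> complex"
 assumes E: "E holomorphic_on {z. - \<delta> < Im z}" and \<delta>: "0 < \<delta>" and E1: "\<And>z. 0 \<le> Im z \<Longrightarrow> cmod (E z) \<le> 1"
  and w: "0 < Im w"
 shows "(LBINT t. poisson w t * E (complex_of_real t)) = E w"
proof -
 \<comment> \<open>Keeps the pole \<open>cnj w\<close> outside the half-plane of holomorphy.\<close>
 define d where "d = min \<delta> (Im w)"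
 have d: "0 < d" "d \<le> \<delta>" "d \<le> Im w" using \<delta> w by (auto simp: d_def)
 let ?S = "{z. - d < Im z}"
 have ES: "E holomorphic_on ?S" by (rule holomorphic_on_subset[OF E]) (use d in auto)
 define g where "g z = (if z = w then deriv E w else (E z - E w) / (z - w))" for z
 have g: "g holomorphic_on ?S" unfolding g_def by (rule pole_lemma_open[OF ES halfplane_open_convex(1)])
 define \<Phi> where "\<Phi> z = g z / (z - cnj w)" for z
 have hol: "\<Phi> holomorphic_on ?S" unfolding \<Phi>_def using d by (intro holomorphic_intros g) (auto simp: complex_eq_iff)
 have dec: "cmod (\<Phi> z) \<le> 8 / (cmod z)\<^sup>2" if z: "0 \<le> Im z" "2 * cmod w + 1 \<le> cmod z" for z
 proof -
  have z0: "0 < cmod z" using z norm_ge_zero[of w] by linarith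
  have 1: "cmod z / 2 \<le> cmod (z - w)" "cmod z / 2 \<le> cmod (z - cnj w)" using z by (intro cmod_diff_ge_half; simp)+
  then have "z \<noteq> w" using z0 by auto
  then have "cmod (\<Phi> z) = cmod (E z - E w) / (cmod (z - w) * cmod (z - cnj w))" by (simp add: \<Phi>_def g_def norm_divide norm_mult)
  also have "\<dots> \<le> 2 / (cmod z / 2 * (cmod z / 2))"
  proof (intro frac_le mult_mono 1)
   show "cmod (E z - E w) \<le> 2" using norm_triangle_ineq4[of "E z" "E w"] E1[of z] E1[of w] z w by simp
  qed (use z0 in auto)
  finally show ?thesis by (simp add: power2_eq_square)
 qed
 note z = line_integral_zero[OF hol d(1) dec]
 have eq: "\<Phi> (complex_of_real t) = (pi / Im w) * (poisson w t * E (complex_of_real t)) - (pi / Im w) * E w * poisson w t" for t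
 proof -
  have nz: "complex_of_real t - w \<noteq> 0" "complex_of_real t \<noteq> w" using of_real_diff_nonzero[of w t] w by auto
  have "(complex_of_real t - w) * (of_real t - cnj w) = complex_of_real ((cmod (of_real t - w))\<^sup>2)"
   using complex_norm_square[of "of_real t - w"] by simp
  then have "\<Phi> (complex_of_real t) = (E (complex_of_real t) - E w) / complex_of_real ((cmod (of_real t - w))\<^sup>2)"
   using nz by (simp add: \<Phi>_def g_def)
  also have "1 / complex_of_real ((cmod (of_real t - w))\<^sup>2) = complex_of_real (pi / Im w * poisson w t)"
   using w by (simp add: poisson_def)
  then have "(E (complex_of_real t) - E w) / complex_of_real ((cmod (of_real t - w))\<^sup>2) = (E (complex_of_real t) - E w) * complex_of_real (pi / Im w * poisson w t)"
   by (metis divide_inverse inverse_eq_divide)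
  finally show ?thesis by (simp add: algebra_simps diff_divide_distrib)
 qed
 have Em: "(\<lambda>t. E (complex_of_real t)) \<in> borel_measurable borel"
  by (rule borel_measurable_continuous_onI, rule continuous_on_compose2[OF holomorphic_on_imp_continuous_on[OF ES]])
   (use d in \<open>auto intro!: continuous_intros\<close>)
 have iE: "integrable lborel (\<lambda>t. poisson w t * E (complex_of_real t))"
 proof (rule Bochner_Integration.integrable_bound)
  show "integrable lborel (poisson w)" using w by (intro poisson_integrable) simp
  show "AE t in lborel. norm (poisson w t * E (complex_of_real t)) \<le> norm (poisson w t)"
   using E1 poisson_nonneg[OF w] by (intro AE_I2) (simp add: norm_mult mult_left_le)
 qed (use Em in measurable)
 have "(LBINT t. \<Phi> (complex_of_real t)) = (pi / Im w) * (LBINT t. poisson w t * E (complex_of_real t)) - (pi / Im w) * E w * (LBINT t. poisson w t)"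
  unfolding eq using iE poisson_integrable[of w] w by (simp del: times_divide_eq_left)
 then have "(pi / Im w) * ((LBINT t. poisson w t * E (complex_of_real t)) - E w) = 0"
  using z(2) by (simp only: poisson_integral[OF w] right_diff_distrib of_real_1 mult_1_right)
 moreover have "complex_of_real (pi / Im w) \<noteq> 0" using w by simp
 ultimately show ?thesis by simp
qed

text \<open>Moments of the weight \<open>|t - w|^(-4)\<close>; the first one vanishes by reflection
  about \<open>Re w\<close>.\<close>

lemma quartic_kernel_integrable:
 assumes "0 < Im w"
 shows "integrable lborel (\<lambda>t. 1 / (cmod (of_real t - w)) ^ 4)"
  "integrable lborel (\<lambda>t. (t - Re w) / (cmod (of_real t - w)) ^ 4)"
  "(LBINT t. (t - Re w) / (cmod (of_real t - w)) ^ 4) = 0"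
  "0 < (LBINT t. 1 / (cmod (of_real t - w)) ^ 4)"
proof -
 let ?n = "\<lambda>t. cmod (of_real t - w)"
 have ge: "Im w \<le> ?n t" for t using cmod_of_real_diff_ge[of w t] assms by simp
 then have pos: "0 < ?n t" for t using assms by (meson less_le_trans)
 have k2: "integrable lborel (\<lambda>t. 1 / (?n t)\<^sup>2)" using assms by (intro kernel_sq_integrable) simp
 show i: "integrable lborel (\<lambda>t. 1 / (?n t) ^ 4)"
 proof (rule Bochner_Integration.integrable_bound)
  show "integrable lborel (\<lambda>t. 1 / (Im w)\<^sup>2 * (1 / (?n t)\<^sup>2))" using k2 by (rule integrable_mult_right)
  have "1 / (?n t) ^ 4 \<le> 1 / (Im w)\<^sup>2 * (1 / (?n t)\<^sup>2)" for t
  proof -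
   have "(Im w)\<^sup>2 * (?n t)\<^sup>2 \<le> (?n t)\<^sup>2 * (?n t)\<^sup>2" using ge assms by (intro mult_right_mono power_mono) auto
   also have "\<dots> = (?n t) ^ 4" by (simp add: power_add[symmetric])
   finally have "1 / (?n t) ^ 4 \<le> 1 / ((Im w)\<^sup>2 * (?n t)\<^sup>2)"
    using pos[of t] assms by (intro divide_left_mono mult_pos_pos) auto
   then show ?thesis by simp
  qed
  then show "AE t in lborel. norm (1 / (?n t) ^ 4) \<le> norm (1 / (Im w)\<^sup>2 * (1 / (?n t)\<^sup>2))" by (intro AE_I2) auto
 qed measurable
 show "integrable lborel (\<lambda>t. (t - Re w) / (?n t) ^ 4)"
 proof (rule Bochner_Integration.integrable_bound)
  show "integrable lborel (\<lambda>t. 1 / Im w * (1 / (?n t)\<^sup>2))" using k2 by (rule integrable_mult_right)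
  have "\<bar>t - Re w\<bar> / (?n t) ^ 4 \<le> 1 / Im w * (1 / (?n t)\<^sup>2)" for t
  proof -
   have "\<bar>t - Re w\<bar> \<le> ?n t" using abs_Re_le_cmod[of "complex_of_real t - w"] by simp
   then have "\<bar>t - Re w\<bar> / (?n t) ^ 4 \<le> ?n t / (?n t) ^ 4" using pos[of t] by (intro divide_right_mono) auto
   also have "\<dots> = 1 / ?n t * (1 / (?n t)\<^sup>2)" using pos[of t] by (simp add: power2_eq_square power4_eq_xxxx)
   also have "\<dots> \<le> 1 / Im w * (1 / (?n t)\<^sup>2)"
    using ge[of t] pos[of t] assms by (intro mult_right_mono divide_left_mono) auto
   finally show ?thesis .
  qed
  then show "AE t in lborel. norm ((t - Re w) / (?n t) ^ 4) \<le> norm (1 / Im w * (1 / (?n t)\<^sup>2))"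
   using assms by (intro AE_I2) auto
 qed measurable
 have n4: "(?n t) ^ 4 = ((t - Re w)\<^sup>2 + (Im w)\<^sup>2)\<^sup>2" for t
  unfolding cmod_real_diff_sq[symmetric] by (simp add: power_mult[symmetric])
 let ?J = "LBINT t. (t - Re w) / (?n t) ^ 4"
 have "?J = \<bar>-1\<bar> *\<^sub>R (LBINT t. (2 * Re w + (-1) * t - Re w) / ((2 * Re w + (-1) * t - Re w)\<^sup>2 + (Im w)\<^sup>2)\<^sup>2)"
  unfolding n4 by (rule lborel_integral_real_affine) simp
 also have "\<dots> = (LBINT t. - ((t - Re w) / (?n t) ^ 4))"
 proof -
  have m: "2 * Re w + (- 1) * t - Re w = - (t - Re w)" for t by simp
  show ?thesis unfolding n4 m power2_minus by (simp only: abs_minus_cancel abs_one scaleR_one minus_divide_left[symmetric])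
 qed
 also have "\<dots> = - ?J" by simp
 finally show "?J = 0" by simp
 show "0 < (LBINT t. 1 / (?n t) ^ 4)"
 proof (rule ccontr)
  assume "\<not> ?thesis"
  moreover have "0 \<le> (LBINT t. 1 / (?n t) ^ 4)" by (intro integral_nonneg_AE AE_I2) simp
  ultimately have "(LBINT t. 1 / (?n t) ^ 4) = 0" by simp
  then have "AE t in lborel. 1 / (?n t) ^ 4 = 0" using i by (subst (asm) integral_nonneg_eq_0_iff_AE) auto
  then have "AE t in lborel. complex_of_real (1 / (?n t) ^ 4) = 0" by simp
  moreover have "?n t \<noteq> 0" for t using pos[of t] by simp
  then have "continuous_on UNIV (\<lambda>t. complex_of_real (1 / (?n t) ^ 4))" by (intro continuous_intros) auto
  ultimately have "complex_of_real (1 / (?n 0) ^ 4) = 0" by (rule continuous_AE_zero[rotated])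
  then show False using pos[of 0] by simp
 qed
qed

text \<open>The weight tolerates quadratic growth of \<open>k\<close>. Subtracting the first-order
  Taylor polynomial at \<open>w\<close> removes the double pole; the odd part of that polynomial
  about \<open>Re w\<close> integrates to 0, and the rest gives the factor on the right, which
  vanishes for \<open>k z = - \<i> * s * z + \<i> * \<theta>\<close> with real \<open>s\<close> and
  \<open>\<theta>\<close>.\<close>

lemma quartic_kernel_formula:
 assumes k: "k holomorphic_on {z. - \<delta> < Im z}" and \<delta>: "0 < \<delta>"
  and gr: "\<And>z. 0 \<le> Im z \<Longrightarrow> 1 \<le> cmod z \<Longrightarrow> cmod (k z) \<le> C * (cmod z)\<^sup>2" and w: "0 < Im w"
 shows "integrable lborel (\<lambda>t. Re (k (complex_of_real t)) / (cmod (of_real t - w)) ^ 4)"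
  and "(LBINT t. Re (k (complex_of_real t)) / (cmod (of_real t - w)) ^ 4)
   = (Re (k w) + Im w * Im (deriv k w)) * (LBINT t. 1 / (cmod (of_real t - w)) ^ 4)"
proof -
 define d where "d = min \<delta> (Im w)"
 have d: "0 < d" "d \<le> \<delta>" "d \<le> Im w" using \<delta> w by (auto simp: d_def)
 let ?S = "{z. - d < Im z}"
 have kS: "k holomorphic_on ?S" by (rule holomorphic_on_subset[OF k]) (use d in auto)
 define g1 where "g1 z = (if z = w then deriv k w else (k z - k w) / (z - w))" for z
 have g1: "g1 holomorphic_on ?S" unfolding g1_def by (rule pole_lemma_open[OF kS halfplane_open_convex(1)])
 define g2 where "g2 z = (if z = w then deriv g1 w else (g1 z - g1 w) / (z - w))" for z
 have g2: "g2 holomorphic_on ?S" unfolding g2_def by (rule pole_lemma_open[OF g1 halfplane_open_convex(1)])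
 have g2_eq: "g2 z = (k z - k w - deriv k w * (z - w)) / (z - w)\<^sup>2" if "z \<noteq> w" for z
  using that by (simp add: g2_def g1_def power2_eq_square divide_simps)
 define \<Phi> where "\<Phi> z = g2 z / (z - cnj w)\<^sup>2" for z
 have hol: "\<Phi> holomorphic_on ?S"
 proof -
  have "z - cnj w \<noteq> 0" if "z \<in> ?S" for z using that d by (auto simp: complex_eq_iff)
  then show ?thesis unfolding \<Phi>_def by (intro holomorphic_intros g2) auto
 qed
 define M where "M = 16 * (C + cmod (k w) + 2 * cmod (deriv k w))"
 have dec: "cmod (\<Phi> z) \<le> M / (cmod z)\<^sup>2" if z: "0 \<le> Im z" "2 * cmod w + 1 \<le> cmod z" for z
 proof -
  have z1: "1 \<le> cmod z" "2 * cmod w \<le> cmod z" using z norm_ge_zero[of w] by linarith+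
  have z2: "1 \<le> (cmod z)\<^sup>2" "cmod z \<le> (cmod z)\<^sup>2"
   using z1 one_le_power[of "cmod z" 2] self_le_power[of "cmod z" 2] by auto
  have 1: "cmod z / 2 \<le> cmod (z - w)" "cmod z / 2 \<le> cmod (z - cnj w)" using z1 by (intro cmod_diff_ge_half; simp)+
  then have "z \<noteq> w" using z1 by auto
  have zw: "cmod (z - w) \<le> 2 * cmod z" using norm_triangle_ineq4[of z w] z1 norm_ge_zero[of w] by linarith
  have num: "cmod (k z - k w - deriv k w * (z - w)) \<le> (C + cmod (k w) + 2 * cmod (deriv k w)) * (cmod z)\<^sup>2"
  proof -
   have "cmod (k z - k w - deriv k w * (z - w)) \<le> cmod (k z) + cmod (k w) + cmod (deriv k w * (z - w))"
    by (rule order_trans[OF norm_triangle_ineq4 add_right_mono[OF norm_triangle_ineq4]])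
   also have "cmod (deriv k w * (z - w)) \<le> cmod (deriv k w) * (2 * (cmod z)\<^sup>2)"
    unfolding norm_mult using zw z2 by (intro mult_left_mono) auto
   also have "cmod (k w) \<le> cmod (k w) * (cmod z)\<^sup>2" using z2 mult_left_mono[of 1 "(cmod z)\<^sup>2" "cmod (k w)"] by simp
   finally show ?thesis using gr[OF z(1) z1(1)] by (simp add: algebra_simps)
  qed
  have "cmod (\<Phi> z) = cmod (k z - k w - deriv k w * (z - w)) / ((cmod (z - w))\<^sup>2 * (cmod (z - cnj w))\<^sup>2)"
   using \<open>z \<noteq> w\<close> by (simp add: \<Phi>_def g2_eq norm_divide norm_mult flip: norm_power)
  also have "\<dots> \<le> ((C + cmod (k w) + 2 * cmod (deriv k w)) * (cmod z)\<^sup>2) / ((cmod z / 2)\<^sup>2 * (cmod z / 2)\<^sup>2)"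
   using z1 order_trans[OF norm_ge_zero num] by (intro frac_le num mult_mono power_mono 1 mult_pos_pos) auto
  also have "\<dots> = M / (cmod z)\<^sup>2"
  proof -
   have "a * c\<^sup>2 / ((c / 2)\<^sup>2 * (c / 2)\<^sup>2) = 16 * a / c\<^sup>2" if "c \<noteq> 0" for a c :: real
    using that by (simp add: power2_eq_square)
   moreover have "cmod z \<noteq> 0" using z1 by auto
   ultimately show ?thesis by (simp only: M_def)
  qed
  finally show ?thesis .
 qed
 note Z = line_integral_zero[OF hol d(1) dec]
 let ?n = "\<lambda>t. cmod (of_real t - w)"
 have nz: "complex_of_real t - w \<noteq> 0" for t using w by (intro of_real_diff_nonzero) simp
 have eq: "\<Phi> (complex_of_real t) = (k (complex_of_real t) - k w - deriv k w * (complex_of_real t - w)) / complex_of_real ((?n t) ^ 4)" for t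
 proof -
  have "(complex_of_real t - w)\<^sup>2 * (of_real t - cnj w)\<^sup>2 = ((complex_of_real t - w) * (of_real t - cnj w))\<^sup>2"
   by (simp add: power_mult_distrib)
  also have "(complex_of_real t - w) * (of_real t - cnj w) = complex_of_real ((?n t)\<^sup>2)"
   using complex_norm_square[of "of_real t - w"] by simp
  finally have "(complex_of_real t - w)\<^sup>2 * (of_real t - cnj w)\<^sup>2 = complex_of_real ((?n t) ^ 4)"
   by (simp add: power_mult[symmetric] del: of_real_power flip: of_real_power)
  then show ?thesis using nz[of t] by (simp add: \<Phi>_def g2_eq)
 qed
 have re: "Re (k (complex_of_real t)) / (?n t) ^ 4 = Re (\<Phi> (complex_of_real t)) + (Re (k w) + Im w * Im (deriv k w)) * (1 / (?n t) ^ 4)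
   + Re (deriv k w) * ((t - Re w) / (?n t) ^ 4)" for t
 proof -
  have "Re (\<Phi> (complex_of_real t)) = Re (k (complex_of_real t) - k w - deriv k w * (complex_of_real t - w)) / (?n t) ^ 4"
   unfolding eq by (rule Re_divide_of_real)
  also have "Re (k (complex_of_real t) - k w - deriv k w * (complex_of_real t - w))
    = Re (k (complex_of_real t)) - Re (k w) - Re (deriv k w) * (t - Re w) - Im (deriv k w) * Im w"
   by (simp add: algebra_simps)
  finally show ?thesis by (simp add: diff_divide_distrib add_divide_distrib algebra_simps)
 qed
 note Q = quartic_kernel_integrable[OF w]
 show "integrable lborel (\<lambda>t. Re (k (complex_of_real t)) / (?n t) ^ 4)"
  unfolding re by (intro Bochner_Integration.integrable_add integrable_mult_right integrable_Re Z Q)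
 have "(LBINT t. Re (\<Phi> (complex_of_real t))) = 0" using Z by (subst integral_Re) auto
 moreover have "(LBINT t. Re (k (complex_of_real t)) / (?n t) ^ 4)
   = (LBINT t. Re (\<Phi> (complex_of_real t))) + (LBINT t. (Re (k w) + Im w * Im (deriv k w)) * (1 / (?n t) ^ 4))
    + (LBINT t. Re (deriv k w) * ((t - Re w) / (?n t) ^ 4))"
  unfolding re using integrable_Re[OF Z(1)] integrable_mult_right[OF Q(1)] integrable_mult_right[OF Q(2)]
  by (simp only: Bochner_Integration.integral_add Bochner_Integration.integrable_add)
 ultimately show "(LBINT t. Re (k (complex_of_real t)) / (?n t) ^ 4)
   = (Re (k w) + Im w * Im (deriv k w)) * (LBINT t. 1 / (?n t) ^ 4)"
  by (simp only: integral_mult_right_zero Q(3))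
qed

text \<open>Transported to the disc by the Cayley transform, this is the Schwarz lemma for
 \<open>(K - a) / (K + cnj a)\<close> with \<open>K = k + 1\<close> and \<open>a = K \<i>\<close>.\<close>

lemma positive_real_part_growth:
 assumes k: "k holomorphic_on {z. 0 < Im z}" and p: "\<And>z. 0 < Im z \<Longrightarrow> 0 \<le> Re (k z)" and z: "0 < Im z"
 shows "cmod (k z + 1) \<le> cmod (k \<i> + 1) * (cmod (z + \<i>))\<^sup>2 / Im z"
proof -
 define a where "a = k \<i> + 1"
 define m where "m \<zeta> = \<i> * (1 + \<zeta>) / (1 - \<zeta>)" for \<zeta> :: complex
 define f where "f \<zeta> = (k (m \<zeta>) + 1 - a) / (k (m \<zeta>) + 1 + cnj a)" for \<zeta>
 have a: "1 \<le> Re a" using p[of \<i>] by (simp add: a_def)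
 have m: "0 < Im (m \<zeta>)" if "cmod \<zeta> < 1" for \<zeta>
 proof -
  have n1: "1 - \<zeta> \<noteq> 0" using that by auto
  have "m \<zeta> = \<i> * (1 + \<zeta>) * cnj (1 - \<zeta>) / complex_of_real ((cmod (1 - \<zeta>))\<^sup>2)"
   using n1 complex_norm_square[of "1 - \<zeta>"] by (simp add: m_def)
  then have "Im (m \<zeta>) = Im (\<i> * (1 + \<zeta>) * cnj (1 - \<zeta>)) / (cmod (1 - \<zeta>))\<^sup>2"
   by (simp only: Im_divide_of_real)
  also have "Im (\<i> * (1 + \<zeta>) * cnj (1 - \<zeta>)) = 1 - (cmod \<zeta>)\<^sup>2"
   unfolding cmod_power2 by (simp add: power2_eq_square algebra_simps)
  finally show ?thesis using n1 that by (simp add: abs_square_less_1)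
 qed
 have sq: "(cmod (K - a))\<^sup>2 = (cmod (K + cnj a))\<^sup>2 - 4 * Re K * Re a" for K
  unfolding cmod_power2 by (simp add: power2_eq_square algebra_simps)
 have K1: "1 \<le> Re (k (m \<zeta>) + 1)" if "cmod \<zeta> < 1" for \<zeta> using p[OF m[OF that]] by simp
 have den: "k (m \<zeta>) + 1 + cnj a \<noteq> 0" if "cmod \<zeta> < 1" for \<zeta>
 proof -
  have "0 < Re (k (m \<zeta>) + 1 + cnj a)" using K1[OF that] a by simp
  then show ?thesis by (metis less_irrefl zero_complex.simps(1))
 qed
 have km: "(\<lambda>\<zeta>. k (m \<zeta>)) holomorphic_on ball 0 1" unfolding m_def
  by (rule holomorphic_on_compose_gen[OF _ k, unfolded o_def]) (use m in \<open>auto intro!: holomorphic_intros simp: m_def\<close>)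
 have "f holomorphic_on ball 0 1" unfolding f_def using den by (intro holomorphic_intros km) auto
 moreover have "f 0 = 0" by (simp add: f_def m_def a_def)
 moreover have "cmod (f \<zeta>) < 1" if "cmod \<zeta> < 1" for \<zeta>
 proof -
  have "(cmod (k (m \<zeta>) + 1 - a))\<^sup>2 < (cmod (k (m \<zeta>) + 1 + cnj a))\<^sup>2" using K1[OF that] a by (simp add: sq)
  then have "cmod (k (m \<zeta>) + 1 - a) < cmod (k (m \<zeta>) + 1 + cnj a)" by (simp add: power2_less_imp_less)
  then show ?thesis using den[OF that] by (simp add: f_def norm_divide)
 qed
 ultimately have schwarz: "cmod (f \<zeta>) \<le> cmod \<zeta>" if "cmod \<zeta> < 1" for \<zeta>
  using Schwarz_Lemma(1)[of f \<zeta>] that by blast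
 define \<zeta> where "\<zeta> = (z - \<i>) / (z + \<i>)"
 have zi: "z + \<i> \<noteq> 0" using z by (auto simp: complex_eq_iff)
 have c1: "1 - (cmod \<zeta>)\<^sup>2 = 4 * Im z / (cmod (z + \<i>))\<^sup>2"
 proof -
  have "(cmod (z + \<i>))\<^sup>2 - (cmod (z - \<i>))\<^sup>2 = 4 * Im z"
   unfolding cmod_power2 by (simp add: power2_eq_square algebra_simps)
  then show ?thesis using zi by (simp add: \<zeta>_def norm_divide power_divide diff_divide_eq_iff)
 qed
 moreover have "0 < 4 * Im z / (cmod (z + \<i>))\<^sup>2" using z zi by simp
 ultimately have c2: "cmod \<zeta> < 1" by (metis abs_norm_cancel abs_square_less_1 diff_gt_0_iff_gt)
 have mz: "m \<zeta> = z"
 proof -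
  have "1 + \<zeta> = 2 * z / (z + \<i>)" "1 - \<zeta> = 2 * \<i> / (z + \<i>)" using zi by (simp_all add: \<zeta>_def field_simps)
  then show ?thesis using zi by (simp add: m_def)
 qed
 define K where "K = k z + 1"
 have "cmod (K - a) \<le> cmod \<zeta> * cmod (K + cnj a)"
  using schwarz[OF c2] den[OF c2] by (simp add: f_def mz K_def norm_divide pos_divide_le_eq)
 moreover have "cmod K - cmod a \<le> cmod (K - a)" by (rule norm_triangle_ineq2)
 moreover have "cmod \<zeta> * cmod (K + cnj a) \<le> cmod \<zeta> * (cmod K + cmod a)"
  using norm_triangle_ineq[of K "cnj a"] by (intro mult_left_mono) auto
 ultimately have "cmod K * (1 - cmod \<zeta>) \<le> cmod a * (1 + cmod \<zeta>)" by (simp add: algebra_simps)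
 also have "\<dots> \<le> cmod a * 2" using c2 by (intro mult_left_mono) auto
 finally have k2: "cmod K * (1 - cmod \<zeta>) \<le> cmod a * 2" .
 have "1 - (cmod \<zeta>)\<^sup>2 = (1 - cmod \<zeta>) * (1 + cmod \<zeta>)" by (simp add: power2_eq_square algebra_simps)
 also have "\<dots> \<le> (1 - cmod \<zeta>) * 2" using c2 by (intro mult_left_mono) auto
 finally have "2 * Im z / (cmod (z + \<i>))\<^sup>2 \<le> 1 - cmod \<zeta>" using c1 by simp
 then have "cmod K * (2 * Im z / (cmod (z + \<i>))\<^sup>2) \<le> cmod K * (1 - cmod \<zeta>)" by (intro mult_left_mono) auto
 with k2 have "cmod K * (2 * Im z / (cmod (z + \<i>))\<^sup>2) \<le> cmod a * 2" by linarith
 then show ?thesis using z zi by (simp add: K_def a_def field_simps)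
qed


section \<open>Holomorphic functions determined by equations for their real part\<close>

lemma Re_line_derivative:
 assumes "(f has_field_derivative D) (at z)"
 shows "((\<lambda>t::real. Re (f (z + of_real t * c))) has_real_derivative Re (c * D)) (at 0)"
proof -
 have "((\<lambda>t::real. z + of_real t * c) has_vector_derivative c) (at 0)" by (auto intro!: derivative_eq_intros)
 then have "(f \<circ> (\<lambda>t::real. z + of_real t * c) has_vector_derivative c * D) (at 0)"
  by (rule field_vector_diff_chain_at) (use assms in simp)
 then have "((\<lambda>t::real. Re ((f \<circ> (\<lambda>t::real. z + of_real t * c)) t)) has_vector_derivative Re (c * D)) (at 0)"
  by (rule bounded_linear.has_vector_derivative[OF bounded_linear_Re])
 then show ?thesis by (simp add: has_real_derivative_iff_has_vector_derivative o_def)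
qed

lemma eventually_line_in_halfplane:
 assumes "0 < Im z"
 shows "\<forall>\<^sub>F t::real in nhds 0. 0 < Im (z + of_real t * c)"
proof -
 have "open {t::real. 0 < Im (z + of_real t * c)}" by (intro open_Collect_less continuous_intros)
 from eventually_nhds_in_open[OF this, of 0] show ?thesis using assms by simp
qed

lemma halfplane_deriv:
 assumes "f holomorphic_on {z. 0 < Im z}" "0 < Im z"
 shows "(f has_field_derivative deriv f z) (at z)" "deriv f holomorphic_on {z. 0 < Im z}"
 using assms by (auto intro!: holomorphic_derivI holomorphic_deriv simp: open_halfspace_Im_gt)

text \<open>Directional derivatives of \<open>Re f\<close> along 1 and \<open>\<i>\<close> recover
  both parts of the complex derivative.\<close>

lemma deriv_zero_if_Re_zero:
 assumes f: "f holomorphic_on {z. 0 < Im z}" and 0: "\<And>z. 0 < Im z \<Longrightarrow> Re (f z) = 0" and z: "0 < Im z"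
 shows "deriv f z = 0"
proof -
 have "Re (c * deriv f z) = 0" for c
 proof (rule DERIV_unique)
  show "((\<lambda>t::real. Re (f (z + of_real t * c))) has_real_derivative Re (c * deriv f z)) (at 0)"
   by (rule Re_line_derivative[OF halfplane_deriv(1)[OF f z]])
  have ev: "\<forall>\<^sub>F t::real in nhds 0. Re (f (z + of_real t * c)) = 0"
   using eventually_line_in_halfplane[OF z, of c] by eventually_elim (rule 0)
  show "((\<lambda>t::real. Re (f (z + of_real t * c))) has_real_derivative 0) (at 0)" by (subst DERIV_cong_ev[OF refl ev refl]) simp
 qed
 from this[of 1] this[of \<i>] show ?thesis by (simp add: complex_eq_iff)
qed

lemma halfplane_constant_if_deriv_zero:
 assumes "f holomorphic_on {z. 0 < Im z}" "\<And>z. 0 < Im z \<Longrightarrow> deriv f z = 0"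
 obtains c where "\<And>z. 0 < Im z \<Longrightarrow> f z = c"
proof -
 have "\<exists>c. \<forall>z\<in>{z. 0 < Im z}. f z = c"
 proof (rule has_field_derivative_zero_constant)
  fix z assume z: "z \<in> {z. 0 < Im z}"
  show "(f has_field_derivative 0) (at z within {z. 0 < Im z})"
   by (rule has_field_derivative_at_within) (use halfplane_deriv(1)[OF assms(1), of z] assms(2)[of z] z in auto)
 qed (rule convex_halfspace_Im_gt)
 then show ?thesis using that by auto
qed

text \<open>Differentiating \<open>Re k + Im z * Im k'\<close> in the direction \<open>\<i>\<close>
  leaves \<open>Im z * Re k''\<close>. Hence \<open>k''\<close> is an imaginary constant and
  \<open>k\<close> is quadratic. On the line \<open>Im z = 1\<close> the equation and positivity
  concern affine functions of \<open>x\<close>, which leaves only the stated form.\<close>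

lemma affine_if_Re_equation:
 assumes k: "k holomorphic_on {z. 0 < Im z}" and p: "\<And>z. 0 < Im z \<Longrightarrow> 0 \<le> Re (k z)"
  and e: "\<And>z. 0 < Im z \<Longrightarrow> Re (k z) + Im z * Im (deriv k z) = 0"
 obtains s \<theta> :: real where "0 \<le> s" "\<And>z. 0 < Im z \<Longrightarrow> k z = - \<i> * of_real s * z + \<i> * of_real \<theta>"
proof -
 let ?H = "{z. 0 < Im z}"
 have k1: "deriv k holomorphic_on ?H" and k2: "deriv (deriv k) holomorphic_on ?H"
  by (auto intro!: holomorphic_deriv k simp: open_halfspace_Im_gt)
 have "Re (deriv (deriv k) z) = 0" if z: "0 < Im z" for z
 proof -
  have "Re (\<i> * deriv k z) + (1 * Re (- \<i> * deriv k z) + Re (\<i> * (- \<i> * deriv (deriv k) z)) * (Im z + 0)) = 0"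
  proof (rule DERIV_unique)
   have d2: "((\<lambda>z. - \<i> * deriv k z) has_field_derivative - \<i> * deriv (deriv k) z) (at z)"
    by (rule DERIV_cmult[OF halfplane_deriv(1)[OF k1 z]])
   have l: "((\<lambda>t. Im z + t) has_real_derivative 1) (at 0)" by (auto intro!: derivative_eq_intros)
   show "((\<lambda>t::real. Re (k (z + of_real t * \<i>)) + (Im z + t) * Re (- \<i> * deriv k (z + of_real t * \<i>))) has_real_derivative
     Re (\<i> * deriv k z) + (1 * Re (- \<i> * deriv k z) + Re (\<i> * (- \<i> * deriv (deriv k) z)) * (Im z + 0))) (at 0)"
    using DERIV_add[OF Re_line_derivative[OF halfplane_deriv(1)[OF k z], of \<i>] DERIV_mult[OF l Re_line_derivative[OF d2, of \<i>]]]
    by simp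
   have ev: "\<forall>\<^sub>F t::real in nhds 0. Re (k (z + of_real t * \<i>)) + (Im z + t) * Re (- \<i> * deriv k (z + of_real t * \<i>)) = 0"
    using eventually_line_in_halfplane[OF z, of \<i>]
   proof eventually_elim
    case (elim t)
    show ?case using e[OF elim] by simp
   qed
   show "((\<lambda>t::real. Re (k (z + of_real t * \<i>)) + (Im z + t) * Re (- \<i> * deriv k (z + of_real t * \<i>))) has_real_derivative 0) (at 0)"
    by (subst DERIV_cong_ev[OF refl ev refl]) simp
  qed
  then show ?thesis using z by simp
 qed
 note r2 = this
 have "deriv (deriv (deriv k)) z = 0" if "0 < Im z" for z by (rule deriv_zero_if_Re_zero[OF k2 r2 that])
 then obtain B where B: "\<And>z. 0 < Im z \<Longrightarrow> deriv (deriv k) z = B" by (rule halfplane_constant_if_deriv_zero[OF k2]) auto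
 have d1: "((\<lambda>z. deriv k z - B * z) has_field_derivative 0) (at z)" if z: "0 < Im z" for z
  using halfplane_deriv(1)[OF k1 z] B[OF z] by (auto intro!: derivative_eq_intros)
 have h1: "(\<lambda>z. deriv k z - B * z) holomorphic_on ?H" by (intro holomorphic_intros k1)
 obtain c where c: "\<And>z. 0 < Im z \<Longrightarrow> deriv k z - B * z = c"
  using halfplane_constant_if_deriv_zero[OF h1 DERIV_imp_deriv[OF d1]] by blast
 have d0: "((\<lambda>z. k z - B * z\<^sup>2 / 2 - c * z) has_field_derivative 0) (at z)" if z: "0 < Im z" for z
  using halfplane_deriv(1)[OF k z] c[OF z] by (auto intro!: derivative_eq_intros simp: algebra_simps)
 have h0: "(\<lambda>z. k z - B * z\<^sup>2 / 2 - c * z) holomorphic_on ?H" by (intro holomorphic_intros k) auto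
 obtain d where d: "\<And>z. 0 < Im z \<Longrightarrow> k z - B * z\<^sup>2 / 2 - c * z = d"
  using halfplane_constant_if_deriv_zero[OF h0 DERIV_imp_deriv[OF d0]] by blast
 have kz: "k z = B * z\<^sup>2 / 2 + c * z + d" "deriv k z = B * z + c" if "0 < Im z" for z
  using c[OF that] d[OF that] by (auto simp: algebra_simps)
 have B0: "Re B = 0" using r2[of \<i>] B[of \<i>] by simp
 have cd: "Re c * x + Re d = 0" for x using e[of "Complex x 1"] B0 kz[of "Complex x 1"] by (simp add: power2_eq_square algebra_simps)
 have c0: "Re c = 0" "Re d = 0" using cd[of 0] cd[of 1] by auto
 have pos: "0 \<le> - Im B * x - Im c" for x
  using p[of "Complex x 1"] B0 c0 kz[of "Complex x 1"] by (simp add: power2_eq_square algebra_simps)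
 have "Im B = 0"
 proof (rule ccontr)
  assume "Im B \<noteq> 0"
  then show False using pos[of "(1 - Im c) / Im B"] by simp
 qed
 then have "B = 0" using B0 by (simp add: complex_eq_iff)
 show ?thesis
 proof (rule that[of "- Im c" "Im d"])
  show "0 \<le> - Im c" using pos[of 0] by simp
  show "k z = - \<i> * of_real (- Im c) * z + \<i> * of_real (Im d)" if "0 < Im z" for z
   using kz(1)[OF that] \<open>B = 0\<close> c0 by (simp add: complex_eq_iff)
 qed
qed

lemma one_minus_exp_limit:
 fixes \<kappa> :: complex
 shows "(\<lambda>n. real (Suc n) * (1 - Re (exp (- \<kappa> / of_nat (Suc n))))) \<longlonglongrightarrow> Re \<kappa>"
proof -
 have "((\<lambda>x::complex. exp (- \<kappa> * x)) has_field_derivative - \<kappa>) (at 0)" by (auto intro!: derivative_eq_intros)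
 then have "((\<lambda>h. (exp (- \<kappa> * h) - 1) / h) \<longlongrightarrow> - \<kappa>) (at 0)" by (simp add: DERIV_def)
 moreover have "filterlim (\<lambda>n. 1 / of_nat (Suc n) :: complex) (at 0) sequentially"
 proof (rule filterlim_atI)
  show "(\<lambda>n. 1 / of_nat (Suc n) :: complex) \<longlonglongrightarrow> 0"
   using LIMSEQ_inverse_real_of_nat[THEN tendsto_of_real[where 'a=complex]] by (simp add: inverse_eq_divide)
 qed (simp del: of_nat_Suc)
 ultimately have "(\<lambda>n. (exp (- \<kappa> * (1 / of_nat (Suc n))) - 1) / (1 / of_nat (Suc n))) \<longlonglongrightarrow> - \<kappa>"
  by (rule filterlim_compose)
 from tendsto_minus[OF tendsto_Re[OF this]] show ?thesis by (simp add: algebra_simps del: of_nat_Suc)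
qed

text \<open>The Poisson formula holds for the bounded functions \<open>exp (- k / n)\<close>, and
  \<open>n * (1 - Re (exp (- k / n)))\<close> is nonnegative and tends to \<open>Re k\<close>, so
  Fatou gives one inequality. Equality can fail: \<open>k z = - \<i> * z\<close> has real part 0 on
  the line.\<close>

lemma positive_real_part_poisson_bound:
 assumes k: "k holomorphic_on {z. - \<delta> < Im z}" and \<delta>: "0 < \<delta>" and p: "\<And>z. 0 \<le> Im z \<Longrightarrow> 0 \<le> Re (k z)" and w: "0 < Im w"
 shows "integrable lborel (\<lambda>t. poisson w t * Re (k (complex_of_real t)))"
  "(LBINT t. poisson w t * Re (k (complex_of_real t))) \<le> Re (k w)"
proof -
 define E where "E n z = exp (- k z / of_nat (Suc n))" for n z
 have Ehol: "E n holomorphic_on {z. - \<delta> < Im z}" for n unfolding E_def by (intro holomorphic_intros k) (simp del: of_nat_Suc)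
 have E1: "cmod (E n z) \<le> 1" if "0 \<le> Im z" for n z using p[OF that] by (simp add: E_def Re_divide_of_nat del: of_nat_Suc)
 have EP: "(LBINT t. poisson w t * E n (complex_of_real t)) = E n w" for n by (rule bounded_holomorphic_poisson[OF Ehol \<delta> E1 w])
 have cont: "continuous_on UNIV (\<lambda>t. k (complex_of_real t))"
  by (rule continuous_on_compose2[OF holomorphic_on_imp_continuous_on[OF k]]) (use \<delta> in \<open>auto intro!: continuous_intros\<close>)
 note [measurable] = borel_measurable_continuous_onI[OF cont] poisson_measurable[of w]
 have [measurable]: "(\<lambda>t. E n (complex_of_real t)) \<in> borel_measurable borel" for n unfolding E_def by measurable
 have iP: "integrable lborel (poisson w)" using w by (intro poisson_integrable) simp
 have iE: "integrable lborel (\<lambda>t. poisson w t * E n (complex_of_real t))" for n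
 proof (rule Bochner_Integration.integrable_bound[OF iP])
  show "AE t in lborel. norm (poisson w t * E n (complex_of_real t)) \<le> norm (poisson w t)"
   using E1 poisson_nonneg[OF w] by (intro AE_I2) (simp add: norm_mult mult_left_le)
 qed measurable
 define f where "f n t = real (Suc n) * (poisson w t - Re (poisson w t * E n (complex_of_real t)))" for n t
 have f_alt: "f n t = poisson w t * (real (Suc n) * (1 - Re (E n (complex_of_real t))))" for n t by (simp add: f_def algebra_simps)
 have f0: "0 \<le> f n t" for n t
  unfolding f_alt using order_trans[OF complex_Re_le_cmod E1[of "complex_of_real t" n]] poisson_nonneg[OF w, of t]
  by (intro mult_nonneg_nonneg) auto
 have fi: "integrable lborel (f n)" for n
  unfolding f_def by (intro integrable_mult_right Bochner_Integration.integrable_diff iP integrable_Re iE)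
 have fI: "integral\<^sup>L lborel (f n) = real (Suc n) * (1 - Re (E n w))" for n unfolding f_def integral_mult_right_zero
   Bochner_Integration.integral_diff[OF iP integrable_Re[OF iE]] integral_Re[OF iE] EP poisson_integral[OF w] ..
 have lim: "(\<lambda>n. f n t) \<longlonglongrightarrow> poisson w t * Re (k (complex_of_real t))" for t
  unfolding f_alt E_def by (intro tendsto_mult_left one_minus_exp_limit)
 have limI: "(\<lambda>n. integral\<^sup>L lborel (f n)) \<longlonglongrightarrow> Re (k w)"
  unfolding fI E_def by (rule one_minus_exp_limit)
 have pk0: "0 \<le> poisson w t * Re (k (complex_of_real t))" for t using poisson_nonneg[OF w] p[of "complex_of_real t"] by simp
 have "(\<integral>\<^sup>+ t. ennreal (poisson w t * Re (k (complex_of_real t))) \<partial>lborel) = (\<integral>\<^sup>+ t. liminf (\<lambda>n. ennreal (f n t)) \<partial>lborel)"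
  by (intro nn_integral_cong lim_imp_Liminf[symmetric] tendsto_ennrealI lim) simp
 also have "\<dots> \<le> liminf (\<lambda>n. \<integral>\<^sup>+ t. ennreal (f n t) \<partial>lborel)"
  by (intro nn_integral_liminf measurable_compose[OF borel_measurable_integrable[OF fi] measurable_ennreal])
 also have "\<dots> = liminf (\<lambda>n. ennreal (integral\<^sup>L lborel (f n)))"
  by (simp only: nn_integral_eq_integral[OF fi AE_I2[OF f0]])
 also have "\<dots> = ennreal (Re (k w))" by (intro lim_imp_Liminf tendsto_ennrealI limI) simp
 finally have nn: "(\<integral>\<^sup>+ t. ennreal (poisson w t * Re (k (complex_of_real t))) \<partial>lborel) \<le> ennreal (Re (k w))" .
 show i: "integrable lborel (\<lambda>t. poisson w t * Re (k (complex_of_real t)))"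
 proof (rule integrableI_nonneg)
  show "(\<integral>\<^sup>+ t. ennreal (poisson w t * Re (k (complex_of_real t))) \<partial>lborel) < \<infinity>"
   using nn by (rule le_less_trans) simp
 qed (use pk0 in auto)
 show "(LBINT t. poisson w t * Re (k (complex_of_real t))) \<le> Re (k w)"
  using nn p[of w] w unfolding nn_integral_eq_integral[OF i AE_I2[OF pk0]] by (subst (asm) ennreal_le_iff) auto
qed

text \<open>For \<open>k\<close> shifted up by \<open>y\<close> the quartic formula holds, with
  value \<open>X y\<close>. As \<open>y\<close> tends to 0 the part over \<open>[- T, T]\<close>
  disappears by \<open>bd\<close>, and the tails cost a multiple of \<open>1 / T^2\<close> times a
  Poisson integral. Hence the limit \<open>X0\<close>, nonnegative by positivity, is 0, which is the
  equation of \<open>affine_if_Re_equation\<close>.\<close>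

lemma positive_real_part_affine:
 assumes k: "k holomorphic_on {z. 0 < Im z}" and p: "\<And>z. 0 < Im z \<Longrightarrow> 0 \<le> Re (k z)"
  and bd: "\<And>T. 0 < T \<Longrightarrow> ((\<lambda>y. LBINT t. indicator {-T..T} t * Re (k (Complex t y))) \<longlongrightarrow> 0) (at_right 0)"
 obtains s \<theta> :: real where "0 \<le> s" "\<And>z. 0 < Im z \<Longrightarrow> k z = - \<i> * of_real s * z + \<i> * of_real \<theta>"
proof (rule affine_if_Re_equation[OF k p])
 fix w assume w: "0 < Im w"
 let ?n = "\<lambda>t. cmod (of_real t - w)"
 define A where "A = (LBINT t. 1 / (?n t) ^ 4)"
 have A: "0 < A" unfolding A_def by (rule quartic_kernel_integrable(4)[OF w])
 define ky where "ky y z = k (z + of_real y * \<i>)" for y :: real and z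
 have kyhol: "ky y holomorphic_on {z. - y < Im z}" for y
  unfolding ky_def by (rule holomorphic_on_compose_gen[OF _ k, unfolded o_def]) (auto intro!: holomorphic_intros)
 have kyp: "0 \<le> Re (ky y z)" if "0 < y" "0 \<le> Im z" for y z using that by (auto simp: ky_def intro!: p)
 have kyd: "deriv (ky y) w = deriv k (w + of_real y * \<i>)" if "0 < y" for y
 proof (rule DERIV_imp_deriv)
  have "(k has_field_derivative deriv k (w + of_real y * \<i>)) (at (w + of_real y * \<i>))"
   using w that by (intro halfplane_deriv[OF k]) simp
  from DERIV_chain2[where g="\<lambda>z. z + of_real y * \<i>", OF this] show "(ky y has_field_derivative deriv k (w + of_real y * \<i>)) (at w)"
   unfolding ky_def by (rule DERIV_chain2[where Db=1, THEN DERIV_cong]) (auto intro!: derivative_eq_intros)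
 qed
 \<comment> \<open>After the shift the denominator in the Schwarz bound is at least
   \<open>y\<close>, so for fixed \<open>y\<close> the bound is quadratic growth.\<close>
 have kyg: "cmod (ky y z) \<le> (cmod (k \<i> + 1) * (y + 2)\<^sup>2 / y + 1) * (cmod z)\<^sup>2" if y: "0 < y" and z: "0 \<le> Im z" "1 \<le> cmod z" for y z
 proof -
  have z2: "1 \<le> (cmod z)\<^sup>2" using one_le_power[OF z(2), of 2] .
  have "cmod (z + of_real y * \<i> + \<i>) \<le> cmod z + cmod (of_real y * \<i> + \<i>)" by (simp only: add.assoc norm_triangle_ineq)
  also have "of_real y * \<i> + \<i> = of_real (y + 1) * \<i>" by (simp add: algebra_simps)
  also have "cmod (of_real (y + 1) * \<i>) = y + 1" using y by (simp add: norm_mult del: of_real_add)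
  also have "cmod z + (y + 1) \<le> (y + 2) * cmod z" using y z mult_left_mono[of 1 "cmod z" "y + 1"] by (simp add: algebra_simps)
  finally have 1: "(cmod (z + of_real y * \<i> + \<i>))\<^sup>2 \<le> ((y + 2) * cmod z)\<^sup>2" by (intro power_mono) auto
  have "cmod (k (z + of_real y * \<i>) + 1) \<le> cmod (k \<i> + 1) * (cmod (z + of_real y * \<i> + \<i>))\<^sup>2 / Im (z + of_real y * \<i>)"
   using y z by (intro positive_real_part_growth[OF k p]) auto
  also have "\<dots> \<le> cmod (k \<i> + 1) * ((y + 2) * cmod z)\<^sup>2 / y" using y z 1 by (intro frac_le mult_left_mono) auto
  finally have "cmod (ky y z + 1) \<le> cmod (k \<i> + 1) * (y + 2)\<^sup>2 / y * (cmod z)\<^sup>2"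
   by (simp add: ky_def power_mult_distrib)
  moreover have "cmod (ky y z) \<le> cmod (ky y z + 1) + 1" using norm_triangle_ineq4[of "ky y z + 1" 1] by simp
  ultimately show ?thesis using z2 by (simp add: distrib_right del: times_divide_eq_left)
 qed
 have lineeq: "ky y (complex_of_real t) = k (Complex t y)" for y t by (simp add: ky_def complex_eq_iff Complex_eq mult.commute)
 define X where "X y = (Re (ky y w) + Im w * Im (deriv (ky y) w)) * A" for y
 have Xeq: "X y = (LBINT t. Re (ky y (complex_of_real t)) / (?n t) ^ 4)"
  and Xint: "integrable lborel (\<lambda>t. Re (ky y (complex_of_real t)) / (?n t) ^ 4)" if "0 < y" for y
  unfolding X_def A_def using quartic_kernel_formula[OF kyhol that kyg[OF that] w] by auto
 define X0 where "X0 = (Re (k w) + Im w * Im (deriv k w)) * A"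
 have Xlim: "(X \<longlongrightarrow> X0) (at_right 0)"
 proof -
  have li: "((\<lambda>y::real. w + of_real y * \<i>) \<longlongrightarrow> w) (at_right 0)" by (auto intro!: tendsto_eq_intros)
  have c: "isCont k w" "isCont (deriv k) w"
   using halfplane_deriv[OF k w] halfplane_deriv(1)[OF halfplane_deriv(2)[OF k w] w] DERIV_isCont by blast+
  have "((\<lambda>y. (Re (k (w + of_real y * \<i>)) + Im w * Im (deriv k (w + of_real y * \<i>))) * A) \<longlongrightarrow> X0) (at_right 0)"
   unfolding X0_def by (intro tendsto_intros isCont_tendsto_compose[OF c(1) li] isCont_tendsto_compose[OF c(2) li])
  moreover have "\<forall>\<^sub>F y in at_right 0. (Re (k (w + of_real y * \<i>)) + Im w * Im (deriv k (w + of_real y * \<i>))) * A = X y"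
   using eventually_at_right_less[of "0::real"] by eventually_elim (simp add: X_def kyd, simp add: ky_def)
  ultimately show ?thesis by (rule Lim_transform_eventually)
 qed
 have "0 \<le> X0"
 proof (rule tendsto_lowerbound[OF Xlim])
  show "\<forall>\<^sub>F y in at_right 0. 0 \<le> X y" using eventually_at_right_less[of "0::real"]
   by eventually_elim (unfold Xeq, auto intro!: integral_nonneg_AE AE_I2 divide_nonneg_nonneg kyp)
 qed simp
 have XT: "X0 \<le> 32 * pi / T\<^sup>2 * Re (k \<i>)" if T: "2 * cmod w + 1 \<le> T" for T
 proof (rule tendsto_le[OF _ _ Xlim])
  have T1: "1 \<le> T" "2 * cmod w \<le> T" using T norm_ge_zero[of w] by linarith+
  have ii: "((\<lambda>y::real. \<i> + of_real y * \<i>) \<longlongrightarrow> \<i>) (at_right 0)" by (auto intro!: tendsto_eq_intros)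
  have "isCont k \<i>" using halfplane_deriv(1)[OF k, of \<i>] DERIV_isCont by auto
  then have "((\<lambda>y. 1 / (Im w) ^ 4 * (LBINT t. indicator {-T..T} t * Re (k (Complex t y))) + 32 * pi / T\<^sup>2 * Re (k (\<i> + of_real y * \<i>)))
    \<longlongrightarrow> 1 / (Im w) ^ 4 * 0 + 32 * pi / T\<^sup>2 * Re (k \<i>)) (at_right 0)"
   using T1 by (intro tendsto_intros bd isCont_tendsto_compose[OF _ ii]) auto
  then show "((\<lambda>y. 1 / (Im w) ^ 4 * (LBINT t. indicator {-T..T} t * Re (k (Complex t y))) + 32 * pi / T\<^sup>2 * Re (k (\<i> + of_real y * \<i>)))
    \<longlongrightarrow> 32 * pi / T\<^sup>2 * Re (k \<i>)) (at_right 0)"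
   by simp
  show "\<forall>\<^sub>F y in at_right 0. X y \<le> 1 / (Im w) ^ 4 * (LBINT t. indicator {-T..T} t * Re (k (Complex t y))) + 32 * pi / T\<^sup>2 * Re (k (\<i> + of_real y * \<i>))"
   using eventually_at_right_less[of "0::real"]
  proof eventually_elim
   case (elim y)
   let ?q = "\<lambda>t. Re (ky y (complex_of_real t))"
   note P = positive_real_part_poisson_bound[OF kyhol elim kyp[OF elim], of \<i>, simplified]
   have q0: "0 \<le> ?q t" for t using elim by (intro kyp) auto
   have qc: "continuous_on {-T..T} ?q"
    by (intro continuous_on_Re continuous_on_compose2[OF holomorphic_on_imp_continuous_on[OF kyhol[of y]]])
     (use elim in \<open>auto intro!: continuous_intros\<close>)
   have iq: "integrable lborel (\<lambda>t. indicator {-T..T} t * ?q t)"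
    using borel_integrable_compact[OF compact_Icc qc] by (simp add: indicator_times_eq_if(1) if_distrib cong: if_cong)
   \<comment> \<open>If \<open>\<bar>t\<bar> > T\<close> then
     \<open>|t - w|^4 \<ge> t^4 / 16 \<ge> T^2 * (1 + t^2) / 32\<close>, because
     \<open>T \<ge> 2 * |w|\<close> and \<open>T \<ge> 1\<close>; with
     \<open>pi * poisson \<i> t = 1 / (1 + t^2)\<close> this is the constant
     \<open>32 * pi\<close>.\<close>
   have ptw: "?q t / (?n t) ^ 4 \<le> 1 / (Im w) ^ 4 * (indicator {-T..T} t * ?q t) + 32 * pi / T\<^sup>2 * (poisson \<i> t * ?q t)" for t
   proof -
    have ge: "Im w \<le> ?n t" using cmod_of_real_diff_ge[of w t] w by simp
    have pp: "0 \<le> poisson \<i> t" by (rule poisson_nonneg) simp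
    have "1 / (?n t) ^ 4 \<le> 1 / (Im w) ^ 4 * indicator {-T..T} t + 32 * pi / T\<^sup>2 * poisson \<i> t"
    proof (cases "t \<in> {-T..T}")
     case True
     have "1 / (?n t) ^ 4 \<le> 1 / (Im w) ^ 4" using ge w by (intro divide_left_mono power_mono mult_pos_pos) auto
     then show ?thesis using True pp by (simp add: add_increasing2)
    next
     case False
     then have tT: "T \<le> \<bar>t\<bar>" "1 \<le> \<bar>t\<bar>" using T1 by auto
     have t2: "T\<^sup>2 \<le> t\<^sup>2" "1 \<le> t\<^sup>2" "1 \<le> T\<^sup>2"
      using power_mono[OF tT(1), of 2] power_mono[OF tT(2), of 2] power_mono[OF T1(1), of 2] T1 by auto
     have "\<bar>t\<bar> / 2 \<le> ?n t" using cmod_diff_ge_half[of w "complex_of_real t"] T1 tT by simp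
     then have "(\<bar>t\<bar> / 2) ^ 4 \<le> (?n t) ^ 4" by (intro power_mono) auto
     moreover have "T\<^sup>2 * ((1 + t\<^sup>2) / 2) \<le> t\<^sup>2 * t\<^sup>2" using t2 by (intro mult_mono) auto
     then have "T\<^sup>2 * (1 + t\<^sup>2) / 32 \<le> (\<bar>t\<bar> / 2) ^ 4"
      by (simp add: power_divide power4_eq_xxxx power2_eq_square)
     ultimately have "T\<^sup>2 * (1 + t\<^sup>2) / 32 \<le> (?n t) ^ 4" by linarith
     then have "1 / (?n t) ^ 4 \<le> 1 / (T\<^sup>2 * (1 + t\<^sup>2) / 32)"
      using t2 ge w T1 by (intro divide_left_mono mult_pos_pos divide_pos_pos) (auto simp: add_pos_nonneg)
     also have "\<dots> = 32 * pi / T\<^sup>2 * poisson \<i> t" by (simp add: poisson_def cmod_real_diff_sq add.commute)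
     finally show ?thesis using False by simp
    qed
    from mult_right_mono[OF this q0[of t]] show ?thesis by (simp add: algebra_simps)
   qed
   have "X y \<le> (LBINT t. 1 / (Im w) ^ 4 * (indicator {-T..T} t * ?q t) + 32 * pi / T\<^sup>2 * (poisson \<i> t * ?q t))"
    unfolding Xeq[OF elim] by (intro integral_mono Xint[OF elim] Bochner_Integration.integrable_add integrable_mult_right iq P ptw)
   also have "\<dots> = 1 / (Im w) ^ 4 * (LBINT t. indicator {-T..T} t * ?q t) + 32 * pi / T\<^sup>2 * (LBINT t. poisson \<i> t * ?q t)"
    using iq P(1) by (simp only: Bochner_Integration.integral_add integrable_mult_right integral_mult_right_zero)
   also have "\<dots> \<le> 1 / (Im w) ^ 4 * (LBINT t. indicator {-T..T} t * ?q t) + 32 * pi / T\<^sup>2 * Re (ky y \<i>)"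
    using P(2) by (intro add_left_mono mult_left_mono) auto
   finally show ?case unfolding lineeq by (simp add: ky_def)
  qed
 qed simp
 have "X0 \<le> 0"
 proof (rule tendsto_lowerbound)
  show "((\<lambda>T. 32 * pi / T\<^sup>2 * Re (k \<i>)) \<longlongrightarrow> 0) at_top" by real_asymp
  show "\<forall>\<^sub>F T in at_top. X0 \<le> 32 * pi / T\<^sup>2 * Re (k \<i>)" using eventually_ge_at_top by eventually_elim (rule XT)
 qed simp
 then show "Re (k w) + Im w * Im (deriv k w) = 0" using \<open>0 \<le> X0\<close> A by (simp add: X0_def mult_le_0_iff zero_le_mult_iff)
qed (assumption, rule that)

section \<open>Inner cocycles for the translation flow\<close>

lemma HmI: "f \<in> L2 \<Longrightarrow> (\<And>v. 0 < Im v \<Longrightarrow> (LBINT t. f t / (of_real t - cnj v)) = 0) \<Longrightarrow> f \<in> Hm"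
 by (simp add: Hm_def)

text \<open>A product of two kernels with poles in the lower half-plane is holomorphic above and
  decays quadratically, so its line integral is 0.\<close>

lemma kernel_in_Hm:
 assumes v: "0 < Im v"
 shows "(\<lambda>t. 1 / (of_real t - cnj v)) \<in> Hm"
proof (rule HmI)
 show "(\<lambda>t. 1 / (of_real t - cnj v)) \<in> L2" using v by (intro L2_kernel) simp
 fix w assume w: "0 < Im w"
 define d where "d = min (Im v) (Im w)"
 have d: "0 < d" "d \<le> Im v" "d \<le> Im w" using v w by (auto simp: d_def)
 have nz: "z - cnj v \<noteq> 0" "z - cnj w \<noteq> 0" if "- d < Im z" for z using that d by (auto simp: complex_eq_iff)
 have hol: "(\<lambda>z. 1 / (z - cnj v) / (z - cnj w)) holomorphic_on {z. - d < Im z}" by (intro holomorphic_intros) (use nz in auto)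
 have dec: "cmod (1 / (z - cnj v) / (z - cnj w)) \<le> 4 / (cmod z)\<^sup>2" if z: "2 * cmod v + 2 * cmod w + 1 \<le> cmod z" for z
 proof -
  have z0: "0 < cmod z" "2 * cmod v \<le> cmod z" "2 * cmod w \<le> cmod z" using z norm_ge_zero[of v] norm_ge_zero[of w] by linarith+
  have "cmod z / 2 \<le> cmod (z - cnj v)" "cmod z / 2 \<le> cmod (z - cnj w)" using z0 by (intro cmod_diff_ge_half; simp)+
  then have "cmod z / 2 * (cmod z / 2) \<le> cmod (z - cnj v) * cmod (z - cnj w)" using z0 by (intro mult_mono) auto
  then have "1 / (cmod (z - cnj v) * cmod (z - cnj w)) \<le> 1 / (cmod z / 2 * (cmod z / 2))" using z0 by (intro frac_le) auto
  then show ?thesis by (simp add: norm_divide norm_mult power2_eq_square)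
 qed
 show "(LBINT t. 1 / (of_real t - cnj v) / (of_real t - cnj w)) = 0" by (rule line_integral_zero(2)[OF hol d(1) dec])
qed

lemma Hm_scale: "f \<in> Hm \<Longrightarrow> (\<lambda>t. c * f t) \<in> Hm"
 by (rule HmI) (simp_all add: L2_scale HmD flip: times_divide_eq_right)

lemma Hm_diff:
 assumes "f \<in> Hm" "g \<in> Hm"
 shows "(\<lambda>t. f t - g t) \<in> Hm"
proof (rule HmI)
 fix v assume v: "0 < Im v"
 then have "Im (cnj v) \<noteq> 0" by simp
 note i = L2_kernel_integrable[OF HmD(1)[OF assms(1)] this] L2_kernel_integrable[OF HmD(1)[OF assms(2)] this]
 show "(LBINT t. (f t - g t) / (of_real t - cnj v)) = 0"
  unfolding diff_divide_distrib Bochner_Integration.integral_diff[OF i] using assms v by (simp add: HmD)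
qed (use assms HmD in \<open>auto intro!: L2_diff\<close>)

lemma Hm_AE_cong:
 assumes "f \<in> Hm" "g \<in> borel_measurable borel" "AE t in lborel. f t = g t"
 shows "g \<in> Hm"
proof (rule HmI)
 show "g \<in> L2" by (rule L2_AE_cong[OF HmD(1)[OF assms(1)] assms(2,3)])
 fix v assume v: "0 < Im v"
 have "(LBINT t. g t / (of_real t - cnj v)) = (LBINT t. f t / (of_real t - cnj v))"
  using assms(3) L2D(1)[OF HmD(1)[OF assms(1)]] assms(2) by (intro integral_cong_AE) auto
 then show "(LBINT t. g t / (of_real t - cnj v)) = 0" using HmD(2)[OF assms(1) v] by simp
qed

lemma Hm_translate:
 assumes "f \<in> Hm"
 shows "(\<lambda>t. f (t - b)) \<in> Hm"
proof (rule HmI)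
 show "(\<lambda>t. f (t - b)) \<in> L2" using L2_Dop[OF HmD(1)[OF assms], of b] by (simp add: Dop_def)
 fix v assume v: "0 < Im v"
 have "(LBINT t. f (t - b) / (of_real t - cnj v)) = (LBINT t. (\<lambda>s. f s / (of_real s - cnj (v - of_real b))) (t - b))"
  by (simp add: algebra_simps)
 also have "\<dots> = (LBINT s. f s / (of_real s - cnj (v - of_real b)))" by (rule lborel_integral_shift(1))
 also have "\<dots> = 0" using v by (intro HmD(2)[OF assms]) simp
 finally show "(LBINT t. f (t - b) / (of_real t - cnj v)) = 0" .
qed

lemma poisson_kernel_product:
 assumes "0 < Im z"
 shows "complex_of_real (poisson z t) = of_real (Im z / pi) / ((of_real t - z) * (of_real t - cnj z))"
proof -
 have "(complex_of_real t - z) * (of_real t - cnj z) = complex_of_real ((cmod (of_real t - z))\<^sup>2)"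
  using complex_norm_square[of "of_real t - z"] by simp
 then show ?thesis by (simp add: poisson_def)
qed

lemma poisson_bounded_integrable:
 fixes \<psi> :: "real \<Rightarrow> complex"
 assumes [measurable]: "\<psi> \<in> borel_measurable borel" and "\<And>t. cmod (\<psi> t) \<le> C" and z: "0 < Im z"
 shows "integrable lborel (\<lambda>t. poisson z t * \<psi> t)"
proof (rule Bochner_Integration.integrable_bound)
 show "integrable lborel (\<lambda>t. C * poisson z t)" using z by (intro integrable_mult_right poisson_integrable) simp
 show "AE t in lborel. norm (poisson z t * \<psi> t) \<le> norm (C * poisson z t)"
 proof (rule AE_I2)
  fix t
  have "poisson z t * cmod (\<psi> t) \<le> poisson z t * C" using assms(2) poisson_nonneg[OF z] by (intro mult_left_mono) auto
  then show "norm (poisson z t * \<psi> t) \<le> norm (C * poisson z t)"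
   using poisson_nonneg[OF z, of t] by (simp add: norm_mult mult.commute order_trans[OF _ abs_ge_self])
 qed
qed measurable

text \<open>A bounded \<open>\<psi>\<close> need not be in L^2, so analyticity is imposed on
  \<open>\<psi> t / (t + \<i>)\<close>. Splitting the Poisson kernel leaves this function once
  against the Poisson kernel and once against \<open>1 / (t - cnj z)\<close>, where it integrates to
  0. The Poisson extension of \<open>\<psi>\<close> is thereby holomorphic in
  \<open>z\<close>.\<close>

lemma poisson_bounded_ext:
 fixes \<psi> :: "real \<Rightarrow> complex"
 assumes [measurable]: "\<psi> \<in> borel_measurable borel" and C: "\<And>t. cmod (\<psi> t) \<le> C"
  and H: "(\<lambda>t. \<psi> t / (of_real t + \<i>)) \<in> Hm" and z: "0 < Im z"
 shows "(LBINT t. poisson z t * \<psi> t) = (z + \<i>) * cauchy_ext (\<lambda>t. \<psi> t / (of_real t + \<i>)) z"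
proof -
 let ?F = "\<lambda>t. \<psi> t / (of_real t + \<i>)"
 have eq: "poisson z t * \<psi> t = (z + \<i>) * (poisson z t * ?F t) + of_real (Im z / pi) * (?F t / (of_real t - cnj z))" for t
 proof -
  have nz: "complex_of_real t - z \<noteq> 0" "of_real t - cnj z \<noteq> 0" "of_real t + \<i> \<noteq> 0"
   using of_real_diff_nonzero[of z t] of_real_diff_nonzero[of "cnj z" t] of_real_diff_nonzero[of "- \<i>" t] z by auto
  have "c / (a * b) * p = (z + \<i>) * (c / (a * b) * (p / d)) + c * (p / d / b)" if "a \<noteq> 0" "b \<noteq> 0" "d \<noteq> 0" "d = a + (z + \<i>)" for a b c d p :: complex
   using that(1-3) by (simp add: that(4) divide_simps) (simp add: algebra_simps)
  note key = this
  show ?thesis unfolding poisson_kernel_product[OF z] by (rule key[OF nz]) simp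
 qed
 have i1: "integrable lborel (\<lambda>t. poisson z t * ?F t)"
  using HmD(1)[OF H] L2_weight_integrable[OF HmD(1)[OF H]] z by (intro poisson_mult_integrable) auto
 have i2: "integrable lborel (\<lambda>t. ?F t / (of_real t - cnj z))" using z by (intro L2_kernel_integrable[OF HmD(1)[OF H]]) simp
 show ?thesis unfolding eq Bochner_Integration.integral_add[OF integrable_mult_right[OF i1] integrable_mult_right[OF i2]]
   integral_mult_right_zero HmD(2)[OF H z] cauchy_ext_eq_poisson[OF H z] by simp
qed

text \<open>Subtracting the value \<open>P\<close> makes the extension of
  \<open>q = \<psi> - P\<close> vanish at \<open>z\<close>, so \<open>q / (t - z)\<close> is still
  in \<open>Hm\<close>. The multiplier \<open>\<phi>\<close> keeps it there, and testing at
  \<open>cnj z\<close> shows that \<open>\<phi> * q\<close> has Poisson integral 0 at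
  \<open>z\<close>.\<close>

lemma poisson_multiplicative:
 fixes \<phi> \<psi> :: "real \<Rightarrow> complex"
 assumes [measurable]: "\<phi> \<in> borel_measurable borel" "\<psi> \<in> borel_measurable borel"
  and \<phi>: "\<And>t. cmod (\<phi> t) \<le> 1" "\<And>h. h \<in> Hm \<Longrightarrow> (\<lambda>t. \<phi> t * h t) \<in> Hm"
  and \<psi>: "\<And>t. cmod (\<psi> t) \<le> 1" "(\<lambda>t. \<psi> t / (of_real t + \<i>)) \<in> Hm" and z: "0 < Im z"
 shows "(LBINT t. poisson z t * (\<phi> t * \<psi> t)) = (LBINT t. poisson z t * \<phi> t) * (LBINT t. poisson z t * \<psi> t)"
proof -
 define P where "P = (LBINT t. poisson z t * \<psi> t)"
 define q where "q t = \<psi> t - P" for t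
 have q_meas [measurable]: "q \<in> borel_measurable borel" unfolding q_def by measurable
 have q_bound: "cmod (q t) \<le> 1 + cmod P" for t unfolding q_def using norm_triangle_ineq4[of "\<psi> t" P] \<psi>(1)[of t] by linarith
 have k1: "(\<lambda>t. 1 / (of_real t + \<i>)) \<in> Hm" using kernel_in_Hm[of \<i>] by simp
 have qH: "(\<lambda>t. q t / (of_real t + \<i>)) \<in> Hm"
  using Hm_diff[OF \<psi>(2) Hm_scale[OF k1, of P]] by (simp add: q_def diff_divide_distrib)
 have iP: "integrable lborel (\<lambda>t. complex_of_real (poisson z t))" using z by (intro integrable_of_real poisson_integrable) simp
 have "(LBINT t. poisson z t * q t) = (LBINT t. poisson z t * \<psi> t) - (LBINT t. poisson z t * P)" unfolding q_def right_diff_distrib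
  by (intro Bochner_Integration.integral_diff poisson_bounded_integrable[OF _ \<psi>(1) z] integrable_mult_left iP) auto
 also have "\<dots> = 0" unfolding integral_mult_left_zero integral_complex_of_real poisson_integral[OF z] by (simp add: P_def)
 finally have "(z + \<i>) * cauchy_ext (\<lambda>t. q t / (of_real t + \<i>)) z = 0"
  unfolding poisson_bounded_ext[OF q_meas q_bound qH z] .
 moreover have "z + \<i> \<noteq> 0" using z by (auto simp: complex_eq_iff)
 ultimately have e0: "(LBINT t. q t / (of_real t + \<i>) / (complex_of_real t - z)) = 0" by (simp add: cauchy_ext_def)
 have "(\<lambda>t. q t / (complex_of_real t - z)) \<in> Hm"
 proof (rule HmI)
  show "(\<lambda>t. q t / (complex_of_real t - z)) \<in> L2" using L2_bounded_mult[OF L2_kernel[of z] q_meas q_bound] z by simp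
  fix v assume v: "0 < Im v"
  have nzv: "z - cnj v \<noteq> 0" using v z by (auto simp: complex_eq_iff)
  \<comment> \<open>Partial fractions in \<open>t + \<i>\<close>, \<open>t - z\<close> and
    \<open>t - cnj v\<close>, arranged so that both summands are known to integrate to 0.\<close>
  have eq: "q t / (complex_of_real t - z) / (of_real t - cnj v)
   = (z + \<i>) / (z + \<i> - (cnj v + \<i>)) * (q t / (of_real t + \<i>) / (complex_of_real t - z))
    + - (cnj v + \<i>) / (z + \<i> - (cnj v + \<i>)) * (q t / (of_real t + \<i>) / (of_real t - cnj v))" for t
  proof -
   have nz: "complex_of_real t - z \<noteq> 0" "of_real t - cnj v \<noteq> 0" "of_real t + \<i> \<noteq> 0"
    using of_real_diff_nonzero[of z t] of_real_diff_nonzero[of "cnj v" t] of_real_diff_nonzero[of "- \<i>" t] z v by auto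
   have "p / a / b = x / (x - y) * (p / d / a) + - y / (x - y) * (p / d / b)"
    if "a \<noteq> 0" "b \<noteq> 0" "d \<noteq> 0" "x - y \<noteq> 0" "a = d - x" "b = d - y" for a b d p x y :: complex
   proof -
    have "x / (x - y) * (p / d / a) + - y / (x - y) * (p / d / b) = p / ((x - y) * d * a * b) * (x * b - y * a)"
     using that(1-4) by (simp add: divide_simps) (simp add: algebra_simps)
    also have "x * b - y * a = (x - y) * d" by (simp add: that(5,6) algebra_simps)
    finally show ?thesis using that(1-4) by simp
   qed
   note key = this
   show ?thesis by (rule key[OF nz]) (use nzv in simp_all)
  qed
  have i: "integrable lborel (\<lambda>t. q t / (of_real t + \<i>) / (complex_of_real t - z))"
   "integrable lborel (\<lambda>t. q t / (of_real t + \<i>) / (of_real t - cnj v))"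
   using z v by (intro L2_kernel_integrable[OF HmD(1)[OF qH]]; simp)+
  show "(LBINT t. q t / (complex_of_real t - z) / (of_real t - cnj v)) = 0"
   unfolding eq Bochner_Integration.integral_add[OF integrable_mult_right[OF i(1)] integrable_mult_right[OF i(2)]]
    integral_mult_right_zero e0 HmD(2)[OF qH v] by simp
 qed
 from HmD(2)[OF \<phi>(2)[OF this] z]
 have "(LBINT t. \<phi> t * (q t / (complex_of_real t - z)) / (of_real t - cnj z)) = 0" .
 then have "0 = of_real (Im z / pi) * (LBINT t. \<phi> t * (q t / (complex_of_real t - z)) / (of_real t - cnj z))" by simp
 also have "\<dots> = (LBINT t. poisson z t * (\<phi> t * q t))"
  unfolding integral_mult_right_zero[symmetric] poisson_kernel_product[OF z] by (rule Bochner_Integration.integral_cong) auto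
 also have "\<dots> = (LBINT t. poisson z t * (\<phi> t * \<psi> t)) - (LBINT t. poisson z t * \<phi> t * P)"
 proof -
  have "cmod (\<phi> t * \<psi> t) \<le> 1" for t using mult_mono[OF \<phi>(1)[of t] \<psi>(1)[of t]] by (simp add: norm_mult)
  then have "integrable lborel (\<lambda>t. poisson z t * (\<phi> t * \<psi> t))" using z by (intro poisson_bounded_integrable) auto
  moreover have "integrable lborel (\<lambda>t. poisson z t * \<phi> t * P)"
   using \<phi>(1) z by (intro integrable_mult_left poisson_bounded_integrable) auto
  ultimately show ?thesis by (simp add: q_def right_diff_distrib mult.assoc flip: Bochner_Integration.integral_diff)
 qed
 finally show ?thesis by (simp add: P_def)
qed

text \<open>Fubini yields one point \<open>x0\<close> with \<open>f x0 \<noteq> 0\<close> where the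
  identity holds for almost every shift and for shift 0. Freezing the conjugated factor there
  expresses \<open>F\<close> as a multiple of \<open>f\<close>; shift 0 makes the multiplier
  unimodular.\<close>

lemma correlation_determines_function:
 fixes f F :: "real \<Rightarrow> complex"
 assumes [measurable]: "f \<in> borel_measurable borel" "F \<in> borel_measurable borel"
  and nz: "\<not> (AE x in lborel. f x = 0)"
  and eq: "\<And>b. 0 \<le> b \<Longrightarrow> AE x in lborel. F (x - b) * cnj (F x) = f (x - b) * cnj (f x)"
 obtains c where "cmod c = 1" "AE x in lborel. F x = c * f x"
proof -
 \<comment> \<open>Negative shifts follow by translating the identity and conjugating it.\<close>
 have all: "AE x in lborel. F (x - b) * cnj (F x) = f (x - b) * cnj (f x)" for b
 proof (cases "0 \<le> b")
  case False
  then have "AE x in lborel. F (x - - b) * cnj (F x) = f (x - - b) * cnj (f x)" by (intro eq) simp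
  from AE_lborel_shift[OF this, of b] show ?thesis
  proof eventually_elim
   case (elim x)
   then have "cnj (F x * cnj (F (x - b))) = cnj (f x * cnj (f (x - b)))" by simp
   then show ?case by (simp add: mult.commute)
  qed
 qed (rule eq)
 have "AE b in lborel. AE x in lborel. F (x - b) * cnj (F x) = f (x - b) * cnj (f x)" by (rule AE_I2) (rule all)
 then have fub: "AE x in lborel. AE b in lborel. F (x - b) * cnj (F x) = f (x - b) * cnj (f x)"
  by (subst lborel_pair.AE_commute) measurable
 have "\<exists>x0. f x0 \<noteq> 0 \<and> F x0 * cnj (F x0) = f x0 * cnj (f x0) \<and> (AE b in lborel. F (x0 - b) * cnj (F x0) = f (x0 - b) * cnj (f x0))"
 proof (rule ccontr)
  assume n: "\<not> ?thesis"
  have "AE x in lborel. f x = 0" using fub all[of 0]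
  proof eventually_elim
   case (elim x)
   then show ?case using n by auto
  qed
  then show False using nz by simp
 qed
 then obtain x0 where x0: "f x0 \<noteq> 0" "F x0 * cnj (F x0) = f x0 * cnj (f x0)"
  "AE b in lborel. F (x0 - b) * cnj (F x0) = f (x0 - b) * cnj (f x0)"
  by blast
 have "(cmod (F x0))\<^sup>2 = (cmod (f x0))\<^sup>2" using x0(2) unfolding complex_norm_square[symmetric] of_real_eq_iff .
 then have n: "cmod (F x0) = cmod (f x0)" by simp
 then have F0: "cnj (F x0) \<noteq> 0" using x0(1) by auto
 have "AE x in lborel. F (x0 - (x0 + - 1 * x)) * cnj (F x0) = f (x0 - (x0 + - 1 * x)) * cnj (f x0)"
 proof (rule AE_borel_affine[OF _ _ x0(3)])
  have m: "(\<lambda>b. g (x0 - b)) \<in> borel_measurable borel" if "g \<in> borel_measurable borel" for g :: "real \<Rightarrow> complex"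
   by (rule measurable_compose[OF _ that]) simp
  have "(\<lambda>b. F (x0 - b) * cnj (F x0) - f (x0 - b) * cnj (f x0)) \<in> borel_measurable borel"
   by (rule borel_measurable_diff[OF borel_measurable_times[OF m[OF assms(2)] borel_measurable_const]
     borel_measurable_times[OF m[OF assms(1)] borel_measurable_const]])
  from measurable_sets[OF this, of "{0}"]
  have "(\<lambda>b. F (x0 - b) * cnj (F x0) - f (x0 - b) * cnj (f x0)) -` {0} \<inter> space borel \<in> sets borel" by simp
  also have "(\<lambda>b. F (x0 - b) * cnj (F x0) - f (x0 - b) * cnj (f x0)) -` {0} \<inter> space borel
    = {b \<in> space borel. F (x0 - b) * cnj (F x0) = f (x0 - b) * cnj (f x0)}"
   by auto
  finally show "Measurable.pred borel (\<lambda>b. F (x0 - b) * cnj (F x0) = f (x0 - b) * cnj (f x0))" by (simp only: pred_def)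
 qed simp
 then have "AE x in lborel. F x = cnj (f x0) / cnj (F x0) * f x"
 proof eventually_elim
  case (elim x)
  then have "F x * cnj (F x0) = f x * cnj (f x0)" by simp
  then show ?case using F0 by (simp add: nonzero_eq_divide_eq mult.commute)
 qed
 moreover have "cmod (cnj (f x0) / cnj (F x0)) = 1" using n F0 x0(1) by (simp add: norm_divide)
 ultimately show ?thesis by (rule that[rotated])
qed

text \<open>Integrating the functional equation over \<open>[0, \<delta>]\<close> writes
  \<open>f\<close> through its own primitive, so continuity already gives differentiability and
  \<open>f' = \<kappa> * f\<close>. A length \<open>\<delta>\<close> with nonzero integral exists
  because \<open>f 0 = 1\<close>.\<close>

lemma continuous_semigroup_character:
 fixes f :: "real \<Rightarrow> complex"
 assumes cont: "continuous_on {0..} f" and mult: "\<And>b c. 0 \<le> b \<Longrightarrow> 0 \<le> c \<Longrightarrow> f (b + c) = f b * f c" and f0: "f 0 = 1"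
 obtains \<kappa> where "\<And>b. 0 \<le> b \<Longrightarrow> f b = exp (\<kappa> * of_real b)"
proof -
 define I where "I x = integral {0..x} f" for x
 have I': "(I has_vector_derivative f x) (at x within {0..R})" if "0 \<le> x" "x \<le> R" for x R
  unfolding I_def using that by (intro integral_has_vector_derivative continuous_on_subset[OF cont]) auto
 have "\<exists>\<delta>>0. I \<delta> \<noteq> 0"
 proof (rule ccontr)
  assume n: "\<not> ?thesis"
  have I0: "I x = 0" if "x \<in> {0..1}" for x using n that by (cases "x = 0") (auto simp: I_def)
  have "((\<lambda>_. 0) has_vector_derivative f 0) (at 0 within {0..1})"
   by (rule has_vector_derivative_transform[OF _ _ I'[of 0 1]]) (use I0 in auto)
  moreover have "((\<lambda>_. 0 :: complex) has_vector_derivative 0) (at 0 within {0..1::real})" by simp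
  ultimately have "f 0 = 0" by (rule vector_derivative_unique_within[rotated]) (simp add: trivial_limit_within)
  then show False using f0 by simp
 qed
 then obtain \<delta> where \<delta>: "0 < \<delta>" "I \<delta> \<noteq> 0" by blast
 define \<kappa> where "\<kappa> = (f \<delta> - 1) / I \<delta>"
 have fI: "f c = (I (c + \<delta>) - I c) / I \<delta>" if c: "0 \<le> c" for c
 proof -
  have int: "f integrable_on {a..b}" if "0 \<le> a" for a b
   using that by (intro integrable_continuous_interval continuous_on_subset[OF cont]) auto
  have "f c * I \<delta> = integral {0..\<delta>} (\<lambda>t. f c * f t)" unfolding I_def by simp
  also have "\<dots> = integral {0..\<delta>} (\<lambda>t. f (t + c))"
   using c by (intro Henstock_Kurzweil_Integration.integral_cong) (simp add: mult)
  also have "\<dots> = integral {c..c + \<delta>} f" using integral_shift_Icc_real[of 0 \<delta> f c] by (simp add: add.commute o_def)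
  also have "\<dots> = I (c + \<delta>) - I c"
   unfolding I_def using Henstock_Kurzweil_Integration.integral_combine[OF c _ int, of "c + \<delta>"] \<delta>(1) by (simp add: algebra_simps)
  finally show ?thesis using \<delta>(2) by (simp add: nonzero_eq_divide_eq)
 qed
 have f': "(f has_vector_derivative \<kappa> * f x) (at x within {0..R})" if x: "x \<in> {0..R}" for x R
 proof -
  have sh: "((\<lambda>c. c + \<delta>) has_vector_derivative 1) (at x within {0..R})" by (auto intro!: derivative_eq_intros)
  have "(I has_vector_derivative f (x + \<delta>)) (at (x + \<delta>) within {0..R + \<delta>})" using x \<delta> by (intro I') auto
  then have "(I has_vector_derivative f (x + \<delta>)) (at (x + \<delta>) within (\<lambda>c. c + \<delta>) ` {0..R})"
   by (rule has_vector_derivative_within_subset) (use \<delta> in auto)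
  from vector_diff_chain_within[OF sh this]
  have "((\<lambda>c. I (c + \<delta>)) has_vector_derivative f (x + \<delta>)) (at x within {0..R})" by (simp add: o_def)
  then have "((\<lambda>c. (I (c + \<delta>) - I c) / I \<delta>) has_vector_derivative (f (x + \<delta>) - f x) / I \<delta>) (at x within {0..R})"
   using x by (intro has_vector_derivative_divide has_vector_derivative_diff I') auto
  moreover have "(f (x + \<delta>) - f x) / I \<delta> = \<kappa> * f x" using x \<delta> by (simp add: mult \<kappa>_def algebra_simps)
  ultimately have "((\<lambda>c. (I (c + \<delta>) - I c) / I \<delta>) has_vector_derivative \<kappa> * f x) (at x within {0..R})"
   by simp
  then show ?thesis by (rule has_vector_derivative_transform[OF x, rotated]) (use fI in auto)
 qed
 show ?thesis
 proof (rule that)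
  fix b :: real assume b: "0 \<le> b"
  have e': "((\<lambda>x. exp (- \<kappa> * of_real x)) has_vector_derivative - \<kappa> * exp (- \<kappa> * of_real x)) (at x within {0..b})" for x :: real
  proof (rule has_vector_derivative_at_within, rule has_vector_derivative_real_field)
   show "((\<lambda>z. exp (- \<kappa> * z)) has_field_derivative - \<kappa> * exp (- \<kappa> * of_real x)) (at (of_real x))"
    by (auto intro!: derivative_eq_intros)
  qed
  have "((\<lambda>x. f x * exp (- \<kappa> * of_real x)) has_vector_derivative 0) (at x within {0..b})" if "x \<in> {0..b}" for x
   using has_vector_derivative_mult[OF f'[OF that] e'] by (simp add: algebra_simps)
  then obtain c where c: "\<And>x. x \<in> {0..b} \<Longrightarrow> f x * exp (- \<kappa> * of_real x) = c"
   using has_vector_derivative_zero_constant[of "{0..b}" "\<lambda>x. f x * exp (- \<kappa> * of_real x)"] by auto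
  from c[of 0] c[of b] b f0 have "f b * exp (- \<kappa> * of_real b) = 1" by simp
  then have "f b * (exp (- \<kappa> * of_real b) * exp (\<kappa> * of_real b)) = exp (\<kappa> * of_real b)"
   by (simp only: mult.assoc[symmetric]) simp
  then show "f b = exp (\<kappa> * of_real b)" by (simp flip: exp_add)
 qed
qed

lemma not_AE_False: "\<not> (AE t in (lborel :: real measure). False)"
proof
 assume "AE t in (lborel :: real measure). False"
 then have "AE t in (lborel :: real measure). (1 :: complex) = 0" by eventually_elim simp
 then show False using continuous_AE_zero[of "\<lambda>_. 1"] by simp
qed

section \<open>The cocycle of a unimodular symbol and its analytic extension\<close>

locale inner_cocycle =
 fixes u :: "real \<Rightarrow> complex"
 assumes u_meas [measurable]: "u \<in> borel_measurable borel" and u1: "\<And>t. cmod (u t) = 1"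
  and inv: "\<And>b h. 0 \<le> b \<Longrightarrow> h \<in> Hm \<Longrightarrow> (\<lambda>t. cnj (u t) * u (t - b) * h t) \<in> Hm"
begin

definition om :: "real \<Rightarrow> real \<Rightarrow> complex" where
 "om b t = cnj (u t) * u (t - b)"

text \<open>For \<open>0 \<le> b\<close> this Poisson extension is holomorphic, because
  \<open>om b\<close> multiplies \<open>Hm\<close> into itself.\<close>

definition Om :: "real \<Rightarrow> complex \<Rightarrow> complex" where
 "Om b z = (LBINT t. poisson z t * om b t)"

lemma om_meas [measurable]: "om b \<in> borel_measurable borel" unfolding om_def by measurable

lemma cmod_om: "cmod (om b t) = 1" by (simp add: om_def norm_mult u1)

lemma cmod_om_le: "cmod (om b t) \<le> 1" by (simp add: cmod_om)

lemma om_Hm: "0 \<le> b \<Longrightarrow> h \<in> Hm \<Longrightarrow> (\<lambda>t. om b t * h t) \<in> Hm" unfolding om_def by (rule inv)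

lemma om_kernel_Hm: "0 \<le> b \<Longrightarrow> (\<lambda>t. om b t / (of_real t + \<i>)) \<in> Hm"
 using om_Hm[OF _ kernel_in_Hm[of \<i>]] by simp

lemma cnj_u_mult_u: "cnj (u t) * u t = 1" using complex_norm_square[of "u t"] by (simp add: u1 mult.commute)

lemma om_zero: "om 0 t = 1" by (simp add: om_def cnj_u_mult_u)

lemma om_add: "om (b + c) t = om b t * om c (t - b)"
proof -
 have "om b t * om c (t - b) = cnj (u t) * (cnj (u (t - b)) * u (t - b)) * u (t - b - c)" by (simp add: om_def mult_ac)
 then show ?thesis by (simp add: cnj_u_mult_u om_def diff_diff_eq)
qed

lemma Om_eq: "0 \<le> b \<Longrightarrow> 0 < Im z \<Longrightarrow> Om b z = (z + \<i>) * cauchy_ext (\<lambda>t. om b t / (of_real t + \<i>)) z"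
 unfolding Om_def by (rule poisson_bounded_ext[OF om_meas cmod_om_le om_kernel_Hm])

lemma Om_bound:
 assumes "0 < Im z"
 shows "cmod (Om b z) \<le> 1"
proof -
 have "cmod (Om b z) \<le> (LBINT t. norm (poisson z t * om b t))" unfolding Om_def by (rule integral_norm_bound)
 also have "\<dots> = (LBINT t. poisson z t)" using poisson_nonneg[OF assms] by (simp add: norm_mult cmod_om)
 finally show ?thesis by (simp add: poisson_integral[OF assms])
qed

lemma Om_holomorphic:
 assumes b: "0 \<le> b"
 shows "Om b holomorphic_on {z. 0 < Im z}"
proof -
 have "(\<lambda>z. (z + \<i>) * cauchy_ext (\<lambda>t. om b t / (of_real t + \<i>)) z) holomorphic_on {z. 0 < Im z}"
  by (intro holomorphic_intros cauchy_ext_holomorphic HmD(1)[OF om_kernel_Hm[OF b]])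
 then show ?thesis by (rule holomorphic_transform) (simp add: Om_eq[OF b])
qed

lemma Om_zero: "0 < Im z \<Longrightarrow> Om 0 z = 1" by (simp add: Om_def om_zero poisson_integral)

text \<open>Poisson extension is multiplicative for the multiplier \<open>om b\<close> and the
  translate of \<open>om c\<close>; translating the boundary function moves the point to
  \<open>z - b\<close>.\<close>

lemma Om_add:
 assumes b: "0 \<le> b" and c: "0 \<le> c" and z: "0 < Im z"
 shows "Om (b + c) z = Om b z * Om c (z - of_real b)"
proof -
 have 1: "(\<lambda>t. om c t * (1 / (of_real t - cnj (\<i> - of_real b)))) \<in> Hm" by (rule om_Hm[OF c kernel_in_Hm]) simp
 have eq: "om c (t - b) * (1 / (complex_of_real (t - b) - cnj (\<i> - of_real b))) = om c (t - b) / (of_real t + \<i>)" for t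
  by (simp add: algebra_simps)
 have H: "(\<lambda>t. om c (t - b) / (of_real t + \<i>)) \<in> Hm" using Hm_translate[OF 1, of b] unfolding eq .
 have "Om (b + c) z = (LBINT t. poisson z t * om b t) * (LBINT t. poisson z t * om c (t - b))"
  unfolding Om_def om_add by (rule poisson_multiplicative[OF _ _ cmod_om_le om_Hm[OF b] cmod_om_le H z]) measurable
 also have "(LBINT t. poisson z t * om c (t - b)) = (LBINT t. (\<lambda>s. poisson (z - of_real b) s * om c s) (t - b))"
  by (simp add: poisson_def)
 also have "\<dots> = Om c (z - of_real b)" unfolding Om_def by (rule lborel_integral_shift(1))
 finally show ?thesis by (simp add: Om_def)
qed

text \<open>\<open>u\<close> is only measurable, so continuity comes from translations in L^2. With
  \<open>f = u / (t - z)\<close> and \<open>1 / (t - z) = (1 - b / (t - z)) / (t - b - z)\<close>,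
  \<open>Om b z\<close> becomes a combination of inner products with the translate of
  \<open>f\<close>.\<close>

lemma Om_continuous:
 assumes z: "0 < Im z"
 shows "continuous_on UNIV (\<lambda>b. Om b z)"
proof -
 define f where "f t = u t / (complex_of_real t - z)" for t
 define g where "g t = f t / (of_real t - cnj z)" for t
 have nz: "complex_of_real t - z \<noteq> 0" "of_real t - cnj z \<noteq> 0" for t
  using of_real_diff_nonzero[of z t] of_real_diff_nonzero[of "cnj z" t] z by auto
 have fL: "f \<in> L2" using L2_bounded_mult[OF L2_kernel[of z], of u 1] z by (simp add: f_def[abs_def] u1)
 have gL: "g \<in> L2" using L2_bounded_mult[OF fL, of "\<lambda>t. 1 / (of_real t - cnj z)" "1 / Im z"] z kernel_bounded[of "cnj z"]
  by (simp add: g_def[abs_def])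
 have DL: "Dop b f \<in> L2" for b by (rule L2_Dop[OF fL])
 have eq: "poisson z t * om b t = of_real (Im z / pi) * (cnj (f t) * Dop b f t - of_real b * (cnj (g t) * Dop b f t))" for b t
 proof -
  have "c / (x * y) * (p * r) = c * (p / y * (r / w) - B * (p / y / x * (r / w)))" if "x \<noteq> 0" "y \<noteq> 0" "w \<noteq> 0" "w = x - B" for c x y p r w B :: complex
  proof -
   have "c * (p / y * (r / w) - B * (p / y / x * (r / w))) = c * p * r * (x - B) / (x * y * w)"
    using that(1-3) by (simp add: divide_simps) (simp add: algebra_simps)
   then show ?thesis unfolding that(4)[symmetric] using that(1-3) by simp
  qed
  note key = this
  show ?thesis
   unfolding poisson_kernel_product[OF z] om_def f_def g_def Dop_def complex_cnj_divide complex_cnj_diff complex_cnj_complex_of_real complex_cnj_cnj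
   by (rule key[OF nz(1)[of t] nz(2)[of t] nz(1)[of "t - b"]]) simp
 qed
 have "Om b z = of_real (Im z / pi) * (cinner (to_l2 f) (Dl b (to_l2 f)) - of_real b * cinner (to_l2 g) (Dl b (to_l2 f)))" for b
  unfolding Om_def eq Dl_to_l2[OF fL] cinner_to_l2[OF fL DL] cinner_to_l2[OF gL DL]
   integral_mult_right_zero
  using L2_mult_integrable[OF L2_cnj[OF fL] DL] L2_mult_integrable[OF L2_cnj[OF gL] DL] by (subst Bochner_Integration.integral_diff) auto
 then show ?thesis by (simp only:) (intro continuous_intros continuous_on_cinner Dl_continuous)
qed

lemma Om_not_identically_zero: "\<exists>z. 0 < Im z \<and> Om b z \<noteq> 0"
proof (rule ccontr)
 assume n: "\<not> ?thesis"
 have "AE t in lborel. om b t = 0"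
 proof (rule poisson_uniqueness[OF om_meas])
  show "integrable lborel (\<lambda>t. cmod (om b t) / (1 + t\<^sup>2))" using integrable_inverse_1_plus_sq by (simp add: cmod_om)
  show "(LBINT t. poisson v t * om b t) = 0" if "0 < Im v" for v using n that by (auto simp: Om_def)
 qed
 then have "AE t in (lborel :: real measure). False"
 proof eventually_elim
  case (elim t)
  then show ?case using cmod_om[of b t] by simp
 qed
 then show False using not_AE_False by simp
qed

lemma cmod_Om_antimono:
 assumes "0 \<le> b" "b \<le> c" "0 < Im z"
 shows "cmod (Om c z) \<le> cmod (Om b z)"
proof -
 have "cmod (Om c z) = cmod (Om b z) * cmod (Om (c - b) (z - of_real b))" using Om_add[of b "c - b" z] assms by (simp add: norm_mult)
 also have "\<dots> \<le> cmod (Om b z) * 1" using assms by (intro mult_left_mono Om_bound) auto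
 finally show ?thesis by simp
qed

text \<open>If \<open>c\<close> is the smallest zero of \<open>b \<mapsto> Om b z\<close>, the cocycle identity forces \<open>Om c\<close> to vanish on a whole segment.\<close>

lemma Om_nonzero:
 assumes b: "0 \<le> b" and z: "0 < Im z"
 shows "Om b z \<noteq> 0"
proof
 assume zero: "Om b z = 0"
 let ?Z = "{c \<in> {0..b}. Om c z = 0}"
 have "closed ?Z" using closed_Int[OF closed_atLeastAtMost closed_Collect_eq[OF Om_continuous[OF z] continuous_on_const, of 0], of 0 b]
  by (simp only: Int_def mem_Collect_eq)
 moreover have "bounded ?Z" by (rule bounded_subset[OF bounded_closed_interval[of 0 b]]) auto
 ultimately have "compact ?Z" by (simp only: compact_eq_bounded_closed)
 moreover have "?Z \<noteq> {}" using zero b by auto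
 ultimately obtain c where c: "c \<in> ?Z" "\<And>x. x \<in> ?Z \<Longrightarrow> c \<le> x" using compact_attains_inf[of ?Z] by blast
 have c0: "0 < c" using c(1) Om_zero[OF z] by (cases "c = 0") auto
 \<comment> \<open>By minimality \<open>Om (c - e) z\<close> is nonzero, so the other factor
   \<open>Om e\<close> vanishes at \<open>z - (c - e)\<close>; it is also a factor of
   \<open>Om c\<close> at that point.\<close>
 have seg: "Om c (z - of_real c + of_real e) = 0" if e: "0 < e" "e \<le> c" for e
 proof -
  have "Om c z = Om (c - e) z * Om e (z - of_real (c - e))" using Om_add[of "c - e" e z] e z by simp
  moreover have "Om (c - e) z \<noteq> 0" using c(2)[of "c - e"] c(1) e by auto
  ultimately have "Om e (z - of_real (c - e)) = 0" using c(1) by simp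
  moreover have "Om c (z - of_real (c - e)) = Om e (z - of_real (c - e)) * Om (c - e) (z - of_real (c - e) - of_real e)"
   using Om_add[of e "c - e" "z - of_real (c - e)"] e z by simp
  ultimately show ?thesis by (simp add: algebra_simps)
 qed
 let ?U = "(\<lambda>e. z - of_real c + complex_of_real e) ` {0<..c}"
 have "Om c w = 0" if w: "0 < Im w" for w
 proof (rule analytic_continuation[of "Om c" "{z. 0 < Im z}" ?U z])
  show "Om c holomorphic_on {z. 0 < Im z}" using c0 by (intro Om_holomorphic) simp
  show "open {z. 0 < Im z}" "connected {z. 0 < Im z}" by (auto simp: open_halfspace_Im_gt intro!: convex_connected convex_halfspace_Im_gt)
  show "z islimpt ?U" unfolding islimpt_approachable
  proof (intro allI impI)
   fix e :: real assume e: "0 < e"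
   define d where "d = min (e / 2) (c / 2)"
   have d: "0 < d" "d < e" "d < c" using e c0 by (auto simp: d_def)
   show "\<exists>x'\<in>?U. x' \<noteq> z \<and> dist x' z < e"
   proof (rule bexI)
    show "z - of_real c + complex_of_real (c - d) \<in> ?U" by (rule imageI) (use d in auto)
    show "z - of_real c + complex_of_real (c - d) \<noteq> z \<and> dist (z - of_real c + complex_of_real (c - d)) z < e"
     using d by (simp add: dist_norm)
   qed
  qed
 qed (use z w seg in auto)
 then show False using Om_not_identically_zero[of c] by blast
qed

text \<open>L^2 boundary convergence for \<open>om b / (t + \<i>)\<close> becomes convergence in
  mean on an interval after multiplying back by \<open>x + \<i>\<close>, bounded there; the extra
  \<open>y\<close> comes from replacing \<open>z + \<i>\<close> by \<open>x + \<i>\<close>. The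
  interval has length 1, so Cauchy-Schwarz adds no constant.\<close>

lemma Om_boundary_modulus:
 assumes b: "0 \<le> b" and T: "0 \<le> T"
 shows "((\<lambda>y. LBINT x. indicator {T..T + 1} x * (1 - cmod (Om b (Complex x y)))) \<longlongrightarrow> 0) (at_right 0)"
proof (rule Lim_null_comparison)
 define F where "F t = om b t / (of_real t + \<i>)" for t
 have F: "F \<in> Hm" unfolding F_def by (rule om_kernel_Hm[OF b])
 define D where "D y x = cauchy_ext F (Complex x y) - F x" for y x
 have DL: "D y \<in> L2" if "0 < y" for y unfolding D_def using Hm_boundary(1)[OF F that] cauchy_ext_line_measurable[OF HmD(1)[OF F] that]
  by (intro L2_diff HmD(1)[OF F] L2I)
 have "((\<lambda>y. LBINT x. (cmod (D y x))\<^sup>2) \<longlongrightarrow> 0) (at_right 0)"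
  using Hm_boundary(3)[OF F] by (simp add: D_def)
 from tendsto_real_sqrt[OF this]
 have "((\<lambda>y. (T + 2) * sqrt (LBINT x. (cmod (D y x))\<^sup>2) + y) \<longlongrightarrow> (T + 2) * sqrt 0 + 0) (at_right 0)"
  by (intro tendsto_add tendsto_mult tendsto_const) (auto simp: tendsto_ident_at)
 then show "((\<lambda>y. (T + 2) * sqrt (LBINT x. (cmod (D y x))\<^sup>2) + y) \<longlongrightarrow> 0) (at_right 0)" by simp
 show "\<forall>\<^sub>F y in at_right 0. norm (LBINT x. indicator {T..T + 1} x * (1 - cmod (Om b (Complex x y))))
   \<le> (T + 2) * sqrt (LBINT x. (cmod (D y x))\<^sup>2) + y"
  using eventually_at_right_less[of "0::real"]
 proof eventually_elim
  case (elim y)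
  let ?i = "\<lambda>x. indicator {T..T + 1} x :: real"
  have Om_le: "cmod (Om b (Complex x y)) \<le> 1" for x using elim by (intro Om_bound) simp
  have ptw: "1 - cmod (Om b (Complex x y)) \<le> (T + 2) * cmod (D y x) + y" if x: "x \<in> {T..T + 1}" for x
  proof -
   have xi: "of_real x + \<i> \<noteq> 0" by (simp add: complex_eq_iff)
   have Oe: "Om b (Complex x y) = (Complex x y + \<i>) * cauchy_ext F (Complex x y)"
    using Om_eq[OF b, of "Complex x y"] elim by (simp add: F_def[abs_def])
   have "Om b (Complex x y) - om b x = (of_real x + \<i>) * D y x + of_real y * \<i> * cauchy_ext F (Complex x y)"
   proof -
    have "(of_real x + \<i>) * F x = om b x" using xi by (simp add: F_def)
    moreover have "(Complex x y + \<i>) * e - (of_real x + \<i>) * f = (of_real x + \<i>) * (e - f) + of_real y * \<i> * e" for e f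
     by (simp add: Complex_eq algebra_simps)
    ultimately show ?thesis unfolding Oe D_def by metis
   qed
   then have "cmod (Om b (Complex x y) - om b x) \<le> cmod (of_real x + \<i>) * cmod (D y x) + y * cmod (cauchy_ext F (Complex x y))"
    using norm_triangle_ineq[of "(of_real x + \<i>) * D y x" "of_real y * \<i> * cauchy_ext F (Complex x y)"] elim by (simp add: norm_mult)
   also have "\<dots> \<le> (T + 2) * cmod (D y x) + y * 1"
   proof (intro add_mono mult_mono mult_left_mono)
    show "cmod (of_real x + \<i>) \<le> T + 2" using norm_triangle_ineq[of "complex_of_real x" \<i>] x T by simp
    have "1 \<le> cmod (Complex x y + \<i>)" using abs_Im_le_cmod[of "Complex x y + \<i>"] elim by simp
    then have "1 * cmod (cauchy_ext F (Complex x y)) \<le> cmod (Om b (Complex x y))"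
     unfolding Oe norm_mult by (intro mult_right_mono) auto
    then show "cmod (cauchy_ext F (Complex x y)) \<le> 1" using Om_le[of x] by simp
   qed (use T elim in auto)
   finally show ?thesis using norm_triangle_ineq3[of "Om b (Complex x y)" "om b x"] cmod_om[of b x] by simp
  qed
  have im: "(\<lambda>x. indicator {T..T + 1} x) \<in> L2"
  proof (rule L2I)
   have "(\<lambda>x. (cmod (indicator {T..T + 1} x))\<^sup>2) = ?i" by (auto simp: indicator_def)
   then show "integrable lborel (\<lambda>x. (cmod (indicator {T..T + 1} x))\<^sup>2)" by simp
  qed measurable
  have Dn: "(\<lambda>x. complex_of_real (cmod (D y x))) \<in> L2" using L2D[OF DL[OF elim]] by (intro L2I) auto
  have iD: "integrable lborel (\<lambda>x. ?i x * cmod (D y x))"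
  proof -
   have "(\<lambda>x. Re (indicator {T..T + 1} x * complex_of_real (cmod (D y x)))) = (\<lambda>x. ?i x * cmod (D y x))"
    by (auto simp: indicator_def)
   then show ?thesis using integrable_Re[OF L2_mult_integrable[OF im Dn]] by simp
  qed
  have ii: "integrable lborel ?i" by simp
  have meas: "(\<lambda>x. Om b (Complex x y)) \<in> borel_measurable borel"
  proof (rule borel_measurable_continuous_onI, rule continuous_on_compose2[OF holomorphic_on_imp_continuous_on[OF Om_holomorphic[OF b]]])
   show "continuous_on UNIV (\<lambda>x. Complex x y)" unfolding Complex_eq by (intro continuous_intros)
  qed (use elim in auto)
  have 0: "0 \<le> (LBINT x. ?i x * (1 - cmod (Om b (Complex x y))))"
   using Om_le by (intro integral_nonneg_AE AE_I2) (simp add: indicator_def)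
  have "(LBINT x. ?i x * (1 - cmod (Om b (Complex x y)))) \<le> (LBINT x. (T + 2) * (?i x * cmod (D y x)) + y * ?i x)"
  proof (rule integral_mono)
   show "integrable lborel (\<lambda>x. ?i x * (1 - cmod (Om b (Complex x y))))"
   proof (rule Bochner_Integration.integrable_bound[OF ii])
    show "AE x in lborel. norm (?i x * (1 - cmod (Om b (Complex x y)))) \<le> norm (?i x)"
     using Om_le by (intro AE_I2) (auto simp: indicator_def)
   qed (use meas in measurable)
   show "integrable lborel (\<lambda>x. (T + 2) * (?i x * cmod (D y x)) + y * ?i x)"
    by (intro Bochner_Integration.integrable_add integrable_mult_right iD ii)
   show "?i x * (1 - cmod (Om b (Complex x y))) \<le> (T + 2) * (?i x * cmod (D y x)) + y * ?i x" for x
    using ptw[of x] by (cases "x \<in> {T..T + 1}") auto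
  qed
  also have "\<dots> = (T + 2) * (LBINT x. ?i x * cmod (D y x)) + y" using iD ii by simp
  also have "(LBINT x. ?i x * cmod (D y x)) \<le> sqrt (LBINT x. (cmod (D y x))\<^sup>2)"
  proof (rule real_le_rsqrt)
   have "(LBINT x. indicator {T..T + 1} x * complex_of_real (cmod (D y x))) = complex_of_real (LBINT x. ?i x * cmod (D y x))"
    unfolding integral_complex_of_real[symmetric] by (rule Bochner_Integration.integral_cong) (auto simp: indicator_def)
   moreover have "(LBINT x. (cmod (indicator {T..T + 1} x))\<^sup>2) = (LBINT x. ?i x)"
    by (rule Bochner_Integration.integral_cong) (auto simp: indicator_def)
   ultimately show "(LBINT x. ?i x * cmod (D y x))\<^sup>2 \<le> (LBINT x. (cmod (D y x))\<^sup>2)"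
    using L2_Cauchy_Schwarz[OF im Dn] by simp
  qed
  finally show ?case using 0 T by (simp add: mult_left_mono)
 qed
qed

text \<open>Convergence in mean does not control logarithms. The cocycle bounds
  \<open>|Om b|\<close> at every \<open>t\<close> in \<open>[- T, T]\<close> from below by
  \<open>|Om B|\<close> at every \<open>x\<close> in \<open>[T, T + 1]\<close>; averaging over
  \<open>x\<close> turns the mean estimate for \<open>B\<close> into the uniform bound
  \<open>1 - |Om b| \<le> J y\<close>, which passes through \<open>ln\<close>.\<close>

lemma Om_log_boundary:
 assumes b: "0 \<le> b" and T: "0 < T"
 shows "((\<lambda>y. LBINT t. indicator {-T..T} t * (- ln (cmod (Om b (Complex t y))))) \<longlongrightarrow> 0) (at_right 0)"
proof (rule Lim_null_comparison)
 \<comment> \<open>The shift \<open>x - t\<close> is at most \<open>2 * T + 1\<close>, so after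
   subtracting it from \<open>B\<close> at least \<open>b\<close> is left.\<close>
 define B where "B = 2 * T + 1 + b"
 define J where "J y = (LBINT x. indicator {T..T + 1} x * (1 - cmod (Om B (Complex x y))))" for y
 have J: "(J \<longlongrightarrow> 0) (at_right 0)" unfolding J_def B_def by (rule Om_boundary_modulus) (use b T in auto)
 have "((\<lambda>y. 2 * T * (- ln (1 - J y))) \<longlongrightarrow> 2 * T * (- ln (1 - 0))) (at_right 0)" by (intro tendsto_intros J) simp
 then show "((\<lambda>y. 2 * T * (- ln (1 - J y))) \<longlongrightarrow> 0) (at_right 0)" by simp
 have "\<forall>\<^sub>F y in at_right 0. J y < 1" using order_tendstoD(2)[OF J, of 1] by simp
 then show "\<forall>\<^sub>F y in at_right 0. norm (LBINT t. indicator {-T..T} t * (- ln (cmod (Om b (Complex t y))))) \<le> 2 * T * (- ln (1 - J y))"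
  using eventually_at_right_less[of "0::real"]
 proof eventually_elim
  case (elim y)
  let ?q = "\<lambda>t. - ln (cmod (Om b (Complex t y)))"
  have le1: "cmod (Om c (Complex x y)) \<le> 1" for c x using elim by (intro Om_bound) simp
  have pos: "0 < cmod (Om c (Complex x y))" if "0 \<le> c" for c x using Om_nonzero[OF that, of "Complex x y"] elim by simp
  have contO: "continuous_on A (\<lambda>x. Om c (Complex x y))" if "0 \<le> c" for A c
  proof (rule continuous_on_compose2[OF holomorphic_on_imp_continuous_on[OF Om_holomorphic[OF that]]])
   show "continuous_on A (\<lambda>x. Complex x y)" unfolding Complex_eq by (intro continuous_intros)
  qed (use elim in auto)
  have B0: "0 \<le> B" using b T by (simp add: B_def)
  have comp: "cmod (Om B (Complex x y)) \<le> cmod (Om b (Complex t y))" if x: "x \<in> {T..T + 1}" and t: "t \<in> {-T..T}" for x t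
  proof -
   have sh: "Complex x y - of_real (x - t) = Complex t y" by (simp add: complex_eq_iff)
   have "Om ((x - t) + (B - (x - t))) (Complex x y) = Om (x - t) (Complex x y) * Om (B - (x - t)) (Complex t y)"
    unfolding sh[symmetric] using x t elim b T by (intro Om_add) (auto simp: B_def)
   then have "cmod (Om B (Complex x y)) = cmod (Om (x - t) (Complex x y)) * cmod (Om (B - (x - t)) (Complex t y))"
    by (simp add: norm_mult)
   also have "\<dots> \<le> 1 * cmod (Om b (Complex t y))"
    using x t elim b T by (intro mult_mono le1 cmod_Om_antimono) (auto simp: B_def)
   finally show ?thesis by simp
  qed
  have ii: "integrable lborel (\<lambda>x. indicator {T..T + 1} x :: real)" by simp
  have qJ: "1 - cmod (Om b (Complex t y)) \<le> J y" if t: "t \<in> {-T..T}" for t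
  proof -
   have "(LBINT x. indicator {T..T + 1} x * (1 - cmod (Om b (Complex t y)))) \<le> J y" unfolding J_def
   proof (rule integral_mono)
    show "integrable lborel (\<lambda>x. indicator {T..T + 1} x * (1 - cmod (Om b (Complex t y))))" by (intro integrable_mult_left ii)
    show "integrable lborel (\<lambda>x. indicator {T..T + 1} x * (1 - cmod (Om B (Complex x y))))"
    proof (rule Bochner_Integration.integrable_bound[OF ii])
     show "AE x in lborel. norm (indicator {T..T + 1} x * (1 - cmod (Om B (Complex x y)))) \<le> norm (indicator {T..T + 1} x :: real)"
      using le1 by (intro AE_I2) (auto simp: indicator_def)
    qed (use borel_measurable_continuous_onI[OF contO[OF B0]] in measurable)
    show "indicator {T..T + 1} x * (1 - cmod (Om b (Complex t y))) \<le> indicator {T..T + 1} x * (1 - cmod (Om B (Complex x y)))" for x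
     using comp[OF _ t, of x] by (auto simp: indicator_def)
   qed
   then show ?thesis by simp
  qed
  have q: "0 \<le> ?q t" "t \<in> {-T..T} \<Longrightarrow> ?q t \<le> - ln (1 - J y)" for t
  proof -
   show "0 \<le> ?q t" using le1[of b t] pos[OF b, of t] by simp
   assume t: "t \<in> {-T..T}"
   have "ln (1 - J y) \<le> ln (cmod (Om b (Complex t y)))" using qJ[OF t] elim pos[OF b, of t] by (subst ln_le_cancel_iff) auto
   then show "?q t \<le> - ln (1 - J y)" by simp
  qed
  have J1: "integrable lborel (\<lambda>t. indicator {-T..T} t * (- ln (1 - J y)))"
   by (intro integrable_mult_left) (simp add: emeasure_lborel_Icc_eq)
  have "(LBINT t. indicator {-T..T} t * ?q t) \<le> (LBINT t. indicator {-T..T} t * (- ln (1 - J y)))"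
  proof (rule integral_mono[OF _ J1])
   show "indicator {-T..T} t * ?q t \<le> indicator {-T..T} t * (- ln (1 - J y))" for t using q(2)[of t] by (auto simp: indicator_def)
   show "integrable lborel (\<lambda>t. indicator {-T..T} t * ?q t)"
   proof (rule Bochner_Integration.integrable_bound[OF J1])
    have "0 \<le> - ln (1 - J y)" using q[of 0] T by auto
    then show "AE t in lborel. norm (indicator {-T..T} t * ?q t) \<le> norm (indicator {-T..T} t * (- ln (1 - J y)))"
     using q by (intro AE_I2) (auto simp: indicator_def)
   qed (use borel_measurable_continuous_onI[OF contO[OF b]] in measurable)
  qed
  moreover have "0 \<le> (LBINT t. indicator {-T..T} t * ?q t)" using q(1) by (intro integral_nonneg_AE AE_I2) (auto simp: indicator_def)
  moreover have "(LBINT t. indicator {-T..T} t * (- ln (1 - J y))) = 2 * T * (- ln (1 - J y))" using T by simp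
  ultimately show ?case by (simp only: real_norm_def abs_of_nonneg)
 qed
qed

text \<open>The half-plane is contractible and \<open>Om b\<close> has no zeros, so a logarithm
  \<open>g\<close> exists; \<open>- g\<close> has nonnegative real part and vanishing boundary
  integrals.\<close>

lemma Om_exponential:
 assumes b: "0 \<le> b"
 obtains s \<theta> :: real where "0 \<le> s" "\<And>z. 0 < Im z \<Longrightarrow> Om b z = exp (\<i> * of_real s * z - \<i> * of_real \<theta>)"
proof -
 let ?H = "{z. 0 < Im z}"
 have "\<exists>g. g holomorphic_on ?H \<and> (\<forall>z\<in>?H. Om b z = exp (g z))"
 proof (rule contractible_imp_holomorphic_log)
  show "contractible ?H" by (intro convex_imp_contractible convex_halfspace_Im_gt)
 qed (use Om_holomorphic[OF b] Om_nonzero[OF b] in \<open>auto simp: open_halfspace_Im_gt\<close>)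
 then obtain g where g: "g holomorphic_on ?H" "\<And>z. 0 < Im z \<Longrightarrow> Om b z = exp (g z)" by blast
 have Re: "Re (g z) = ln (cmod (Om b z))" if "0 < Im z" for z using g(2)[OF that] by simp
 obtain s \<theta> :: real where s: "0 \<le> s" and gz: "\<And>z. 0 < Im z \<Longrightarrow> - g z = - \<i> * of_real s * z + \<i> * of_real \<theta>"
 proof (rule positive_real_part_affine[of "\<lambda>z. - g z"])
  show "(\<lambda>z. - g z) holomorphic_on ?H" by (intro holomorphic_intros g)
  show "0 \<le> Re (- g z)" if "0 < Im z" for z using Re[OF that] Om_bound[OF that] Om_nonzero[OF b that] by simp
  fix T :: real assume T: "0 < T"
  have "\<forall>\<^sub>F y in at_right 0. (LBINT t. indicator {-T..T} t * (- ln (cmod (Om b (Complex t y))))) = (LBINT t. indicator {-T..T} t * Re (- g (Complex t y)))"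
   using eventually_at_right_less[of "0::real"] by eventually_elim (simp add: Re)
  then show "((\<lambda>y. LBINT t. indicator {-T..T} t * Re (- g (Complex t y))) \<longlongrightarrow> 0) (at_right 0)"
   by (rule Lim_transform_eventually[OF Om_log_boundary[OF b T]])
 qed (rule that)
 show ?thesis
 proof (rule that[OF s])
  fix z assume z: "0 < Im z"
  have "g z = \<i> * of_real s * z - \<i> * of_real \<theta>" using arg_cong[OF gz[OF z], of uminus] by simp
  then show "Om b z = exp (\<i> * of_real s * z - \<i> * of_real \<theta>)" using g(2)[OF z] by simp
 qed
qed

text \<open>The character is the boundary value of \<open>exp (\<i> * s * z)\<close>, bounded above
  the line for \<open>0 \<le> s\<close>, so it has the same Poisson integrals as \<open>om b\<close>
  up to \<open>c\<close>.\<close>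

lemma om_eq_exponential:
 assumes s: "0 \<le> s" and Om: "\<And>z. 0 < Im z \<Longrightarrow> Om b z = exp (\<i> * of_real s * z) * c"
 shows "AE t in lborel. om b t = cis_mult s t * c"
proof -
 have E: "(LBINT t. poisson z t * exp (\<i> * of_real s * complex_of_real t)) = exp (\<i> * of_real s * z)" if z: "0 < Im z" for z
 proof (rule bounded_holomorphic_poisson[of "\<lambda>z. exp (\<i> * of_real s * z)" 1, OF _ _ _ z])
  show "(\<lambda>z. exp (\<i> * of_real s * z)) holomorphic_on {z. - 1 < Im z}" by (intro holomorphic_intros)
 qed (use s in auto)
 have eq: "cis_mult s t = exp (\<i> * of_real s * complex_of_real t)" for t by (simp add: mult.assoc)
 let ?h = "\<lambda>t. om b t - cis_mult s t * c"
 have [measurable]: "?h \<in> borel_measurable borel" by measurable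
 have bd: "cmod (?h t) \<le> 1 + cmod c" for t
  using norm_triangle_ineq4[of "om b t" "cis_mult s t * c"] cmod_om[of b t] norm_exp_ii_of_real[of "s * t"] by (simp add: norm_mult)
 have "AE t in lborel. ?h t = 0"
 proof (rule poisson_uniqueness)
  show "integrable lborel (\<lambda>t. cmod (?h t) / (1 + t\<^sup>2))"
  proof (rule Bochner_Integration.integrable_bound)
   show "integrable lborel (\<lambda>t::real. (1 + cmod c) * (1 / (1 + t\<^sup>2)))"
    by (intro integrable_mult_right integrable_inverse_1_plus_sq)
   show "AE t in lborel. norm (cmod (?h t) / (1 + t\<^sup>2)) \<le> norm ((1 + cmod c) * (1 / (1 + t\<^sup>2)))"
    using bd by (intro AE_I2) (auto intro!: divide_right_mono simp: add_nonneg_nonneg)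
  qed measurable
  fix z assume z: "0 < Im z"
  have "(LBINT t. poisson z t * ?h t) = (LBINT t. poisson z t * om b t) - (LBINT t. poisson z t * exp (\<i> * of_real s * complex_of_real t) * c)"
  proof -
   have "integrable lborel (\<lambda>t. poisson z t * om b t)" by (rule poisson_bounded_integrable[OF om_meas cmod_om_le z])
   moreover have "integrable lborel (\<lambda>t. poisson z t * exp (\<i> * of_real s * complex_of_real t) * c)" unfolding eq[symmetric]
    by (intro integrable_mult_left poisson_bounded_integrable[OF _ _ z, of _ 1]) (auto simp del: of_real_mult simp: norm_exp_ii_of_real)
   ultimately show ?thesis unfolding eq by (simp add: right_diff_distrib mult.assoc flip: Bochner_Integration.integral_diff)
  qed
  also have "\<dots> = 0" unfolding integral_mult_left_zero E[OF z] Om[OF z, unfolded Om_def] by simp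
  finally show "(LBINT t. poisson z t * ?h t) = 0" .
 qed measurable
 then show ?thesis by eventually_elim simp
qed

text \<open>The exponents in \<open>Om b z\<close> are determined as functions of \<open>b\<close>:
  the modulus gives \<open>\<sigma> b = s * b\<close>, and the phase is additive up to a quadratic
  term. Then \<open>u\<close> has the correlations of an explicit quadratic exponential and agrees
  with it up to a constant.\<close>

theorem classification:
 obtains c :: complex and a s :: real where "cmod c = 1" "0 \<le> s" "AE t in lborel. u t = c * (cis_mult a t * phi s t)"
proof -
 have "\<exists>p. 0 \<le> b \<longrightarrow> 0 \<le> fst p \<and> (\<forall>z. 0 < Im z \<longrightarrow> Om b z = exp (\<i> * of_real (fst p) * z - \<i> * of_real (snd p)))" for b
 proof (cases "0 \<le> b")
  case True
  obtain s \<theta> :: real where "0 \<le> s" "\<And>z. 0 < Im z \<Longrightarrow> Om b z = exp (\<i> * of_real s * z - \<i> * of_real \<theta>)"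
   by (rule Om_exponential[OF True]) (rule that)
  then show ?thesis by (intro exI[of _ "(s, \<theta>)"]) auto
 qed simp
 then obtain p where p: "\<And>b. 0 \<le> b \<longrightarrow> 0 \<le> fst (p b) \<and> (\<forall>z. 0 < Im z \<longrightarrow> Om b z = exp (\<i> * of_real (fst (p b)) * z - \<i> * of_real (snd (p b))))"
  by metis
 define \<sigma> where "\<sigma> b = fst (p b)" for b
 define \<theta> where "\<theta> b = snd (p b)" for b
 have \<sigma>: "0 \<le> \<sigma> b" if "0 \<le> b" for b using p[of b] that by (simp add: \<sigma>_def)
 have O: "Om b z = exp (\<i> * of_real (\<sigma> b) * z - \<i> * of_real (\<theta> b))" if "0 \<le> b" "0 < Im z" for b z
  using p[of b] that by (simp add: \<sigma>_def \<theta>_def)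
 have cmodO: "cmod (Om b z) = exp (- \<sigma> b * Im z)" if "0 \<le> b" "0 < Im z" for b z by (simp add: O[OF that])
 have contO: "continuous_on {0..} (\<lambda>b. Om b \<i>)" by (rule continuous_on_subset[OF Om_continuous]) auto
 \<comment> \<open>\<open>|Om c|\<close> depends only on the imaginary part of its argument, so the
   real shift in the cocycle identity is invisible and the modulus at \<open>\<i>\<close> is a
   semigroup.\<close>
 obtain \<kappa> where \<kappa>: "\<And>b. 0 \<le> b \<Longrightarrow> complex_of_real (cmod (Om b \<i>)) = exp (\<kappa> * of_real b)"
 proof (rule continuous_semigroup_character[of "\<lambda>b. complex_of_real (cmod (Om b \<i>))"])
  show "continuous_on {0..} (\<lambda>b. complex_of_real (cmod (Om b \<i>)))" by (intro continuous_intros contO)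
  show "complex_of_real (cmod (Om (b + c) \<i>)) = complex_of_real (cmod (Om b \<i>)) * complex_of_real (cmod (Om c \<i>))" if "0 \<le> b" "0 \<le> c" for b c
   using that by (simp add: Om_add norm_mult cmodO)
  show "complex_of_real (cmod (Om 0 \<i>)) = 1" by (simp add: Om_zero)
 qed (rule that)
 define s where "s = \<sigma> 1"
 have \<sigma>b: "\<sigma> b = - Re \<kappa> * b" if "0 \<le> b" for b
 proof -
  have "cmod (of_real (cmod (Om b \<i>))) = exp (Re \<kappa> * b)" unfolding \<kappa>[OF that] by simp
  then show ?thesis using cmodO[OF that, of \<i>] by simp
 qed
 then have \<sigma>s: "\<sigma> b = s * b" if "0 \<le> b" for b using \<sigma>b[OF that] \<sigma>b[of 1] by (simp add: s_def)
 have s0: "0 \<le> s" unfolding s_def by (rule \<sigma>) simp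
 \<comment> \<open>The shift in the cocycle identity produces a cross term \<open>s * b * c\<close>
   in the phase. The quadratic phase \<open>s * b^2 / 2\<close> compensates it and the factor
   \<open>exp (s * b)\<close> removes the modulus, so \<open>\<xi>\<close> is a unimodular
   character.\<close>
 define \<xi> where "\<xi> b = Om b \<i> * exp (of_real (s * b) + \<i> * of_real (s * b\<^sup>2 / 2))" for b
 have \<xi>_alt: "\<xi> b = exp (\<i> * of_real (s * b\<^sup>2 / 2) - \<i> * of_real (\<theta> b))" if "0 \<le> b" for b
 proof -
  have "\<i> * of_real (s * b) * \<i> - \<i> * of_real (\<theta> b) + (of_real (s * b) + \<i> * of_real (s * b\<^sup>2 / 2)) = \<i> * of_real (s * b\<^sup>2 / 2) - \<i> * of_real (\<theta> b)"
   by (simp add: complex_eq_iff)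
  then show ?thesis
   unfolding \<xi>_def using O[OF that, of \<i>] by (simp only: \<sigma>s[OF that] exp_add[symmetric] imaginary_unit.sel zero_less_one)
 qed
 have O2: "Om b z = exp (\<i> * of_real (s * b) * z) * (\<xi> b * exp (- \<i> * of_real (s * b\<^sup>2 / 2)))" if "0 \<le> b" "0 < Im z" for b z
  unfolding O[OF that] \<xi>_alt[OF that(1)] \<sigma>s[OF that(1)] by (simp flip: exp_add)
 obtain \<kappa>' where \<kappa>': "\<And>b. 0 \<le> b \<Longrightarrow> \<xi> b = exp (\<kappa>' * of_real b)"
 proof (rule continuous_semigroup_character[of \<xi>])
  show "continuous_on {0..} \<xi>" unfolding \<xi>_def by (intro continuous_intros contO) auto
  show "\<xi> 0 = 1" by (simp add: \<xi>_def Om_zero)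
  fix b c :: real assume bc: "0 \<le> b" "0 \<le> c"
  have "Om (b + c) \<i> = Om b \<i> * Om c (\<i> - of_real b)" using bc by (simp add: Om_add)
  then have "exp (\<i> * of_real (s * (b + c)) * \<i>) * (\<xi> (b + c) * exp (- \<i> * of_real (s * (b + c)\<^sup>2 / 2)))
   = exp (\<i> * of_real (s * b) * \<i>) * (\<xi> b * exp (- \<i> * of_real (s * b\<^sup>2 / 2)))
    * (exp (\<i> * of_real (s * c) * (\<i> - of_real b)) * (\<xi> c * exp (- \<i> * of_real (s * c\<^sup>2 / 2))))"
   using O2[of "b + c" \<i>] O2[of b \<i>] O2[of c "\<i> - of_real b"] bc by simp
  then have "\<xi> (b + c) * exp (\<i> * of_real (s * (b + c)) * \<i> + - \<i> * of_real (s * (b + c)\<^sup>2 / 2))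
   = \<xi> b * \<xi> c * exp (\<i> * of_real (s * b) * \<i> + - \<i> * of_real (s * b\<^sup>2 / 2) + (\<i> * of_real (s * c) * (\<i> - of_real b) + - \<i> * of_real (s * c\<^sup>2 / 2)))"
   by (simp only: exp_add mult_ac)
  moreover have "\<i> * of_real (s * (b + c)) * \<i> + - \<i> * of_real (s * (b + c)\<^sup>2 / 2)
   = \<i> * of_real (s * b) * \<i> + - \<i> * of_real (s * b\<^sup>2 / 2) + (\<i> * of_real (s * c) * (\<i> - of_real b) + - \<i> * of_real (s * c\<^sup>2 / 2))"
   by (simp add: complex_eq_iff power2_eq_square field_simps)
  ultimately show "\<xi> (b + c) = \<xi> b * \<xi> c" by (simp only: mult_cancel_right exp_not_eq_zero) simp
 qed (rule that)
 define \<tau> where "\<tau> = Im \<kappa>'"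
 have \<xi>\<tau>: "\<xi> b = exp (\<i> * of_real (\<tau> * b))" if "0 \<le> b" for b
 proof -
  have "cmod (\<xi> 1) = 1" by (simp add: \<xi>_alt)
  then have "Re \<kappa>' = 0" using \<kappa>'[of 1] by simp
  then have "\<kappa>' = \<i> * of_real \<tau>" by (simp add: complex_eq_iff \<tau>_def)
  then show ?thesis using \<kappa>'[OF that] by (simp add: mult.assoc)
 qed
 define f where "f t = cis_mult (- \<tau>) t * phi s t" for t
 have f_meas: "f \<in> borel_measurable borel" unfolding f_def phi_def by (intro borel_measurable_continuous_onI continuous_intros) auto
 obtain c where "cmod c = 1" "AE t in lborel. u t = c * f t"
 proof (rule correlation_determines_function[OF f_meas u_meas])
  show "\<not> (AE t in lborel. f t = 0)" using not_AE_False by (simp add: f_def phi_def)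
  fix b :: real assume b: "0 \<le> b"
  have "AE t in lborel. om b t = cis_mult (s * b) t * (\<xi> b * exp (- \<i> * of_real (s * b\<^sup>2 / 2)))"
   using b s0 by (intro om_eq_exponential O2) auto
  then show "AE t in lborel. u (t - b) * cnj (u t) = f (t - b) * cnj (f t)"
  proof eventually_elim
   case (elim t)
   have 1: "f (t - b) = exp (\<i> * of_real (- \<tau> * (t - b)) + - \<i> * of_real (s * (t - b)\<^sup>2 / 2))"
    unfolding f_def phi_def exp_add ..
   have 2: "cnj (f t) = exp (- \<i> * of_real (- \<tau> * t) + \<i> * of_real (s * t\<^sup>2 / 2))"
    unfolding f_def phi_def exp_add complex_cnj_mult exp_cnj by simp
   have "\<i> * of_real (- \<tau> * (t - b)) + - \<i> * of_real (s * (t - b)\<^sup>2 / 2) + (- \<i> * of_real (- \<tau> * t) + \<i> * of_real (s * t\<^sup>2 / 2))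
    = \<i> * of_real (s * b * t) + (\<i> * of_real (\<tau> * b) + - \<i> * of_real (s * b\<^sup>2 / 2))"
    by (simp add: complex_eq_iff power2_eq_square field_simps)
   then have "f (t - b) * cnj (f t) = exp (\<i> * of_real (s * b * t) + (\<i> * of_real (\<tau> * b) + - \<i> * of_real (s * b\<^sup>2 / 2)))"
    unfolding 1 2 exp_add[symmetric] by (rule arg_cong)
   also have "\<dots> = om b t" unfolding elim exp_add \<xi>\<tau>[OF b] ..
   finally show ?case by (simp add: om_def mult.commute)
  qed
 qed (rule that)
 then show ?thesis using that[of c s "- \<tau>"] s0 by (simp add: f_def)
qed

end

section \<open>The model spaces\<close>

text \<open>The extension of the product is \<open>exp (\<i> * a * z) * F z\<close>, and the
  exponential has modulus at most 1 above the line; the analytic description of the Hardy space is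
  the convenient one here.\<close>

lemma Hm_Mop:
 assumes h: "h \<in> Hm" and a: "0 \<le> a"
 shows "(\<lambda>t. cis_mult a t * h t) \<in> Hm"
proof -
 have hL: "h \<in> L2" by (rule HmD(1)[OF h])
 from h obtain F C where F: "F holomorphic_on {z. 0 < Im z}"
  and FC: "\<And>y. 0 < y \<Longrightarrow> integrable lborel (\<lambda>x. (cmod (F (Complex x y)))\<^sup>2)"
   "\<And>y. 0 < y \<Longrightarrow> (LBINT x. (cmod (F (Complex x y)))\<^sup>2) \<le> C"
  and lim: "((\<lambda>y. LBINT x. (cmod (F (Complex x y) - h x))\<^sup>2) \<longlongrightarrow> 0) (at_right 0)"
  unfolding hardy2_eq_Hm[symmetric] hardy2_def by blast
 define G where "G z = exp (\<i> * of_real a * z) * F z" for z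
 have G: "G holomorphic_on {z. 0 < Im z}" unfolding G_def by (intro holomorphic_intros F)
 have meas: "(\<lambda>x. H (Complex x y)) \<in> borel_measurable borel" if "0 < y" "H holomorphic_on {z. 0 < Im z}" for y H
 proof (rule borel_measurable_continuous_onI, rule continuous_on_compose2[OF holomorphic_on_imp_continuous_on[OF that(2)]])
  show "continuous_on UNIV (\<lambda>x. Complex x y)" unfolding Complex_eq by (intro continuous_intros)
 qed (use that in auto)
 have FL: "(\<lambda>x. F (Complex x y)) \<in> L2" if "0 < y" for y by (rule L2I[OF meas[OF that F] FC(1)[OF that]])
 have le: "cmod (G (Complex x y)) \<le> cmod (F (Complex x y))" if "0 < y" for x y
  using a that by (simp add: G_def norm_mult mult_left_le_one_le)
 have GL: "(\<lambda>x. G (Complex x y)) \<in> L2" if "0 < y" for y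
  by (rule L2_bound[OF FL[OF that] meas[OF that G], of 1]) (use le[OF that] in simp)
 have GC: "(LBINT x. (cmod (G (Complex x y)))\<^sup>2) \<le> C" if "0 < y" for y
 proof -
  have "(LBINT x. (cmod (G (Complex x y)))\<^sup>2) \<le> (LBINT x. (cmod (F (Complex x y)))\<^sup>2)"
   using le[OF that] by (intro integral_mono L2D(2)[OF GL[OF that]] FC(1)[OF that] power_mono) auto
  then show ?thesis using FC(2)[OF that] by linarith
 qed
 have "((\<lambda>y. LBINT x. (cmod (G (Complex x y) - cis_mult a x * h x))\<^sup>2) \<longlongrightarrow> 0) (at_right 0)"
 proof (rule Lim_null_comparison)
  have "((\<lambda>y. 2 * (LBINT x. (cmod (F (Complex x y) - h x))\<^sup>2) + 2 * (1 - exp (- a * y))\<^sup>2 * C) \<longlongrightarrow> 2 * 0 + 2 * (1 - exp (- a * 0))\<^sup>2 * C) (at_right 0)"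
   by (intro tendsto_intros lim)
  then show "((\<lambda>y. 2 * (LBINT x. (cmod (F (Complex x y) - h x))\<^sup>2) + 2 * (1 - exp (- a * y))\<^sup>2 * C) \<longlongrightarrow> 0) (at_right 0)"
   by simp
  show "\<forall>\<^sub>F y in at_right 0. norm (LBINT x. (cmod (G (Complex x y) - cis_mult a x * h x))\<^sup>2)
    \<le> 2 * (LBINT x. (cmod (F (Complex x y) - h x))\<^sup>2) + 2 * (1 - exp (- a * y))\<^sup>2 * C"
   using eventually_at_right_less[of "0::real"]
  proof eventually_elim
   case (elim y)
   let ?e = "exp (- a * y)"
   have i1: "integrable lborel (\<lambda>x. (cmod (F (Complex x y) - h x))\<^sup>2)" by (rule L2D(2)[OF L2_diff[OF FL[OF elim] hL]])
   have i2: "integrable lborel (\<lambda>x. (cmod (G (Complex x y) - cis_mult a x * h x))\<^sup>2)"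
    using L2D(2)[OF L2_diff[OF GL[OF elim] L2_Mop[OF hL, of a]]] by (simp add: Mop_def)
   \<comment> \<open>At height \<open>y\<close> the factor \<open>exp (\<i> * a * z)\<close> is
     \<open>cis_mult a x\<close> times \<open>exp (- a * y)\<close>, so the error splits into the
     boundary error of \<open>F\<close> and \<open>1 - exp (- a * y)\<close> times
     \<open>F\<close>.\<close>
   have ptw: "(cmod (G (Complex x y) - cis_mult a x * h x))\<^sup>2 \<le> 2 * (cmod (F (Complex x y) - h x))\<^sup>2 + 2 * (1 - ?e)\<^sup>2 * (cmod (F (Complex x y)))\<^sup>2" for x
   proof -
    have "\<i> * of_real a * Complex x y = \<i> * of_real (a * x) + of_real (- a * y)" by (simp add: complex_eq_iff)
    then have "G (Complex x y) - cis_mult a x * h x = cis_mult a x * ((F (Complex x y) - h x) - of_real (1 - ?e) * F (Complex x y))"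
     by (simp only: G_def exp_add exp_of_real) (simp add: algebra_simps)
    then have "cmod (G (Complex x y) - cis_mult a x * h x) = cmod ((F (Complex x y) - h x) - of_real (1 - ?e) * F (Complex x y))"
     by (simp only: norm_mult norm_exp_ii_of_real mult_1_left)
    also have "\<dots> \<le> cmod (F (Complex x y) - h x) + \<bar>1 - ?e\<bar> * cmod (F (Complex x y))"
     using norm_triangle_ineq4[of "F (Complex x y) - h x" "of_real (1 - ?e) * F (Complex x y)"] by (simp only: norm_mult norm_of_real)
    finally have "(cmod (G (Complex x y) - cis_mult a x * h x))\<^sup>2 \<le> (cmod (F (Complex x y) - h x) + \<bar>1 - ?e\<bar> * cmod (F (Complex x y)))\<^sup>2"
     by (intro power_mono) auto
    also have "\<dots> \<le> 2 * (cmod (F (Complex x y) - h x))\<^sup>2 + 2 * (\<bar>1 - ?e\<bar> * cmod (F (Complex x y)))\<^sup>2"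
     using sum_squares_bound[of "cmod (F (Complex x y) - h x)" "\<bar>1 - ?e\<bar> * cmod (F (Complex x y))"] unfolding power2_sum by linarith
    finally show ?thesis by (simp add: power_mult_distrib)
   qed
   have "(LBINT x. (cmod (G (Complex x y) - cis_mult a x * h x))\<^sup>2)
     \<le> (LBINT x. 2 * (cmod (F (Complex x y) - h x))\<^sup>2 + 2 * (1 - ?e)\<^sup>2 * (cmod (F (Complex x y)))\<^sup>2)"
    by (intro integral_mono i2 Bochner_Integration.integrable_add integrable_mult_right i1 FC(1)[OF elim] ptw)
   also have "\<dots> = 2 * (LBINT x. (cmod (F (Complex x y) - h x))\<^sup>2) + 2 * (1 - ?e)\<^sup>2 * (LBINT x. (cmod (F (Complex x y)))\<^sup>2)"
    using i1 FC(1)[OF elim] by simp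
   also have "\<dots> \<le> 2 * (LBINT x. (cmod (F (Complex x y) - h x))\<^sup>2) + 2 * (1 - ?e)\<^sup>2 * C"
    using FC(2)[OF elim] by (intro add_left_mono mult_left_mono) auto
   finally show ?case by simp
  qed
 qed
 then have "(\<lambda>t. cis_mult a t * h t) \<in> hardy2"
  unfolding hardy2_def using L2_Mop[OF hL, of a] G GC L2D(2)[OF GL] by (auto simp: Mop_def intro!: exI[of _ G] exI[of _ C])
 then show ?thesis by (simp add: hardy2_eq_Hm)
qed

text \<open>Division by \<open>t + \<i>\<close> makes \<open>h\<close> integrable, and the
  hypotheses say that this quotient \<open>g\<close> integrates to 0 against every
  \<open>cis_mult (- a)\<close>. So the Cauchy transforms of \<open>g\<close> at upper points
  vanish, those of \<open>h\<close> with them; as \<open>h\<close> is also in \<open>Hm\<close>, it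
  is 0.\<close>

lemma Hm_pure:
 assumes h: "\<And>a. 0 \<le> a \<Longrightarrow> (\<lambda>t. cis_mult (- a) t * h t) \<in> Hm"
 shows "AE t in lborel. h t = 0"
proof -
 have h0: "h \<in> Hm" using h[of 0] by simp
 have up: "(LBINT t. h t / (complex_of_real t - w)) = 0" if w: "0 < Im w" for w
 proof -
  let ?v = "\<i> :: complex"
  define g where "g t = h t / (of_real t - cnj ?v)" for t
  have gi: "integrable lborel g" unfolding g_def by (rule L2_kernel_integrable[OF HmD(1)[OF h0]]) simp
  have "(LBINT t. cnj (g t) / (of_real t - cnj w)) = 0"
  proof (rule cauchy_transform_zero_if_fourier_zero[OF _ _ w])
   show "integrable lborel (\<lambda>t. cnj (g t))" using gi by (rule integrable_cnj)
   fix a :: real assume a: "0 \<le> a"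
   have "(LBINT t. cis_mult a t * cnj (g t)) = (LBINT t. cnj (cis_mult (- a) t * h t / (of_real t - cnj ?v)))"
    by (simp add: g_def exp_cnj)
   also have "\<dots> = cnj (LBINT t. cis_mult (- a) t * h t / (of_real t - cnj ?v))" by (rule Bochner_Integration.integral_cnj)
   also have "\<dots> = 0" using HmD(2)[OF h[OF a], of ?v] by simp
   finally show "(LBINT t. cis_mult a t * cnj (g t)) = 0" .
  qed
  then have "cnj (LBINT t. g t / (complex_of_real t - w)) = 0" by (simp flip: Bochner_Integration.integral_cnj)
  then have z: "(LBINT t. g t / (complex_of_real t - w)) = 0" by simp
  have nz: "w + \<i> \<noteq> 0" using w by (auto simp: complex_eq_iff)
  have eq: "h t / (complex_of_real t - w) = (w + \<i>) * (g t / (complex_of_real t - w)) + g t" for t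
  proof -
   have nz: "complex_of_real t - w \<noteq> 0" "of_real t - cnj \<i> \<noteq> 0"
    using of_real_diff_nonzero[of w t] of_real_diff_nonzero[of "- \<i>" t] w by auto
   have key: "p / x = y * (p / d / x) + p / d" if "x \<noteq> 0" "d \<noteq> 0" "d = x + y" for p x y d :: complex
    using that(1,2) by (simp add: divide_simps) (simp add: that(3) algebra_simps)
   show ?thesis unfolding g_def by (rule key[OF nz]) simp
  qed
  have gw: "integrable lborel (\<lambda>t. g t / (complex_of_real t - w))" using w by (intro integrable_kernel_mult gi) simp
  have "(LBINT t. h t / (complex_of_real t - w)) = (w + \<i>) * (LBINT t. g t / (complex_of_real t - w)) + (LBINT t. g t)"
   unfolding eq Bochner_Integration.integral_add[OF integrable_mult_right[OF gw] gi] integral_mult_right_zero ..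
  moreover have "(LBINT t. g t) = 0" using HmD(2)[OF h0, of \<i>] by (simp add: g_def)
  ultimately show ?thesis using z by simp
 qed
 show ?thesis by (rule L2_zero_if_cauchy_transforms_zero[OF HmD(1)[OF h0] up HmD(2)[OF h0]])
qed

text \<open>The unimodular symbol of \<open>K_ls a s\<close>: the space is this function times the
  Hardy space.\<close>

definition md :: "real \<Rightarrow> real \<Rightarrow> real \<Rightarrow> complex" where
 "md a s t = cis_mult a t * phi s t"

lemma md_exp: "md a s t = exp (\<i> * of_real (a * t - s * t\<^sup>2 / 2))"
 unfolding md_def phi_def exp_add[symmetric] by (rule arg_cong[of _ _ exp]) (simp add: algebra_simps)

lemma cmod_md [simp]: "cmod (md a s t) = 1" unfolding md_exp by (rule norm_exp_ii_of_real)

lemma md_measurable [measurable]: "md a s \<in> borel_measurable borel"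
 unfolding md_exp[abs_def] by (intro borel_measurable_continuous_onI continuous_intros) auto

lemma cnj_md_mult: "cnj (md a s t) * md a s t = 1" "md a s t * cnj (md a s t) = 1"
 using complex_norm_square[of "md a s t"] by (simp_all add: mult.commute)

lemma cnj_md_mult_md: "cnj (md a s t) * md a' s' t' = exp (\<i> * of_real ((a' * t' - s' * t'\<^sup>2 / 2) - (a * t - s * t\<^sup>2 / 2)))"
 unfolding md_exp exp_cnj exp_add[symmetric] by (rule arg_cong[of _ _ exp]) (simp add: complex_eq_iff)

lemma md_shift: "cnj (md a s t) * md a s (t - b) = exp (- \<i> * of_real (a * b + s * b\<^sup>2 / 2)) * cis_mult (s * b) t"
 unfolding cnj_md_mult_md exp_add[symmetric] by (rule arg_cong[of _ _ exp]) (simp add: complex_eq_iff power2_eq_square field_simps)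

lemma K_ls_iff:
 assumes f: "f \<in> L2"
 shows "f \<in> K_ls a s \<longleftrightarrow> (\<lambda>t. cnj (md a s t) * f t) \<in> Hm"
proof
 assume "f \<in> K_ls a s"
 then obtain h where h: "h \<in> Hm" "AE x in lborel. f x = Mop a (\<lambda>t. phi s t * h t) x" by (auto simp: K_ls_def hardy2_eq_Hm)
 have "AE t in lborel. h t = cnj (md a s t) * f t" using h(2)
 proof eventually_elim
  case (elim t)
  have "cnj (md a s t) * f t = (cnj (md a s t) * md a s t) * h t" unfolding elim Mop_def md_def by (simp only: mult.assoc)
  then show ?case by (simp only: cnj_md_mult mult_1_left)
 qed
 then show "(\<lambda>t. cnj (md a s t) * f t) \<in> Hm" using L2D(1)[OF f] by (intro Hm_AE_cong[OF h(1)]) measurable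
next
 assume h: "(\<lambda>t. cnj (md a s t) * f t) \<in> Hm"
 have "f t = Mop a (\<lambda>t. phi s t * (cnj (md a s t) * f t)) t" for t
 proof -
  have "Mop a (\<lambda>t. phi s t * (cnj (md a s t) * f t)) t = (md a s t * cnj (md a s t)) * f t"
   unfolding Mop_def md_def by (simp only: mult.assoc)
  then show ?thesis by (simp only: cnj_md_mult mult_1_left)
 qed
 then show "f \<in> K_ls a s" unfolding K_ls_def hardy2_eq_Hm by (intro CollectI conjI f bexI[OF _ h] AE_I2)
qed

lemma K_l_eq_K_ls: "K_l a = K_ls a 0" by (simp add: K_l_def K_ls_def phi_def)

text \<open>Removing the symbol turns \<open>Dop b\<close> into a translation, a modulation by
  \<open>s * b\<close> and a constant. Translations and nonzero constants preserve \<open>Hm\<close>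
  in both directions, so the modulation alone decides.\<close>

lemma K_ls_Dop_iff:
 assumes f: "f \<in> L2"
 shows "Dop b f \<in> K_ls a s \<longleftrightarrow> (\<lambda>t. cis_mult (s * b) t * (cnj (md a s t) * f t)) \<in> Hm"
proof -
 let ?g = "\<lambda>t. cnj (md a s t) * f t"
 define c where "c = exp (- \<i> * of_real (a * b + s * b\<^sup>2 / 2))"
 define d where "d = exp (\<i> * of_real (s * b * b))"
 have c0: "c \<noteq> 0" "d \<noteq> 0" by (simp_all add: c_def d_def)
 have eq: "cnj (md a s t) * Dop b f t = c * (cis_mult (s * b) t * ?g (t - b))" for t
 proof -
  have "cnj (md a s t) * Dop b f t = cnj (md a s t) * (md a s (t - b) * cnj (md a s (t - b))) * f (t - b)"
   unfolding cnj_md_mult by (simp add: Dop_def)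
  also have "\<dots> = (cnj (md a s t) * md a s (t - b)) * ?g (t - b)" by (simp only: mult.assoc)
  finally show ?thesis unfolding md_shift c_def by (simp only: mult.assoc)
 qed
 have sh: "cis_mult (s * b) t = d * cis_mult (s * b) (t - b)" for t
  unfolding d_def exp_add[symmetric] by (rule arg_cong[of _ _ exp]) (simp add: algebra_simps)
 have eq2: "cnj (md a s t) * Dop b f t = (c * d) * (cis_mult (s * b) (t - b) * ?g (t - b))" for t
  unfolding eq sh[of t] by (simp only: mult.assoc)
 show ?thesis
 proof
  assume "Dop b f \<in> K_ls a s"
  then have "(\<lambda>t. (c * d) * (cis_mult (s * b) (t - b) * ?g (t - b))) \<in> Hm" unfolding K_ls_iff[OF L2_Dop[OF f]] eq2 .
  from Hm_translate[OF Hm_scale[OF this, of "1 / (c * d)"], of "- b"] show "(\<lambda>t. cis_mult (s * b) t * ?g t) \<in> Hm"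
   using c0 by simp
 next
  assume "(\<lambda>t. cis_mult (s * b) t * ?g t) \<in> Hm"
  from Hm_scale[OF Hm_translate[OF this, of b], of "c * d"] show "Dop b f \<in> K_ls a s" unfolding K_ls_iff[OF L2_Dop[OF f]] eq2 .
 qed
qed

lemma K_ls_Mop_iff:
 assumes f: "f \<in> L2"
 shows "Mop b f \<in> K_ls a s \<longleftrightarrow> (\<lambda>t. cis_mult b t * (cnj (md a s t) * f t)) \<in> Hm"
 unfolding K_ls_iff[OF L2_Mop[OF f]] by (simp add: Mop_def mult.left_commute)

text \<open>The closure properties common to the three families of models, on which the comparison
  of equivalent models rests.\<close>

locale model_space =
 fixes K :: "(real \<Rightarrow> complex) set"
 assumes K_L2: "f \<in> K \<Longrightarrow> f \<in> L2"
  and K_AE: "f \<in> K \<Longrightarrow> g \<in> L2 \<Longrightarrow> AE t in lborel. f t = g t \<Longrightarrow> g \<in> K"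
  and K_add: "f \<in> K \<Longrightarrow> g \<in> K \<Longrightarrow> (\<lambda>t. f t + g t) \<in> K"
  and K_scale: "f \<in> K \<Longrightarrow> (\<lambda>t. c * f t) \<in> K"
  and K_Mop: "f \<in> K \<Longrightarrow> 0 \<le> a \<Longrightarrow> Mop a f \<in> K"
  and K_Dop: "f \<in> K \<Longrightarrow> 0 \<le> b \<Longrightarrow> Dop b f \<in> K"

lemma model_space_K_ls:
 assumes s: "0 \<le> s"
 shows "model_space (K_ls a s)"
proof
 fix f g :: "real \<Rightarrow> complex" and b :: real and c :: complex
 assume fK: "f \<in> K_ls a s"
 then show f: "f \<in> L2" by (simp add: K_ls_def)
 note fH = fK[unfolded K_ls_iff[OF f]]
 show "(\<lambda>t. c * f t) \<in> K_ls a s"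
  unfolding K_ls_iff[OF L2_scale[OF f]] using Hm_scale[OF fH, of c] by (simp add: mult.left_commute)
 show "g \<in> K_ls a s" if g: "g \<in> L2" "AE t in lborel. f t = g t" unfolding K_ls_iff[OF g(1)]
 proof (rule Hm_AE_cong[OF fH])
  show "AE t in lborel. cnj (md a s t) * f t = cnj (md a s t) * g t" using g(2) by eventually_elim simp
 qed (use L2D(1)[OF g(1)] in measurable)
 show "(\<lambda>t. f t + g t) \<in> K_ls a s" if "g \<in> K_ls a s"
 proof -
  have g: "g \<in> L2" using that by (simp add: K_ls_def)
  note gH = that[unfolded K_ls_iff[OF g]]
  show ?thesis unfolding K_ls_iff[OF L2_add[OF f g]] using Hm_diff[OF fH Hm_scale[OF gH, of "-1"]] by (simp add: algebra_simps)
 qed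
 assume b: "0 \<le> b"
 show "Mop b f \<in> K_ls a s" unfolding K_ls_Mop_iff[OF f] by (rule Hm_Mop[OF fH b])
 show "Dop b f \<in> K_ls a s" unfolding K_ls_Dop_iff[OF f] by (rule Hm_Mop[OF fH]) (use b s in simp)
qed

lemma model_space_K_up: "model_space (K_up c)"
proof
 fix f g :: "real \<Rightarrow> complex" and b :: real and d :: complex
 assume fK: "f \<in> K_up c"
 then show f: "f \<in> L2" by (simp add: K_up_def)
 from fK have f0: "AE x in lborel. x < c \<longrightarrow> f x = 0" by (simp add: K_up_def)
 show "(\<lambda>t. d * f t) \<in> K_up c" unfolding K_up_def using L2_scale[OF f, of d] f0 by auto
 show "g \<in> K_up c" if g: "g \<in> L2" "AE t in lborel. f t = g t"
 proof -
  have "AE x in lborel. x < c \<longrightarrow> g x = 0" using f0 g(2) by eventually_elim simp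
  then show ?thesis using g(1) by (simp add: K_up_def)
 qed
 show "(\<lambda>t. f t + g t) \<in> K_up c" if "g \<in> K_up c"
 proof -
  have g: "g \<in> L2" "AE x in lborel. x < c \<longrightarrow> g x = 0" using that by (auto simp: K_up_def)
  have "AE x in lborel. x < c \<longrightarrow> f x + g x = 0" using f0 g(2) by eventually_elim simp
  then show ?thesis using L2_add[OF f g(1)] by (simp add: K_up_def)
 qed
 assume b: "0 \<le> b"
 have "AE x in lborel. x < c \<longrightarrow> Mop b f x = 0" using f0 by eventually_elim (simp add: Mop_def)
 then show "Mop b f \<in> K_up c" using L2_Mop[OF f] by (simp add: K_up_def)
 have "AE x in lborel. x < c \<longrightarrow> Dop b f x = 0"
  using AE_lborel_shift[OF f0, of b] by eventually_elim (use b in \<open>simp add: Dop_def\<close>)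
 then show "Dop b f \<in> K_up c" using L2_Dop[OF f] by (simp add: K_up_def)
qed

lemma to_l2_eq_0_iff:
 assumes "f \<in> L2"
 shows "to_l2 f = 0 \<longleftrightarrow> (AE t in lborel. f t = 0)"
proof -
 have z: "(\<lambda>_. 0) \<in> L2" using L2_scale[OF assms, of 0] by simp
 have "to_l2 (\<lambda>_. 0) = 0" using to_l2_ops(2)[OF assms assms] by simp
 then show ?thesis using to_l2_eq_iff[OF assms z] by simp
qed

text \<open>An intertwiner \<open>W\<close> preserves the matrix coefficients \<open>\<langle>f, M\<^sub>a D\<^sub>b f\<rangle>\<close>, which by Fourier uniqueness
 determine the correlations \<open>f (x - b) * cnj (f x)\<close>, hence \<open>f\<close> up to a unimodular constant.\<close>

lemma models_equiv_imp_eq: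
 assumes K1: "model_space K1" and K2: "model_space K2" and eqv: "models_equiv K1 K2"
 shows "K1 = K2"
proof -
 interpret A: model_space K1 by fact
 interpret B: model_space K2 by fact
 from eqv obtain W :: "(real \<Rightarrow> complex) \<Rightarrow> real \<Rightarrow> complex" where all:
  "(\<forall>f\<in>K1. W f \<in> K2 \<and> L2norm_sq (W f) = L2norm_sq f) \<and>
  (\<forall>f\<in>K1. \<forall>g\<in>K1. AE t in lborel. W (\<lambda>u. f u + g u) t = W f t + W g t) \<and>
  (\<forall>c. \<forall>f\<in>K1. AE t in lborel. W (\<lambda>u. c * f u) t = c * W f t) \<and>
  (\<forall>g\<in>K2. \<exists>f\<in>K1. AE t in lborel. W f t = g t) \<and>
  (\<forall>a. \<forall>f\<in>K1. 0 \<le> a \<longrightarrow> (AE t in lborel. W (Mop a f) t = Mop a (W f) t)) \<and>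
  (\<forall>b. \<forall>f\<in>K1. 0 \<le> b \<longrightarrow> (AE t in lborel. W (Dop b f) t = Dop b (W f) t))"
  unfolding models_equiv_def by (rule exE)
 note W = all[THEN conjunct1, rule_format, THEN conjunct1] all[THEN conjunct1, rule_format, THEN conjunct2]
 note Wadd = all[THEN conjunct2, THEN conjunct1, rule_format]
 note Wscale = all[THEN conjunct2, THEN conjunct2, THEN conjunct1, rule_format]
 note Wsurj = all[THEN conjunct2, THEN conjunct2, THEN conjunct2, THEN conjunct1, rule_format]
 note WM = all[THEN conjunct2, THEN conjunct2, THEN conjunct2, THEN conjunct2, THEN conjunct1, rule_format]
 note WD = all[THEN conjunct2, THEN conjunct2, THEN conjunct2, THEN conjunct2, THEN conjunct2, rule_format]
 have WL: "W f \<in> L2" if "f \<in> K1" for f by (rule B.K_L2[OF W(1)[OF that]])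
 have nrm: "(norm (to_l2 (W f)))\<^sup>2 = (norm (to_l2 f))\<^sup>2" if "f \<in> K1" for f
  using W(2)[OF that] by (simp add: norm_to_l2_sq[OF WL[OF that]] norm_to_l2_sq[OF A.K_L2[OF that]] L2norm_sq_def)
 have ReW: "Re (cinner (to_l2 (W f)) (to_l2 (W g))) = Re (cinner (to_l2 f) (to_l2 g))" if f: "f \<in> K1" and g: "g \<in> K1" for f g
 proof -
  have "to_l2 (W f) + to_l2 (W g) = to_l2 (W (\<lambda>u. f u + g u))" unfolding to_l2_ops(1)[OF WL[OF f] WL[OF g]]
   by (rule to_l2_eqI) (use Wadd[OF f g] in \<open>eventually_elim, simp\<close>)
  then have "(norm (to_l2 (W f) + to_l2 (W g)))\<^sup>2 = (norm (to_l2 f + to_l2 g))\<^sup>2"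
   unfolding to_l2_ops(1)[OF A.K_L2[OF f] A.K_L2[OF g]] using nrm[OF A.K_add[OF f g]] by simp
  then show ?thesis unfolding norm_add_sq nrm[OF f] nrm[OF g] by simp
 qed
 have cW: "cinner (to_l2 (W f)) (to_l2 (W g)) = cinner (to_l2 f) (to_l2 g)" if f: "f \<in> K1" and g: "g \<in> K1" for f g
 proof -
  have "to_l2 (W (\<lambda>u. \<i> * f u)) = scaleC \<i> (to_l2 (W f))"
   unfolding scaleC_to_l2[OF WL[OF f]] by (rule to_l2_eqI) (rule Wscale[OF f])
  moreover have "to_l2 (\<lambda>u. \<i> * f u) = scaleC \<i> (to_l2 f)" unfolding scaleC_to_l2[OF A.K_L2[OF f]] ..
  ultimately have "Im (cinner (to_l2 (W f)) (to_l2 (W g))) = Im (cinner (to_l2 f) (to_l2 g))"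
   using ReW[OF A.K_scale[OF f, of \<i>] g] by (simp add: cinner_scaleC_left)
  then show ?thesis using ReW[OF f g] by (simp add: complex_eq_iff)
 qed
 have const: "\<exists>c. cmod c = 1 \<and> (AE t in lborel. W f t = c * f t)" if f: "f \<in> K1" for f
 proof (cases "AE t in lborel. f t = 0")
  case True
  then have "norm (to_l2 (W f)) = 0" using nrm[OF f] to_l2_eq_0_iff[OF A.K_L2[OF f]] by simp
  then have "AE t in lborel. W f t = 0" using to_l2_eq_0_iff[OF WL[OF f]] by simp
  then have "AE t in lborel. W f t = 1 * f t" using True by eventually_elim simp
  then show ?thesis by (intro exI[of _ 1]) simp
 next
  case False
  have fL: "f \<in> L2" and FL: "W f \<in> L2" using A.K_L2[OF f] WL[OF f] by auto
  have corr: "AE x in lborel. W f (x - b) * cnj (W f x) = f (x - b) * cnj (f x)" if b: "0 \<le> b" for b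
  proof -
   have fb: "Dop b f \<in> K1" by (rule A.K_Dop[OF f b])
   have WDb: "to_l2 (W (Dop b f)) = to_l2 (Dop b (W f))" by (rule to_l2_eqI[OF WD[OF f b]])
   define h where "h x = cnj (W f x) * W f (x - b) - cnj (f x) * f (x - b)" for x
   have i: "integrable lborel (\<lambda>x. cnj (W f x) * W f (x - b))" "integrable lborel (\<lambda>x. cnj (f x) * f (x - b))"
    using L2_mult_integrable[OF L2_cnj[OF FL] L2_Dop[OF FL, of b]] L2_mult_integrable[OF L2_cnj[OF fL] L2_Dop[OF fL, of b]]
    by (simp_all add: Dop_def)
   have "AE x in lborel. h x = 0"
   proof (rule fourier_uniqueness)
    show "integrable lborel h" unfolding h_def by (rule Bochner_Integration.integrable_diff[OF i])
    fix a :: real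
    \<comment> \<open>Only nonnegative modulations are intertwined, so for negative \<open>a\<close>
      the modulation by \<open>- a\<close> is put on the other factor.\<close>
    have four: "(LBINT x. cis_mult a x * (cnj (p x) * p (x - b)))
      = (if 0 \<le> a then cinner (to_l2 p) (to_l2 (Mop a (Dop b p))) else cinner (to_l2 (Mop (- a) p)) (to_l2 (Dop b p)))"
     if p: "p \<in> L2" for p
     using cinner_to_l2[OF p L2_Mop[OF L2_Dop[OF p, of b], of a]] cinner_to_l2[OF L2_Mop[OF p, of "- a"] L2_Dop[OF p, of b]]
     by (simp add: Mop_def Dop_def exp_cnj mult_ac)
    have "(LBINT x. cis_mult a x * (cnj (W f x) * W f (x - b))) = (LBINT x. cis_mult a x * (cnj (f x) * f (x - b)))"
    proof (cases "0 \<le> a")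
     case True
     have "to_l2 (W (Mop a (Dop b f))) = Ml a (to_l2 (W (Dop b f)))"
      unfolding Ml_to_l2[OF WL[OF fb]] by (rule to_l2_eqI[OF WM[OF fb True]])
     also have "\<dots> = to_l2 (Mop a (Dop b (W f)))" unfolding WDb by (rule Ml_to_l2[OF L2_Dop[OF FL]])
     finally have e: "to_l2 (W (Mop a (Dop b f))) = to_l2 (Mop a (Dop b (W f)))" .
     show ?thesis using cW[OF f A.K_Mop[OF fb True], unfolded e] by (simp only: four[OF fL] four[OF FL] True if_True)
    next
     case False
     then have a: "0 \<le> - a" by simp
     have e: "to_l2 (W (Mop (- a) f)) = to_l2 (Mop (- a) (W f))" by (rule to_l2_eqI[OF WM[OF f a]])
     show ?thesis using cW[OF A.K_Mop[OF f a] fb, unfolded e WDb] by (simp only: four[OF fL] four[OF FL] False if_False)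
    qed
    then show "(LBINT x. cis_mult a x * h x) = 0" unfolding h_def right_diff_distrib
     by (subst Bochner_Integration.integral_diff[OF integrable_cis_mult[OF i(1)] integrable_cis_mult[OF i(2)]]) simp
   qed
   then show ?thesis by eventually_elim (simp add: h_def mult.commute)
  qed
  obtain c where "cmod c = 1" "AE x in lborel. W f x = c * f x"
   by (rule correlation_determines_function[OF L2D(1)[OF fL] L2D(1)[OF FL] False corr]) (assumption, rule that)
  then show ?thesis by blast
 qed
 show ?thesis
 proof (intro equalityI subsetI)
  fix f assume f: "f \<in> K1"
  obtain c where c: "cmod c = 1" "AE t in lborel. W f t = c * f t" using const[OF f] by blast
  have c0: "c \<noteq> 0" using c(1) by auto
  show "f \<in> K2"
  proof (rule B.K_AE[OF B.K_scale[OF W(1)[OF f], of "1 / c"] A.K_L2[OF f]])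
   show "AE t in lborel. 1 / c * W f t = f t" using c(2) by eventually_elim (use c0 in simp)
  qed
 next
  fix g assume g: "g \<in> K2"
  obtain f where f: "f \<in> K1" "AE t in lborel. W f t = g t" using Wsurj[OF g] by blast
  obtain c where c: "AE t in lborel. W f t = c * f t" using const[OF f(1)] by blast
  show "g \<in> K1"
  proof (rule A.K_AE[OF A.K_scale[OF f(1), of c] B.K_L2[OF g]])
   show "AE t in lborel. c * f t = g t" using c f(2) by eventually_elim simp
  qed
 qed
qed

text \<open>The kernel at \<open>\<i>\<close> is a nonzero element of \<open>Hm\<close>. Both halves
  of the injectivity proof for \<open>K_ls\<close> end in this contradiction.\<close>

lemma no_Hm_pure: "\<not> (\<forall>a\<ge>0. \<forall>h\<in>Hm. (\<lambda>t. cis_mult (- a) t * h t) \<in> Hm)"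
proof
 assume *: "\<forall>a\<ge>0. \<forall>h\<in>Hm. (\<lambda>t. cis_mult (- a) t * h t) \<in> Hm"
 have "AE t in lborel. 1 / (of_real t - cnj \<i>) = 0"
 proof (rule Hm_pure)
  fix a :: real assume a: "0 \<le> a"
  have k: "(\<lambda>t. 1 / (of_real t - cnj \<i>)) \<in> Hm" by (rule kernel_in_Hm) simp
  show "(\<lambda>t. cis_mult (- a) t * (1 / (of_real t - cnj \<i>))) \<in> Hm" by (rule *[rule_format, OF a k])
 qed
 then have "AE t in (lborel :: real measure). False"
 proof eventually_elim
  case (elim t)
  then show ?case using of_real_diff_nonzero[of "cnj \<i>" t] by simp
 qed
 then show False using not_AE_False by simp
qed

text \<open>Equal spaces make the quotient of the two symbols preserve \<open>Hm\<close> in both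
  directions. If \<open>s \<noteq> s'\<close>, its commutators with translations yield every
  modulation; if \<open>s = s'\<close> and \<open>a \<noteq> a'\<close>, it is itself a modulation
  whose iterates go arbitrarily far. Either way \<open>Hm\<close> would be invariant under inverse
  modulations.\<close>

lemma K_ls_inject:
 assumes eq: "K_ls a s = K_ls a' s'"
 shows "a = a' \<and> s = s'"
proof -
 have tr: "(\<lambda>t. cnj (md a' s' t) * md a s t * h t) \<in> Hm \<longleftrightarrow> h \<in> Hm" if h: "h \<in> L2" for h
 proof -
  have mL: "(\<lambda>t. md a s t * h t) \<in> L2" by (rule L2_bounded_mult[OF h, of _ 1]) auto
  have "(\<lambda>t. md a s t * h t) \<in> K_ls a s \<longleftrightarrow> h \<in> Hm"
   unfolding K_ls_iff[OF mL] by (simp add: cnj_md_mult flip: mult.assoc)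
  moreover have "(\<lambda>t. md a s t * h t) \<in> K_ls a' s' \<longleftrightarrow> (\<lambda>t. cnj (md a' s' t) * md a s t * h t) \<in> Hm"
   unfolding K_ls_iff[OF mL] by (simp add: mult.assoc)
  ultimately show ?thesis using eq by simp
 qed
 let ?r = "\<lambda>t. cnj (md a' s' t) * md a s t"
 have r1: "cmod (?r t) = 1" for t by (simp add: norm_mult)
 have rc: "cnj (?r t) * ?r t = 1" for t using complex_norm_square[of "?r t"] unfolding r1 by (simp add: mult.commute)
 have s: "s = s'"
 proof (rule ccontr)
  assume ne: "s \<noteq> s'"
  have all: "(\<lambda>t. cis_mult (- \<alpha>) t * h t) \<in> Hm" if h: "h \<in> Hm" for \<alpha> h
  proof -
   \<comment> \<open>The translation whose commutator with the quadratic phase \<open>?r\<close> is,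
     up to a constant, modulation by \<open>- \<alpha>\<close>.\<close>
   define b where "b = \<alpha> / (s' - s)"
   have hb: "(\<lambda>t. h (t + b)) \<in> Hm" using Hm_translate[OF h, of "- b"] by simp
   then have "(\<lambda>t. ?r t * h (t + b)) \<in> Hm" using tr[OF HmD(1)] by blast
   from Hm_translate[OF this, of b] have 1: "(\<lambda>t. ?r (t - b) * h t) \<in> Hm" by simp
   have e: "?r (t - b) * h t = ?r t * (cnj (?r t) * (?r (t - b) * h t))" for t using rc[of t] by (simp add: mult_ac)
   have 2: "(\<lambda>t. cnj (?r t) * (?r (t - b) * h t)) \<in> L2"
   proof (rule L2_bounded_mult[OF HmD(1)[OF 1]])
    show "cmod (cnj (?r t)) \<le> 1" for t by (simp only: complex_mod_cnj r1 order_refl)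
   qed measurable
   have 3: "(\<lambda>t. cnj (?r t) * (?r (t - b) * h t)) \<in> Hm" using tr[OF 2] 1 unfolding e[symmetric] by simp
   define c where "c = exp (\<i> * of_real ((a' - a) * b + (s' - s) * b\<^sup>2 / 2))"
   have "cnj (?r t) * ?r (t - b) = c * cis_mult (- \<alpha>) t" for t
   proof -
    have "(s' - s) * b = \<alpha>" using ne by (simp add: b_def)
    then have \<alpha>: "- \<alpha> * t = - ((s' - s) * b) * t" by simp
    have "cnj (?r t) * ?r (t - b) = (cnj (md a s t) * md a' s' t) * (cnj (md a' s' (t - b)) * md a s (t - b))" by (simp add: mult_ac)
    also have "\<dots> = c * cis_mult (- \<alpha>) t" unfolding \<alpha> cnj_md_mult_md c_def exp_add[symmetric]
     by (rule arg_cong[of _ _ exp]) (simp add: complex_eq_iff power2_eq_square field_simps)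
    finally show ?thesis .
   qed
   then have "(\<lambda>t. c * (cis_mult (- \<alpha>) t * h t)) \<in> Hm" using 3 by (simp add: mult.assoc[symmetric])
   from Hm_scale[OF this, of "1 / c"] show ?thesis by (simp add: c_def)
  qed
  show False by (rule notE[OF no_Hm_pure]) (intro allI impI ballI all)
 qed
 moreover have "a = a'"
 proof (rule ccontr)
  assume ne: "a \<noteq> a'"
  define \<delta> where "\<delta> = \<bar>a - a'\<bar>"
  have \<delta>: "0 < \<delta>" using ne by (simp add: \<delta>_def)
  have r: "?r t = cis_mult (a - a') t" for t unfolding cnj_md_mult_md s by (rule arg_cong[of _ _ exp]) (simp add: algebra_simps)
  have step: "(\<lambda>t. cis_mult (- \<delta>) t * h t) \<in> Hm" if h: "h \<in> Hm" for h
  proof (cases "a < a'")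
   case True
   then show ?thesis using tr[OF HmD(1)[OF h]] h unfolding r \<delta>_def by simp
  next
   case False
   have L: "(\<lambda>t. cis_mult (a' - a) t * h t) \<in> L2" using L2_Mop[OF HmD(1)[OF h], of "a' - a"] by (simp add: Mop_def)
   have e: "cis_mult (a - a') t * (cis_mult (a' - a) t * h t) = h t" for t
    unfolding mult.assoc[symmetric] exp_add[symmetric] by (simp add: algebra_simps)
   have "(\<lambda>t. cis_mult (a' - a) t * h t) \<in> Hm" using tr[OF L] h by (simp only: r e)
   moreover have "a' - a = - \<delta>" using False by (simp add: \<delta>_def)
   ultimately show ?thesis by (simp only:)
  qed
  have steps: "(\<lambda>t. cis_mult (- (real n * \<delta>)) t * h t) \<in> Hm" if h: "h \<in> Hm" for n h
  proof (induction n)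
   case (Suc n)
   have e: "cis_mult (- \<delta>) t * (cis_mult (- (real n * \<delta>)) t * h t) = cis_mult (- (real (Suc n) * \<delta>)) t * h t" for t
    unfolding mult.assoc[symmetric] exp_add[symmetric] by (simp add: algebra_simps)
   show ?case using step[OF Suc.IH] by (simp only: e)
  qed (use h in simp)
  \<comment> \<open>Overshoot by a multiple of \<open>\<delta>\<close>, then come back by a
    nonnegative modulation.\<close>
  have all: "(\<lambda>t. cis_mult (- \<alpha>) t * h t) \<in> Hm" if h: "h \<in> Hm" for \<alpha> h
  proof -
   obtain n where n: "\<alpha> / \<delta> \<le> real n" using real_arch_simple by blast
   then have n': "0 \<le> real n * \<delta> - \<alpha>" using \<delta> by (simp add: pos_divide_le_eq)
   have e: "cis_mult (real n * \<delta> - \<alpha>) t * (cis_mult (- (real n * \<delta>)) t * h t) = cis_mult (- \<alpha>) t * h t" for t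
    unfolding mult.assoc[symmetric] exp_add[symmetric] by (simp add: algebra_simps)
   show ?thesis using Hm_Mop[OF steps[OF h, of n] n'] by (simp only: e)
  qed
  show False by (rule notE[OF no_Hm_pure]) (intro allI impI ballI all)
 qed
 ultimately show ?thesis by simp
qed

lemma K_up_subset_imp_le:
 assumes sub: "K_up b \<subseteq> K_up b'"
 shows "b' \<le> b"
proof (rule ccontr)
 assume n: "\<not> b' \<le> b"
 let ?f = "\<lambda>x. indicator {b..b'} x :: complex"
 have "integrable lborel (\<lambda>x. (cmod (?f x))\<^sup>2)"
 proof -
  have "(\<lambda>x. (cmod (?f x))\<^sup>2) = indicator {b..b'}" by (auto simp: indicator_def)
  then show ?thesis by (simp add: emeasure_lborel_Icc_eq)
 qed
 then have fL: "?f \<in> L2" by (intro L2I) measurable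
 then have "?f \<in> K_up b" by (auto simp: K_up_def indicator_def)
 then have "?f \<in> K_up b'" using sub by blast
 then have "AE x in lborel. x < b' \<longrightarrow> ?f x = 0" by (simp add: K_up_def)
 moreover have "AE x in lborel. x \<noteq> b'" by (rule AE_lborel_singleton)
 ultimately have "AE x in lborel. indicator {b..b'} x = (0::real)" by eventually_elim (auto simp: indicator_def)
 then have "(LBINT x. indicator {b..b'} x :: real) = 0" by (rule integral_eq_zero_AE)
 then show False using n by simp
qed

section \<open>Classification\<close>

text \<open>Monotonicity is known only up to a null set depending on \<open>b\<close>. Fubini
  reverses the quantifiers: for almost every \<open>t\<close> outside \<open>E\<close>, almost all
  points to the left of \<open>t\<close> are outside \<open>E\<close>. The set \<open>A\<close> of
  points with only a null part of \<open>E\<close> to their left is genuinely downward closed, and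
  its supremum is the threshold.\<close>

lemma translation_increasing_set:
 assumes E [measurable]: "E \<in> sets borel" and inv: "\<And>b. 0 \<le> b \<Longrightarrow> AE t in lborel. t - b \<in> E \<longrightarrow> t \<in> E"
 shows "(AE t in lborel. t \<notin> E) \<or> (AE t in lborel. t \<in> E) \<or> (\<exists>c::real. AE t in lborel. t \<in> E \<longleftrightarrow> c \<le> t)"
proof -
 define A where "A = {t. AE s in lborel. s \<le> t \<longrightarrow> s \<notin> E}"
 have "AE b in lborel. AE t in lborel. 0 \<le> b \<and> t - b \<in> E \<longrightarrow> t \<in> E"
 proof (rule AE_I2)
  fix b :: real
  show "AE t in lborel. 0 \<le> b \<and> t - b \<in> E \<longrightarrow> t \<in> E"
  proof (cases "0 \<le> b")
   case True
   show ?thesis using inv[OF True] by eventually_elim simp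
  qed simp
 qed
 then have fub: "AE t in lborel. AE b in lborel. 0 \<le> b \<and> t - b \<in> E \<longrightarrow> t \<in> E"
  by (subst lborel_pair.AE_commute) measurable
 have AA: "AE t in lborel. t \<notin> E \<longrightarrow> t \<in> A" using fub
 proof eventually_elim
  case (elim t)
  show ?case
  proof
   assume t: "t \<notin> E"
   have 1: "AE b in lborel. 0 \<le> b \<longrightarrow> t - b \<notin> E" using elim by eventually_elim (use t in auto)
   have "AE s in lborel. 0 \<le> t + - 1 * s \<longrightarrow> t - (t + - 1 * s) \<notin> E"
   proof (rule AE_borel_affine[OF _ _ 1])
    show "Measurable.pred borel (\<lambda>b. 0 \<le> b \<longrightarrow> t - b \<notin> E)" by measurable
   qed simp
   then show "t \<in> A" by (simp add: A_def)
  qed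
 qed
 have down: "t' \<in> A" if "t \<in> A" "t' \<le> t" for t t'
 proof -
  have "AE s in lborel. s \<le> t \<longrightarrow> s \<notin> E" using that(1) by (simp add: A_def)
  then have "AE s in lborel. s \<le> t' \<longrightarrow> s \<notin> E" by eventually_elim (use that(2) in auto)
  then show ?thesis by (simp add: A_def)
 qed
 consider "A = {}" | "A \<noteq> {}" "\<not> bdd_above A" | "A \<noteq> {}" "bdd_above A"
  by (cases "A = {}"; cases "bdd_above A") auto
 then show ?thesis
 proof cases
  case 1
  have "AE t in lborel. t \<in> E" using AA by eventually_elim (use 1 in auto)
  then show ?thesis by blast
 next
  case 2
  have "\<forall>n. AE s in lborel. s \<le> real n \<longrightarrow> s \<notin> E"
  proof
   fix n
   obtain a where "a \<in> A" "real n < a" using 2(2) unfolding bdd_above_def by (meson not_le)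
   then have "real n \<in> A" by (rule down[OF _ less_imp_le])
   then show "AE s in lborel. s \<le> real n \<longrightarrow> s \<notin> E" by (simp add: A_def)
  qed
  then have "AE s in lborel. \<forall>n. s \<le> real n \<longrightarrow> s \<notin> E" unfolding AE_all_countable .
  then have "AE s in lborel. s \<notin> E"
  proof eventually_elim
   case (elim s)
   obtain n where "s \<le> real n" using real_arch_simple by blast
   then show ?case using elim by blast
  qed
  then show ?thesis by blast
 next
  case 3
  define c where "c = Sup A"
  have "\<forall>n. AE s in lborel. s \<le> c - inverse (real (Suc n)) \<longrightarrow> s \<notin> E"
  proof
   fix n
   have "c - inverse (real (Suc n)) < Sup A" by (simp add: c_def)
   then obtain a where "a \<in> A" "c - inverse (real (Suc n)) < a" using less_cSup_iff[OF 3] by blast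
   then have "c - inverse (real (Suc n)) \<in> A" by (rule down[OF _ less_imp_le])
   then show "AE s in lborel. s \<le> c - inverse (real (Suc n)) \<longrightarrow> s \<notin> E" by (simp add: A_def)
  qed
  then have "AE s in lborel. \<forall>n. s \<le> c - inverse (real (Suc n)) \<longrightarrow> s \<notin> E" unfolding AE_all_countable .
  moreover have "AE s in lborel. s \<noteq> c" by (rule AE_lborel_singleton)
  ultimately have "AE t in lborel. t \<in> E \<longleftrightarrow> c \<le> t" using AA
  proof eventually_elim
   case (elim t)
   show ?case
   proof
    assume t: "t \<in> E"
    show "c \<le> t"
    proof (rule ccontr)
     assume "\<not> c \<le> t"
     then obtain n where "inverse (real (Suc n)) < c - t" using reals_Archimedean[of "c - t"] by auto
     then have "t \<le> c - inverse (real (Suc n))" by linarith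
     then show False using elim(1) t by blast
    qed
   next
    assume ct: "c \<le> t"
    show "t \<in> E"
    proof (rule ccontr)
     assume "t \<notin> E"
     then have "t \<in> A" using elim(3) by blast
     then have "t \<le> c" unfolding c_def by (rule cSup_upper[OF _ 3(2)])
     then show False using ct elim(2) by simp
    qed
   qed
  qed
  then show ?thesis by blast
 qed
qed

text \<open>The compression of \<open>G\<close> to the range of \<open>J\<close> already preserves
  norms, so nothing of \<open>G (J x)\<close> can stick out of that range: its squared distance from
  \<open>J (u x)\<close> expands to 0.\<close>

lemma compression_intertwines:
 fixes J :: "'h::chilbert_space \<Rightarrow> 'k::chilbert_space"
 assumes J: "isometry_op J" and G: "isometry_op G" and u: "isometry_op u"
  and c: "\<And>x y. cinner (G (J x)) (J y) = cinner (u x) y"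
 shows "G (J x) = J (u x)"
proof -
 have "(norm (G (J x) - J (u x)))\<^sup>2 = (norm x)\<^sup>2 + (norm x)\<^sup>2 - 2 * Re (cinner (u x) (u x))"
  unfolding norm_diff_sq c isometry_opD(3)[OF J] isometry_opD(3)[OF G] isometry_opD(3)[OF u] ..
 also have "\<dots> = 0" by (simp add: cinner_self isometry_opD(3)[OF u])
 finally show ?thesis by simp
qed

text \<open>A vector in all the ranges stays in the subspace under every inverse
  \<open>Gop (- a)\<close>. The generic \<open>G\<close> stands for the modulations as well as for
  the translations.\<close>

lemma pure_sg_realization:
 fixes R :: "'h::chilbert_space \<Rightarrow> l2" and U :: "real \<Rightarrow> 'h \<Rightarrow> 'h"
 assumes U: "isometric_semigroup U" and R: "isometry_op R" and RU: "\<And>a x. 0 \<le> a \<Longrightarrow> R (U a x) = G a (R x)"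
  and G: "\<And>a f. f \<in> L2 \<Longrightarrow> G a (to_l2 f) = to_l2 (Gop a f)" "\<And>a f. f \<in> L2 \<Longrightarrow> Gop a f \<in> L2" "\<And>a f. Gop (- a) (Gop a f) = f"
  and pure: "\<And>f. f \<in> L2 \<Longrightarrow> to_l2 f \<in> range R \<Longrightarrow> \<forall>a\<ge>0. to_l2 (Gop (- a) f) \<in> range R \<Longrightarrow> AE t in lborel. f t = 0"
 shows "pure_sg U" unfolding pure_sg_def
proof (intro equalityI subsetI)
 fix z assume z: "z \<in> (\<Inter>a\<in>{0..}. range (U a))"
 obtain f where f: "f \<in> L2" "R z = to_l2 f" by (rule l2_cases)
 have "AE t in lborel. f t = 0"
 proof (rule pure[OF f(1)])
  show "to_l2 f \<in> range R" by (simp flip: f(2))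
  show "\<forall>a\<ge>0. to_l2 (Gop (- a) f) \<in> range R"
  proof (intro allI impI)
   fix a :: real assume a: "0 \<le> a"
   then obtain x where x: "z = U a x" using z by auto
   obtain g where g: "g \<in> L2" "R x = to_l2 g" by (rule l2_cases)
   have "to_l2 f = to_l2 (Gop a g)" using f(2) RU[OF a, of x] unfolding x g(2) G(1)[OF g(1)] by simp
   then have "G (- a) (to_l2 f) = G (- a) (to_l2 (Gop a g))" by simp
   then have "to_l2 (Gop (- a) f) = R x" unfolding G(1)[OF f(1)] G(1)[OF G(2)[OF g(1)]] G(3) g(2) .
   then show "to_l2 (Gop (- a) f) \<in> range R" by simp
  qed
 qed
 then have "R z = 0" using f to_l2_eq_0_iff[OF f(1)] by simp
 then show "z \<in> {0}" using isometry_opD(3)[OF R, of z] by simp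
next
 fix z :: 'h assume "z \<in> {0}"
 then have "z = U a 0" if "0 \<le> a" for a using U that isometry_opD(5)[of "U a"] by (simp add: isometric_semigroup_def)
 then show "z \<in> (\<Inter>a\<in>{0..}. range (U a))" by auto
qed

text \<open>Invariance of the subspace under the inverse operators supplies preimages in L^2, and
  injectivity of \<open>R\<close> pulls them back.\<close>

lemma unitary_sg_realization:
 fixes R :: "'h::chilbert_space \<Rightarrow> l2" and U :: "real \<Rightarrow> 'h \<Rightarrow> 'h"
 assumes R: "isometry_op R" and RU: "\<And>a x. 0 \<le> a \<Longrightarrow> R (U a x) = G a (R x)"
  and G: "\<And>a f. f \<in> L2 \<Longrightarrow> G a (to_l2 f) = to_l2 (Gop a f)" "\<And>a f. f \<in> L2 \<Longrightarrow> Gop a f \<in> L2" "\<And>a f. Gop a (Gop (- a) f) = f"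
  and inv: "\<And>f a. f \<in> L2 \<Longrightarrow> to_l2 f \<in> range R \<Longrightarrow> 0 \<le> a \<Longrightarrow> to_l2 (Gop (- a) f) \<in> range R"
 shows "unitary_sg U" unfolding unitary_sg_def
proof (intro allI impI)
 fix a :: real assume a: "0 \<le> a"
 have "\<exists>x. z = U a x" for z
 proof -
  obtain f where f: "f \<in> L2" "R z = to_l2 f" by (rule l2_cases)
  have "to_l2 (Gop (- a) f) \<in> range R" by (rule inv[OF f(1) _ a]) (simp flip: f(2))
  then obtain x where x: "R x = to_l2 (Gop (- a) f)" by (metis rangeE)
  have "R (U a x) = R z" unfolding RU[OF a] x G(1)[OF G(2)[OF f(1)]] G(3) f(2) ..
  then have "R (z - U a x) = 0" by (simp add: isometry_opD(4)[OF R])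
  then have "z - U a x = 0" using isometry_opD(3)[OF R, of "z - U a x"] by simp
  then show ?thesis by (intro exI[of _ x]) simp
 qed
 then show "surj (U a)" unfolding surj_def by blast
qed

lemma equiv_to_model_realization:
 fixes R :: "'h::chilbert_space \<Rightarrow> l2"
 assumes R: "isometry_op R" and RU: "\<And>a x. 0 \<le> a \<Longrightarrow> R (U a x) = Ml a (R x)" and RV: "\<And>b x. 0 \<le> b \<Longrightarrow> R (V b x) = Dl b (R x)"
  and KL: "K \<subseteq> L2" and K: "\<And>f. f \<in> L2 \<Longrightarrow> f \<in> K \<longleftrightarrow> to_l2 f \<in> range R"
 shows "equiv_to_model U V K" unfolding equiv_to_model_def
proof (intro exI[of _ "\<lambda>x. fun_of_l2 (R x)"] conjI allI impI ballI)
 fix x y :: 'h and c :: complex and a :: real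
 show "fun_of_l2 (R x) \<in> K" by (simp add: K)
 show "(norm x)\<^sup>2 = L2norm_sq (fun_of_l2 (R x))" unfolding L2norm_sq_def l2_norm_sq[symmetric] isometry_opD(3)[OF R] ..
 show "AE t in lborel. fun_of_l2 (R (x + y)) t = fun_of_l2 (R x) t + fun_of_l2 (R y) t"
  unfolding isometry_opD(1)[OF R] by (rule fun_of_l2_ops(2))
 show "AE t in lborel. fun_of_l2 (R (scaleC c x)) t = c * fun_of_l2 (R x) t" unfolding isometry_opD(2)[OF R] by (rule fun_of_l2_scaleC)
 assume a: "0 \<le> a"
 show "AE t in lborel. fun_of_l2 (R (U a x)) t = Mop a (fun_of_l2 (R x)) t"
  using fun_of_to_l2[OF L2_Mop[OF fun_of_l2_L2[of "R x"], of a]] Ml_to_l2[OF fun_of_l2_L2[of "R x"], of a] by (simp add: RU[OF a])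
 show "AE t in lborel. fun_of_l2 (R (V a x)) t = Dop a (fun_of_l2 (R x)) t"
  using fun_of_to_l2[OF L2_Dop[OF fun_of_l2_L2[of "R x"], of a]] Dl_to_l2[OF fun_of_l2_L2[of "R x"], of a] by (simp add: RV[OF a])
next
 fix f assume f: "f \<in> K"
 then have fL: "f \<in> L2" using KL by blast
 then obtain x where "R x = to_l2 f" using K[OF fL] f by (metis rangeE)
 then show "\<exists>x. AE t in lborel. fun_of_l2 (R x) t = f t" using fun_of_to_l2[OF fL] by (intro exI[of _ x]) simp
qed

theorem theorem4p1:
  fixes U V :: "real \<Rightarrow> 'h::chilbert_space \<Rightarrow> 'h"
  assumes sep: "separable_hilbert TYPE('h)"
    and rep: "isometric_weyl_rep U V"
    and sirr: "strongly_irreducible_in TYPE('k::chilbert_space) U V"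
    and not_uu: "\<not> type_uu U V"
  shows "(let P1 = (type_pu U V \<and> (\<exists>a. equiv_to_model U V (K_l a)));
              P2 = (type_up U V \<and> (\<exists>b. equiv_to_model U V (K_up b)));
              P3 = (type_pp U V \<and> (\<exists>a s. 0 < s \<and> equiv_to_model U V (K_ls a s)))
          in (P1 \<and> \<not> P2 \<and> \<not> P3) \<or> (\<not> P1 \<and> P2 \<and> \<not> P3) \<or> (\<not> P1 \<and> \<not> P2 \<and> P3))
       \<and> (\<forall>a a'. a \<noteq> a' \<longrightarrow> \<not> models_equiv (K_l a) (K_l a'))
       \<and> (\<forall>b b'. b \<noteq> b' \<longrightarrow> \<not> models_equiv (K_up b) (K_up b'))
       \<and> (\<forall>a s a' s'. 0 < s \<longrightarrow> 0 < s' \<longrightarrow> (a, s) \<noteq> (a', s')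
            \<longrightarrow> \<not> models_equiv (K_ls a s) (K_ls a' s'))"
proof (intro conjI)
 show "\<forall>a a'. a \<noteq> a' \<longrightarrow> \<not> models_equiv (K_l a) (K_l a')"
  unfolding K_l_eq_K_ls using models_equiv_imp_eq[OF model_space_K_ls model_space_K_ls, of 0 0] K_ls_inject by blast
 show "\<forall>b b'. b \<noteq> b' \<longrightarrow> \<not> models_equiv (K_up b) (K_up b')"
 proof (intro allI impI notI)
  fix b b' :: real assume "b \<noteq> b'" and m: "models_equiv (K_up b) (K_up b')"
  have "K_up b = K_up b'" by (rule models_equiv_imp_eq[OF model_space_K_up model_space_K_up m])
  then show False using K_up_subset_imp_le[of b b'] K_up_subset_imp_le[of b' b] \<open>b \<noteq> b'\<close> by simp
 qed
 show "\<forall>a s a' s'. 0 < s \<longrightarrow> 0 < s' \<longrightarrow> (a, s) \<noteq> (a', s') \<longrightarrow> \<not> models_equiv (K_ls a s) (K_ls a' s')"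
 proof (intro allI impI notI)
  fix a s a' s' :: real assume s: "0 < s" "0 < s'" and ne: "(a, s) \<noteq> (a', s')" and m: "models_equiv (K_ls a s) (K_ls a' s')"
  have "K_ls a s = K_ls a' s'" using s by (intro models_equiv_imp_eq[OF model_space_K_ls model_space_K_ls m]) auto
  then show False using K_ls_inject ne by blast
 qed
 have U: "isometric_semigroup U" and V: "isometric_semigroup V" using rep by (auto simp: isometric_weyl_rep_def)
 \<comment> \<open>The zero space is of type uu, since every map on it is surjective.\<close>
 obtain x0 :: 'h where x0: "x0 \<noteq> 0"
 proof (rule ccontr)
  assume "\<not> thesis"
  then have "x = 0" for x :: 'h using that by blast
  then have "surj g" for g :: "'h \<Rightarrow> 'h" unfolding surj_def by metis
  then show False using not_uu by (simp add: type_uu_def unitary_sg_def)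
 qed
 \<comment> \<open>Yields exclusiveness: any two of the types pu, up, pp disagree on whether some
   semigroup is pure or unitary, and on a nonzero space it cannot be both.\<close>
 have excl: "\<not> unitary_sg G" if "pure_sg G" for G :: "real \<Rightarrow> 'h \<Rightarrow> 'h"
 proof
  assume "unitary_sg G"
  then have "x0 \<in> (\<Inter>a\<in>{0..}. range (G a))" by (simp add: unitary_sg_def)
  then have "x0 \<in> {0}" using that unfolding pure_sg_def by (simp only:)
  then show False using x0 by simp
 qed
 obtain Ut Vt :: "real \<Rightarrow> 'k \<Rightarrow> 'k" and J where dil: "unitary_dilation Ut Vt J U V" and irr: "irreducible_pair Ut Vt"
  using sirr unfolding strongly_irreducible_in_def minimal_dilation_def by blast
 have Ut: "unitary_group Ut" and Vt: "unitary_group Vt" and wr: "weyl_rel Ut Vt UNIV" and J: "isometry_op J"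
  and cU: "\<And>a x y. 0 \<le> a \<Longrightarrow> cinner (Ut a (J x)) (J y) = cinner (U a x) y"
  and cV: "\<And>b x y. 0 \<le> b \<Longrightarrow> cinner (Vt b (J x)) (J y) = cinner (V b x) y"
  using dil by (auto simp: unitary_dilation_def)
 have iso: "isometry_op (Ut a)" "isometry_op (Vt a)" "0 \<le> a \<Longrightarrow> isometry_op (U a)" "0 \<le> a \<Longrightarrow> isometry_op (V a)" for a
  using Ut Vt U V by (simp_all add: unitary_group_def isometric_semigroup_def)
 have JU: "Ut a (J x) = J (U a x)" and JV: "Vt a (J x) = J (V a x)" if a: "0 \<le> a" for a x
  by (rule compression_intertwines[OF J iso(1) iso(3)[OF a] cU[OF a]])
   (rule compression_intertwines[OF J iso(2) iso(4)[OF a] cV[OF a]])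
 have "J x0 \<noteq> 0" using isometry_opD(3)[OF J, of x0] x0 by auto
 then obtain T :: "'k \<Rightarrow> l2" where T: "isometry_op T" and TU: "\<And>a x. T (Ut a x) = Ml a (T x)" and TV: "\<And>b x. T (Vt b x) = Dl b (T x)"
  by (rule stone_von_neumann_embedding[OF Ut Vt wr irr]) (rule that)
 define R where "R = T \<circ> J"
 have R: "isometry_op R" unfolding R_def by (rule isometry_op_compose[OF T J])
 have RU: "R (U a x) = Ml a (R x)" and RV: "R (V a x) = Dl a (R x)" if "0 \<le> a" for a x
  using JU[OF that, of x] JV[OF that, of x] TU[of a "J x"] TV[of a "J x"] by (simp_all add: R_def)
 have D_inv: "to_l2 (Dop b f) \<in> range R" if f: "f \<in> L2" "to_l2 f \<in> range R" and b: "0 \<le> b" for f b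
 proof -
  obtain x where "to_l2 f = R x" using f(2) by blast
  then have "to_l2 (Dop b f) = R (V b x)" using RV[OF b, of x] Dl_to_l2[OF f(1), of b] by simp
  then show ?thesis by simp
 qed
 interpret half_invariant "range R"
 proof
  show "closed_csubspace (range R)" by (rule closed_csubspace_isometry_range[OF R])
  show "Ml a x \<in> range R" if a: "0 \<le> a" and x: "x \<in> range R" for a x
  proof -
   obtain y where "x = R y" using x by blast
   then have "Ml a x = R (U a y)" using RU[OF a, of y] by simp
   then show ?thesis by simp
  qed
 qed
 have MM: "Mop (- a) (Mop a f) = f" "Mop a (Mop (- a) f) = f" and DD: "Dop (- a) (Dop a f) = f" "Dop a (Dop (- a) f) = f" for a f
  by (simp_all add: Mop_Mop Dop_Dop Mop_zero Dop_zero)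
 have pureU: "pure_sg U" if "\<And>f. f \<in> L2 \<Longrightarrow> to_l2 f \<in> range R \<Longrightarrow> \<forall>a\<ge>0. to_l2 (Mop (- a) f) \<in> range R \<Longrightarrow> AE t in lborel. f t = 0"
  by (rule pure_sg_realization[where R=R and G=Ml and Gop=Mop]) (fact U, fact R, erule RU, erule Ml_to_l2, erule L2_Mop, rule MM, rule that)
 have pureV: "pure_sg V" if "\<And>f. f \<in> L2 \<Longrightarrow> to_l2 f \<in> range R \<Longrightarrow> \<forall>a\<ge>0. to_l2 (Dop (- a) f) \<in> range R \<Longrightarrow> AE t in lborel. f t = 0"
  by (rule pure_sg_realization[where R=R and G=Dl and Gop=Dop]) (fact V, fact R, erule RV, erule Dl_to_l2, erule L2_Dop, rule DD, rule that)
 have unitU: "unitary_sg U" if "\<And>f a. f \<in> L2 \<Longrightarrow> to_l2 f \<in> range R \<Longrightarrow> 0 \<le> a \<Longrightarrow> to_l2 (Mop (- a) f) \<in> range R"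
  by (rule unitary_sg_realization[where R=R and G=Ml and Gop=Mop]) (fact R, erule RU, erule Ml_to_l2, erule L2_Mop, rule MM, rule that)
 have unitV: "unitary_sg V" if "\<And>f a. f \<in> L2 \<Longrightarrow> to_l2 f \<in> range R \<Longrightarrow> 0 \<le> a \<Longrightarrow> to_l2 (Dop (- a) f) \<in> range R"
  by (rule unitary_sg_realization[where R=R and G=Dl and Gop=Dop]) (fact R, erule RV, erule Dl_to_l2, erule L2_Dop, rule DD, rule that)
 have "(type_pu U V \<and> (\<exists>a. equiv_to_model U V (K_l a))) \<or> (type_up U V \<and> (\<exists>b. equiv_to_model U V (K_up b)))
  \<or> (type_pp U V \<and> (\<exists>a s. 0 < s \<and> equiv_to_model U V (K_ls a s)))"
  using beurling_dichotomy
 proof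
  assume "\<exists>E\<in>sets borel. \<forall>f\<in>L2. to_l2 f \<in> range R \<longleftrightarrow> (AE t in lborel. t \<notin> E \<longrightarrow> f t = 0)"
  then obtain E where E: "E \<in> sets borel" and S: "\<And>f. f \<in> L2 \<Longrightarrow> to_l2 f \<in> range R \<longleftrightarrow> (AE t in lborel. t \<notin> E \<longrightarrow> f t = 0)"
   by blast
  have inc: "AE t in lborel. t - b \<in> E \<longrightarrow> t \<in> E" if b: "0 \<le> b" for b
  proof -
   \<comment> \<open>The kernel vanishes nowhere, so this element of the subspace has support
     exactly \<open>E\<close>, and translating it tests \<open>E\<close> against its shift.\<close>
   define f where "f t = indicator E t * (1 / (of_real t - cnj \<i>))" for t
   have f: "f \<in> L2" unfolding f_def using E by (intro L2_bounded_mult[OF L2_kernel, of _ _ 1]) (auto simp: indicator_def)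
   have "to_l2 f \<in> range R" unfolding S[OF f] by (simp add: f_def)
   from D_inv[OF f this b] have "AE t in lborel. t \<notin> E \<longrightarrow> Dop b f t = 0" unfolding S[OF L2_Dop[OF f]] .
   then show ?thesis
   proof eventually_elim
    case (elim t)
    then show ?case using of_real_diff_nonzero[of "cnj \<i>" "t - b"] by (auto simp: Dop_def f_def indicator_def)
   qed
  qed
  \<comment> \<open>A null \<open>E\<close> would make the space zero and a conull \<open>E\<close>
    would give type uu; the half-line is what remains.\<close>
  from translation_increasing_set[OF E inc] consider "AE t in lborel. t \<notin> E" | "AE t in lborel. t \<in> E" | c where "AE t in lborel. t \<in> E \<longleftrightarrow> c \<le> t"
   by blast
  then show ?thesis
  proof cases
   case 1
   obtain f where f: "f \<in> L2" "R x0 = to_l2 f" by (rule l2_cases)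
   have "AE t in lborel. t \<notin> E \<longrightarrow> f t = 0" using S[OF f(1)] by (simp flip: f(2))
   then have "AE t in lborel. f t = 0" using 1 by eventually_elim simp
   then have "R x0 = 0" using f to_l2_eq_0_iff[OF f(1)] by simp
   then show ?thesis using isometry_opD(3)[OF R, of x0] x0 by simp
  next
   case 2
   have all: "to_l2 f \<in> range R" if "f \<in> L2" for f unfolding S[OF that] using 2 by eventually_elim simp
   have "unitary_sg U" by (rule unitU) (intro all L2_Mop)
   moreover have "unitary_sg V" by (rule unitV) (intro all L2_Dop)
   ultimately show ?thesis using not_uu by (simp add: type_uu_def)
  next
   case (3 c)
   have K: "f \<in> K_up c \<longleftrightarrow> to_l2 f \<in> range R" if "f \<in> L2" for f
   proof -
    have "(AE t in lborel. t \<notin> E \<longrightarrow> f t = 0) \<longleftrightarrow> (AE t in lborel. t < c \<longrightarrow> f t = 0)"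
    proof
     assume "AE t in lborel. t \<notin> E \<longrightarrow> f t = 0"
     then show "AE t in lborel. t < c \<longrightarrow> f t = 0" using 3 by eventually_elim simp
    next
     assume "AE t in lborel. t < c \<longrightarrow> f t = 0"
     then show "AE t in lborel. t \<notin> E \<longrightarrow> f t = 0" using 3 by eventually_elim simp
    qed
    then show ?thesis unfolding S[OF that] using that by (simp add: K_up_def)
   qed
   have "equiv_to_model U V (K_up c)" by (rule equiv_to_model_realization[OF R RU RV _ K]) (auto simp: K_up_def)
   moreover have "unitary_sg U"
   proof (rule unitU)
    fix f a assume f: "f \<in> L2" "to_l2 f \<in> range R"
    then have "AE t in lborel. t < c \<longrightarrow> f t = 0" using K by (simp add: K_up_def)
    then have "AE t in lborel. t < c \<longrightarrow> Mop (- a) f t = 0" by eventually_elim (simp add: Mop_def)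
    then show "to_l2 (Mop (- a) f) \<in> range R" using K[OF L2_Mop[OF f(1)]] L2_Mop[OF f(1)] by (simp add: K_up_def)
   qed
   moreover have "pure_sg V"
   proof (rule pureV)
    fix f assume f: "f \<in> L2" and inv: "\<forall>b\<ge>0. to_l2 (Dop (- b) f) \<in> range R"
    \<comment> \<open>Inverse translations keep \<open>f\<close> in the subspace, so
      \<open>f\<close> vanishes to the left of \<open>c + real n\<close> for every
      \<open>n\<close>.\<close>
    have "\<forall>n. AE t in lborel. t < c + real n \<longrightarrow> f t = 0"
    proof
     fix n
     have "Dop (- real n) f \<in> K_up c" using K[OF L2_Dop[OF f]] inv[rule_format, of "real n"] by simp
     then have "AE t in lborel. t < c \<longrightarrow> f (t + real n) = 0" by (simp add: K_up_def Dop_def)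
     from AE_lborel_shift[OF this, of "real n"] show "AE t in lborel. t < c + real n \<longrightarrow> f t = 0" by eventually_elim auto
    qed
    then have "AE t in lborel. \<forall>n. t < c + real n \<longrightarrow> f t = 0" unfolding AE_all_countable .
    then show "AE t in lborel. f t = 0"
    proof eventually_elim
     case (elim t)
     obtain n where "t - c < real n" using reals_Archimedean2 by blast
     then show ?case using elim by (auto simp: algebra_simps)
    qed
   qed
   ultimately show ?thesis by (auto simp: type_up_def)
  qed
 next
  assume "\<exists>u\<in>borel_measurable borel. (\<forall>t. cmod (u t) = 1) \<and> (\<forall>f\<in>L2. to_l2 f \<in> range R \<longleftrightarrow> (\<lambda>t. cnj (u t) * f t) \<in> Hm)"
  then obtain u where u [measurable]: "u \<in> borel_measurable borel" and u1: "\<And>t. cmod (u t) = 1"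
   and S: "\<And>f. f \<in> L2 \<Longrightarrow> to_l2 f \<in> range R \<longleftrightarrow> (\<lambda>t. cnj (u t) * f t) \<in> Hm"
   by blast
  have uu: "cnj (u t) * u t = 1" for t using complex_norm_square[of "u t"] by (simp add: u1 mult.commute)
  \<comment> \<open>Invariance of the subspace under \<open>Dop b\<close>, applied to
    \<open>u\<close> times a translate \<open>g\<close> of \<open>h\<close> chosen so that the shift
    in \<open>h\<close> cancels.\<close>
  interpret inner_cocycle u
  proof
   fix b :: real and h assume b: "0 \<le> b" and h: "h \<in> Hm"
   define g where "g t = h (t - - b)" for t
   have g: "g \<in> Hm" unfolding g_def by (rule Hm_translate[OF h])
   have ug: "(\<lambda>t. u t * g t) \<in> L2" by (rule L2_bounded_mult[OF HmD(1)[OF g], of _ 1]) (auto simp: u1)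
   have "to_l2 (\<lambda>t. u t * g t) \<in> range R" unfolding S[OF ug] mult.assoc[symmetric] uu using g by simp
   from D_inv[OF ug this b] show "(\<lambda>t. cnj (u t) * u (t - b) * h t) \<in> Hm"
    unfolding S[OF L2_Dop[OF ug]] by (simp add: Dop_def g_def mult.assoc)
  qed (fact u, fact u1)
  obtain c a s where c: "cmod c = 1" and s: "0 \<le> s" and uc: "AE t in lborel. u t = c * (cis_mult a t * phi s t)"
   by (rule classification) (rule that)
  have c0: "cnj c * c = 1" using complex_norm_square[of c] c by (simp add: mult.commute)
  have K: "f \<in> K_ls a s \<longleftrightarrow> to_l2 f \<in> range R" if f: "f \<in> L2" for f
  proof -
   have fm: "f \<in> borel_measurable borel" by (rule L2D(1)[OF f])
   have 1: "AE t in lborel. cnj c * (cnj (md a s t) * f t) = cnj (u t) * f t" using uc by eventually_elim (simp add: md_def)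
   have 2: "AE t in lborel. c * (cnj (u t) * f t) = cnj (md a s t) * f t" using 1
   proof eventually_elim
    case (elim t)
    have "c * (cnj (u t) * f t) = (cnj c * c) * (cnj (md a s t) * f t)" unfolding elim[symmetric] by (simp only: mult_ac)
    then show ?case by (simp only: c0 mult_1_left)
   qed
   show ?thesis unfolding K_ls_iff[OF f] S[OF f]
   proof
    assume "(\<lambda>t. cnj (md a s t) * f t) \<in> Hm"
    from Hm_AE_cong[OF Hm_scale[OF this] _ 1] show "(\<lambda>t. cnj (u t) * f t) \<in> Hm" using fm by simp
   next
    assume "(\<lambda>t. cnj (u t) * f t) \<in> Hm"
    from Hm_AE_cong[OF Hm_scale[OF this] _ 2] show "(\<lambda>t. cnj (md a s t) * f t) \<in> Hm" using fm by simp
   qed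
  qed
  have vanish: "AE t in lborel. f t = 0" if "\<And>\<alpha>. 0 \<le> \<alpha> \<Longrightarrow> (\<lambda>t. cis_mult (- \<alpha>) t * (cnj (md a s t) * f t)) \<in> Hm" for f
  proof -
   have "AE t in lborel. cnj (md a s t) * f t = 0" by (rule Hm_pure) (rule that)
   then show ?thesis
   proof eventually_elim
    case (elim t)
    have "md a s t * (cnj (md a s t) * f t) = f t" unfolding mult.assoc[symmetric] cnj_md_mult by simp
    then show ?case using elim by simp
   qed
  qed
  have eqv: "equiv_to_model U V (K_ls a s)" by (rule equiv_to_model_realization[OF R RU RV _ K]) (auto simp: K_ls_def)
  have pU: "pure_sg U"
  proof (rule pureU)
   fix f assume f: "f \<in> L2" and inv: "\<forall>b\<ge>0. to_l2 (Mop (- b) f) \<in> range R"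
   show "AE t in lborel. f t = 0"
   proof (rule vanish)
    fix \<alpha> :: real assume "0 \<le> \<alpha>"
    then show "(\<lambda>t. cis_mult (- \<alpha>) t * (cnj (md a s t) * f t)) \<in> Hm"
     unfolding K_ls_Mop_iff[OF f, symmetric] K[OF L2_Mop[OF f]] by (rule inv[rule_format])
   qed
  qed
  show ?thesis
  proof (cases "s = 0")
   \<comment> \<open>The modulation in \<open>K_ls_Dop_iff\<close> is trivial for
     \<open>s = 0\<close>, so the subspace is invariant under translations in both
     directions.\<close>
   case True
   have "unitary_sg V"
   proof (rule unitV)
    fix f b assume f: "f \<in> L2" "to_l2 f \<in> range R"
    then have "(\<lambda>t. cnj (md a s t) * f t) \<in> Hm" using K[OF f(1)] unfolding K_ls_iff[OF f(1)] by simp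
    then show "to_l2 (Dop (- b) f) \<in> range R" unfolding K[OF L2_Dop[OF f(1)], symmetric] K_ls_Dop_iff[OF f(1)] by (simp add: True)
   qed
   then show ?thesis using pU eqv True by (auto simp: type_pu_def K_l_eq_K_ls)
  next
   case False
   then have s0: "0 < s" using s by simp
   have "pure_sg V"
   proof (rule pureV)
    fix f assume f: "f \<in> L2" and inv: "\<forall>b\<ge>0. to_l2 (Dop (- b) f) \<in> range R"
    show "AE t in lborel. f t = 0"
    proof (rule vanish)
     fix \<alpha> :: real assume \<alpha>: "0 \<le> \<alpha>"
     \<comment> \<open>By \<open>K_ls_Dop_iff\<close>, translation by
       \<open>- (\<alpha> / s)\<close> tests the modulation by \<open>- \<alpha>\<close>, so purity
       of the translations reduces to that of the modulations on \<open>Hm\<close>.\<close>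
     have "Dop (- (\<alpha> / s)) f \<in> K_ls a s" unfolding K[OF L2_Dop[OF f]] using \<alpha> s0 by (intro inv[rule_format]) simp
     moreover have "s * - (\<alpha> / s) = - \<alpha>" using s0 by simp
     ultimately show "(\<lambda>t. cis_mult (- \<alpha>) t * (cnj (md a s t) * f t)) \<in> Hm"
      unfolding K_ls_Dop_iff[OF f] by (simp only:)
    qed
   qed
   then show ?thesis using pU eqv s0 by (auto simp: type_pp_def)
  qed
 qed
 then show "let P1 = (type_pu U V \<and> (\<exists>a. equiv_to_model U V (K_l a)));
       P2 = (type_up U V \<and> (\<exists>b. equiv_to_model U V (K_up b)));
       P3 = (type_pp U V \<and> (\<exists>a s. 0 < s \<and> equiv_to_model U V (K_ls a s)))
     in (P1 \<and> \<not> P2 \<and> \<not> P3) \<or> (\<not> P1 \<and> P2 \<and> \<not> P3) \<or> (\<not> P1 \<and> \<not> P2 \<and> P3)"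
  unfolding Let_def type_pu_def type_up_def type_pp_def using excl[of U] excl[of V] by blast
qed

end
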